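(* Let $n\ge 1$, $1<p<q$, $2\le q<\infty$, and $0<s=n\left(\frac1p-\frac1q\right)<1$. Let $f\in \dot L^p_s(\mathbb R^n)$ be a bounded real-valued function on $\mathbb R^n$ with continuous first-order partial derivatives. Then $$\|\mathcal D_{s,q}f\|_{L^{p,\infty}(\mathbb R^n)}\le C\,\|f\|_{\dot L^p_s(\mathbb R^n)},$$ equivalently $\mathcal L^n(\{x:\mathcal D_{s,q}f(x)>\alpha\})\le C\alpha^{-p}\|f\|_{\dot L^p_s(\mathbb R^n)}^p$ for all $\alpha>0$, where $C$ depends only on $n,p,q$ (and fixed auxiliary choices), not on $f$ or $\alpha$.
   Context: Fourier transform: $\mathcal F_n f(\xi)=\int_{\mathbb R^n}f(x)e^{-2\pi i x\cdot\xi}dx$. $\mathcal S_0(\mathbb R^n)$ is the closed subspace of Schwartz functions $\phi$ with $\int x^\gamma\phi(x)dx=0$ for all multi-indices $\gamma$, and $\mathcal S_0'(\mathbb R^n)$ is its dual (tempered distributions modulo polynomials). For $f$ a tempered distribution, $\mathcal I_s f=\mathcal F_n^{-1}(|\xi|^s\mathcal F_n f)$, regarded as an element of $\mathcal S_0'(\mathbb R^n)$, i.e. $\langle \mathcal I_s f,\phi\rangle=\langle f,\mathcal F_n(|\xi|^s\mathcal F_n^{-1}\phi)\rangle$ for $\phi\in\mathcal S_0$. The homogeneous Sobolev space $\dot L^p_s(\mathbb R^n)$ ($1<p<\infty$) consists of those $f$ for which $\mathcal I_s f$ has a (unique modulo polynomials) function representative in $L^p(\mathbb R^n)$, with $\|f\|_{\dot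 L^p_s}=\|\mathcal I_s f\|_{L^p}$. For $q>0$, $s\in\mathbb R$: $\mathcal D_{s,q}f(x)=\left(\int_{\mathbb R^n}\frac{|f(x+y)-f(x)|^q}{|y|^{n+sq}}dy\right)^{1/q}$. $\|h\|_{L^{p,\infty}}=\sup_{\alpha>0}\alpha\,\mathcal L^n(\{|h|>\alpha\})^{1/p}$ is the weak $L^p$ quasinorm. *)

theory Defs
  imports "HOL-Analysis.Analysis"
begin

definition fourier :: "('a::euclidean_space \<Rightarrow> complex) \<Rightarrow> 'a \<Rightarrow> complex" where
  "fourier \<phi> \<xi> = (\<integral>x. \<phi> x * cis (- 2 * pi * (x \<bullet> \<xi>)) \<partial>lborel)"

definition inv_fourier :: "('a::euclidean_space \<Rightarrow> complex) \<Rightarrow> 'a \<Rightarrow> complex" where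
  "inv_fourier \<phi> x = (\<integral>\<xi>. \<phi> \<xi> * cis (2 * pi * (x \<bullet> \<xi>)) \<partial>lborel)"

definition dir_deriv :: "'a::euclidean_space \<Rightarrow> ('a \<Rightarrow> complex) \<Rightarrow> 'a \<Rightarrow> complex" where
  "dir_deriv v \<phi> x = vector_derivative (\<lambda>t::real. \<phi> (x + t *\<^sub>R v)) (at 0)"

fun iter_deriv :: "'a::euclidean_space list \<Rightarrow> ('a \<Rightarrow> complex) \<Rightarrow> 'a \<Rightarrow> complex" where
  "iter_deriv [] \<phi> = \<phi>"
| "iter_deriv (v # vs) \<phi> = dir_deriv v (iter_deriv vs \<phi>)"

definition schwartz :: "('a::euclidean_space \<Rightarrow> complex) \<Rightarrow> bool" where
  "schwartz \<phi> \<longleftrightarrow>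
     (\<forall>ds. set ds \<subseteq> Basis \<longrightarrow>
        (\<forall>x. iter_deriv ds \<phi> differentiable (at x)) \<and>
        (\<forall>N::nat. bounded (range (\<lambda>x. (1 + norm x) ^ N *\<^sub>R iter_deriv ds \<phi> x))))"

definition schwartz0 :: "('a::euclidean_space \<Rightarrow> complex) \<Rightarrow> bool" where
  "schwartz0 \<phi> \<longleftrightarrow> schwartz \<phi> \<and>
     (\<forall>\<gamma>::'a \<Rightarrow> nat. (\<integral>x. (\<Prod>i\<in>Basis. (x \<bullet> i) ^ \<gamma> i) *\<^sub>R \<phi> x \<partial>lborel) = 0)"

text \<open>g is an L^p function representing I_s f in S_0' (for f a bounded function, viewed as
  a tempered distribution): for all phi in S_0,
  <I_s f, phi> = <f, F(|xi|^s F^{-1} phi)> = integral of g * phi.\<close>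
definition Is_Lp_rep :: "real \<Rightarrow> real \<Rightarrow> ('a::euclidean_space \<Rightarrow> real) \<Rightarrow> ('a \<Rightarrow> complex) \<Rightarrow> bool" where
  "Is_Lp_rep p s f g \<longleftrightarrow>
     g \<in> borel_measurable lborel \<and>
     (\<integral>\<^sup>+ x. ennreal (norm (g x) powr p) \<partial>lborel) < \<infinity> \<and>
     (\<forall>\<phi>. schwartz0 \<phi> \<longrightarrow>
        (\<integral>x. g x * \<phi> x \<partial>lborel) =
        (\<integral>x. complex_of_real (f x) *
               fourier (\<lambda>\<xi>. complex_of_real (norm \<xi> powr s) * inv_fourier \<phi> \<xi>) x \<partial>lborel))"

definition Lp_pow :: "real \<Rightarrow> ('a::euclidean_space \<Rightarrow> complex) \<Rightarrow> ennreal" where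
  "Lp_pow p g = (\<integral>\<^sup>+ x. ennreal (norm (g x) powr p) \<partial>lborel)"

definition D_sq :: "real \<Rightarrow> real \<Rightarrow> ('a::euclidean_space \<Rightarrow> real) \<Rightarrow> 'a \<Rightarrow> ennreal" where
  "D_sq s q f x =
     (let I = (\<integral>\<^sup>+ y. ennreal (\<bar>f (x + y) - f x\<bar> powr q / norm y powr (real DIM('a) + s * q)) \<partial>lborel)
      in if I = \<infinity> then \<infinity> else ennreal (enn2real I powr (1 / q)))"

definition C1_partials :: "('a::euclidean_space \<Rightarrow> real) \<Rightarrow> bool" where
  "C1_partials f \<longleftrightarrow>
     (\<forall>i\<in>Basis. \<exists>d. continuous_on UNIV d \<and>
        (\<forall>x. ((\<lambda>t. f (x + t *\<^sub>R i)) has_real_derivative d x) (at 0)))"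

end

(* Let R be convolution with the Riesz kernel norm z powr (s - n).

The weak type bound for the Riesz potential R g is a Calderon-Zygmund argument without cubes. Let Omega be a
neighbourhood of {M(|g|^p) > 1}. Spreading g on Omega over balls of radius comparable to the distance to the
complement gives a bounded function, for which a TT* (Schur) estimate in L^2, interpolated with boundedness,
controls the L^q form, q >= 2. The remainder is controlled off Omega by the cancellation of the kernel, except
close to the diagonal, where Hedberg's inequality is used.

To identify f with R g up to a constant, test the hypothesis with superpositions over v of heat kernels at
scale r exp v, with weight osc v = exp (- v^2) sin (2 pi v). This weight annihilates exp (k v) for all k in
nat, so that the test functions have vanishing moments, but not exp (- a v), a = s / 2. With
U t = (heat average of f - c * heat average of R g at scale t, at x) - (the same at x'), the hypothesis says that the
fractional derivative of order a of a weighted mean Y of the dilates of U vanishes. A maximum principle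
gives Y = 0, and r -> 0 gives f x - f x' = c * (R g x - R g x'). *)

theory Submission
 imports Defs "HOL-Probability.Probability"
begin

text \<open>The level is normalised to 1 by rescaling \<open>g\<close>. The set
  \<open>\<Omega>\<close> is built from |g|^p rather than |g| because its measure has to be paid for
  by the p-th power of the L^p norm. The relation s = n / p - n / q enters through Hedberg's
  inequality, which turns the q-th power of the part near the diagonal into the p-th power of a
  maximal function. Interpolation starts from L^2, hence q >= 2.

  Dividing by |xi|^s is not possible in the second half, as the hypothesis is tested only against
  functions orthogonal to all polynomials. On Gaussians, however, multiplication by |xi|^(2 a) is a
  fractional derivative of order a in the scale variable, so every test stays explicit and the
  multiplier is never applied to \<open>f\<close> or \<open>g\<close>. The weight \<open>osc\<close>
  is, in the variable u = exp v, Stieltjes' nonzero function whose moments all vanish. Two base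
  points are compared because the heat averages of a bounded function need not tend to 0 at large
  scales, whereas their differences do.\<close>

abbreviation (input) nn_integral_lborel :: "('a::euclidean_space => ennreal) => ennreal" (binder "NBINT " 10) where
 "nn_integral_lborel \<equiv> nn_integral lborel"

section \<open>Lebesgue integrals under translation, dilation and reflection; Fubini\<close>

lemma nn_integral_lborel_shift:
 fixes c :: "'a::euclidean_space"
 assumes [measurable]: "f \<in> borel_measurable borel"
 shows "(NBINT x. f (c + x)) = (NBINT x. f x)"
 by (subst (2) lborel_distr_plus[of c, symmetric], subst nn_integral_distr) auto

lemma nn_integral_lborel_scale:
 fixes t :: "'a::euclidean_space"
 assumes [measurable]: "f \<in> borel_measurable borel" and c: "c ~= 0"
 shows "(NBINT x. f x) = ennreal (\<bar>c\<bar> ^ DIM('a)) * (NBINT x. f (t + c *\<^sub>R x))"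
 by (subst lborel_affine[OF c, of t])
   (simp add: nn_integral_density nn_integral_distr nn_integral_cmult)

lemma nn_integral_lborel_reflect:
 fixes c :: "'a::euclidean_space"
 assumes [measurable]: "f \<in> borel_measurable borel"
 shows "(NBINT x. f (c - x)) = (NBINT x. f x)"
 using nn_integral_lborel_scale[of f "-1" c] assms by simp

lemma lborel_distr_reflect:
 fixes c :: "'a::euclidean_space"
 shows "distr lborel borel (\<lambda>x. c - x) = lborel"
 by (subst (2) lborel_affine[of "-1" c]) (auto simp: density_1)

lemma integral_lborel_reflect:
 fixes c :: "'a::euclidean_space" and f :: "'a => 'b::{banach, second_countable_topology}"
 assumes [measurable]: "f \<in> borel_measurable borel"
 shows "(LBINT x. f (c - x)) = (LBINT x. f x)"
 by (subst (2) lborel_distr_reflect[of c, symmetric], subst integral_distr) auto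

lemma integral_lborel_shift:
 fixes c :: "'a::euclidean_space" and f :: "'a => 'b::{banach, second_countable_topology}"
 assumes [measurable]: "f \<in> borel_measurable borel"
 shows "(LBINT x. f (c + x)) = (LBINT x. f x)"
 by (subst (2) lborel_distr_plus[of c, symmetric], subst integral_distr) auto

lemma AE_lborel_shift:
 fixes c :: "'a::euclidean_space"
 assumes "AE x in lborel. P x"
 shows "AE x in lborel. P (c + x)"
proof -
 have "AE x in distr lborel borel ((+) c). P x"
  by (subst lborel_distr_plus) fact
 then show ?thesis
  by (rule AE_distrD[rotated]) simp
qed

text \<open>Integrability on the product is replaced by finiteness of an iterated nonnegative
  integral, the form in which it gets verified at each use.\<close>

lemma Fubini_nn:
 fixes f :: "'a => 'b => 'c::{banach, second_countable_topology}"
 assumes "sigma_finite_measure M" "sigma_finite_measure N"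
  and m: "(\<lambda>(x, y). f x y) \<in> borel_measurable (M \<Otimes>\<^sub>M N)"
  and fin: "(\<integral>\<^sup>+x. \<integral>\<^sup>+y. ennreal (norm (f x y)) \<partial>N \<partial>M) < \<infinity>"
 shows Fubini_nn_eq: "(\<integral>x. \<integral>y. f x y \<partial>N \<partial>M) = (\<integral>y. \<integral>x. f x y \<partial>M \<partial>N)"
  and Fubini_nn_integrable2: "integrable N (\<lambda>y. \<integral>x. f x y \<partial>M)"
proof -
 interpret M: sigma_finite_measure M by fact
 interpret N: sigma_finite_measure N by fact
 interpret pair_sigma_finite M N ..
 have i: "integrable (M \<Otimes>\<^sub>M N) (\<lambda>(x, y). f x y)"
 proof (rule integrableI_bounded[OF m])
  have "(\<integral>\<^sup>+z. ennreal (norm (case z of (x, y) => f x y)) \<partial>(M \<Otimes>\<^sub>M N))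
    = (\<integral>\<^sup>+x. \<integral>\<^sup>+y. ennreal (norm (f x y)) \<partial>N \<partial>M)"
   using m by (subst N.nn_integral_fst[symmetric]) auto
  then show "(\<integral>\<^sup>+z. ennreal (norm (case z of (x, y) => f x y)) \<partial>(M \<Otimes>\<^sub>M N)) < \<infinity>"
   using fin by simp
 qed
 show "(\<integral>x. \<integral>y. f x y \<partial>N \<partial>M) = (\<integral>y. \<integral>x. f x y \<partial>M \<partial>N)"
  using Fubini_integral[OF i] by simp
 show "integrable N (\<lambda>y. \<integral>x. f x y \<partial>M)"
  using integrable_snd[OF i] by simp
qed

section \<open>Polar coordinates and integrals of powers of the norm\<close>

definition sph :: "'a::euclidean_space itself => real" where
 "sph _ = real DIM('a) * unit_ball_vol (real DIM('a))"

lemma sph_pos [simp]: "0 < sph TYPE('a::euclidean_space)"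
 by (simp add: sph_def)

text \<open>Polar coordinates without a measure on the sphere: the image of Lebesgue measure under
  \<open>norm\<close> and the measure with density \<open>sph TYPE('a) * r ^ (DIM('a) - 1)\<close>
  agree on every half line \<open>{..a}\<close>, by the volume of balls and the fundamental theorem
  of calculus, and half lines are an intersection-stable generator.\<close>

lemma nn_integral_radial:
 assumes [measurable]: "h \<in> borel_measurable borel"
 shows "(\<integral>\<^sup>+z. h (norm z) \<partial>(lborel :: 'a::euclidean_space measure))
  = (\<integral>\<^sup>+r\<in>{0<..}. ennreal (sph TYPE('a) * r ^ (DIM('a) - 1)) * h r \<partial>lborel)"
proof -
 let ?N = "distr (lborel :: 'a measure) borel norm"
 let ?D = "density lborel (\<lambda>r::real. ennreal (sph TYPE('a) * r ^ (DIM('a) - 1)) * indicator {0<..} r)"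
 have eqN: "emeasure ?N {..a} = ennreal (if a \<ge> 0 then unit_ball_vol DIM('a) * a ^ DIM('a) else 0)" for a
 proof -
  have "norm -` {..a} \<inter> space lborel = cball (0::'a) a"
   by (auto simp: dist_norm)
  then show ?thesis
   by (cases "a \<ge> 0") (auto simp: emeasure_distr emeasure_cball)
 qed
 have eqD: "emeasure ?D {..a} = ennreal (if a \<ge> 0 then unit_ball_vol DIM('a) * a ^ DIM('a) else 0)" for a
 proof (cases "a \<ge> 0")
  case True
  have "emeasure ?D {..a} = (NBINT r. ennreal (sph TYPE('a) * r ^ (DIM('a) - 1)) * indicator {0<..} r * indicator {..a} r)"
   by (simp add: emeasure_density)
  also have "... = (NBINT r. ennreal (sph TYPE('a) * r ^ (DIM('a) - 1)) * indicator {0..a} r)"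
  proof (rule nn_integral_cong_AE)
   show "AE r in lborel. ennreal (sph TYPE('a) * r ^ (DIM('a) - 1)) * indicator {0<..} r * indicator {..a} r
     = ennreal (sph TYPE('a) * r ^ (DIM('a) - 1)) * indicator {0..a} r"
    using AE_lborel_singleton[of "0::real"] by eventually_elim (auto simp: indicator_def)
  qed
  also have "... = ennreal (unit_ball_vol DIM('a) * a ^ DIM('a) - unit_ball_vol DIM('a) * 0 ^ DIM('a))"
  proof (rule nn_integral_FTC_Icc[where F="\<lambda>r. unit_ball_vol DIM('a) * r ^ DIM('a)"])
   fix x :: real assume x: "x \<in> {0..a}"
   show "((\<lambda>r. unit_ball_vol DIM('a) * r ^ DIM('a)) has_real_derivative sph TYPE('a) * x ^ (DIM('a) - 1)) (at x)"
    by (auto intro!: derivative_eq_intros simp: sph_def)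
   show "0 <= sph TYPE('a) * x ^ (DIM('a) - 1)"
    using x by (simp add: less_imp_le)
  qed (use True in auto)
  finally show ?thesis using True by simp
 next
  case False
  then have "(\<lambda>r. ennreal (sph TYPE('a) * r ^ (DIM('a) - 1)) * indicator {0<..} r * indicator {..a} r) = (\<lambda>r. 0)"
   by (auto simp: indicator_def)
  then show ?thesis using False by (simp add: emeasure_density)
 qed
 have "?N = ?D"
 proof (rule measure_eqI_generator_eq[where E="range (\<lambda>a::real. {..a})" and A="\<lambda>i. {..real i}" and \<Omega>=UNIV])
  show "Int_stable (range (\<lambda>a::real. {..a}))"
   by (auto simp: Int_stable_def Int_atMost)
  show "sets ?N = sigma_sets UNIV (range (\<lambda>a::real. {..a}))" "sets ?D = sigma_sets UNIV (range (\<lambda>a::real. {..a}))"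
   by (simp_all add: borel_eq_atMost)
  show "(\<Union>i. {..real i}) = UNIV"
   using real_arch_simple by auto
  show "emeasure ?N X = emeasure ?D X" if X: "X \<in> range (\<lambda>a::real. {..a})" for X
  proof -
   obtain a where "X = {..a}" using X by blast
   then show ?thesis by (simp only: eqN eqD)
  qed
 qed (auto simp: eqN)
 have "(\<integral>\<^sup>+z. h (norm z) \<partial>(lborel :: 'a measure)) = integral\<^sup>N ?N h"
  by (subst nn_integral_distr) auto
 also note \<open>?N = ?D\<close>
 also have "integral\<^sup>N ?D h = (\<integral>\<^sup>+r\<in>{0<..}. ennreal (sph TYPE('a) * r ^ (DIM('a) - 1)) * h r \<partial>lborel)"
  by (subst nn_integral_density) (auto simp: mult_ac)
 finally show ?thesis .
qed

lemma has_integral_indicator_times: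
 fixes f :: "'a::euclidean_space => real"
 shows "(f has_integral I) S \<longleftrightarrow> ((\<lambda>x. f x * indicator S x) has_integral I) UNIV"
proof -
 have "(\<lambda>x. f x * indicator S x) = (\<lambda>x. if x \<in> S then f x else 0)"
  by (auto simp: indicator_def)
 then show ?thesis
  by (simp only: has_integral_restrict_UNIV)
qed

lemma nn_integral_powr_from_0:
 fixes e R :: real
 assumes "0 < e" "0 <= R"
 shows "(\<integral>\<^sup>+r\<in>{0<..<R}. ennreal (r powr (e - 1)) \<partial>lborel) = ennreal (R powr e / e)"
proof -
 have "((\<lambda>x. x powr (e - 1)) has_integral (R powr e / e)) {0..R}"
  using has_integral_powr_from_0[of "e - 1" R] assms by simp
 then have "((\<lambda>x. x powr (e - 1) * indicator {0..R} x) has_integral (R powr e / e)) UNIV"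
  by (rule iffD1[OF has_integral_indicator_times])
 then have "(NBINT x. ennreal (x powr (e - 1) * indicator {0..R} x)) = ennreal (R powr e / e)"
  by (intro nn_integral_has_integral_lborel) auto
 moreover have "(\<integral>\<^sup>+r\<in>{0<..<R}. ennreal (r powr (e - 1)) \<partial>lborel) = (NBINT x. ennreal (x powr (e - 1) * indicator {0..R} x))"
 proof (rule nn_integral_cong_AE)
  show "AE r in lborel. ennreal (r powr (e - 1)) * indicator {0<..<R} r = ennreal (r powr (e - 1) * indicator {0..R} r)"
   using AE_lborel_singleton[of "0::real"] AE_lborel_singleton[of R] by eventually_elim (auto simp: indicator_def)
 qed
 ultimately show ?thesis by simp
qed

lemma nn_integral_powr_to_inf:
 fixes e R :: real
 assumes "0 < e" "0 < R"
 shows "(\<integral>\<^sup>+r\<in>{R..}. ennreal (r powr (- e - 1)) \<partial>lborel) = ennreal (R powr (- e) / e)"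
proof -
 have "((\<lambda>x. x powr (- e - 1)) has_integral (R powr (- e) / e)) {R..}"
  using has_integral_powr_to_inf[of "- e - 1" R] assms by simp
 then have "((\<lambda>x. x powr (- e - 1) * indicator {R..} x) has_integral (R powr (- e) / e)) UNIV"
  by (rule iffD1[OF has_integral_indicator_times])
 then have "(NBINT x. ennreal (x powr (- e - 1) * indicator {R..} x)) = ennreal (R powr (- e) / e)"
  by (intro nn_integral_has_integral_lborel) auto
 then show ?thesis
  by (simp add: ennreal_mult' ennreal_indicator)
qed

lemma nn_integral_ball_powr:
 fixes w :: "'a::euclidean_space" and e R :: real
 assumes "0 < e" "0 <= R"
 shows "(\<integral>\<^sup>+z\<in>{z. norm (w - z) < R}. ennreal (norm (w - z) powr (e - DIM('a))) \<partial>lborel)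
  = ennreal (sph TYPE('a) / e * R powr e)"
proof -
 have "(\<integral>\<^sup>+z\<in>{z. norm (w - z) < R}. ennreal (norm (w - z) powr (e - DIM('a))) \<partial>lborel)
   = (NBINT z. ennreal (norm (w - z) powr (e - DIM('a))) * indicator {..<R} (norm (w - z)))"
  by (intro nn_integral_cong) (auto simp: indicator_def)
 also have "... = (\<integral>\<^sup>+z. ennreal (norm z powr (e - DIM('a))) * indicator {..<R} (norm z) \<partial>(lborel::'a measure))"
  by (rule nn_integral_lborel_reflect) measurable
 also have "... = (\<integral>\<^sup>+r\<in>{0<..}. ennreal (sph TYPE('a) * r ^ (DIM('a) - 1)) * (ennreal (r powr (e - DIM('a))) * indicator {..<R} r) \<partial>lborel)"
  by (rule nn_integral_radial[where h="\<lambda>r. ennreal (r powr (e - DIM('a))) * indicator {..<R} r"]) measurable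
 also have "... = (NBINT r. ennreal (sph TYPE('a)) * (ennreal (r powr (e - 1)) * indicator {0<..<R} r))"
 proof (intro nn_integral_cong)
  fix r :: real
  have "r ^ (DIM('a) - 1) * r powr (e - DIM('a)) = r powr (e - 1)" if "r > 0"
   using that by (simp add: powr_realpow[symmetric] powr_add[symmetric] of_nat_diff)
  then show "ennreal (sph TYPE('a) * r ^ (DIM('a) - 1)) * (ennreal (r powr (e - DIM('a))) * indicator {..<R} r) * indicator {0<..} r
   = ennreal (sph TYPE('a)) * (ennreal (r powr (e - 1)) * indicator {0<..<R} r)"
   by (auto simp: indicator_def ennreal_mult'[symmetric] mult.assoc less_imp_le)
 qed
 also have "... = ennreal (sph TYPE('a)) * ennreal (R powr e / e)"
  using assms by (subst nn_integral_cmult) (auto simp: nn_integral_powr_from_0)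
 finally show ?thesis
  by (simp add: ennreal_mult'[symmetric] less_imp_le)
qed

lemma nn_integral_outside_powr:
 fixes w :: "'a::euclidean_space" and e R :: real
 assumes "0 < e" "0 < R"
 shows "(\<integral>\<^sup>+z\<in>{z. R <= norm (w - z)}. ennreal (norm (w - z) powr (- e - DIM('a))) \<partial>lborel)
  = ennreal (sph TYPE('a) / e * R powr (- e))"
proof -
 have "(\<integral>\<^sup>+z\<in>{z. R <= norm (w - z)}. ennreal (norm (w - z) powr (- e - DIM('a))) \<partial>lborel)
   = (NBINT z. ennreal (norm (w - z) powr (- e - DIM('a))) * indicator {R..} (norm (w - z)))"
  by (intro nn_integral_cong) (auto simp: indicator_def)
 also have "... = (\<integral>\<^sup>+z. ennreal (norm z powr (- e - DIM('a))) * indicator {R..} (norm z) \<partial>(lborel::'a measure))"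
  by (rule nn_integral_lborel_reflect) measurable
 also have "... = (\<integral>\<^sup>+r\<in>{0<..}. ennreal (sph TYPE('a) * r ^ (DIM('a) - 1)) * (ennreal (r powr (- e - DIM('a))) * indicator {R..} r) \<partial>lborel)"
  by (rule nn_integral_radial[where h="\<lambda>r. ennreal (r powr (- e - DIM('a))) * indicator {R..} r"]) measurable
 also have "... = (NBINT r. ennreal (sph TYPE('a)) * (ennreal (r powr (- e - 1)) * indicator {R..} r))"
 proof (intro nn_integral_cong)
  fix r :: real
  have "r ^ (DIM('a) - 1) * r powr (- e - DIM('a)) = r powr (- e - 1)" if "r > 0"
  proof -
   have "real (DIM('a) - 1) + (- e - DIM('a)) = - e - 1"
    by (simp add: of_nat_diff)
   then show ?thesis
    using that by (simp only: powr_realpow[symmetric] powr_add[symmetric])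
  qed
  then show "ennreal (sph TYPE('a) * r ^ (DIM('a) - 1)) * (ennreal (r powr (- e - DIM('a))) * indicator {R..} r) * indicator {0<..} r
   = ennreal (sph TYPE('a)) * (ennreal (r powr (- e - 1)) * indicator {R..} r)"
   using assms by (auto simp: indicator_def ennreal_mult'[symmetric] mult.assoc less_imp_le)
 qed
 also have "... = ennreal (sph TYPE('a)) * ennreal (R powr (- e) / e)"
  using assms by (subst nn_integral_cmult) (auto simp: nn_integral_powr_to_inf)
 finally show ?thesis
  by (simp add: ennreal_mult'[symmetric] less_imp_le)
qed

section \<open>The Riesz kernel and square functions\<close>

definition riesz :: "real => 'a::euclidean_space => real" where
 "riesz s z = norm z powr (s - DIM('a))"

lemma riesz_nonneg [simp]: "0 <= riesz s z"
 by (simp add: riesz_def)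

lemma riesz_minus [simp]: "riesz s (- z) = riesz s z"
 by (simp add: riesz_def)

lemma riesz_measurable [measurable]: "riesz s \<in> borel_measurable borel"
 unfolding riesz_def[abs_def] by measurable

lemma powr_neg_lipschitz:
 fixes x y m \<beta> :: real
 assumes "0 < m" "m <= x" "m <= y" "0 <= \<beta>"
 shows "\<bar>x powr (- \<beta>) - y powr (- \<beta>)\<bar> <= \<beta> * m powr (- \<beta> - 1) * \<bar>x - y\<bar>"
proof -
 have "norm (x powr (- \<beta>) - y powr (- \<beta>)) <= (\<beta> * m powr (- \<beta> - 1)) * norm (x - y)"
 proof (rule field_differentiable_bound[of "{m..}" "\<lambda>x. x powr (- \<beta>)" "\<lambda>x. - \<beta> * x powr (- \<beta> - 1)"])
  fix z assume z: "z \<in> {m..}"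
  then show "((\<lambda>x. x powr (- \<beta>)) has_field_derivative - \<beta> * z powr (- \<beta> - 1)) (at z within {m..})"
   using assms by (auto intro!: derivative_eq_intros has_real_derivative_powr[THEN has_field_derivative_at_within])
  have "z powr (- \<beta> - 1) <= m powr (- \<beta> - 1)"
   using z assms by (intro powr_mono2') auto
  then show "norm (- \<beta> * z powr (- \<beta> - 1)) <= \<beta> * m powr (- \<beta> - 1)"
   using assms by (simp add: abs_mult mult_left_mono)
 qed (use assms in auto)
 then show ?thesis by simp
qed

lemma riesz_lipschitz:
 fixes a b :: "'a::euclidean_space" and s m :: real
 assumes "0 < m" "m <= norm a" "m <= norm b" "s <= DIM('a)"
 shows "\<bar>riesz s a - riesz s b\<bar> <= (DIM('a) - s) * m powr (s - DIM('a) - 1) * norm (a - b)"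
proof -
 have "\<bar>riesz s a - riesz s b\<bar> <= (DIM('a) - s) * m powr (s - DIM('a) - 1) * \<bar>norm a - norm b\<bar>"
  using powr_neg_lipschitz[of m "norm a" "norm b" "DIM('a) - s"] assms by (simp add: riesz_def)
 also have "... <= (DIM('a) - s) * m powr (s - DIM('a) - 1) * norm (a - b)"
  using assms by (intro mult_left_mono norm_triangle_ineq3) auto
 finally show ?thesis .
qed

section \<open>Absolute convergence, Schur's test and real interpolation\<close>

lemma norm_integral_le_nn:
 fixes f :: "'a => 'b::{banach, second_countable_topology}"
 shows "ennreal (norm (\<integral>x. f x \<partial>M)) <= (\<integral>\<^sup>+x. ennreal (norm (f x)) \<partial>M)"
 by (cases "integrable M f") (auto simp: integral_norm_bound_ennreal not_integrable_integral_eq)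

lemma norm_integral_le_real:
 fixes f :: "'a => 'b::{banach, second_countable_topology}"
 assumes "(\<integral>\<^sup>+x. ennreal (norm (f x)) \<partial>M) <= ennreal C" "0 <= C"
 shows "norm (\<integral>x. f x \<partial>M) <= C"
proof -
 have "ennreal (norm (\<integral>x. f x \<partial>M)) <= ennreal C"
  using norm_integral_le_nn assms(1) by (rule order_trans)
 then show ?thesis using assms(2) by simp
qed

text \<open>Let T have kernel \<open>\<kappa>\<close>. The square norm x of T h is the pairing of h
  with the adjoint image S of T h, and the square norm of S is a quadratic form with the kernel of T
  composed with its adjoint, to which Schur's test applies with constant \<open>C\<^sub>1\<close>.
  Finiteness of \<open>M\<close>, boundedness of \<open>h\<close> and the constants
  \<open>C\<^sub>0\<close>, \<open>D\<close> only make all integrals absolutely convergent and x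
  finite, so that x can be absorbed; they do not enter the bound.\<close>

lemma TTstar_schur:
 fixes \<kappa> :: "'e => 'w => real" and h :: "'w => real" and C\<^sub>0 C\<^sub>1 D H :: real
 assumes M: "finite_measure M" and N: "sigma_finite_measure N"
  and \<kappa>[measurable]: "(\<lambda>(e, w). \<kappa> e w) \<in> borel_measurable (M \<Otimes>\<^sub>M N)"
  and h[measurable]: "h \<in> borel_measurable N" and hH: "!!w. \<bar>h w\<bar> <= H"
  and row: "!!e. e \<in> space M ==> (\<integral>\<^sup>+w. ennreal \<bar>\<kappa> e w\<bar> \<partial>N) <= ennreal C\<^sub>0" and "0 <= C\<^sub>0"
  and col: "!!w. w \<in> space N ==> (\<integral>\<^sup>+e. ennreal \<bar>\<kappa> e w\<bar> \<partial>M) <= ennreal D" and "0 <= D"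
  and schur: "!!e. e \<in> space M ==> (\<integral>\<^sup>+e'. ennreal \<bar>\<integral>w. \<kappa> e w * \<kappa> e' w \<partial>N\<bar> \<partial>M) <= ennreal C\<^sub>1" and "0 < C\<^sub>1"
 shows "(\<integral>\<^sup>+e. ennreal ((\<integral>w. \<kappa> e w * h w \<partial>N)\<^sup>2) \<partial>M) <= ennreal C\<^sub>1 * (\<integral>\<^sup>+w. ennreal ((h w)\<^sup>2) \<partial>N)"
proof (cases "(\<integral>\<^sup>+w. ennreal ((h w)\<^sup>2) \<partial>N) = \<infinity>")
 case True
 then show ?thesis using \<open>0 < C\<^sub>1\<close> by (simp add: ennreal_mult_top)
next
 case False
 interpret M: finite_measure M by fact
 interpret N: sigma_finite_measure N by fact
 have sM: "sigma_finite_measure M" ..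
 have "0 <= H" using hH[of undefined] by linarith
 have \<kappa>1[measurable]: "\<kappa> e \<in> borel_measurable N" if "e \<in> space M" for e
  using measurable_Pair2[OF \<kappa> that] by simp
 have \<kappa>2[measurable]: "(\<lambda>e. \<kappa> e w) \<in> borel_measurable M" if "w \<in> space N" for w
  using measurable_Pair1[OF \<kappa> that] by simp
 have \<kappa>s[measurable]: "(\<lambda>(w, e). \<kappa> e w) \<in> borel_measurable (N \<Otimes>\<^sub>M M)"
  using measurable_compose[OF measurable_pair_swap' \<kappa>] by (simp add: case_prod_unfold)
 define \<Phi> where "\<Phi> e = (\<integral>w. \<kappa> e w * h w \<partial>N)" for e
 define B where "B = H * C\<^sub>0"
 have "0 <= B" using \<open>0 <= H\<close> \<open>0 <= C\<^sub>0\<close> by (simp add: B_def)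
 have \<Phi>m[measurable]: "\<Phi> \<in> borel_measurable M"
  unfolding \<Phi>_def[abs_def] by measurable
 have rowH: "(\<integral>\<^sup>+w. ennreal (norm (\<kappa> e w * u w)) \<partial>N) <= ennreal (c * C\<^sub>0)"
  if "e \<in> space M" "!!w. \<bar>u w\<bar> <= c" "0 <= c" for e u c
 proof -
  have "(\<integral>\<^sup>+w. ennreal (norm (\<kappa> e w * u w)) \<partial>N) <= (\<integral>\<^sup>+w. ennreal c * ennreal \<bar>\<kappa> e w\<bar> \<partial>N)"
   using that by (intro nn_integral_mono) (auto simp: abs_mult ennreal_mult[symmetric] mult.commute intro!: mult_right_mono)
  also have "... = ennreal c * (\<integral>\<^sup>+w. ennreal \<bar>\<kappa> e w\<bar> \<partial>N)"
   using that by (intro nn_integral_cmult) auto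
  also have "... <= ennreal c * ennreal C\<^sub>0"
   using row[OF that(1)] by (intro mult_left_mono) auto
  finally show ?thesis using that by (simp add: ennreal_mult' )
 qed
 have \<Phi>B: "\<bar>\<Phi> e\<bar> <= B" if "e \<in> space M" for e
  using norm_integral_le_real[OF rowH[OF that hH \<open>0 <= H\<close>]] \<open>0 <= B\<close> by (simp add: \<Phi>_def B_def)
 have colB: "(\<integral>\<^sup>+e. ennreal (norm (\<Phi> e * \<kappa> e w)) \<partial>M) <= ennreal (B * D)" if "w \<in> space N" for w
 proof -
  have "(\<integral>\<^sup>+e. ennreal (norm (\<Phi> e * \<kappa> e w)) \<partial>M) <= (\<integral>\<^sup>+e. ennreal B * ennreal \<bar>\<kappa> e w\<bar> \<partial>M)"
   using \<Phi>B \<open>0 <= B\<close> by (intro nn_integral_mono) (auto simp: abs_mult ennreal_mult[symmetric] intro!: mult_right_mono)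
  also have "... = ennreal B * (\<integral>\<^sup>+e. ennreal \<bar>\<kappa> e w\<bar> \<partial>M)"
   using that by (intro nn_integral_cmult) auto
  also have "... <= ennreal B * ennreal D"
   using col[OF that] by (intro mult_left_mono) auto
  finally show ?thesis using \<open>0 <= B\<close> by (simp add: ennreal_mult')
 qed
 define S where "S w = (\<integral>e. \<Phi> e * \<kappa> e w \<partial>M)" for w
 have Sm[measurable]: "S \<in> borel_measurable N"
  unfolding S_def[abs_def] by measurable
 have SB: "\<bar>S w\<bar> <= B * D" if "w \<in> space N" for w
  using norm_integral_le_real[OF colB[OF that]] \<open>0 <= B\<close> \<open>0 <= D\<close> by (simp add: S_def)
 \<comment> \<open>The column bound is available on \<open>space N\<close> only, whereas
   \<open>fin\<close> wants a function bounded everywhere.\<close>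
 define S' where "S' w = (if w \<in> space N then S w else 0)" for w
 have S'B: "\<bar>S' w\<bar> <= B * D" for w
  using SB \<open>0 <= B\<close> \<open>0 <= D\<close> by (simp add: S'_def)
 have Mfin: "emeasure M (space M) < \<infinity>"
  using M.emeasure_finite[of "space M"] by (simp add: less_top[symmetric])
 have fin: "(\<integral>\<^sup>+e. \<integral>\<^sup>+w. ennreal (norm (\<Phi> e * (\<kappa> e w * u w))) \<partial>N \<partial>M) < \<infinity>"
  if "!!w. \<bar>u w\<bar> <= c" "0 <= c" and [measurable]: "u \<in> borel_measurable N" for u c
 proof -
  have "(\<integral>\<^sup>+e. \<integral>\<^sup>+w. ennreal (norm (\<Phi> e * (\<kappa> e w * u w))) \<partial>N \<partial>M) <= (\<integral>\<^sup>+e. ennreal (B * (c * C\<^sub>0)) \<partial>M)"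
  proof (rule nn_integral_mono)
   fix e assume e: "e \<in> space M"
   have "(\<integral>\<^sup>+w. ennreal (norm (\<Phi> e * (\<kappa> e w * u w))) \<partial>N) <= (\<integral>\<^sup>+w. ennreal B * ennreal (norm (\<kappa> e w * u w)) \<partial>N)"
    using \<Phi>B[OF e] \<open>0 <= B\<close> by (intro nn_integral_mono) (auto simp: abs_mult ennreal_mult[symmetric] intro!: mult_right_mono)
   also have "... = ennreal B * (\<integral>\<^sup>+w. ennreal (norm (\<kappa> e w * u w)) \<partial>N)"
    using e by (intro nn_integral_cmult) auto
   also have "... <= ennreal B * ennreal (c * C\<^sub>0)"
    by (intro mult_left_mono rowH[OF e that(1,2)]) auto
   finally show "(\<integral>\<^sup>+w. ennreal (norm (\<Phi> e * (\<kappa> e w * u w))) \<partial>N) <= ennreal (B * (c * C\<^sub>0))"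
    using \<open>0 <= B\<close> by (simp add: ennreal_mult')
  qed
  also have "... < \<infinity>"
   using Mfin by (simp add: ennreal_mult_less_top)
  finally show ?thesis .
 qed
 define R where "R e e' = (\<integral>w. \<kappa> e w * \<kappa> e' w \<partial>N)" for e e'
 let ?P = "\<lambda>e. \<integral>e'. \<Phi> e' * R e e' \<partial>M"
 let ?Q = "\<lambda>e e'. (\<Phi> e)\<^sup>2 / 2 * \<bar>R e e'\<bar>"
 have R_sym: "R e e' = R e' e" for e e'
  by (simp add: R_def mult.commute)
 have Rm[measurable]: "(\<lambda>(e, e'). R e e') \<in> borel_measurable (M \<Otimes>\<^sub>M M)"
 proof -
  have "(\<lambda>(e, e'). R e e') = (\<lambda>z. \<integral>w. \<kappa> (fst z) w * \<kappa> (snd z) w \<partial>N)"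
   by (auto simp: R_def)
  moreover have "(\<lambda>(z, w). \<kappa> (fst z) w * \<kappa> (snd z) w) \<in> borel_measurable ((M \<Otimes>\<^sub>M M) \<Otimes>\<^sub>M N)"
   by measurable
  ultimately show ?thesis
   using N.borel_measurable_lebesgue_integral[of "\<lambda>z w. \<kappa> (fst z) w * \<kappa> (snd z) w" "M \<Otimes>\<^sub>M M"] by simp
 qed
 define X where "X = (\<integral>\<^sup>+e. ennreal ((\<Phi> e)\<^sup>2) \<partial>M)"
 have X_int: "integrable M (\<lambda>e. (\<Phi> e)\<^sup>2)"
 proof (rule M.integrable_const_bound[where B="B\<^sup>2"])
  show "AE e in M. norm ((\<Phi> e)\<^sup>2) <= B\<^sup>2"
   using \<Phi>B by (intro AE_I2) (auto simp: abs_le_square_iff[symmetric] intro: order_trans[OF _ abs_ge_self])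
 qed simp
 define x where "x = (\<integral>e. (\<Phi> e)\<^sup>2 \<partial>M)"
 have Xx: "X = ennreal x"
  unfolding X_def x_def by (rule nn_integral_eq_integral[OF X_int]) simp
 have "0 <= x" unfolding x_def by simp
 have h2: "integrable N (\<lambda>w. (h w)\<^sup>2)"
  using False by (intro integrableI_bounded) (auto simp: less_top)
 define y where "y = (\<integral>w. (h w)\<^sup>2 \<partial>N)"
 have xhS: "x = (\<integral>w. h w * S w \<partial>N)" and hS_int: "integrable N (\<lambda>w. h w * S w)"
 proof -
  have "x = (\<integral>e. \<integral>w. \<Phi> e * (\<kappa> e w * h w) \<partial>N \<partial>M)"
   by (simp add: x_def \<Phi>_def power2_eq_square)
  also have "... = (\<integral>w. \<integral>e. \<Phi> e * (\<kappa> e w * h w) \<partial>M \<partial>N)"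
   by (rule Fubini_nn_eq[OF sM N]) (use fin[OF hH \<open>0 <= H\<close> h] in measurable)
  also have "... = (\<integral>w. h w * S w \<partial>N)"
   by (simp add: S_def mult_ac flip: integral_mult_right_zero integral_mult_left_zero)
  finally show "x = (\<integral>w. h w * S w \<partial>N)" .
  have "integrable N (\<lambda>w. \<integral>e. \<Phi> e * (\<kappa> e w * h w) \<partial>M)"
   by (rule Fubini_nn_integrable2[OF sM N]) (use fin[OF hH \<open>0 <= H\<close> h] in measurable)
  then show "integrable N (\<lambda>w. h w * S w)"
   by (simp add: S_def mult_ac flip: integral_mult_right_zero integral_mult_left_zero)
 qed
 have S'm[measurable]: "S' \<in> borel_measurable N"
  using Sm by (subst measurable_cong[of _ _ S]) (auto simp: S'_def)
 have BD: "0 <= B * D" using \<open>0 <= B\<close> \<open>0 <= D\<close> by simp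
 have S2_eq: "(\<integral>w. (S' w)\<^sup>2 \<partial>N) = (\<integral>e. \<Phi> e * (?P e) \<partial>M)"
  and S2_int: "integrable N (\<lambda>w. (S' w)\<^sup>2)"
 proof -
  have *: "(\<integral>e. \<Phi> e * (\<kappa> e w * S' w) \<partial>M) = (S' w)\<^sup>2" if "w \<in> space N" for w
   using that by (simp add: S_def S'_def power2_eq_square mult_ac flip: integral_mult_right_zero integral_mult_left_zero)
  have "integrable N (\<lambda>w. \<integral>e. \<Phi> e * (\<kappa> e w * S' w) \<partial>M)"
   by (rule Fubini_nn_integrable2[OF sM N]) (use fin[OF S'B BD S'm] in measurable)
  then show "integrable N (\<lambda>w. (S' w)\<^sup>2)"
   by (subst (asm) Bochner_Integration.integrable_cong[OF refl *]) auto
  have "(\<integral>w. (S' w)\<^sup>2 \<partial>N) = (\<integral>w. \<integral>e. \<Phi> e * (\<kappa> e w * S' w) \<partial>M \<partial>N)"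
   by (intro Bochner_Integration.integral_cong refl) (simp add: *)
  also have "... = (\<integral>e. \<integral>w. \<Phi> e * (\<kappa> e w * S' w) \<partial>N \<partial>M)"
   by (rule Fubini_nn_eq[OF sM N, symmetric]) (use fin[OF S'B BD S'm] in measurable)
  also have "... = (\<integral>e. \<Phi> e * (?P e) \<partial>M)"
  proof (intro Bochner_Integration.integral_cong refl)
   fix e assume e: "e \<in> space M"
   have f: "(\<integral>\<^sup>+w. \<integral>\<^sup>+e'. ennreal (norm (\<kappa> e w * (\<Phi> e' * \<kappa> e' w))) \<partial>M \<partial>N) < \<infinity>"
   proof -
    have "(\<integral>\<^sup>+w. \<integral>\<^sup>+e'. ennreal (norm (\<kappa> e w * (\<Phi> e' * \<kappa> e' w))) \<partial>M \<partial>N) <= (\<integral>\<^sup>+w. ennreal \<bar>\<kappa> e w\<bar> * ennreal (B * D) \<partial>N)"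
    proof (rule nn_integral_mono)
     fix w assume w: "w \<in> space N"
     have "(\<integral>\<^sup>+e'. ennreal (norm (\<kappa> e w * (\<Phi> e' * \<kappa> e' w))) \<partial>M) = ennreal \<bar>\<kappa> e w\<bar> * (\<integral>\<^sup>+e'. ennreal (norm (\<Phi> e' * \<kappa> e' w)) \<partial>M)"
      using w by (subst nn_integral_cmult[symmetric]) (auto simp: abs_mult ennreal_mult)
     also have "... <= ennreal \<bar>\<kappa> e w\<bar> * ennreal (B * D)"
      using colB[OF w] by (intro mult_left_mono) auto
     finally show "(\<integral>\<^sup>+e'. ennreal (norm (\<kappa> e w * (\<Phi> e' * \<kappa> e' w))) \<partial>M) <= ennreal \<bar>\<kappa> e w\<bar> * ennreal (B * D)" .
    qed
    also have "... = (\<integral>\<^sup>+w. ennreal \<bar>\<kappa> e w\<bar> \<partial>N) * ennreal (B * D)"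
     using e by (intro nn_integral_multc) auto
    also have "... <= ennreal C\<^sub>0 * ennreal (B * D)"
     using row[OF e] by (intro mult_right_mono) auto
    also have "... < \<infinity>" by (simp add: ennreal_mult_less_top)
    finally show ?thesis .
   qed
   have "(\<integral>w. \<kappa> e w * S' w \<partial>N) = (\<integral>w. \<integral>e'. \<kappa> e w * (\<Phi> e' * \<kappa> e' w) \<partial>M \<partial>N)"
    by (intro Bochner_Integration.integral_cong refl) (simp add: S'_def S_def)
   also have "... = (\<integral>e'. \<integral>w. \<kappa> e w * (\<Phi> e' * \<kappa> e' w) \<partial>N \<partial>M)"
    by (rule Fubini_nn_eq[OF N sM]) (use f e in measurable)
   also have "... = (?P e)"
    by (simp add: R_def mult_ac flip: integral_mult_right_zero)
   finally show "(\<integral>w. \<Phi> e * (\<kappa> e w * S' w) \<partial>N) = \<Phi> e * (?P e)"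
    by simp
  qed
  finally show "(\<integral>w. (S' w)\<^sup>2 \<partial>N) = (\<integral>e. \<Phi> e * (?P e) \<partial>M)" .
 qed
 \<comment> \<open>Schur's test for a symmetric kernel: the product of two values of
   \<open>\<Phi>\<close> is at most the sum of their half squares, both halves contribute equally by
   symmetry of \<open>R\<close>, and the inner integral of |R| is at most
   \<open>C\<^sub>1\<close>.\<close>
 have half: "(\<integral>\<^sup>+e. \<integral>\<^sup>+e'. ennreal (?Q e e') \<partial>M \<partial>M) <= ennreal (C\<^sub>1 * x / 2)"
 proof -
  have "(\<integral>\<^sup>+e. \<integral>\<^sup>+e'. ennreal (?Q e e') \<partial>M \<partial>M) <= (\<integral>\<^sup>+e. ennreal ((\<Phi> e)\<^sup>2) * ennreal (C\<^sub>1 / 2) \<partial>M)"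
  proof (rule nn_integral_mono)
   fix e assume e: "e \<in> space M"
   have "(\<integral>\<^sup>+e'. ennreal (?Q e e') \<partial>M) = ennreal ((\<Phi> e)\<^sup>2 / 2) * (\<integral>\<^sup>+e'. ennreal \<bar>R e e'\<bar> \<partial>M)"
    using e by (subst nn_integral_cmult[symmetric]) (auto simp: ennreal_mult[symmetric])
   also have "... <= ennreal ((\<Phi> e)\<^sup>2 / 2) * ennreal C\<^sub>1"
    using schur[OF e] by (intro mult_left_mono) (auto simp: R_def)
   also have "... = ennreal ((\<Phi> e)\<^sup>2) * ennreal (C\<^sub>1 / 2)"
    using \<open>0 < C\<^sub>1\<close> by (simp add: ennreal_mult[symmetric])
   finally show "(\<integral>\<^sup>+e'. ennreal (?Q e e') \<partial>M) <= ennreal ((\<Phi> e)\<^sup>2) * ennreal (C\<^sub>1 / 2)" .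
  qed
  also have "... = X * ennreal (C\<^sub>1 / 2)"
   by (simp add: nn_integral_multc X_def)
  finally show ?thesis
   using \<open>0 <= x\<close> \<open>0 < C\<^sub>1\<close> by (simp add: Xx ennreal_mult[symmetric] mult.commute)
 qed
 have "ennreal (norm (\<integral>e. \<Phi> e * (?P e) \<partial>M)) <= ennreal (C\<^sub>1 * x)"
 proof -
  have "ennreal (norm (\<integral>e. \<Phi> e * (?P e) \<partial>M)) <= (\<integral>\<^sup>+e. ennreal (norm (\<integral>e'. \<Phi> e * (\<Phi> e' * R e e') \<partial>M)) \<partial>M)"
   using norm_integral_le_nn[of M "\<lambda>e. \<Phi> e * (?P e)"] by simp
  also have "... <= (\<integral>\<^sup>+e. \<integral>\<^sup>+e'. ennreal (norm (\<Phi> e * (\<Phi> e' * R e e'))) \<partial>M \<partial>M)"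
   by (intro nn_integral_mono norm_integral_le_nn)
  also have "... <= (\<integral>\<^sup>+e. \<integral>\<^sup>+e'. ennreal (?Q e e') + ennreal (?Q e' e) \<partial>M \<partial>M)"
  proof (intro nn_integral_mono)
   fix e e'
   have "0 <= (\<bar>\<Phi> e\<bar> - \<bar>\<Phi> e'\<bar>)\<^sup>2" by simp
   then have "\<bar>\<Phi> e\<bar> * \<bar>\<Phi> e'\<bar> <= (\<Phi> e)\<^sup>2 / 2 + (\<Phi> e')\<^sup>2 / 2"
    by (simp add: power2_diff)
   then have "\<bar>\<Phi> e\<bar> * \<bar>\<Phi> e'\<bar> * \<bar>R e e'\<bar> <= ((\<Phi> e)\<^sup>2 / 2 + (\<Phi> e')\<^sup>2 / 2) * \<bar>R e e'\<bar>"
    by (intro mult_right_mono) auto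
   then show "ennreal (norm (\<Phi> e * (\<Phi> e' * R e e'))) <= ennreal (?Q e e') + ennreal (?Q e' e)"
    by (simp add: R_sym[of e' e] abs_mult algebra_simps flip: ennreal_plus)
  qed
  also have "... = (\<integral>\<^sup>+e. \<integral>\<^sup>+e'. ennreal (?Q e e') \<partial>M \<partial>M) + (\<integral>\<^sup>+e. \<integral>\<^sup>+e'. ennreal (?Q e' e) \<partial>M \<partial>M)"
   by (subst nn_integral_add[symmetric], measurable, intro nn_integral_cong nn_integral_add) measurable
  also have "(\<integral>\<^sup>+e. \<integral>\<^sup>+e'. ennreal (?Q e' e) \<partial>M \<partial>M) = (\<integral>\<^sup>+e'. \<integral>\<^sup>+e. ennreal (?Q e' e) \<partial>M \<partial>M)"
  proof -
   interpret MM: pair_sigma_finite M M ..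
   show ?thesis by (rule MM.Fubini'[symmetric]) measurable
  qed
  also have "(\<integral>\<^sup>+e. \<integral>\<^sup>+e'. ennreal (?Q e e') \<partial>M \<partial>M) + (\<integral>\<^sup>+e. \<integral>\<^sup>+e'. ennreal (?Q e e') \<partial>M \<partial>M) <= ennreal (C\<^sub>1 * x / 2) + ennreal (C\<^sub>1 * x / 2)"
   by (intro add_mono half)
  also have "... = ennreal (C\<^sub>1 * x)"
   using \<open>0 <= x\<close> \<open>0 < C\<^sub>1\<close> by (simp flip: ennreal_plus)
  finally show ?thesis .
 qed
 then have S2: "(\<integral>w. (S' w)\<^sup>2 \<partial>N) <= C\<^sub>1 * x"
  using \<open>0 <= x\<close> \<open>0 < C\<^sub>1\<close> by (simp add: S2_eq)
 have "x = (\<integral>w. h w * S' w \<partial>N)"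
  unfolding xhS by (intro Bochner_Integration.integral_cong) (auto simp: S'_def)
 \<comment> \<open>The weights in this arithmetic-geometric inequality are chosen so that the
   \<open>S'\<close> term becomes x / 2, which the left side absorbs.\<close>
 also have "... <= (\<integral>w. C\<^sub>1 / 2 * (h w)\<^sup>2 + 1 / (2 * C\<^sub>1) * (S' w)\<^sup>2 \<partial>N)"
 proof (rule integral_mono)
  show "integrable N (\<lambda>w. h w * S' w)"
   using hS_int by (subst Bochner_Integration.integrable_cong[of N N _ "\<lambda>w. h w * S w"]) (auto simp: S'_def)
  show "integrable N (\<lambda>w. C\<^sub>1 / 2 * (h w)\<^sup>2 + 1 / (2 * C\<^sub>1) * (S' w)\<^sup>2)"
   using h2 S2_int by auto
  fix w
  have "0 <= (C\<^sub>1 * h w - S' w)\<^sup>2 / (2 * C\<^sub>1)" using \<open>0 < C\<^sub>1\<close> by simp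
  also have "... = C\<^sub>1 / 2 * (h w)\<^sup>2 + 1 / (2 * C\<^sub>1) * (S' w)\<^sup>2 - h w * S' w"
   using \<open>0 < C\<^sub>1\<close> by (simp add: power2_eq_square field_simps)
  finally show "h w * S' w <= C\<^sub>1 / 2 * (h w)\<^sup>2 + 1 / (2 * C\<^sub>1) * (S' w)\<^sup>2" by simp
 qed
 also have "... = C\<^sub>1 / 2 * y + 1 / (2 * C\<^sub>1) * (\<integral>w. (S' w)\<^sup>2 \<partial>N)"
  using h2 S2_int by (simp add: y_def)
 also have "... <= C\<^sub>1 / 2 * y + 1 / (2 * C\<^sub>1) * (C\<^sub>1 * x)"
  using S2 \<open>0 < C\<^sub>1\<close> by (intro add_left_mono mult_left_mono) auto
 finally have "x <= C\<^sub>1 * y"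
  using \<open>0 < C\<^sub>1\<close> by (simp add: field_simps)
 then have "X <= ennreal (C\<^sub>1 * y)"
  by (simp add: Xx ennreal_leI)
 also have "... = ennreal C\<^sub>1 * ennreal y"
  using \<open>0 < C\<^sub>1\<close> by (simp add: ennreal_mult')
 also have "ennreal y = (\<integral>\<^sup>+w. ennreal ((h w)\<^sup>2) \<partial>N)"
  unfolding y_def by (rule nn_integral_eq_integral[OF h2, symmetric]) simp
 finally show ?thesis
  by (simp add: X_def \<Phi>_def)
qed

text \<open>Powers are needed on \<open>ennreal\<close>, since maximal functions and potentials of
  |g| may be infinite at some points.\<close>

definition epow :: "ennreal => real => ennreal" where
 "epow x q = (if x = \<infinity> then \<infinity> else ennreal (enn2real x powr q))"

lemma epow_ennreal [simp]: "0 <= t ==> epow (ennreal t) q = ennreal (t powr q)"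
 by (simp add: epow_def)

lemma epow_layer_cake:
 assumes "0 < q"
 shows "epow x q = (NBINT l. ennreal (q * l powr (q - 1)) * indicator {l. 0 < l & ennreal l < x} l)"
proof -
 have fin: "(NBINT l. ennreal (q * l powr (q - 1)) * indicator {0<..<t} l) = ennreal (t powr q)" if "0 <= t" for t
 proof -
  have "(NBINT l. ennreal (q * l powr (q - 1)) * indicator {0<..<t} l) = (NBINT l. ennreal q * (ennreal (l powr (q - 1)) * indicator {0<..<t} l))"
   using assms by (simp add: ennreal_mult mult.assoc)
  also have "... = ennreal q * ennreal (t powr q / q)"
   using assms that by (subst nn_integral_cmult) (auto simp: nn_integral_powr_from_0)
  finally show ?thesis using assms by (simp add: ennreal_mult[symmetric])
 qed
 show ?thesis
 proof (cases x)
  case (real t)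
  then have "{l. 0 < l & ennreal l < x} = {0<..<t}"
   by (auto simp: ennreal_less_iff)
  then show ?thesis using fin real by simp
 next
  case top
  let ?I = "(NBINT l. ennreal (q * l powr (q - 1)) * indicator {l. 0 < l & ennreal l < x} l)"
  have *: "ennreal (t powr q) <= ?I" if "0 <= t" for t
   unfolding fin[OF that, symmetric] using top by (intro nn_integral_mono) (auto simp: indicator_def)
  have "of_nat n <= ?I" for n :: nat
   using assms *[of "real n powr (1 / q)"] by (simp add: powr_powr ennreal_of_nat_eq_real_of_nat)
  then have "?I = \<infinity>"
   by (metis ennreal_Ex_less_of_nat infinity_ennreal_def less_top not_less)
  then show ?thesis using top by (simp add: epow_def)
 qed
qed

text \<open>No operator occurs: \<open>weak\<close> is the estimate that remains once the data have
  been cut at height l / D, with only the large part surviving. After the layer cake formula and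
  Tonelli, the integral of l powr (q - r - 1) over 0 < l < D * \<gamma> w converges because r <
  q.\<close>

lemma marcinkiewicz:
 fixes \<Phi> :: "'e => ennreal" and \<gamma> :: "'w => real" and r q B D :: real
 assumes "sigma_finite_measure M" "sigma_finite_measure N"
  and [measurable]: "\<Phi> \<in> borel_measurable M" "\<gamma> \<in> borel_measurable N"
  and \<gamma>0: "!!w. 0 <= \<gamma> w" and "0 < r" "r < q" "0 <= B" "0 < D"
  and weak: "!!l. 0 < l ==> emeasure M {e \<in> space M. ennreal l < \<Phi> e}
   <= ennreal (B * l powr (- r)) * (\<integral>\<^sup>+w. ennreal (\<gamma> w powr r) * indicator {w. l < D * \<gamma> w} w \<partial>N)"
 shows "(\<integral>\<^sup>+e. epow (\<Phi> e) q \<partial>M) <= ennreal (B * q / (q - r) * D powr (q - r)) * (\<integral>\<^sup>+w. ennreal (\<gamma> w powr q) \<partial>N)"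
proof -
 let ?J = "\<lambda>l w. ennreal (\<gamma> w powr r) * (ennreal (l powr ((q - r) - 1)) * indicator {0<..<D * \<gamma> w} l)"
 interpret M: sigma_finite_measure M by fact
 interpret N: sigma_finite_measure N by fact
 interpret MxL: pair_sigma_finite M lborel ..
 interpret NxL: pair_sigma_finite N lborel ..
 have "0 < q" using assms by simp
 have "(\<integral>\<^sup>+e. epow (\<Phi> e) q \<partial>M)
  = (\<integral>\<^sup>+e. (NBINT l. ennreal (q * l powr (q - 1)) * indicator {l. 0 < l & ennreal l < \<Phi> e} l) \<partial>M)"
  by (simp add: epow_layer_cake[OF \<open>0 < q\<close>])
 also have "... = (NBINT l. \<integral>\<^sup>+e. ennreal (q * l powr (q - 1)) * indicator {l. 0 < l & ennreal l < \<Phi> e} l \<partial>M)"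
  by (rule MxL.Fubini'[symmetric]) measurable
 also have "... <= (NBINT l. \<integral>\<^sup>+w. ennreal (B * q) * (?J l w) \<partial>N)"
 proof (rule nn_integral_mono)
  fix l :: real
  show "(\<integral>\<^sup>+e. ennreal (q * l powr (q - 1)) * indicator {l. 0 < l & ennreal l < \<Phi> e} l \<partial>M)
   <= (\<integral>\<^sup>+w. ennreal (B * q) * (?J l w) \<partial>N)"
  proof (cases "0 < l")
   case True
   have "(\<integral>\<^sup>+e. ennreal (q * l powr (q - 1)) * indicator {l. 0 < l & ennreal l < \<Phi> e} l \<partial>M)
    = (\<integral>\<^sup>+e. ennreal (q * l powr (q - 1)) * indicator {e \<in> space M. ennreal l < \<Phi> e} e \<partial>M)"
    using True by (intro nn_integral_cong) (auto simp: indicator_def)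
   also have "... = ennreal (q * l powr (q - 1)) * emeasure M {e \<in> space M. ennreal l < \<Phi> e}"
    by (rule nn_integral_cmult_indicator) measurable
   also have "... <= ennreal (q * l powr (q - 1)) * (ennreal (B * l powr (- r)) * (\<integral>\<^sup>+w. ennreal (\<gamma> w powr r) * indicator {w. l < D * \<gamma> w} w \<partial>N))"
    by (intro mult_left_mono weak True) auto
   also have "... = ennreal (B * q * l powr ((q - r) - 1)) * (\<integral>\<^sup>+w. ennreal (\<gamma> w powr r) * indicator {w. l < D * \<gamma> w} w \<partial>N)"
   proof -
    have "q * l powr (q - 1) * (B * l powr (- r)) = B * q * (l powr (q - 1) * l powr (- r))" by simp
    also have "l powr (q - 1) * l powr (- r) = l powr ((q - r) - 1)"
     using True by (simp add: algebra_simps flip: powr_add)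
    finally have "ennreal (q * l powr (q - 1)) * ennreal (B * l powr (- r)) = ennreal (B * q * l powr ((q - r) - 1))"
     using \<open>0 <= B\<close> \<open>0 < q\<close> by (subst ennreal_mult[symmetric]) auto
    then show ?thesis
     by (simp only: mult.assoc[symmetric])
   qed
   also have "... = (\<integral>\<^sup>+w. ennreal (B * q * l powr ((q - r) - 1)) * (ennreal (\<gamma> w powr r) * indicator {w. l < D * \<gamma> w} w) \<partial>N)"
    by (rule nn_integral_cmult[symmetric]) measurable
   also have "... = (\<integral>\<^sup>+w. ennreal (B * q) * (?J l w) \<partial>N)"
    using True \<open>0 <= B\<close> \<open>0 < q\<close> by (intro nn_integral_cong) (auto simp: indicator_def ennreal_mult[symmetric] mult_ac)
   finally show ?thesis by simp
  qed auto
 qed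
 also have "... = (\<integral>\<^sup>+w. (NBINT l. ennreal (B * q) * (?J l w)) \<partial>N)"
  by (rule NxL.Fubini', unfold indicator_def greaterThanLessThan_iff) measurable
 also have "... = (\<integral>\<^sup>+w. ennreal (B * q / (q - r) * D powr (q - r)) * ennreal (\<gamma> w powr q) \<partial>N)"
 proof (rule nn_integral_cong)
  fix w
  have "(NBINT l. ennreal (B * q) * (?J l w))
   = ennreal (B * q) * (ennreal (\<gamma> w powr r) * ennreal ((D * \<gamma> w) powr (q - r) / (q - r)))"
   using \<gamma>0[of w] assms by (simp add: nn_integral_cmult nn_integral_powr_from_0)
  also have "... = ennreal (B * q * (\<gamma> w powr r * ((D * \<gamma> w) powr (q - r) / (q - r))))"
   using \<open>0 <= B\<close> \<open>r < q\<close> \<open>0 < q\<close> by (simp add: ennreal_mult[symmetric])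
  also have "B * q * (\<gamma> w powr r * ((D * \<gamma> w) powr (q - r) / (q - r))) = B * q / (q - r) * D powr (q - r) * (\<gamma> w powr r * \<gamma> w powr (q - r))"
   using \<gamma>0[of w] \<open>0 < D\<close> by (simp add: powr_mult)
  also have "\<gamma> w powr r * \<gamma> w powr (q - r) = \<gamma> w powr q"
   by (simp flip: powr_add)
  finally show "(NBINT l. ennreal (B * q) * (?J l w))
   = ennreal (B * q / (q - r) * D powr (q - r)) * ennreal (\<gamma> w powr q)"
   using \<open>0 <= B\<close> \<open>r < q\<close> \<open>0 < q\<close> by (simp add: ennreal_mult[symmetric])
 qed
 also have "... = ennreal (B * q / (q - r) * D powr (q - r)) * (\<integral>\<^sup>+w. ennreal (\<gamma> w powr q) \<partial>N)"
  by (rule nn_integral_cmult) measurable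
 finally show ?thesis .
qed

section \<open>The maximal function\<close>

text \<open>Uncentred, over open balls: superlevel sets are then unions of open balls, hence open
  for an arbitrary \<open>\<gamma>\<close>, and such a union is what the covering lemma takes as
  input.\<close>

definition maximal :: "('a::euclidean_space => ennreal) => 'a => ennreal" where
 "maximal \<gamma> z = (SUP (c, r)\<in>{(c, r). 0 < r & z \<in> ball c r}. (\<integral>\<^sup>+w\<in>ball c r. \<gamma> w \<partial>lborel) / emeasure lborel (ball c r))"

lemma emeasure_ball_pos: "0 < r ==> 0 < emeasure lborel (ball (c::'a::euclidean_space) r)"
 by (simp add: emeasure_ball)

lemma emeasure_ball_fin: "emeasure lborel (ball (c::'a::euclidean_space) r) < \<infinity>"
 by (cases "0 <= r") (auto simp: emeasure_ball ball_empty)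

lemma ennreal_less_divide_iff:
 fixes a b x :: ennreal
 assumes "0 < b" "b < \<infinity>"
 shows "x < a / b \<longleftrightarrow> x * b < a"
proof -
 obtain b' where b: "b = ennreal b'" "0 < b'"
  using assms by (cases b) auto
 show ?thesis
 proof (cases x; cases a)
  fix x' a' assume "x = ennreal x'" "0 <= x'" "a = ennreal a'" "0 <= a'"
  then show ?thesis using b
   by (simp add: divide_ennreal ennreal_mult[symmetric] ennreal_less_iff pos_less_divide_eq)
 next
  fix x' assume "x = ennreal x'" "0 <= x'" "a = top"
  then show ?thesis using b
   by (simp add: ennreal_top_divide ennreal_mult[symmetric])
 next
  fix a' assume "x = top" "a = ennreal a'" "0 <= a'"
  then show ?thesis using b by (simp add: ennreal_top_mult)
 next
  assume "x = top" "a = top"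
  then show ?thesis using b by (simp add: ennreal_top_mult)
 qed
qed

lemma maximal_superlevel:
 "{z. x < maximal \<gamma> z} = (\<Union>(c, r)\<in>{(c, r). 0 < r & x * emeasure lborel (ball c r) < (\<integral>\<^sup>+w\<in>ball c r. \<gamma> w \<partial>lborel)}. ball c r)"
proof (intro set_eqI iffI)
 fix z assume "z \<in> {z. x < maximal \<gamma> z}"
 then obtain c r where "0 < r" "z \<in> ball c r" "x < (\<integral>\<^sup>+w\<in>ball c r. \<gamma> w \<partial>lborel) / emeasure lborel (ball c r)"
  unfolding maximal_def less_SUP_iff by auto
 then show "z \<in> (\<Union>(c, r)\<in>{(c, r). 0 < r & x * emeasure lborel (ball c r) < (\<integral>\<^sup>+w\<in>ball c r. \<gamma> w \<partial>lborel)}. ball c r)"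
  by (intro UN_I[of "(c, r)"]) (auto simp: ennreal_less_divide_iff emeasure_ball_pos emeasure_ball_fin[unfolded infinity_ennreal_def])
next
 fix z assume "z \<in> (\<Union>(c, r)\<in>{(c, r). 0 < r & x * emeasure lborel (ball c r) < (\<integral>\<^sup>+w\<in>ball c r. \<gamma> w \<partial>lborel)}. ball c r)"
 then obtain c r where *: "0 < r" "z \<in> ball c r" "x * emeasure lborel (ball c r) < (\<integral>\<^sup>+w\<in>ball c r. \<gamma> w \<partial>lborel)"
  by auto
 have "x < (\<integral>\<^sup>+w\<in>ball c r. \<gamma> w \<partial>lborel) / emeasure lborel (ball c r)"
  using * by (simp add: ennreal_less_divide_iff emeasure_ball_pos emeasure_ball_fin[unfolded infinity_ennreal_def])
 then show "z \<in> {z. x < maximal \<gamma> z}"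
  unfolding maximal_def less_SUP_iff using * by (intro CollectI bexI[of _ "(c, r)"]) auto
qed

lemma open_maximal_superlevel: "open {z. x < maximal \<gamma> z}"
 unfolding maximal_superlevel by auto

lemma maximal_measurable [measurable]: "maximal \<gamma> \<in> borel_measurable borel"
 by (intro borel_measurableI_greater) (simp add: borel_open open_maximal_superlevel)

lemma average_le_maximal:
 assumes "0 < r" "z \<in> ball c r"
 shows "(\<integral>\<^sup>+w\<in>ball c r. \<gamma> w \<partial>lborel) <= maximal \<gamma> z * emeasure lborel (ball c r)"
proof (rule ccontr)
 assume "\<not> ?thesis"
 then have "z \<in> {z'. maximal \<gamma> z < maximal \<gamma> z'}"
  unfolding maximal_superlevel using assms by (auto simp: not_le)
 then show False by simp
qed

text \<open>Vitali covering: the balls on which the average exceeds l contain a countable disjoint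
  subfamily whose fivefold enlargements cover the superlevel set. Disjointness turns the sum of the
  integrals over the subfamily into a single integral of \<open>\<gamma>\<close>.\<close>

lemma maximal_weak_type:
 fixes \<gamma> :: "'a::euclidean_space => ennreal"
 assumes [measurable]: "\<gamma> \<in> borel_measurable borel" and "0 < l"
 shows "emeasure lborel {z. ennreal l < maximal \<gamma> z} <= ennreal (5 ^ DIM('a) / l) * (NBINT w. \<gamma> w)"
proof (cases "(NBINT w. \<gamma> w)")
 case top
 then show ?thesis using \<open>0 < l\<close> by (simp add: ennreal_mult_top)
next
 case (real i)
 define \<omega> where "\<omega> = unit_ball_vol (real DIM('a))"
 have "0 < \<omega>" by (simp add: \<omega>_def)
 define K where "K = {(c::'a, r). 0 < r & ennreal l * emeasure lborel (ball c r) < (\<integral>\<^sup>+w\<in>ball c r. \<gamma> w \<partial>lborel)}"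
 \<comment> \<open>The covering lemma asks for bounded radii. The condition on a ball bounds r ^ n,
   and r <= r ^ n holds for r >= 1 only, which explains the \<open>max 1\<close>.\<close>
 have bound: "0 < snd k & snd k <= max 1 (i / (l * \<omega>))" if "k \<in> K" for k
 proof -
  obtain c r where k: "k = (c, r)" by (cases k)
  have r: "0 < r" "ennreal l * emeasure lborel (ball c r) < (\<integral>\<^sup>+w\<in>ball c r. \<gamma> w \<partial>lborel)"
   using that by (auto simp: k K_def)
  note r(2)
  also have "(\<integral>\<^sup>+w\<in>ball c r. \<gamma> w \<partial>lborel) <= (NBINT w. \<gamma> w)"
   by (intro nn_integral_mono) (auto simp: indicator_def)
  finally have "l * (\<omega> * r ^ DIM('a)) < i"
   using r(1) real \<open>0 < l\<close> by (simp add: emeasure_ball \<omega>_def ennreal_mult[symmetric] ennreal_less_iff)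
  then have *: "r ^ DIM('a) < i / (l * \<omega>)"
   using \<open>0 < l\<close> \<open>0 < \<omega>\<close> by (simp add: field_simps)
  have "r <= max 1 (i / (l * \<omega>))"
  proof (cases "r <= 1")
   case False
   then have "r ^ 1 <= r ^ DIM('a)"
    by (intro power_increasing) (auto simp: Suc_leI)
   then show ?thesis using * by simp
  qed simp
  then show ?thesis using r k by simp
 qed
 have "{z. ennreal l < maximal \<gamma> z} \<subseteq> (\<Union>k\<in>K. ball (fst k) (snd k))"
  unfolding maximal_superlevel K_def by force
 then obtain C where C: "countable C" "C \<subseteq> K"
  and disj: "pairwise (\<lambda>i j. disjnt (ball (fst i) (snd i)) (ball (fst j) (snd j))) C"
  and cov: "{z. ennreal l < maximal \<gamma> z} \<subseteq> (\<Union>i\<in>C. ball (fst i) (5 * snd i))"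
  by (rule Vitali_covering_lemma_balls[OF _ bound])
 have "emeasure lborel {z. ennreal l < maximal \<gamma> z} <= (NBINT z. \<integral>\<^sup>+k. indicator (ball (fst k) (5 * snd k)) z \<partial>count_space C)"
 proof -
  have "emeasure lborel {z. ennreal l < maximal \<gamma> z} = (NBINT z. indicator {z. ennreal l < maximal \<gamma> z} z)"
   by (rule nn_integral_indicator[symmetric]) (simp add: open_maximal_superlevel)
  also have "... <= (NBINT z. \<integral>\<^sup>+k. indicator (ball (fst k) (5 * snd k)) z \<partial>count_space C)"
  proof (rule nn_integral_mono)
   fix z :: 'a
   show "indicator {z. ennreal l < maximal \<gamma> z} z <= (\<integral>\<^sup>+k. indicator (ball (fst k) (5 * snd k)) z \<partial>count_space C)"
   proof (cases "ennreal l < maximal \<gamma> z")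
    case True
    then obtain k where k: "k \<in> C" "z \<in> ball (fst k) (5 * snd k)" using cov by auto
    have "(1::ennreal) = indicator (ball (fst k) (5 * snd k)) z" using k by simp
    also have "... <= (\<integral>\<^sup>+k. indicator (ball (fst k) (5 * snd k)) z \<partial>count_space C)"
     by (rule nn_integral_ge_point[OF k(1)])
    finally show ?thesis using True by simp
   qed simp
  qed
  finally show ?thesis .
 qed
 also have "... = (\<integral>\<^sup>+k. (NBINT z. indicator (ball (fst k) (5 * snd k)) z) \<partial>count_space C)"
  by (rule nn_integral_count_space_nn_integral[OF C(1)]) (simp add: borel_measurable_indicator)
 also have "... <= (\<integral>\<^sup>+k. ennreal (5 ^ DIM('a) / l) * emeasure (density lborel \<gamma>) (ball (fst k) (snd k)) \<partial>count_space C)"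
 proof (rule nn_integral_mono)
  fix k assume k: "k \<in> space (count_space C)"
  then have kK: "0 < snd k" "ennreal l * emeasure lborel (ball (fst k) (snd k)) < (\<integral>\<^sup>+w\<in>ball (fst k) (snd k). \<gamma> w \<partial>lborel)"
   using C(2) by (auto simp: K_def)
  have "(NBINT z. indicator (ball (fst k) (5 * snd k)) z) = emeasure lborel (ball (fst k) (5 * snd k))"
   by simp
  also have "... = ennreal (5 ^ DIM('a) / l) * (ennreal l * emeasure lborel (ball (fst k) (snd k)))"
   using kK(1) \<open>0 < l\<close> by (simp add: emeasure_ball power_mult_distrib ennreal_mult[symmetric])
  also have "... <= ennreal (5 ^ DIM('a) / l) * (\<integral>\<^sup>+w\<in>ball (fst k) (snd k). \<gamma> w \<partial>lborel)"
   using kK(2) by (intro mult_left_mono) auto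
  also have "(\<integral>\<^sup>+w\<in>ball (fst k) (snd k). \<gamma> w \<partial>lborel) = emeasure (density lborel \<gamma>) (ball (fst k) (snd k))"
   by (simp add: emeasure_density)
  finally show "(NBINT z. indicator (ball (fst k) (5 * snd k)) z) <= ennreal (5 ^ DIM('a) / l) * emeasure (density lborel \<gamma>) (ball (fst k) (snd k))" .
 qed
 also have "... = ennreal (5 ^ DIM('a) / l) * (\<integral>\<^sup>+k. emeasure (density lborel \<gamma>) (ball (fst k) (snd k)) \<partial>count_space C)"
  by (rule nn_integral_cmult) simp
 also have "(\<integral>\<^sup>+k. emeasure (density lborel \<gamma>) (ball (fst k) (snd k)) \<partial>count_space C) = emeasure (density lborel \<gamma>) (\<Union>k\<in>C. ball (fst k) (snd k))"
 proof (rule emeasure_UN_countable[symmetric])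
  show "disjoint_family_on (\<lambda>k. ball (fst k) (snd k)) C"
   using disj unfolding disjoint_family_on_def pairwise_def disjnt_def by blast
 qed (use C in auto)
 also have "... <= emeasure (density lborel \<gamma>) UNIV"
  by (rule emeasure_mono) auto
 also have "... = (NBINT w. \<gamma> w)"
  by (simp add: emeasure_density)
 finally show ?thesis by (simp add: mult_left_mono)
qed

text \<open>The part of \<open>\<gamma>\<close> of height at most l / 2 adds at most l / 2 to any
  average, so level l for \<open>\<gamma>\<close> forces level l / 2 for the large part
  \<open>\<gamma>1\<close>. The weak type bound at l / 2 is the hypothesis of
  \<open>marcinkiewicz\<close> with exponent 1 and D = 2; this explains the factor 2 in front of
  \<open>5 ^ DIM('a)\<close>.\<close>

lemma maximal_strong_type:
 fixes p :: real
 assumes "1 < p"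
 shows "\<exists>C>0. \<forall>\<gamma>::'a::euclidean_space => real. \<gamma> \<in> borel_measurable borel \<longrightarrow> (\<forall>w. 0 <= \<gamma> w) \<longrightarrow>
  (NBINT z. epow (maximal (\<lambda>w. ennreal (\<gamma> w)) z) p) <= ennreal C * (NBINT w. ennreal (\<gamma> w powr p))"
proof (intro exI conjI allI impI)
 let ?B = "2 * 5 ^ DIM('a) :: real"
 let ?C = "?B * p / (p - 1) * 2 powr (p - 1)"
 show "0 < ?C" using assms by (intro mult_pos_pos divide_pos_pos) auto
 fix \<gamma> :: "'a => real" assume [measurable]: "\<gamma> \<in> borel_measurable borel" and \<gamma>0: "\<forall>w. 0 <= \<gamma> w"
 show "(NBINT z. epow (maximal (\<lambda>w. ennreal (\<gamma> w)) z) p) <= ennreal ?C * (NBINT w. ennreal (\<gamma> w powr p))"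
 proof (rule marcinkiewicz[where r=1 and D=2 and B="?B"])
  fix l :: real assume l: "0 < l"
  define \<gamma>1 where "\<gamma>1 w = ennreal (\<gamma> w) * indicator {w. l < 2 * \<gamma> w} w" for w
  have [measurable]: "\<gamma>1 \<in> borel_measurable borel" unfolding \<gamma>1_def[abs_def] by measurable
  have "{z. ennreal l < maximal (\<lambda>w. ennreal (\<gamma> w)) z} \<subseteq> {z. ennreal (l / 2) < maximal \<gamma>1 z}"
  proof
   fix z assume "z \<in> {z. ennreal l < maximal (\<lambda>w. ennreal (\<gamma> w)) z}"
   then obtain c r where r: "0 < r" "z \<in> ball c r"
    and gt: "ennreal l * emeasure lborel (ball c r) < (\<integral>\<^sup>+w\<in>ball c r. ennreal (\<gamma> w) \<partial>lborel)"
    unfolding maximal_superlevel by auto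
   have [measurable]: "ball c r \<in> sets borel" by simp
   have "(\<integral>\<^sup>+w\<in>ball c r. ennreal (\<gamma> w) \<partial>lborel) <= (NBINT w. \<gamma>1 w * indicator (ball c r) w + ennreal (l / 2) * indicator (ball c r) w)"
    using l by (intro nn_integral_mono) (auto simp: \<gamma>1_def indicator_def not_less intro!: ennreal_leI)
   also have "... = (\<integral>\<^sup>+w\<in>ball c r. \<gamma>1 w \<partial>lborel) + ennreal (l / 2) * emeasure lborel (ball c r)"
    by (subst nn_integral_add) (auto simp: nn_integral_cmult_indicator)
   finally have le: "ennreal l * emeasure lborel (ball c r) < (\<integral>\<^sup>+w\<in>ball c r. \<gamma>1 w \<partial>lborel) + ennreal (l / 2) * emeasure lborel (ball c r)"
    by (rule less_le_trans[OF gt])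
   have "ennreal l * emeasure lborel (ball c r) = ennreal (l / 2) * emeasure lborel (ball c r) + ennreal (l / 2) * emeasure lborel (ball c r)"
   proof -
    have "ennreal l = ennreal (l / 2) + ennreal (l / 2)"
     using l by (simp flip: ennreal_plus)
    then show ?thesis by (simp only: distrib_right)
   qed
   then have "ennreal (l / 2) * emeasure lborel (ball c r) < (\<integral>\<^sup>+w\<in>ball c r. \<gamma>1 w \<partial>lborel)"
    using le add_right_mono[of "\<integral>\<^sup>+w\<in>ball c r. \<gamma>1 w \<partial>lborel" "ennreal (l / 2) * emeasure lborel (ball c r)" "ennreal (l / 2) * emeasure lborel (ball c r)"]
    by (auto simp: not_le[symmetric])
   then show "z \<in> {z. ennreal (l / 2) < maximal \<gamma>1 z}"
    unfolding maximal_superlevel using r by auto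
  qed
  then have "emeasure lborel {z. ennreal l < maximal (\<lambda>w. ennreal (\<gamma> w)) z} <= emeasure lborel {z. ennreal (l / 2) < maximal \<gamma>1 z}"
   by (rule emeasure_mono) (simp add: open_maximal_superlevel)
  also have "... <= ennreal (5 ^ DIM('a) / (l / 2)) * (NBINT w. \<gamma>1 w)"
   using l by (intro maximal_weak_type) auto
  also have "... = ennreal (?B * l powr (- 1)) * (NBINT w. ennreal (\<gamma> w powr 1) * indicator {w. l < 2 * \<gamma> w} w)"
   using l \<gamma>0 by (simp add: \<gamma>1_def powr_minus divide_simps mult.commute[of "5 ^ DIM('a)" "2::real"])
  finally show "emeasure lborel {z \<in> space lborel. ennreal l < maximal (\<lambda>w. ennreal (\<gamma> w)) z}
   <= ennreal (?B * l powr (- 1)) * (NBINT w. ennreal (\<gamma> w powr 1) * indicator {w. l < 2 * \<gamma> w} w)"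
   by (simp only: space_lborel space_borel UNIV_I simp_thms)
 next
  show "sigma_finite_measure (lborel :: 'a measure)" "sigma_finite_measure (lborel :: 'a measure)"
   by (rule lborel.sigma_finite_measure_axioms)+
  show "maximal (\<lambda>w. ennreal (\<gamma> w)) \<in> borel_measurable lborel" "\<gamma> \<in> borel_measurable lborel"
   by measurable
  show "0 <= \<gamma> w" for w using \<gamma>0 by blast
  show "1 < p" by fact
  show "0 <= ?B" by (intro mult_nonneg_nonneg zero_le_power) auto
 qed (rule zero_less_one zero_less_numeral)+
qed

section \<open>Increments of Riesz potentials of bounded functions\<close>

definition riesz_diff :: "real => 'a::euclidean_space => 'a => real" where
 "riesz_diff s y z = riesz s (z + y) - riesz s z"

lemma riesz_diff_measurable [measurable]:
 "(\<lambda>(y, z). riesz_diff s y (z::'a::euclidean_space)) \<in> borel_measurable (borel \<Otimes>\<^sub>M borel)"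
 unfolding riesz_diff_def by measurable

lemma DIM_ge_1: "1 <= real DIM('a::euclidean_space)"
 by (simp add: Suc_leI)

lemma sph_nonneg [simp]: "0 <= sph TYPE('a::euclidean_space)"
 using sph_pos[where 'a='a] by linarith

lemma integrable_lborel_shift:
 fixes c :: "'a::euclidean_space" and f :: "'a => 'b::{banach, second_countable_topology}"
 assumes "integrable lborel f"
 shows "integrable lborel (\<lambda>x. f (c + x))"
proof -
 have "integrable (distr lborel borel ((+) c)) f"
  by (subst lborel_distr_plus) fact
 then show ?thesis by (rule integrable_distr[rotated]) simp
qed

lemma integrable_lborel_reflect:
 fixes c :: "'a::euclidean_space" and f :: "'a => 'b::{banach, second_countable_topology}"
 assumes "integrable lborel f"
 shows "integrable lborel (\<lambda>x. f (c - x))"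
proof -
 have "integrable (distr lborel borel (\<lambda>x. c - x)) f"
  by (subst lborel_distr_reflect) fact
 then show ?thesis by (rule integrable_distr[rotated]) simp
qed

lemma ennreal_mult_add_mult:
 assumes "0 <= a" "0 <= b" "0 <= c" "0 <= d" "0 <= f"
 shows "ennreal a * (ennreal b + ennreal c) + ennreal d * ennreal f = ennreal (a * (b + c) + d * f)"
 using assms by (simp add: ennreal_mult)

text \<open>Within distance 2 |y| of the origin each of the two kernels is integrated separately;
  the centre of the second one is at distance less than 3 |y| there. Further out the mean value
  theorem gives |y| |z|^(s - n - 1), and s + e < 1 makes this integrable at infinity against the
  weight.\<close>

lemma riesz_diff_weighted_integral:
 fixes s e :: real
 assumes "0 < s" "0 <= e" "s + e < 1"
 shows "\<exists>C>0. \<forall>y::'a::euclidean_space.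
  (NBINT z. ennreal (norm z powr e * \<bar>riesz_diff s y z\<bar>)) <= ennreal (C * norm y powr (s + e))"
proof -
 let ?J = "\<lambda>(y::'a) z. norm z powr e * \<bar>riesz_diff s y z\<bar>"
 let ?n = "real DIM('a)" and ?c = "sph TYPE('a)"
 have sn: "s < ?n" using assms DIM_ge_1[where 'a='a] by linarith
 define A where "A = (?n - s) * (1 / 2) powr (s - ?n - 1)"
 have "0 <= A" using sn by (simp add: A_def)
 define C where "C = 2 powr e * (?c / s * 2 powr s + ?c / s * 3 powr s) + A * (?c / (1 - s - e) * 2 powr (- (1 - s - e)))"
 have "0 < C"
  unfolding C_def using assms \<open>0 <= A\<close> by (intro add_pos_nonneg mult_pos_pos add_pos_pos divide_pos_pos mult_nonneg_nonneg) auto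
 have "(NBINT z. ennreal (?J y z)) <= ennreal (C * norm y powr (s + e))" for y :: 'a
 proof (cases "y = 0")
  case True
  then show ?thesis by (simp add: riesz_diff_def)
 next
  case False
  define r where "r = norm y"
  have "0 < r" using False by (simp add: r_def)
  let ?f1 = "\<lambda>z::'a. ennreal (norm (0 - z) powr (s - ?n)) * indicator {z. norm (0 - z) < 2 * r} z"
  let ?f2 = "\<lambda>z::'a. ennreal (norm (- y - z) powr (s - ?n)) * indicator {z. norm (- y - z) < 3 * r} z"
  let ?f3 = "\<lambda>z::'a. ennreal (norm (0 - z) powr (- (1 - s - e) - ?n)) * indicator {z. 2 * r <= norm (0 - z)} z"
  have pw: "ennreal (?J y z) <= ennreal ((2 * r) powr e) * (?f1 z + ?f2 z) + ennreal (A * r) * ?f3 z" for z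
  proof (cases "norm z < 2 * r")
   case True
   have eq: "norm (- y - z) = norm (z + y)"
    using norm_minus_cancel[of "z + y"] by (simp add: algebra_simps)
   have "norm (z + y) < 3 * r"
    using True norm_triangle_ineq[of z y] by (simp add: r_def)
   have "\<bar>riesz_diff s y z\<bar> <= riesz s z + riesz s (z + y)"
    using riesz_nonneg[of s z] riesz_nonneg[of s "z + y"] unfolding riesz_diff_def by linarith
   then have "norm z powr e * \<bar>riesz_diff s y z\<bar> <= (2 * r) powr e * (riesz s z + riesz s (z + y))"
    using True assms by (intro mult_mono powr_mono2) auto
   then have "ennreal (?J y z) <= ennreal ((2 * r) powr e) * (ennreal (riesz s z) + ennreal (riesz s (z + y)))"
    by (simp flip: ennreal_plus ennreal_mult)
   then show ?thesis
    using True \<open>norm (z + y) < 3 * r\<close> by (simp add: riesz_def eq)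
  next
   case False
   then have z: "0 < norm z" "r <= norm z / 2" using \<open>0 < r\<close> by auto
   have "norm z / 2 <= norm (z + y)"
    using z norm_diff_ineq[of z y] by (simp add: r_def)
   then have "\<bar>riesz_diff s y z\<bar> <= (?n - s) * (norm z / 2) powr (s - ?n - 1) * norm ((z + y) - z)"
    unfolding riesz_diff_def using z sn by (intro riesz_lipschitz) auto
   also have "(norm z / 2) powr (s - ?n - 1) = (1 / 2) powr (s - ?n - 1) * norm z powr (s - ?n - 1)"
    using powr_mult[of "1/2" "norm z" "s - ?n - 1"] by simp
   finally have "norm z powr e * \<bar>riesz_diff s y z\<bar> <= norm z powr e * (A * r * norm z powr (s - ?n - 1))"
    by (intro mult_left_mono) (auto simp: A_def r_def mult_ac)
   also have "... = A * r * (norm z powr e * norm z powr (s - ?n - 1))" by simp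
   also have "norm z powr e * norm z powr (s - ?n - 1) = norm z powr (- (1 - s - e) - ?n)"
    unfolding powr_add[symmetric] by (simp add: algebra_simps)
   finally have "ennreal (?J y z) <= ennreal (A * r) * ennreal (norm z powr (- (1 - s - e) - ?n))"
    using \<open>0 <= A\<close> \<open>0 < r\<close> by (simp flip: ennreal_mult)
   then show ?thesis
    using False by (auto simp: add_increasing)
  qed
  have "(NBINT z. ennreal (?J y z))
   <= (NBINT z. ennreal ((2 * r) powr e) * (?f1 z + ?f2 z) + ennreal (A * r) * ?f3 z)"
   by (intro nn_integral_mono pw)
  also have "... = ennreal ((2 * r) powr e) * ((NBINT z. ?f1 z) + (NBINT z. ?f2 z)) + ennreal (A * r) * (NBINT z. ?f3 z)"
   by (simp add: nn_integral_add nn_integral_cmult)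
  also have "(NBINT z. ?f1 z) = ennreal (?c / s * (2 * r) powr s)"
   using assms \<open>0 < r\<close> by (intro nn_integral_ball_powr) auto
  also have "(NBINT z. ?f2 z) = ennreal (?c / s * (3 * r) powr s)"
   using assms \<open>0 < r\<close> by (intro nn_integral_ball_powr) auto
  also have "(NBINT z. ?f3 z) = ennreal (?c / (1 - s - e) * (2 * r) powr (- (1 - s - e)))"
   using assms \<open>0 < r\<close> by (intro nn_integral_outside_powr) auto
  also have "ennreal ((2 * r) powr e) * (ennreal (?c / s * (2 * r) powr s) + ennreal (?c / s * (3 * r) powr s)) + ennreal (A * r) * ennreal (?c / (1 - s - e) * (2 * r) powr (- (1 - s - e)))
   = ennreal ((2 * r) powr e * (?c / s * (2 * r) powr s + ?c / s * (3 * r) powr s) + A * r * (?c / (1 - s - e) * (2 * r) powr (- (1 - s - e))))"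
   using assms \<open>0 <= A\<close> \<open>0 < r\<close> by (intro ennreal_mult_add_mult mult_nonneg_nonneg divide_nonneg_pos) auto
  also have "(2 * r) powr e * (?c / s * (2 * r) powr s + ?c / s * (3 * r) powr s) + A * r * (?c / (1 - s - e) * (2 * r) powr (- (1 - s - e))) = C * r powr (s + e)"
  proof -
   have 1: "(2 * r) powr e = 2 powr e * r powr e" "(2 * r) powr s = 2 powr s * r powr s" "(3 * r) powr s = 3 powr s * r powr s"
    "(2 * r) powr (- (1 - s - e)) = 2 powr (- (1 - s - e)) * r powr (- (1 - s - e))"
    using \<open>0 < r\<close> by (auto simp: powr_mult)
   have 2: "r * r powr (- (1 - s - e)) = r powr (s + e)"
    using \<open>0 < r\<close> powr_add[of r 1 "- (1 - s - e)"] by (simp add: add.commute[of s e])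
   have 3: "r powr (s + e) = r powr e * r powr s" by (simp add: powr_add)
   have "A * r * (?c / (1 - s - e) * (2 * r) powr (- (1 - s - e))) = A * (?c / (1 - s - e) * 2 powr (- (1 - s - e))) * r powr (s + e)"
    unfolding 1 2[symmetric] by simp
   moreover have "(2 * r) powr e * (?c / s * (2 * r) powr s + ?c / s * (3 * r) powr s) = 2 powr e * (?c / s * 2 powr s + ?c / s * 3 powr s) * r powr (s + e)"
    unfolding 1 3 by (simp add: algebra_simps)
   ultimately show ?thesis by (simp only: C_def distrib_right)
  qed
  finally show ?thesis by (simp add: r_def)
 qed
 then show ?thesis using \<open>0 < C\<close> by blast
qed

lemma riesz_diff_integral:
 fixes s :: real
 assumes "0 < s" "s < 1"
 shows "\<exists>C>0. \<forall>y::'a::euclidean_space. (NBINT z. ennreal \<bar>riesz_diff s y z\<bar>) <= ennreal (C * norm y powr s)"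
proof -
 obtain C where "C > 0" and C: "!!y::'a. (NBINT z. ennreal (norm z powr 0 * \<bar>riesz_diff s y z\<bar>)) <= ennreal (C * norm y powr (s + 0))"
  using riesz_diff_weighted_integral[of s 0, where 'a='a] assms by auto
 \<comment> \<open>Since \<open>0 powr 0 = 0\<close>, the weight with exponent 0 equals 1 off the
   origin only.\<close>
 have "(NBINT z. ennreal \<bar>riesz_diff s y z\<bar>) = (NBINT z. ennreal (norm z powr 0 * \<bar>riesz_diff s y z\<bar>))" for y :: 'a
  by (rule nn_integral_cong_AE) (use AE_lborel_singleton[of "0::'a"] in eventually_elim, simp)
 then show ?thesis using C \<open>C > 0\<close> by (intro exI[of _ C]) simp
qed

lemma riesz_diff_integrable:
 fixes s :: real and y :: "'a::euclidean_space"
 assumes "0 < s" "s < 1"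
 shows "integrable lborel (riesz_diff s y)"
proof -
 obtain C where "(NBINT z. ennreal \<bar>riesz_diff s y z\<bar>) <= ennreal (C * norm y powr s)"
  using riesz_diff_integral[OF assms, where 'a='a] by auto
 then show ?thesis
  by (intro integrableI_bounded) (auto intro: le_less_trans simp: riesz_diff_def[abs_def])
qed

text \<open>The reflection of z to - y - z exchanges the two terms and thus changes the
  sign.\<close>

lemma riesz_diff_integral_0:
 fixes s :: real and y :: "'a::euclidean_space"
 shows "(LBINT z. riesz_diff s y z) = 0"
proof -
 have "(LBINT z. riesz_diff s y z) = (LBINT z. riesz_diff s y (- y - z))"
  by (rule integral_lborel_reflect[symmetric]) (simp add: riesz_diff_def[abs_def])
 also have "(\<lambda>z. riesz_diff s y (- y - z)) = (\<lambda>z. - riesz_diff s y z)"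
 proof
  fix z
  have "riesz s (- y - z) = riesz s (z + y)"
   using riesz_minus[of s "z + y"] by (simp add: algebra_simps)
  then show "riesz_diff s y (- y - z) = - riesz_diff s y z"
   by (simp add: riesz_diff_def)
 qed
 finally show ?thesis by simp
qed

text \<open>Up to the factors \<open>norm y powr (- s)\<close> and
  \<open>norm y' powr (- s)\<close>, this is the kernel of \<open>riesz_op\<close> composed with its
  adjoint. By translation invariance it depends on the two base points only through their difference
  \<open>d\<close>.\<close>

definition riesz_corr :: "real => 'a::euclidean_space => 'a => 'a => real" where
 "riesz_corr s y y' d = (LBINT w. riesz_diff s y (d + w) * riesz_diff s y' w)"

lemma riesz_corr_swap: "riesz_corr s y y' d = riesz_corr s y' y (- d)"
proof -
 have "riesz_corr s y y' d = (LBINT w. riesz_diff s y (d + (- d + w)) * riesz_diff s y' (- d + w))"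
  unfolding riesz_corr_def
  by (rule integral_lborel_shift[symmetric]) (simp add: riesz_diff_def[abs_def])
 then show ?thesis by (simp add: riesz_corr_def mult.commute)
qed

text \<open>The shift \<open>e\<close> yields geometric decay in the ratio of the two scales \<open>norm y\<close> and \<open>norm y'\<close>, as Schur's test requires.\<close>

lemma riesz_corr_bound:
 fixes s e :: real
 assumes "0 < s" "0 < e" "e <= s" "s + e < 1"
 shows "\<exists>C>0. \<forall>y y'::'a::euclidean_space. (NBINT d. ennreal \<bar>riesz_corr s y y' d\<bar>)
   <= ennreal (C * (norm y powr (s + e) * norm y' powr (s - e)))"
proof -
 let ?I = "\<lambda>(y'::'a) a. NBINT z. ennreal \<bar>riesz_diff s y' (a + z) - riesz_diff s y' z\<bar>"
 let ?J = "\<lambda>(y::'a) y' a d. \<bar>riesz_diff s y a\<bar> * \<bar>riesz_diff s y' (a - d) - riesz_diff s y' (- d)\<bar>"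
 obtain C0 where "C0 > 0" and C0: "!!y::'a. (NBINT z. ennreal \<bar>riesz_diff s y z\<bar>) <= ennreal (C0 * norm y powr s)"
  using riesz_diff_integral[of s, where 'a='a] assms by auto
 obtain C1 where "C1 > 0" and C1: "!!y::'a. (NBINT z. ennreal (norm z powr e * \<bar>riesz_diff s y z\<bar>)) <= ennreal (C1 * norm y powr (s + e))"
  using riesz_diff_weighted_integral[of s e, where 'a='a] assms by auto
 have m[measurable]: "riesz_diff s y \<in> borel_measurable borel" for y :: 'a
  by (simp add: riesz_diff_def[abs_def])
 \<comment> \<open>The second difference is symmetric in \<open>a\<close> and \<open>y'\<close>, so
   its L^1 norm is bounded by a multiple of the s-th power of the smaller of the two norms.
   Distributing the exponent as e and s - e gives the stated product.\<close>
 have second: "(?I y' a) <= ennreal (2 * C0 * (norm a powr e * norm y' powr (s - e)))" for y' a :: 'a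
 proof -
  have sum2: "(NBINT z. ennreal \<bar>riesz_diff s b (c + z)\<bar> + ennreal \<bar>riesz_diff s b z\<bar>) <= ennreal (2 * C0 * norm b powr s)" for b c :: 'a
  proof -
   have "(NBINT z. ennreal \<bar>riesz_diff s b (c + z)\<bar> + ennreal \<bar>riesz_diff s b z\<bar>)
    = (NBINT z. ennreal \<bar>riesz_diff s b (c + z)\<bar>) + (NBINT z. ennreal \<bar>riesz_diff s b z\<bar>)"
    by (rule nn_integral_add) measurable
   also have "(NBINT z. ennreal \<bar>riesz_diff s b (c + z)\<bar>) = (NBINT z. ennreal \<bar>riesz_diff s b z\<bar>)"
    by (rule nn_integral_lborel_shift) measurable
   also have "(NBINT z. ennreal \<bar>riesz_diff s b z\<bar>) + (NBINT z. ennreal \<bar>riesz_diff s b z\<bar>)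
    <= ennreal (C0 * norm b powr s) + ennreal (C0 * norm b powr s)"
    by (intro add_mono C0)
   also have "... = ennreal (2 * C0 * norm b powr s)"
    using \<open>C0 > 0\<close> by (simp flip: ennreal_plus)
   finally show ?thesis .
  qed
  have 1: "(?I y' a) <= ennreal (2 * C0 * norm y' powr s)"
  proof -
   have "(?I y' a) <= (NBINT z. ennreal \<bar>riesz_diff s y' (a + z)\<bar> + ennreal \<bar>riesz_diff s y' z\<bar>)"
    by (intro nn_integral_mono) (simp flip: ennreal_plus)
   then show ?thesis using sum2 by (rule order_trans)
  qed
  have 2: "(?I y' a) <= ennreal (2 * C0 * norm a powr s)"
  proof -
   have "(?I y' a) <= (NBINT z. ennreal \<bar>riesz_diff s a (y' + z)\<bar> + ennreal \<bar>riesz_diff s a z\<bar>)"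
   proof (intro nn_integral_mono)
    fix z
    have "riesz_diff s y' (a + z) - riesz_diff s y' z = riesz_diff s a (y' + z) - riesz_diff s a z"
     by (simp add: riesz_diff_def algebra_simps)
    then show "ennreal \<bar>riesz_diff s y' (a + z) - riesz_diff s y' z\<bar> <= ennreal \<bar>riesz_diff s a (y' + z)\<bar> + ennreal \<bar>riesz_diff s a z\<bar>"
     by (simp flip: ennreal_plus)
   qed
   then show ?thesis using sum2 by (rule order_trans)
  qed
  show ?thesis
  proof (cases "norm a <= norm y'")
   case True
   have "norm a powr s = norm a powr e * norm a powr (s - e)"
    by (simp flip: powr_add)
   also have "... <= norm a powr e * norm y' powr (s - e)"
    using True assms by (intro mult_left_mono powr_mono2) auto
   finally show ?thesis
    using 2 \<open>C0 > 0\<close> by (intro order_trans[OF 2] ennreal_leI mult_left_mono) auto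
  next
   case False
   have "norm y' powr s = norm y' powr e * norm y' powr (s - e)"
    by (simp flip: powr_add)
   also have "... <= norm a powr e * norm y' powr (s - e)"
    using False assms by (intro mult_right_mono powr_mono2) auto
   finally show ?thesis
    using 1 \<open>C0 > 0\<close> by (intro order_trans[OF 1] ennreal_leI mult_left_mono) auto
  qed
 qed
 have "(NBINT d. ennreal \<bar>riesz_corr s y y' d\<bar>) <= ennreal (2 * C0 * C1 * (norm y powr (s + e) * norm y' powr (s - e)))" for y y' :: 'a
 proof -
  have "(NBINT d. ennreal \<bar>riesz_corr s y y' d\<bar>)
   <= (NBINT d. NBINT a. ennreal (?J y y' a d))"
  proof (intro nn_integral_mono)
   fix d :: 'a
   have int: "integrable lborel (\<lambda>w. riesz_diff s y (d + w))"
    using riesz_diff_integrable[of s y] assms by (intro integrable_lborel_shift) auto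
   show "ennreal \<bar>riesz_corr s y y' d\<bar> <= (NBINT a. ennreal (?J y y' a d))"
   proof (cases "integrable lborel (\<lambda>w. riesz_diff s y (d + w) * riesz_diff s y' w)")
    case True
    \<comment> \<open>The increment has mean zero, so a constant may be subtracted from the other
      factor; this brings in the modulus of continuity \<open>second\<close>, with the gain
      |a|^e.\<close>
    have "(LBINT w. riesz_diff s y (d + w)) = 0"
     using integral_lborel_shift[of "riesz_diff s y" d] riesz_diff_integral_0[of s y] by simp
    then have "riesz_corr s y y' d = (LBINT w. riesz_diff s y (d + w) * riesz_diff s y' w - riesz_diff s y (d + w) * riesz_diff s y' (- d))"
     using True int by (simp add: riesz_corr_def)
    then have "ennreal \<bar>riesz_corr s y y' d\<bar> <= (NBINT w. ennreal \<bar>riesz_diff s y (d + w) * riesz_diff s y' w - riesz_diff s y (d + w) * riesz_diff s y' (- d)\<bar>)"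
     using norm_integral_le_nn[of lborel "\<lambda>w. riesz_diff s y (d + w) * riesz_diff s y' w - riesz_diff s y (d + w) * riesz_diff s y' (- d)"] by simp
    also have "... = (NBINT w. ennreal (\<bar>riesz_diff s y (d + w)\<bar> * \<bar>riesz_diff s y' ((d + w) - d) - riesz_diff s y' (- d)\<bar>))"
     by (simp add: abs_mult[symmetric] right_diff_distrib)
    also have "... = (NBINT a. ennreal (?J y y' a d))"
     by (rule nn_integral_lborel_shift) measurable
    finally show ?thesis .
   next
    case False
    then show ?thesis by (simp add: riesz_corr_def not_integrable_integral_eq)
   qed
  qed
  also have "... = (NBINT a. NBINT d. ennreal (?J y y' a d))"
   by (rule lborel_pair.Fubini') measurable
  also have "... <= (NBINT a. ennreal (2 * C0 * norm y' powr (s - e)) * ennreal (norm a powr e * \<bar>riesz_diff s y a\<bar>))"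
  proof (intro nn_integral_mono)
   fix a :: 'a
   have "(NBINT d. ennreal (?J y y' a d))
    = ennreal \<bar>riesz_diff s y a\<bar> * (NBINT d. ennreal \<bar>riesz_diff s y' (a + (0 - d)) - riesz_diff s y' (0 - d)\<bar>)"
    by (subst nn_integral_cmult[symmetric]) (auto simp: ennreal_mult)
   also have "(NBINT d. ennreal \<bar>riesz_diff s y' (a + (0 - d)) - riesz_diff s y' (0 - d)\<bar>) = (?I y' a)"
    by (rule nn_integral_lborel_reflect) measurable
   also have "ennreal \<bar>riesz_diff s y a\<bar> * ... <= ennreal \<bar>riesz_diff s y a\<bar> * ennreal (2 * C0 * (norm a powr e * norm y' powr (s - e)))"
    by (intro mult_left_mono second) auto
   also have "... = ennreal (2 * C0 * norm y' powr (s - e)) * ennreal (norm a powr e * \<bar>riesz_diff s y a\<bar>)"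
    using \<open>C0 > 0\<close> by (simp add: ennreal_mult[symmetric] mult_ac)
   finally show "(NBINT d. ennreal (?J y y' a d)) <= ..." .
  qed
  also have "... = ennreal (2 * C0 * norm y' powr (s - e)) * (NBINT a. ennreal (norm a powr e * \<bar>riesz_diff s y a\<bar>))"
   by (rule nn_integral_cmult) measurable
  also have "... <= ennreal (2 * C0 * norm y' powr (s - e)) * ennreal (C1 * norm y powr (s + e))"
   by (intro mult_left_mono C1) auto
  also have "... = ennreal (2 * C0 * C1 * (norm y powr (s + e) * norm y' powr (s - e)))"
   using \<open>C0 > 0\<close> \<open>C1 > 0\<close> by (simp add: ennreal_mult[symmetric] mult_ac)
  finally show ?thesis .
 qed
 then show ?thesis using \<open>C0 > 0\<close> \<open>C1 > 0\<close> by (intro exI[of _ "2 * C0 * C1"]) auto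
qed

text \<open>With the factor \<open>norm y powr (- s)\<close> and the measure
  \<open>haar_weight\<close>, which is dilation invariant in \<open>y\<close>, the form with kernel
  |y|^(- n - s q) becomes the q-th power of an L^q norm of one operator independent of q. Hence it
  can be interpolated.\<close>

definition riesz_op :: "real => ('a::euclidean_space => real) => 'a \<times> 'a => real" where
 "riesz_op s h = (\<lambda>(x, y). norm y powr (- s) * (LBINT w. riesz_diff s y (x - w) * h w))"

lemma riesz_op_measurable [measurable]:
 fixes h :: "'a::euclidean_space => real"
 assumes [measurable]: "h \<in> borel_measurable borel"
 shows "riesz_op s h \<in> borel_measurable (lborel \<Otimes>\<^sub>M lborel)"
 unfolding riesz_op_def by measurable

lemma nn_integral_riesz_diff_reflect:
 fixes x y :: "'a::euclidean_space"
 shows "(NBINT w. ennreal \<bar>riesz_diff s y (x - w)\<bar>) = (NBINT w. ennreal \<bar>riesz_diff s y w\<bar>)"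
 by (rule nn_integral_lborel_reflect[of "\<lambda>w. ennreal \<bar>riesz_diff s y w\<bar>"]) measurable

lemma riesz_op_bounded:
 fixes s :: real
 assumes "0 < s" "s < 1"
 shows "\<exists>C>0. \<forall>(h::'a::euclidean_space => real) H e. h \<in> borel_measurable borel \<longrightarrow> (\<forall>w. \<bar>h w\<bar> <= H) \<longrightarrow>
  \<bar>riesz_op s h e\<bar> <= C * H"
proof -
 obtain C0 where "C0 > 0" and C0: "!!y::'a. (NBINT z. ennreal \<bar>riesz_diff s y z\<bar>) <= ennreal (C0 * norm y powr s)"
  using riesz_diff_integral[of s, where 'a='a] assms by auto
 have "\<bar>riesz_op s h (x, y)\<bar> <= C0 * H" if [measurable]: "h \<in> borel_measurable borel" and hH: "!!w. \<bar>h w\<bar> <= H" for h H and x y :: 'a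
 proof -
  have "0 <= H" using hH[of 0] by linarith
  have "(NBINT w. ennreal (norm (riesz_diff s y (x - w) * h w))) <= (NBINT w. ennreal H * ennreal \<bar>riesz_diff s y (x - w)\<bar>)"
   using hH \<open>0 <= H\<close> by (intro nn_integral_mono) (auto simp: abs_mult ennreal_mult[symmetric] mult.commute intro!: mult_right_mono ennreal_leI)
  also have "... = ennreal H * (NBINT w. ennreal \<bar>riesz_diff s y w\<bar>)"
   by (subst nn_integral_cmult) (simp_all add: nn_integral_riesz_diff_reflect)
  also have "... <= ennreal H * ennreal (C0 * norm y powr s)"
   by (intro mult_left_mono C0) auto
  also have "... = ennreal (H * (C0 * norm y powr s))"
   using \<open>0 <= H\<close> by (simp add: ennreal_mult')
  finally have "norm (LBINT w. riesz_diff s y (x - w) * h w) <= H * (C0 * norm y powr s)"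
   using \<open>0 <= H\<close> \<open>C0 > 0\<close> by (intro norm_integral_le_real) auto
  then have "norm y powr (- s) * \<bar>(LBINT w. riesz_diff s y (x - w) * h w)\<bar> <= norm y powr (- s) * (H * (C0 * norm y powr s))"
   by (intro mult_left_mono) auto
  also have "... = C0 * H * (norm y powr (- s) * norm y powr s)" by simp
  also have "... <= C0 * H * 1"
   using \<open>0 <= H\<close> \<open>C0 > 0\<close> by (intro mult_left_mono) (auto simp flip: powr_add simp: powr_zero_eq_one)
  finally show ?thesis by (simp add: riesz_op_def abs_mult)
 qed
 then show ?thesis using \<open>C0 > 0\<close> by (intro exI[of _ C0]) auto
qed

lemma ennreal_mult_plus_mult:
 assumes "0 <= a" "0 <= b" "0 <= c" "0 <= d"
 shows "ennreal a * ennreal b + ennreal c * ennreal d = ennreal (a * b + c * d)"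
 using assms by (simp add: ennreal_mult)

text \<open>The minimum decays geometrically in the ratio of \<open>norm y\<close> and
  \<open>r\<close> in both directions, and the measure |y|^(- n) dy is dilation invariant; hence a
  bound independent of \<open>r\<close>.\<close>

lemma nn_integral_min_powr:
 fixes e r :: real
 assumes "0 < e" "0 < r"
 shows "(\<integral>\<^sup>+y. ennreal (norm y powr (- DIM('a)) * min (r powr e * norm y powr (- e)) (norm y powr e * r powr (- e))) \<partial>(lborel::'a::euclidean_space measure))
  <= ennreal (2 * sph TYPE('a) / e)"
proof -
 let ?n = "real DIM('a)" and ?c = "sph TYPE('a)"
 let ?f1 = "\<lambda>z::'a. ennreal (norm (0 - z) powr (e - ?n)) * indicator {z. norm (0 - z) < r} z"
 let ?f2 = "\<lambda>z::'a. ennreal (norm (0 - z) powr (- e - ?n)) * indicator {z. r <= norm (0 - z)} z"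
 have "(\<integral>\<^sup>+y. ennreal (norm y powr (- ?n) * min (r powr e * norm y powr (- e)) (norm y powr e * r powr (- e))) \<partial>(lborel::'a measure))
  <= (NBINT y. ennreal (r powr (- e)) * ?f1 y + ennreal (r powr e) * ?f2 y)"
 proof (rule nn_integral_mono)
  fix y :: 'a
  have 1: "norm y powr (- ?n) * (norm y powr e * r powr (- e)) = r powr (- e) * norm y powr (e - ?n)"
   by (simp add: mult_ac flip: powr_add)
  have 2: "norm y powr (- ?n) * (r powr e * norm y powr (- e)) = r powr e * norm y powr (- e - ?n)"
   by (simp add: mult_ac flip: powr_add)
  show "ennreal (norm y powr (- ?n) * min (r powr e * norm y powr (- e)) (norm y powr e * r powr (- e)))
   <= ennreal (r powr (- e)) * ?f1 y + ennreal (r powr e) * ?f2 y"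
  proof (cases "norm y < r")
   case True
   have "norm y powr (- ?n) * min (r powr e * norm y powr (- e)) (norm y powr e * r powr (- e)) <= r powr (- e) * norm y powr (e - ?n)"
    unfolding 1[symmetric] by (intro mult_left_mono) auto
   then show ?thesis using True by (simp add: ennreal_mult[symmetric] ennreal_leI)
  next
   case False
   have "norm y powr (- ?n) * min (r powr e * norm y powr (- e)) (norm y powr e * r powr (- e)) <= r powr e * norm y powr (- e - ?n)"
    unfolding 2[symmetric] by (intro mult_left_mono) auto
   then show ?thesis using False by (simp add: ennreal_mult[symmetric] ennreal_leI)
  qed
 qed
 also have "... = ennreal (r powr (- e)) * (NBINT y. ?f1 y) + ennreal (r powr e) * (NBINT y. ?f2 y)"
  by (simp add: nn_integral_add nn_integral_cmult)
 also have "(NBINT y. ?f1 y) = ennreal (?c / e * r powr e)"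
  using assms by (intro nn_integral_ball_powr) auto
 also have "(NBINT y. ?f2 y) = ennreal (?c / e * r powr (- e))"
  using assms by (intro nn_integral_outside_powr) auto
 also have "ennreal (r powr (- e)) * ennreal (?c / e * r powr e) + ennreal (r powr e) * ennreal (?c / e * r powr (- e))
  = ennreal (r powr (- e) * (?c / e * r powr e) + r powr e * (?c / e * r powr (- e)))"
  using assms by (intro ennreal_mult_plus_mult) auto
 also have "r powr (- e) * (?c / e * r powr e) + r powr e * (?c / e * r powr (- e)) = 2 * ?c / e * (r powr e * r powr (- e))"
  by (simp add: field_simps)
 also have "r powr e * r powr (- e) = 1"
  using assms by (simp flip: powr_add)
 finally show ?thesis by simp
qed

text \<open>An exhaustion by sets of finite mass for \<open>haar_weight\<close>, since
  \<open>TTstar_schur\<close> requires a finite measure.\<close>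

definition shell :: "nat => ('a::euclidean_space \<times> 'a) set" where
 "shell k = {(x, y). norm x <= real k & 1 / real (Suc k) <= norm y & norm y <= real k}"

lemma shell_measurable [measurable]: "shell k \<in> sets (lborel \<Otimes>\<^sub>M lborel)"
proof -
 have "shell k = {z \<in> space (lborel \<Otimes>\<^sub>M lborel). norm (fst z) <= real k & 1 / real (Suc k) <= norm (snd z) & norm (snd z) <= real k}"
  by (auto simp: shell_def space_pair_measure)
 also have "... \<in> sets (lborel \<Otimes>\<^sub>M lborel)"
  by measurable
 finally show ?thesis .
qed

definition haar_weight :: "'a::euclidean_space \<times> 'a => ennreal" where
 "haar_weight e = ennreal (norm (snd e) powr (- real DIM('a)))"

lemma haar_weight_measurable [measurable]: "haar_weight \<in> borel_measurable (lborel \<Otimes>\<^sub>M lborel)"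
 unfolding haar_weight_def[abs_def] by measurable

lemma nn_integral_shell_le:
 fixes F :: "'a::euclidean_space \<times> 'a => ennreal"
 assumes [measurable]: "F \<in> borel_measurable (lborel \<Otimes>\<^sub>M lborel)"
 shows "(\<integral>\<^sup>+e. F e \<partial>density (lborel \<Otimes>\<^sub>M lborel) (\<lambda>e. haar_weight e * indicator (shell k) e))
  <= (NBINT y. ennreal (norm y powr (- real DIM('a))) * indicator (cball 0 (real k) - ball 0 (1 / real (Suc k))) y * (NBINT x. F (x, y) * indicator (cball 0 (real k)) x))"
proof -
 have [measurable]: "cball (0::'a) (real k) \<in> sets borel" by simp
 have "(\<integral>\<^sup>+e. F e \<partial>density (lborel \<Otimes>\<^sub>M lborel) (\<lambda>e. haar_weight e * indicator (shell k) e))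
  = (\<integral>\<^sup>+e. haar_weight e * indicator (shell k) e * F e \<partial>(lborel \<Otimes>\<^sub>M lborel))"
  by (rule nn_integral_density) measurable
 also have "... = (NBINT y. NBINT x. haar_weight (x, y) * indicator (shell k) (x, y) * F (x, y))"
  by (rule lborel_pair.nn_integral_snd[symmetric]) measurable
 also have "... = (NBINT y. NBINT x. (ennreal (norm y powr (- real DIM('a))) * indicator (cball 0 (real k) - ball 0 (1 / real (Suc k))) y) * (F (x, y) * indicator (cball 0 (real k)) x))"
  by (intro nn_integral_cong) (auto simp: shell_def haar_weight_def indicator_def mult_ac)
 also have "... = (NBINT y. ennreal (norm y powr (- real DIM('a))) * indicator (cball 0 (real k) - ball 0 (1 / real (Suc k))) y * (NBINT x. F (x, y) * indicator (cball 0 (real k)) x))"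
  by (intro nn_integral_cong nn_integral_cmult) measurable
 finally show ?thesis by simp
qed

lemma shell_weight_finite:
 "(\<integral>\<^sup>+y. ennreal (norm y powr (- real DIM('a))) * indicator (cball 0 (real k) - ball 0 (1 / real (Suc k))) y \<partial>(lborel::'a::euclidean_space measure)) < \<infinity>"
proof -
 have "(\<integral>\<^sup>+y. ennreal (norm y powr (- real DIM('a))) * indicator (cball 0 (real k) - ball 0 (1 / real (Suc k))) y \<partial>(lborel::'a measure))
  <= (\<integral>\<^sup>+y. ennreal ((1 / real (Suc k)) powr (- real DIM('a))) * indicator (cball 0 (real k)) y \<partial>(lborel::'a measure))"
  by (intro nn_integral_mono) (auto simp: indicator_def not_less intro!: ennreal_leI powr_mono2')
 also have "... = ennreal ((1 / real (Suc k)) powr (- real DIM('a))) * emeasure lborel (cball (0::'a) (real k))"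
  by (rule nn_integral_cmult_indicator) simp
 also have "... < \<infinity>"
  using emeasure_bounded_finite[of "cball (0::'a) (real k)"] unfolding infinity_ennreal_def ennreal_mult_less_top by auto
 finally show ?thesis .
qed

text \<open>\<open>TTstar_schur\<close> is applied on each shell; its constant depends neither on
  the shell nor on the bound \<open>H\<close>, so monotone convergence gives the whole
  space.\<close>

lemma riesz_op_L2:
 fixes s :: real
 assumes "0 < s" "s < 1"
 shows "\<exists>C>0. \<forall>(h::'a::euclidean_space => real) H. h \<in> borel_measurable borel \<longrightarrow> (\<forall>w. \<bar>h w\<bar> <= H) \<longrightarrow>
  (\<integral>\<^sup>+e. ennreal ((riesz_op s h e)\<^sup>2) \<partial>density (lborel \<Otimes>\<^sub>M lborel) haar_weight) <= ennreal C * (NBINT w. ennreal ((h w)\<^sup>2))"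
proof -
 let ?J = "\<lambda>(y::'a) y'. NBINT d. ennreal \<bar>riesz_corr s y y' d\<bar>"
 \<comment> \<open>Chosen to satisfy both restrictions of \<open>riesz_corr_bound\<close>,
   \<epsilon> <= s and s + \<epsilon> < 1.\<close>
 define \<epsilon> where "\<epsilon> = min s ((1 - s) / 2)"
 have "\<epsilon> <= (1 - s) / 2" unfolding \<epsilon>_def by (rule min.cobounded2)
 then have \<epsilon>: "0 < \<epsilon>" "\<epsilon> <= s" "s + \<epsilon> < 1" using assms by (auto simp: \<epsilon>_def)
 obtain C where "C > 0" and C: "!!y y'::'a. (?J y y')
   <= ennreal (C * (norm y powr (s + \<epsilon>) * norm y' powr (s - \<epsilon>)))"
  using riesz_corr_bound[OF assms(1) \<epsilon>, where 'a='a] by blast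
 obtain C0 where "C0 > 0" and C0: "!!y::'a. (NBINT z. ennreal \<bar>riesz_diff s y z\<bar>) <= ennreal (C0 * norm y powr s)"
  using riesz_diff_integral[of s, where 'a='a] assms by auto
 have m[measurable]: "riesz_diff s y \<in> borel_measurable borel" for y :: 'a
  by (simp add: riesz_diff_def[abs_def])
 have [measurable]: "riesz_corr s y y' \<in> borel_measurable borel" for y y' :: 'a
  unfolding riesz_corr_def[abs_def] by measurable
 have [measurable]: "(\<lambda>(y', d). riesz_corr s y y' d) \<in> borel_measurable (borel \<Otimes>\<^sub>M borel)" for y :: 'a
  unfolding riesz_corr_def by measurable
 define \<kappa> where "\<kappa> e w = norm (snd e) powr (- s) * riesz_diff s (snd e) (fst e - w)" for e :: "'a \<times> 'a" and w
 define C1 where "C1 = C * (2 * sph TYPE('a) / \<epsilon>)"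
 have "C1 > 0" using \<open>C > 0\<close> \<epsilon> by (simp add: C1_def)
 have powr_cancel: "norm y powr (- s) * norm y powr s <= 1" for y :: 'a
  by (cases "y = 0") (auto simp flip: powr_add)
 have row: "(NBINT w. ennreal \<bar>\<kappa> e w\<bar>) <= ennreal C0" for e
 proof -
  have "(NBINT w. ennreal \<bar>\<kappa> e w\<bar>) = ennreal (norm (snd e) powr (- s)) * (NBINT w. ennreal \<bar>riesz_diff s (snd e) (fst e - w)\<bar>)"
   by (subst nn_integral_cmult[symmetric]) (auto simp: \<kappa>_def abs_mult ennreal_mult)
  also have "... <= ennreal (norm (snd e) powr (- s)) * ennreal (C0 * norm (snd e) powr s)"
   unfolding nn_integral_riesz_diff_reflect by (intro mult_left_mono C0) auto
  also have "... = ennreal (C0 * (norm (snd e) powr (- s) * norm (snd e) powr s))"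
   using \<open>C0 > 0\<close> by (simp add: ennreal_mult[symmetric] mult_ac)
  also have "... <= ennreal C0"
   using \<open>C0 > 0\<close> powr_cancel[of "snd e"] by (intro ennreal_leI) (simp add: mult_left_le)
  finally show ?thesis .
 qed
 have \<kappa>m: "(\<lambda>(e, w). \<kappa> e w) \<in> borel_measurable ((lborel \<Otimes>\<^sub>M lborel) \<Otimes>\<^sub>M lborel)"
  unfolding \<kappa>_def by measurable
 note [measurable] = \<kappa>m
 have main: "(\<integral>\<^sup>+e. ennreal ((LBINT w. \<kappa> e w * h w)\<^sup>2) \<partial>density (lborel \<Otimes>\<^sub>M lborel) (\<lambda>e. haar_weight e * indicator (shell k) e)) <= ennreal C1 * (NBINT w. ennreal ((h w)\<^sup>2))"
  if [measurable]: "h \<in> borel_measurable borel" and hH: "!!w. \<bar>h w\<bar> <= H" for h H k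
 proof -
  let ?M = "density (lborel \<Otimes>\<^sub>M lborel) (\<lambda>e. haar_weight e * indicator (shell k) e) :: ('a \<times> 'a) measure"
  let ?wt = "(\<lambda>y. ennreal (norm y powr (- real DIM('a))) * indicator (cball 0 (real k) - ball 0 (1 / real (Suc k))) y) :: 'a => ennreal"
  let ?W = "NBINT y. ?wt y"
  have W: "?W < \<infinity>" by (rule shell_weight_finite)
  have [measurable]: "cball (0::'a) (real k) \<in> sets borel" "ball (0::'a) (1 / real (Suc k)) \<in> sets borel" by simp_all
  have wtm: "?wt \<in> borel_measurable borel" by measurable
  obtain W where W': "?W = ennreal W" "0 <= W" using W by (cases "?W") auto
  show ?thesis
  proof (rule TTstar_schur[where C\<^sub>0=C0 and H=H and D="C0 * W"])
   show "finite_measure ?M"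
   proof (rule finite_measureI)
    have "emeasure ?M (space ?M) = (\<integral>\<^sup>+e. 1 \<partial>?M)"
     by (simp only: nn_integral_const mult_1)
    also have "... <= (NBINT y. ?wt y * (\<integral>\<^sup>+x. 1 * indicator (cball 0 (real k)) x \<partial>(lborel::'a measure)))"
     by (rule nn_integral_shell_le) measurable
    also have "... = ?W * emeasure lborel (cball (0::'a) (real k))"
     by (subst nn_integral_multc[OF wtm[unfolded measurable_lborel2[symmetric]]]) simp
    also have "... < \<infinity>"
     using W emeasure_bounded_finite[of "cball (0::'a) (real k)"] unfolding infinity_ennreal_def ennreal_mult_less_top by auto
    finally show "emeasure ?M (space ?M) ~= \<infinity>" by simp
   qed
   show "sigma_finite_measure (lborel :: 'a measure)" by (rule lborel.sigma_finite_measure_axioms)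
   show "(\<lambda>(e, w). \<kappa> e w) \<in> borel_measurable (?M \<Otimes>\<^sub>M lborel)"
    by (subst measurable_cong_sets[OF sets_pair_measure_cong[OF sets_density refl] refl]) (rule \<kappa>m)
   show "(\<integral>\<^sup>+e. ennreal \<bar>\<kappa> e w\<bar> \<partial>?M) <= ennreal (C0 * W)" for w
   proof -
    have "(\<integral>\<^sup>+e. ennreal \<bar>\<kappa> e w\<bar> \<partial>?M) <= (NBINT y. ?wt y * (NBINT x. ennreal \<bar>\<kappa> (x, y) w\<bar> * indicator (cball 0 (real k)) x))"
     by (rule nn_integral_shell_le) (simp add: \<kappa>_def)
    also have "... <= (NBINT y. ?wt y * ennreal C0)"
    proof (intro nn_integral_mono mult_left_mono)
     fix y :: 'a
     have "(NBINT x. ennreal \<bar>\<kappa> (x, y) w\<bar> * indicator (cball 0 (real k)) x) <= (NBINT x. ennreal (norm y powr (- s)) * ennreal \<bar>riesz_diff s y (- w + x)\<bar>)"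
      by (intro nn_integral_mono) (auto simp: \<kappa>_def abs_mult ennreal_mult indicator_def)
     also have "... = ennreal (norm y powr (- s)) * (NBINT x. ennreal \<bar>riesz_diff s y (- w + x)\<bar>)"
      by (rule nn_integral_cmult) measurable
     also have "(NBINT x. ennreal \<bar>riesz_diff s y (- w + x)\<bar>) = (NBINT x. ennreal \<bar>riesz_diff s y x\<bar>)"
      by (rule nn_integral_lborel_shift) measurable
     also have "ennreal (norm y powr (- s)) * ... <= ennreal (norm y powr (- s)) * ennreal (C0 * norm y powr s)"
      by (intro mult_left_mono C0) auto
     also have "... = ennreal (C0 * (norm y powr (- s) * norm y powr s))"
      using \<open>C0 > 0\<close> by (simp add: ennreal_mult[symmetric] mult_ac)
     also have "... <= ennreal C0"
      using \<open>C0 > 0\<close> powr_cancel[of y] by (intro ennreal_leI) (simp add: mult_left_le)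
     finally show "(NBINT x. ennreal \<bar>\<kappa> (x, y) w\<bar> * indicator (cball 0 (real k)) x) <= ennreal C0" .
    qed auto
    also have "... = ?W * ennreal C0"
     by (rule nn_integral_multc) (rule wtm[unfolded measurable_lborel2[symmetric]])
    also have "... = ennreal (C0 * W)"
     using \<open>C0 > 0\<close> W' by (simp add: ennreal_mult[symmetric] mult_ac)
    finally show ?thesis .
   qed
   show "(\<integral>\<^sup>+e'. ennreal \<bar>(LBINT w. \<kappa> e w * \<kappa> e' w)\<bar> \<partial>?M) <= ennreal C1" for e
   proof -
    obtain x y where e: "e = (x, y)" by (cases e)
    have R: "(LBINT w. \<kappa> (x, y) w * \<kappa> (x', y') w) = norm y powr (- s) * norm y' powr (- s) * riesz_corr s y y' (x - x')" for x' y'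
    proof -
     have "(LBINT w. \<kappa> (x, y) w * \<kappa> (x', y') w) = (LBINT w. (norm y powr (- s) * norm y' powr (- s)) * (riesz_diff s y ((x - x') + (x' - w)) * riesz_diff s y' (x' - w)))"
      by (intro Bochner_Integration.integral_cong) (auto simp: \<kappa>_def)
     also have "... = (norm y powr (- s) * norm y' powr (- s)) * (LBINT w. riesz_diff s y ((x - x') + (x' - w)) * riesz_diff s y' (x' - w))"
      by simp
     also have "(LBINT w. riesz_diff s y ((x - x') + (x' - w)) * riesz_diff s y' (x' - w)) = riesz_corr s y y' (x - x')"
      unfolding riesz_corr_def by (rule integral_lborel_reflect) measurable
     finally show ?thesis .
    qed
    show ?thesis
    proof (cases "y = 0")
     case True
     then show ?thesis by (simp add: e \<kappa>_def)
    next
     case False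
     have "(\<integral>\<^sup>+e'. ennreal \<bar>(LBINT w. \<kappa> e w * \<kappa> e' w)\<bar> \<partial>?M) <= (NBINT y'. ?wt y' * (NBINT x'. ennreal \<bar>(LBINT w. \<kappa> e w * \<kappa> (x', y') w)\<bar> * indicator (cball 0 (real k)) x'))"
      by (rule nn_integral_shell_le) (simp add: \<kappa>_def)
     also have "... <= (\<integral>\<^sup>+y'. ennreal C * ennreal (norm y' powr (- real DIM('a)) * min (norm y powr \<epsilon> * norm y' powr (- \<epsilon>)) (norm y' powr \<epsilon> * norm y powr (- \<epsilon>))) \<partial>(lborel::'a measure))"
     proof (intro nn_integral_mono)
      fix y' :: 'a
      let ?m = "min (norm y powr \<epsilon> * norm y' powr (- \<epsilon>)) (norm y' powr \<epsilon> * norm y powr (- \<epsilon>))"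
      show "?wt y' * (NBINT x'. ennreal \<bar>(LBINT w. \<kappa> e w * \<kappa> (x', y') w)\<bar> * indicator (cball 0 (real k)) x')
       <= ennreal C * ennreal (norm y' powr (- real DIM('a)) * ?m)"
      proof (cases "y' = 0")
       case True
       then show ?thesis by simp
      next
       case y': False
       let ?p = "norm y powr (- s) * norm y' powr (- s)"
       have "(NBINT x'. ennreal \<bar>(LBINT w. \<kappa> e w * \<kappa> (x', y') w)\<bar> * indicator (cball 0 (real k)) x')
        <= (NBINT x'. ennreal ?p * ennreal \<bar>riesz_corr s y y' (x - x')\<bar>)"
        by (intro nn_integral_mono) (auto simp: e R abs_mult ennreal_mult indicator_def)
       also have "... = ennreal ?p * (NBINT x'. ennreal \<bar>riesz_corr s y y' (x - x')\<bar>)"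
        by (rule nn_integral_cmult) measurable
       also have "(NBINT x'. ennreal \<bar>riesz_corr s y y' (x - x')\<bar>) = (?J y y')"
        by (rule nn_integral_lborel_reflect) measurable
       \<comment> \<open>\<open>riesz_corr_bound\<close> decays in one direction of the ratio of
         scales. Applied once as it stands and once with the two scales exchanged by
         \<open>riesz_corr_swap\<close>, it gives the minimum of both bounds.\<close>
       also have "ennreal ?p * (?J y y') <= ennreal (C * ?m)"
       proof -
        have c: "norm v powr (- s) * norm v powr (s + t) = norm v powr t" for v :: 'a and t
         by (simp flip: powr_add)
        have A: "?p * (norm y powr (s + \<epsilon>) * norm y' powr (s - \<epsilon>)) = norm y powr \<epsilon> * norm y' powr (- \<epsilon>)"
         using c[of y \<epsilon>] c[of y' "- \<epsilon>"] by (simp add: mult_ac)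
        have B: "?p * (norm y' powr (s + \<epsilon>) * norm y powr (s - \<epsilon>)) = norm y' powr \<epsilon> * norm y powr (- \<epsilon>)"
         using c[of y' \<epsilon>] c[of y "- \<epsilon>"] by (simp add: mult_ac)
        have "ennreal ?p * (?J y y') <= ennreal ?p * ennreal (C * (norm y powr (s + \<epsilon>) * norm y' powr (s - \<epsilon>)))"
         by (intro mult_left_mono C) auto
        also have "... = ennreal (C * (?p * (norm y powr (s + \<epsilon>) * norm y' powr (s - \<epsilon>))))"
         using \<open>C > 0\<close> by (simp add: ennreal_mult[symmetric] mult_ac)
        finally have 1: "ennreal ?p * (?J y y') <= ennreal (C * (norm y powr \<epsilon> * norm y' powr (- \<epsilon>)))"
         unfolding A .
        have "(?J y y') = (NBINT d. ennreal \<bar>riesz_corr s y' y (0 - d)\<bar>)"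
         by (simp add: riesz_corr_swap[of s y y'])
        also have "... = (?J y' y)"
         by (rule nn_integral_lborel_reflect) measurable
        finally have "ennreal ?p * (?J y y') <= ennreal ?p * ennreal (C * (norm y' powr (s + \<epsilon>) * norm y powr (s - \<epsilon>)))"
         by (simp only:) (intro mult_left_mono C, auto)
        also have "... = ennreal (C * (?p * (norm y' powr (s + \<epsilon>) * norm y powr (s - \<epsilon>))))"
         using \<open>C > 0\<close> by (simp add: ennreal_mult[symmetric] mult_ac)
        finally have 2: "ennreal ?p * (?J y y') <= ennreal (C * (norm y' powr \<epsilon> * norm y powr (- \<epsilon>)))"
         unfolding B .
        from 1 2 show ?thesis by (simp add: min_def)
       qed
       finally have "?wt y' * (NBINT x'. ennreal \<bar>(LBINT w. \<kappa> e w * \<kappa> (x', y') w)\<bar> * indicator (cball 0 (real k)) x')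
        <= ennreal (norm y' powr (- real DIM('a))) * ennreal (C * ?m)"
        by (intro mult_mono) (auto simp: indicator_def)
       also have "... = ennreal C * ennreal (norm y' powr (- real DIM('a)) * ?m)"
        using \<open>C > 0\<close> by (simp add: ennreal_mult[symmetric] mult_ac)
       finally show ?thesis .
      qed
     qed
     also have "... = ennreal C * (\<integral>\<^sup>+y'. ennreal (norm y' powr (- real DIM('a)) * min (norm y powr \<epsilon> * norm y' powr (- \<epsilon>)) (norm y' powr \<epsilon> * norm y powr (- \<epsilon>))) \<partial>(lborel::'a measure))"
      by (rule nn_integral_cmult) measurable
     also have "... <= ennreal C * ennreal (2 * sph TYPE('a) / \<epsilon>)"
      using False \<epsilon> nn_integral_min_powr[of \<epsilon> "norm y", where 'a='a] by (intro mult_left_mono) simp_all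
     also have "... = ennreal C1"
      using \<open>C > 0\<close> \<epsilon> unfolding C1_def by (intro ennreal_mult[symmetric]) auto
     finally show ?thesis .
    qed
   qed
  qed (use row hH \<open>C0 > 0\<close> \<open>C1 > 0\<close> W'(2) in auto)
 qed
 have "(\<integral>\<^sup>+e. ennreal ((riesz_op s h e)\<^sup>2) \<partial>density (lborel \<Otimes>\<^sub>M lborel) haar_weight) <= ennreal C1 * (NBINT w. ennreal ((h w)\<^sup>2))"
  if [measurable]: "h \<in> borel_measurable borel" and hH: "!!w. \<bar>h w\<bar> <= H" for h :: "'a => real" and H
 proof -
  have op: "riesz_op s h e = (LBINT w. \<kappa> e w * h w)" for e
   by (cases e) (simp add: riesz_op_def \<kappa>_def mult.assoc)
  let ?F = "\<lambda>e. ennreal ((riesz_op s h e)\<^sup>2)"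
  have "(\<integral>\<^sup>+e. ?F e \<partial>density (lborel \<Otimes>\<^sub>M lborel) haar_weight) = (\<integral>\<^sup>+e. haar_weight e * ?F e \<partial>(lborel \<Otimes>\<^sub>M lborel))"
   by (rule nn_integral_density) measurable
  also have "... = (\<integral>\<^sup>+e. (SUP k. haar_weight e * indicator (shell k) e * ?F e) \<partial>(lborel \<Otimes>\<^sub>M lborel))"
  proof (rule nn_integral_cong)
   fix e :: "'a \<times> 'a"
   show "haar_weight e * ?F e = (SUP k. haar_weight e * indicator (shell k) e * ?F e)"
   \<comment> \<open>At \<open>snd e = 0\<close> the weight vanishes because \<open>powr\<close>
     with base 0 is 0; any other point belongs to some shell.\<close>
   proof (cases "snd e = 0")
    case True
    then show ?thesis by (simp add: haar_weight_def)
   next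
    case False
    obtain k1 :: nat where "norm (fst e) + norm (snd e) + 1 / norm (snd e) <= real k1"
     using real_arch_simple by blast
    then have k1: "norm (fst e) <= real k1" "norm (snd e) <= real k1" "1 / norm (snd e) <= real (Suc k1)"
     using norm_ge_zero[of "fst e"] norm_ge_zero[of "snd e"] zero_le_divide_1_iff[of "norm (snd e)"] by linarith+
    then have "1 / real (Suc k1) <= norm (snd e)"
     using False by (simp add: field_simps)
    then have "e \<in> shell k1" using k1 by (auto simp: shell_def case_prod_unfold)
    then have "haar_weight e * ?F e <= (SUP k. haar_weight e * indicator (shell k) e * ?F e)"
     by (intro SUP_upper2[of k1]) auto
    moreover have "(SUP k. haar_weight e * indicator (shell k) e * ?F e) <= haar_weight e * ?F e"
     by (intro SUP_least) (auto simp: indicator_def)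
    ultimately show ?thesis by (rule antisym)
   qed
  qed
  also have "... = (SUP k. \<integral>\<^sup>+e. haar_weight e * indicator (shell k) e * ?F e \<partial>(lborel \<Otimes>\<^sub>M lborel))"
  proof (rule nn_integral_monotone_convergence_SUP)
   have "shell k \<subseteq> (shell l :: ('a \<times> 'a) set)" if "k <= l" for k l
   proof -
    have "1 / real (Suc l) <= 1 / real (Suc k)"
     using that by (intro divide_left_mono) auto
    then show ?thesis
     using that unfolding shell_def by force
   qed
   then show "incseq (\<lambda>k e. haar_weight e * indicator (shell k) e * ?F e)"
    by (fastforce simp: incseq_def le_fun_def indicator_def)
  qed measurable
  also have "... <= ennreal C1 * (NBINT w. ennreal ((h w)\<^sup>2))"
  proof (rule SUP_least)
   fix k
   have "(\<integral>\<^sup>+e. haar_weight e * indicator (shell k) e * ?F e \<partial>(lborel \<Otimes>\<^sub>M lborel)) = (\<integral>\<^sup>+e. ?F e \<partial>density (lborel \<Otimes>\<^sub>M lborel) (\<lambda>e. haar_weight e * indicator (shell k) e))"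
    by (rule nn_integral_density[symmetric]) measurable
   also have "... <= ennreal C1 * (NBINT w. ennreal ((h w)\<^sup>2))"
    unfolding op by (rule main[OF that(1) hH])
   finally show "(\<integral>\<^sup>+e. haar_weight e * indicator (shell k) e * ?F e \<partial>(lborel \<Otimes>\<^sub>M lborel)) <= ennreal C1 * (NBINT w. ennreal ((h w)\<^sup>2))" .
  qed
  finally show ?thesis .
 qed
 then show ?thesis using \<open>C1 > 0\<close> by blast
qed

text \<open>Interpolation between L^2 and the sup bound. The case q = 2 is separate because
  \<open>marcinkiewicz\<close> needs a strict inequality between the exponents.\<close>

lemma riesz_op_Lq:
 fixes s q :: real
 assumes "0 < s" "s < 1" "2 <= q"
 shows "\<exists>C>0. \<forall>(h::'a::euclidean_space => real) H. h \<in> borel_measurable borel \<longrightarrow> (\<forall>w. \<bar>h w\<bar> <= H) \<longrightarrow>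
  (\<integral>\<^sup>+e. haar_weight e * ennreal (\<bar>riesz_op s h e\<bar> powr q) \<partial>(lborel \<Otimes>\<^sub>M lborel)) <= ennreal C * (NBINT w. ennreal (\<bar>h w\<bar> powr q))"
proof -
 let ?J = "\<lambda>h. \<integral>\<^sup>+e. haar_weight e * ennreal (\<bar>riesz_op s h e\<bar> powr q) \<partial>(lborel \<Otimes>\<^sub>M lborel)"
 let ?M = "density (lborel \<Otimes>\<^sub>M lborel) haar_weight :: ('a \<times> 'a) measure"
 obtain C2 where "C2 > 0" and C2: "!!(h::'a => real) H. h \<in> borel_measurable borel ==> (!!w. \<bar>h w\<bar> <= H) ==>
  (\<integral>\<^sup>+e. ennreal ((riesz_op s h e)\<^sup>2) \<partial>?M) <= ennreal C2 * (NBINT w. ennreal ((h w)\<^sup>2))"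
  using riesz_op_L2[OF assms(1,2), where 'a='a] by blast
 obtain C0 where "C0 > 0" and C0: "!!(h::'a => real) H e. h \<in> borel_measurable borel ==> (!!w. \<bar>h w\<bar> <= H) ==> \<bar>riesz_op s h e\<bar> <= C0 * H"
  using riesz_op_bounded[OF assms(1,2), where 'a='a] by blast
 have dens: "(?J h) = (\<integral>\<^sup>+e. ennreal (\<bar>riesz_op s h e\<bar> powr q) \<partial>?M)"
  if [measurable]: "h \<in> borel_measurable borel" for h
  by (rule nn_integral_density[symmetric]) measurable
 show ?thesis
 proof (cases "q = 2")
  case True
  have "(?J h) <= ennreal C2 * (NBINT w. ennreal (\<bar>h w\<bar> powr q))"
   if h: "h \<in> borel_measurable borel" "!!w. \<bar>h w\<bar> <= H" for h :: "'a => real" and H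
   unfolding dens[OF h(1)] using C2[OF h] True by simp
  then show ?thesis using \<open>C2 > 0\<close> by blast
 next
  case False
  then have "2 < q" using assms by simp
  \<comment> \<open>The part of \<open>h\<close> bounded by l / D then contributes at most l / 2 to
    \<open>riesz_op\<close> at every point, so exceeding l forces the large part above l / 2, and
    Chebyshev's inequality applies to its square.\<close>
  define D where "D = 2 * C0"
  have "D > 0" using \<open>C0 > 0\<close> by (simp add: D_def)
  define C where "C = 4 * C2 * q / (q - 2) * D powr (q - 2)"
  have "C > 0" unfolding C_def using \<open>C2 > 0\<close> \<open>2 < q\<close> \<open>D > 0\<close> by (intro mult_pos_pos divide_pos_pos) auto
  have "(?J h) <= ennreal C * (NBINT w. ennreal (\<bar>h w\<bar> powr q))"
   if h[measurable]: "h \<in> borel_measurable borel" and hH: "!!w. \<bar>h w\<bar> <= H" for h :: "'a => real" and H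
  proof -
   have "0 <= H" using hH[of 0] by linarith
   have sf: "sigma_finite_measure ?M"
    unfolding haar_weight_def[abs_def] by (subst sigma_finite_measure.sigma_finite_iff_density_finite[OF lborel_pair.sigma_finite_measure_axioms]) auto
   have opm[measurable]: "riesz_op s h \<in> borel_measurable ?M"
    by simp
   have "(\<integral>\<^sup>+e. epow (ennreal \<bar>riesz_op s h e\<bar>) q \<partial>?M) <= ennreal (4 * C2 * q / (q - 2) * D powr (q - 2)) * (NBINT w. ennreal (\<bar>h w\<bar> powr q))"
   proof (rule marcinkiewicz)
    fix l :: real assume l: "0 < l"
    define h1 where "h1 w = (if l < D * \<bar>h w\<bar> then h w else 0)" for w
    define h2 where "h2 w = (if l < D * \<bar>h w\<bar> then 0 else h w)" for w
    have m1[measurable]: "h1 \<in> borel_measurable borel" and m2[measurable]: "h2 \<in> borel_measurable borel"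
     unfolding h1_def[abs_def] h2_def[abs_def] by measurable
    have b1: "\<bar>h1 w\<bar> <= H" and b2: "\<bar>h2 w\<bar> <= l / D" for w
     using hH \<open>0 <= H\<close> l \<open>D > 0\<close> by (auto simp: h1_def h2_def field_simps)
    have add: "riesz_op s h e = riesz_op s h1 e + riesz_op s h2 e" for e
    proof -
     obtain x y where e: "e = (x, y)" by (cases e)
     have i: "integrable lborel (\<lambda>w. riesz_diff s y (x - w) * u w)" if [measurable]: "u \<in> borel_measurable borel" and "!!w. \<bar>u w\<bar> <= c" for u c
     proof (rule Bochner_Integration.integrable_bound)
      show "integrable lborel (\<lambda>w. c * riesz_diff s y (x - w))"
       using assms by (intro integrable_mult_right integrable_lborel_reflect riesz_diff_integrable) auto
      have "0 <= c" using that(2)[of 0] by linarith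
      show "AE w in lborel. norm (riesz_diff s y (x - w) * u w) <= norm (c * riesz_diff s y (x - w))"
       using that(2) \<open>0 <= c\<close> by (intro AE_I2) (auto simp: abs_mult mult.commute intro!: mult_right_mono)
     qed measurable
     have "(LBINT w. riesz_diff s y (x - w) * h w) = (LBINT w. riesz_diff s y (x - w) * h1 w + riesz_diff s y (x - w) * h2 w)"
      by (intro Bochner_Integration.integral_cong) (auto simp: h1_def h2_def)
     also have "... = (LBINT w. riesz_diff s y (x - w) * h1 w) + (LBINT w. riesz_diff s y (x - w) * h2 w)"
      by (intro Bochner_Integration.integral_add i[OF m1 b1] i[OF m2 b2])
     finally show ?thesis by (simp add: e riesz_op_def distrib_left)
    qed
    have "\<bar>riesz_op s h2 e\<bar> <= l / 2" for e
     using C0[OF m2 b2, of e] \<open>C0 > 0\<close> by (simp add: D_def)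
    then have sub: "{e \<in> space ?M. ennreal l < ennreal \<bar>riesz_op s h e\<bar>} \<subseteq> {e \<in> space ?M. 1 <= ennreal (4 / l\<^sup>2) * ennreal ((riesz_op s h1 e)\<^sup>2)}"
    proof (intro subsetI)
     fix e assume *: "!!e. \<bar>riesz_op s h2 e\<bar> <= l / 2" and e: "e \<in> {e \<in> space ?M. ennreal l < ennreal \<bar>riesz_op s h e\<bar>}"
     have "l < \<bar>riesz_op s h1 e + riesz_op s h2 e\<bar>" using e l by (simp add: ennreal_less_iff add)
     with *[of e] have "l / 2 <= \<bar>riesz_op s h1 e\<bar>" by linarith
     then have "(l / 2)\<^sup>2 <= (riesz_op s h1 e)\<^sup>2"
      using l by (metis abs_le_square_iff abs_of_pos half_gt_zero)
     then have "1 <= 4 / l\<^sup>2 * (riesz_op s h1 e)\<^sup>2"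
      using l by (simp add: power_divide field_simps)
     then have "ennreal 1 <= ennreal (4 / l\<^sup>2 * (riesz_op s h1 e)\<^sup>2)"
      by (rule ennreal_leI)
     moreover have "ennreal (4 / l\<^sup>2 * (riesz_op s h1 e)\<^sup>2) = ennreal (4 / l\<^sup>2) * ennreal ((riesz_op s h1 e)\<^sup>2)"
      by (rule ennreal_mult) auto
     ultimately have "1 <= ennreal (4 / l\<^sup>2) * ennreal ((riesz_op s h1 e)\<^sup>2)"
      by (simp only: ennreal_1)
     then show "e \<in> {e \<in> space ?M. 1 <= ennreal (4 / l\<^sup>2) * ennreal ((riesz_op s h1 e)\<^sup>2)}"
      using e by (simp add: ennreal_mult)
    qed
    have "emeasure ?M {e \<in> space ?M. ennreal l < ennreal \<bar>riesz_op s h e\<bar>} <= emeasure ?M {e \<in> space ?M. 1 <= ennreal (4 / l\<^sup>2) * ennreal ((riesz_op s h1 e)\<^sup>2)}"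
     by (rule emeasure_mono[OF sub]) measurable
    also have "... <= ennreal (4 / l\<^sup>2) * (\<integral>\<^sup>+e. ennreal ((riesz_op s h1 e)\<^sup>2) * indicator (space ?M) e \<partial>?M)"
     by (rule nn_integral_Markov_inequality) measurable
    also have "(\<integral>\<^sup>+e. ennreal ((riesz_op s h1 e)\<^sup>2) * indicator (space ?M) e \<partial>?M) = (\<integral>\<^sup>+e. ennreal ((riesz_op s h1 e)\<^sup>2) \<partial>?M)"
     by (rule nn_integral_cong) simp
    also have "ennreal (4 / l\<^sup>2) * ... <= ennreal (4 / l\<^sup>2) * (ennreal C2 * (NBINT w. ennreal ((h1 w)\<^sup>2)))"
     by (intro mult_left_mono C2[OF m1 b1]) auto
    also have "... = ennreal (4 / l\<^sup>2 * C2) * (NBINT w. ennreal ((h1 w)\<^sup>2))"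
    proof -
     have "ennreal (4 / l\<^sup>2 * C2) = ennreal (4 / l\<^sup>2) * ennreal C2"
      using \<open>C2 > 0\<close> by (intro ennreal_mult) auto
     then show ?thesis by (simp only: mult.assoc)
    qed
    also have "(NBINT w. ennreal ((h1 w)\<^sup>2)) = (NBINT w. ennreal (\<bar>h w\<bar> powr 2) * indicator {w. l < D * \<bar>h w\<bar>} w)"
     by (intro nn_integral_cong) (auto simp: h1_def indicator_def)
    also have "4 / l\<^sup>2 * C2 = 4 * C2 * l powr (- 2)"
     using l by (simp add: powr_minus divide_simps)
    finally show "emeasure ?M {e \<in> space ?M. ennreal l < ennreal \<bar>riesz_op s h e\<bar>}
     <= ennreal (4 * C2 * l powr (- 2)) * (NBINT w. ennreal (\<bar>h w\<bar> powr 2) * indicator {w. l < D * \<bar>h w\<bar>} w)" .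
   next
    show "sigma_finite_measure (lborel :: 'a measure)" by (rule lborel.sigma_finite_measure_axioms)
    show "sigma_finite_measure ?M" by (rule sf)
    show "(\<lambda>w. \<bar>h w\<bar>) \<in> borel_measurable lborel" "(\<lambda>e. ennreal \<bar>riesz_op s h e\<bar>) \<in> borel_measurable ?M"
     by measurable
   qed (use \<open>2 < q\<close> \<open>C2 > 0\<close> \<open>D > 0\<close> in simp_all)
   then show ?thesis
    unfolding dens[OF h] by (simp add: C_def)
  qed
  then show ?thesis using \<open>C > 0\<close> by blast
 qed
qed

section \<open>Cancellation of the kernel against a point mass spread over a ball\<close>

lemma weighted_average_close:
 fixes F u :: "'a => real"
 assumes [measurable]: "F \<in> borel_measurable M" "u \<in> borel_measurable M"
  and u0: "!!v. 0 <= u v" and u1: "(\<integral>\<^sup>+v. ennreal (u v) \<partial>M) = 1"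
  and close: "!!v. u v ~= 0 ==> \<bar>F v - a\<bar> <= B" and "0 <= B"
 shows "integrable M (\<lambda>v. F v * u v)" "\<bar>(\<integral>v. F v * u v \<partial>M) - a\<bar> <= B"
proof -
 have ui: "integrable M u"
  using u0 u1 by (intro integrableI_bounded) auto
 have uI: "(\<integral>v. u v \<partial>M) = 1"
  using u0 u1 by (subst integral_eq_nn_integral) auto
 show Fi: "integrable M (\<lambda>v. F v * u v)"
 proof (rule Bochner_Integration.integrable_bound)
  show "integrable M (\<lambda>v. (\<bar>a\<bar> + B) * u v)" using ui by simp
  show "AE v in M. norm (F v * u v) <= norm ((\<bar>a\<bar> + B) * u v)"
  proof (intro AE_I2)
   fix v
   have "u v ~= 0 ==> \<bar>F v\<bar> <= \<bar>a\<bar> + B" using close[of v] by linarith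
   then have "\<bar>F v\<bar> * u v <= (\<bar>a\<bar> + B) * u v"
    using u0[of v] by (cases "u v = 0") (auto intro: mult_right_mono)
   then show "norm (F v * u v) <= norm ((\<bar>a\<bar> + B) * u v)"
    using u0[of v] \<open>0 <= B\<close> by (simp add: abs_mult)
  qed
 qed measurable
 have "(\<integral>v. F v * u v \<partial>M) - a = (\<integral>v. F v * u v \<partial>M) - (\<integral>v. a * u v \<partial>M)"
  by (simp add: uI)
 also have "... = (\<integral>v. F v * u v - a * u v \<partial>M)"
  using Fi ui by (intro Bochner_Integration.integral_diff[symmetric]) auto
 finally have eq: "(\<integral>v. F v * u v \<partial>M) - a = (\<integral>v. F v * u v - a * u v \<partial>M)" .
 have "norm (\<integral>v. F v * u v - a * u v \<partial>M) <= (\<integral>v. norm (F v * u v - a * u v) \<partial>M)"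
  by (rule integral_norm_bound)
 also have "... <= (\<integral>v. B * u v \<partial>M)"
 proof (rule integral_mono)
  fix v
  have "\<bar>F v - a\<bar> * u v <= B * u v"
   using close[of v] u0[of v] by (cases "u v = 0") (auto intro: mult_right_mono)
  then show "norm (F v * u v - a * u v) <= B * u v"
   using u0[of v] by (simp add: abs_mult flip: left_diff_distrib)
 qed (use Fi ui in auto)
 finally show "\<bar>(\<integral>v. F v * u v \<partial>M) - a\<bar> <= B"
  by (simp add: eq uI)
qed

text \<open>The kernel of a point mass at \<open>w\<close> minus its average \<open>u\<close> over a ball of radius \<open>\<delta> / 4\<close>;
 the cancellation yields one extra power of decay away from \<open>w\<close>.\<close>
definition cancellation_const :: "'a::euclidean_space itself => real => real => bool" where
 "cancellation_const _ s C \<longleftrightarrow> (\<forall>(x::'a) z w \<delta> u. u \<in> borel_measurable borel \<longrightarrow> 0 < \<delta> \<longrightarrow> \<delta> <= norm (x - w) \<longrightarrow> z ~= w \<longrightarrow>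
  (\<forall>v. 0 <= u v & u v <= 4 ^ DIM('a) / (unit_ball_vol DIM('a) * \<delta> ^ DIM('a))) \<longrightarrow> (\<forall>v. u v ~= 0 \<longrightarrow> norm (v - w) < \<delta> / 4) \<longrightarrow>
  (NBINT v. ennreal (u v)) = 1 \<longrightarrow>
  \<bar>(riesz s (z - w) - (LBINT v. riesz s (z - v) * u v)) - (riesz s (x - w) - (LBINT v. riesz s (x - v) * u v))\<bar>
  <= C * (indicator {z. norm (z - w) < \<delta> / 2} z * riesz s (z - w)
   + min (norm (z - x)) \<delta> * (indicator {z. \<delta> / 2 <= norm (z - w)} z * norm (z - w) powr (s - DIM('a) - 1) + norm (x - w) powr (s - DIM('a) - 1))))"

text \<open>If z is within \<delta> / 2 of x, moving from x to z changes the point kernel and its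
  average by a Lipschitz amount each. Otherwise the values at x and z are estimated separately:
  moving the source from w to v gains a factor \<delta> over the distance, except when z is within
  \<delta> / 2 of w, where only the size of the two kernels is used.\<close>

lemma riesz_cancellation_bound:
 fixes s :: real
 assumes s: "0 < s" "s < 1"
 shows "\<exists>C>0. cancellation_const TYPE('a::euclidean_space) s C"
proof -
 let ?n = "real DIM('a)" and ?\<omega> = "unit_ball_vol (real DIM('a))"
 have sn: "s < ?n" using s DIM_ge_1[where 'a='a] by linarith
 \<comment> \<open>The factor 1 / 4 comes from the distances along which the Lipschitz estimate is
   used: they stay above a quarter of the reference distance.\<close>
 define A where "A = (?n - s) * (1 / 4) powr (s - ?n - 1)"
 have "0 < A" using sn by (simp add: A_def)
 \<comment> \<open>The bound on the density \<open>u\<close> times the integral of the kernel over a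
   ball of radius 3 \<delta> / 4, divided by the least value of \<open>riesz s (z - w)\<close> over
   |z - w| < \<delta> / 2.\<close>
 define C2 where "C2 = 4 ^ DIM('a) / ?\<omega> * (sph TYPE('a) / s) * ((3 / 4) powr s * (1 / 2) powr (?n - s))"
 have "0 < ?\<omega>" by simp
 then have "0 <= C2" using s unfolding C2_def by (intro mult_nonneg_nonneg divide_nonneg_pos) auto
 define C where "C = 4 * A + 1 + C2"
 have "0 < C" using \<open>0 < A\<close> \<open>0 <= C2\<close> by (simp add: C_def)
 {
  fix x z w :: 'a and \<delta> :: real and u :: "'a => real"
  assume um[measurable]: "u \<in> borel_measurable borel" and "0 < \<delta>" and xw: "\<delta> <= norm (x - w)" and "z ~= w"
   and u0: "!!v. 0 <= u v" and ub: "!!v. u v <= 4 ^ DIM('a) / (?\<omega> * \<delta> ^ DIM('a))"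
   and supp: "!!v. u v ~= 0 ==> norm (v - w) < \<delta> / 4" and u1: "(NBINT v. ennreal (u v)) = 1"
  define av where "av t = (LBINT v. riesz s (t - v) * u v)" for t
  have far_lip: "\<bar>riesz s a - riesz s b\<bar> <= A * \<rho> powr (s - ?n - 1) * norm (a - b)" if "0 < \<rho>" "\<rho> / 4 <= norm a" "\<rho> / 4 <= norm b" for \<rho> and a b :: 'a
  proof -
   have "\<bar>riesz s a - riesz s b\<bar> <= (?n - s) * (\<rho> / 4) powr (s - ?n - 1) * norm (a - b)"
    using that sn by (intro riesz_lipschitz) auto
   also have "(\<rho> / 4) powr (s - ?n - 1) = (1 / 4) powr (s - ?n - 1) * \<rho> powr (s - ?n - 1)"
    using powr_mult[of "1/4" \<rho> "s - ?n - 1"] that by simp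
   finally show ?thesis by (simp add: A_def mult_ac)
  qed
  have far: "integrable lborel (\<lambda>v. riesz s (t - v) * u v)" "\<bar>riesz s (t - w) - av t\<bar> <= A * \<delta> * norm (t - w) powr (s - ?n - 1)"
   if t: "\<delta> / 2 <= norm (t - w)" for t
  proof -
   have close: "\<bar>riesz s (t - v) - riesz s (t - w)\<bar> <= A * \<delta> * norm (t - w) powr (s - ?n - 1)" if "u v ~= 0" for v
   proof -
    have v: "norm (v - w) < \<delta> / 4" using supp[OF that] .
    have "norm (t - w) <= norm (t - v) + norm (v - w)"
     using norm_triangle_ineq[of "t - v" "v - w"] by simp
    then have "norm (t - w) / 4 <= norm (t - v)" using v t norm_ge_zero[of "t - w"] by linarith
    then have "\<bar>riesz s (t - v) - riesz s (t - w)\<bar> <= A * norm (t - w) powr (s - ?n - 1) * norm ((t - v) - (t - w))"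
     using t \<open>0 < \<delta>\<close> by (intro far_lip) auto
    also have "... <= A * norm (t - w) powr (s - ?n - 1) * \<delta>"
     using v \<open>0 < A\<close> \<open>0 < \<delta>\<close> norm_minus_commute[of w v] by (intro mult_left_mono) auto
    finally show ?thesis by (simp add: mult_ac)
   qed
   have B0: "0 <= A * \<delta> * norm (t - w) powr (s - ?n - 1)" using \<open>0 < A\<close> \<open>0 < \<delta>\<close> by simp
   have [measurable]: "(\<lambda>v. riesz s (t - v)) \<in> borel_measurable borel" by measurable
   note w = weighted_average_close[of "\<lambda>v. riesz s (t - v)" lborel u "riesz s (t - w)" "A * \<delta> * norm (t - w) powr (s - ?n - 1)", OF _ _ u0 u1 close B0]
   show "integrable lborel (\<lambda>v. riesz s (t - v) * u v)" by (rule w) auto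
   have "\<bar>(LBINT v. riesz s (t - v) * u v) - riesz s (t - w)\<bar> <= A * \<delta> * norm (t - w) powr (s - ?n - 1)" by (rule w) auto
   then show "\<bar>riesz s (t - w) - av t\<bar> <= A * \<delta> * norm (t - w) powr (s - ?n - 1)"
    by (simp add: av_def abs_minus_commute)
  qed
  let ?X = "norm (x - w) powr (s - ?n - 1)" and ?Z = "norm (z - w) powr (s - ?n - 1)"
  have "\<bar>(riesz s (z - w) - av z) - (riesz s (x - w) - av x)\<bar> <= C * (indicator {z. norm (z - w) < \<delta> / 2} z * riesz s (z - w)
   + min (norm (z - x)) \<delta> * (indicator {z. \<delta> / 2 <= norm (z - w)} z * ?Z + ?X))"
  proof (cases "norm (z - x) < \<delta> / 2")
   case True
   have "norm (x - w) <= norm (z - w) + norm (z - x)"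
    using norm_triangle_ineq[of "z - w" "x - z"] norm_minus_commute[of x z] by simp
   then have zw: "\<delta> / 2 <= norm (z - w)" "norm (x - w) / 4 <= norm (z - w)" using True xw \<open>0 < \<delta>\<close> by linarith+
   have "0 < norm (x - w)" using xw \<open>0 < \<delta>\<close> by linarith
   have 1: "\<bar>riesz s (z - w) - riesz s (x - w)\<bar> <= A * ?X * norm (z - x)"
    using far_lip[of "norm (x - w)" "z - w" "x - w"] zw \<open>0 < norm (x - w)\<close> by simp
   have close: "\<bar>(riesz s (z - v) - riesz s (x - v)) - 0\<bar> <= A * ?X * norm (z - x)" if "u v ~= 0" for v
   proof -
    have v: "norm (v - w) < \<delta> / 4" using supp[OF that] .
    have "norm (x - w) <= norm (x - v) + norm (v - w)"
     using norm_triangle_ineq[of "x - v" "v - w"] by simp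
    then have xv: "norm (x - w) / 4 <= norm (x - v)" "3 / 4 * norm (x - w) <= norm (x - v)" using v xw norm_ge_zero[of "x - w"] by linarith+
    have "norm (x - v) <= norm (z - v) + norm (z - x)"
     using norm_triangle_ineq[of "z - v" "x - z"] norm_minus_commute[of x z] by simp
    then have "norm (x - w) / 4 <= norm (z - v)" using xv True xw by linarith
    then show ?thesis
     using far_lip[of "norm (x - w)" "z - v" "x - v"] xv \<open>0 < norm (x - w)\<close> by simp
   qed
   have "0 <= A * ?X * norm (z - x)" using \<open>0 < A\<close> by simp
   then have 2: "\<bar>(LBINT v. (riesz s (z - v) - riesz s (x - v)) * u v) - 0\<bar> <= A * ?X * norm (z - x)"
    by (intro weighted_average_close(2)[OF _ _ u0 u1 close]) auto
   have "(LBINT v. (riesz s (z - v) - riesz s (x - v)) * u v) = av z - av x"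
    unfolding av_def left_diff_distrib using zw xw \<open>0 < \<delta>\<close>
    by (intro Bochner_Integration.integral_diff far(1)) auto
   with 1 2 have "\<bar>(riesz s (z - w) - av z) - (riesz s (x - w) - av x)\<bar> <= 2 * (A * ?X * norm (z - x))"
    by linarith
   also have "... = 2 * A * (min (norm (z - x)) \<delta> * ?X)"
    using True \<open>0 < \<delta>\<close> by simp
   also have "... <= C * (indicator {z. norm (z - w) < \<delta> / 2} z * riesz s (z - w)
   + min (norm (z - x)) \<delta> * (indicator {z. \<delta> / 2 <= norm (z - w)} z * ?Z + ?X))"
    using \<open>0 < A\<close> \<open>0 <= C2\<close> \<open>0 < \<delta>\<close>
    by (intro mult_mono add_increasing mult_left_mono) (auto simp: C_def)
   finally show ?thesis .
  next
   case False
   \<comment> \<open>From here on the minimum is comparable to \<delta>, so a gain of \<delta> at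
     each of x and z suffices.\<close>
   have mn: "\<delta> <= 2 * min (norm (z - x)) \<delta>" using False \<open>0 < \<delta>\<close> by auto
   have X: "\<bar>riesz s (x - w) - av x\<bar> <= 2 * A * (min (norm (z - x)) \<delta> * ?X)"
   proof -
    have "\<bar>riesz s (x - w) - av x\<bar> <= A * \<delta> * ?X" using xw \<open>0 < \<delta>\<close> by (intro far(2)) auto
    also have "... <= A * (2 * min (norm (z - x)) \<delta>) * ?X"
     using mn \<open>0 < A\<close> by (intro mult_right_mono mult_left_mono) auto
    finally show ?thesis by (simp add: mult_ac)
   qed
   show ?thesis
   proof (cases "norm (z - w) < \<delta> / 2")
    case True
    have K: "(1 / 2) powr (s - ?n) * \<delta> powr (s - ?n) <= riesz s (z - w)"
    proof -
     have "(\<delta> / 2) powr (s - ?n) <= norm (z - w) powr (s - ?n)"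
      using True \<open>z ~= w\<close> sn by (intro powr_mono2') auto
     then show ?thesis using powr_mult[of "1/2" \<delta> "s - ?n"] \<open>0 < \<delta>\<close> by (simp add: riesz_def)
    qed
    have "(NBINT v. ennreal (norm (riesz s (z - v) * u v)))
     <= (NBINT v. ennreal (4 ^ DIM('a) / (?\<omega> * \<delta> ^ DIM('a))) * (ennreal (norm (z - v) powr (s - ?n)) * indicator {v. norm (z - v) < 3 / 4 * \<delta>} v))"
    proof (rule nn_integral_mono)
     fix v
     have zv: "norm (z - v) <= norm (z - w) + norm (v - w)"
      using norm_triangle_ineq[of "z - w" "w - v"] norm_minus_commute[of w v] by simp
     show "ennreal (norm (riesz s (z - v) * u v)) <= ennreal (4 ^ DIM('a) / (?\<omega> * \<delta> ^ DIM('a))) * (ennreal (norm (z - v) powr (s - ?n)) * indicator {v. norm (z - v) < 3 / 4 * \<delta>} v)"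
     proof (cases "u v = 0")
      case False
      have "norm (z - v) < 3 / 4 * \<delta>" using zv supp[OF False] True by linarith
      moreover have "norm (riesz s (z - v) * u v) <= 4 ^ DIM('a) / (?\<omega> * \<delta> ^ DIM('a)) * norm (z - v) powr (s - ?n)"
       using u0[of v] mult_right_mono[OF ub[of v], of "norm (z - v) powr (s - ?n)"] by (simp add: abs_mult riesz_def mult.commute)
      moreover have "0 <= 4 ^ DIM('a) / (?\<omega> * \<delta> ^ DIM('a))" using u0 ub order_trans by blast
      ultimately show ?thesis by (simp add: ennreal_mult[symmetric] ennreal_leI)
     qed simp
    qed
    also have "... = ennreal (4 ^ DIM('a) / (?\<omega> * \<delta> ^ DIM('a))) * (NBINT v. ennreal (norm (z - v) powr (s - ?n)) * indicator {v. norm (z - v) < 3 / 4 * \<delta>} v)"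
     by (rule nn_integral_cmult) measurable
    also have "(NBINT v. ennreal (norm (z - v) powr (s - ?n)) * indicator {v. norm (z - v) < 3 / 4 * \<delta>} v) = ennreal (sph TYPE('a) / s * (3 / 4 * \<delta>) powr s)"
     using s \<open>0 < \<delta>\<close> by (intro nn_integral_ball_powr) auto
    also have "ennreal (4 ^ DIM('a) / (?\<omega> * \<delta> ^ DIM('a))) * ennreal (sph TYPE('a) / s * (3 / 4 * \<delta>) powr s) = ennreal (4 ^ DIM('a) / (?\<omega> * \<delta> ^ DIM('a)) * (sph TYPE('a) / s * (3 / 4 * \<delta>) powr s))"
     using \<open>0 < \<delta>\<close> s by (intro ennreal_mult[symmetric]) auto
    also have "4 ^ DIM('a) / (?\<omega> * \<delta> ^ DIM('a)) * (sph TYPE('a) / s * (3 / 4 * \<delta>) powr s) = C2 * ((1 / 2) powr (s - ?n) * \<delta> powr (s - ?n))"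
    proof -
     have "(3 / 4 * \<delta>) powr s = (3 / 4) powr s * \<delta> powr s" using powr_mult[of "3 / 4" \<delta> s] \<open>0 < \<delta>\<close> by simp
     moreover have "\<delta> powr s = \<delta> powr (s - ?n) * \<delta> ^ DIM('a)" using \<open>0 < \<delta>\<close> by (simp add: powr_realpow[symmetric] flip: powr_add)
     moreover have "(1 / 2) powr (?n - s) * (1 / 2) powr (s - ?n) = (1::real)" by (simp flip: powr_add)
     moreover have "a / (\<omega> * X) * (S * (t * (d * X))) = a / \<omega> * S * (t * h) * (h' * d)"
      if "h * h' = 1" "\<omega> ~= 0" "X ~= 0" for a \<omega> X S t d h h' :: real
     proof -
      have "a / \<omega> * S * (t * h) * (h' * d) = a / \<omega> * S * t * d * (h * h')" by (simp only: mult_ac)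
      then show ?thesis using that by (simp add: field_simps)
     qed
     moreover have "?\<omega> ~= 0" using unit_ball_vol_pos[of "real DIM('a)"] by linarith
     moreover have "\<delta> ^ DIM('a) ~= 0" using \<open>0 < \<delta>\<close> by simp
     ultimately show ?thesis unfolding C2_def by (simp only:)
    qed
    finally have "(NBINT v. ennreal (norm (riesz s (z - v) * u v))) <= ennreal (C2 * ((1 / 2) powr (s - ?n) * \<delta> powr (s - ?n)))" .
    then have "norm (av z) <= C2 * ((1 / 2) powr (s - ?n) * \<delta> powr (s - ?n))"
     unfolding av_def using \<open>0 <= C2\<close> by (intro norm_integral_le_real) auto
    also have "... <= C2 * riesz s (z - w)"
     using K \<open>0 <= C2\<close> by (intro mult_left_mono) auto
    finally have Z: "\<bar>riesz s (z - w) - av z\<bar> <= (1 + C2) * riesz s (z - w)"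
     using riesz_nonneg[of s "z - w"] unfolding real_norm_def distrib_right by linarith
    have "\<bar>(riesz s (z - w) - av z) - (riesz s (x - w) - av x)\<bar> <= (1 + C2) * riesz s (z - w) + 2 * A * (min (norm (z - x)) \<delta> * ?X)"
     using X Z by linarith
    also have "... <= C * riesz s (z - w) + C * (min (norm (z - x)) \<delta> * ?X)"
     using \<open>0 < A\<close> \<open>0 <= C2\<close> \<open>0 < \<delta>\<close> by (intro add_mono mult_right_mono) (auto simp: C_def)
    finally show ?thesis using True by (simp add: distrib_left)
   next
    case zfar: False
    have Z: "\<bar>riesz s (z - w) - av z\<bar> <= 2 * A * (min (norm (z - x)) \<delta> * ?Z)"
    proof -
     have "\<bar>riesz s (z - w) - av z\<bar> <= A * \<delta> * ?Z" using zfar by (intro far(2)) auto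
     also have "... <= A * (2 * min (norm (z - x)) \<delta>) * ?Z"
      using mn \<open>0 < A\<close> by (intro mult_right_mono mult_left_mono) auto
     finally show ?thesis by (simp add: mult_ac)
    qed
    have "\<bar>(riesz s (z - w) - av z) - (riesz s (x - w) - av x)\<bar> <= 2 * A * (min (norm (z - x)) \<delta> * ?Z) + 2 * A * (min (norm (z - x)) \<delta> * ?X)"
     using X Z by linarith
    also have "... = 2 * A * (min (norm (z - x)) \<delta> * (?Z + ?X))" by (simp add: algebra_simps)
    also have "... <= C * (min (norm (z - x)) \<delta> * (?Z + ?X))"
     using \<open>0 < A\<close> \<open>0 <= C2\<close> \<open>0 < \<delta>\<close> by (intro mult_right_mono) (auto simp: C_def)
    finally show ?thesis using zfar by simp
   qed
  qed
  note this[unfolded av_def]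
 }
 then show ?thesis using \<open>0 < C\<close> unfolding cancellation_const_def by (intro exI[of _ C]) auto
qed

section \<open>Calderon-Zygmund decomposition\<close>

text \<open>This records all that is needed of the set where the maximal function of |g|^p exceeds
  1: averages over balls that meet the complement are at most 1, and so is |g| itself on the
  complement. Other levels are reached by rescaling \<open>g\<close>.\<close>

locale calderon_zygmund =
 fixes p :: real and g :: "'a::euclidean_space => real" and \<Omega> :: "'a set"
 assumes p_gt_1: "1 < p" and g_measurable [measurable]: "g \<in> borel_measurable borel"
  and open_\<Omega>: "open \<Omega>" and \<Omega>_finite: "emeasure lborel \<Omega> < \<infinity>"
  and average_le_1: "!!c r x. 0 < r ==> x \<notin> \<Omega> ==> x \<in> ball c r ==>
   (\<integral>\<^sup>+w\<in>ball c r. ennreal (\<bar>g w\<bar> powr p) \<partial>lborel) <= emeasure lborel (ball c r)"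
  and g_le_1: "!!w. w \<notin> \<Omega> ==> \<bar>g w\<bar> <= 1"
begin

definition \<delta> :: "'a => real" where "\<delta> w = infdist w (- \<Omega>)"

lemma \<Omega>_measurable [measurable]: "\<Omega> \<in> sets borel"
 using open_\<Omega> by simp

text \<open>Finite measure excludes \<open>\<Omega> = UNIV\<close>, for which \<open>infdist\<close>
  to the empty complement would be 0 and \<open>\<delta>\<close> would carry no information.\<close>

lemma compl_nonempty: "- \<Omega> ~= {}"
proof
 assume "- \<Omega> = {}"
 then have "\<Omega> = UNIV" by auto
 then show False using \<Omega>_finite by simp
qed

lemma \<delta>_measurable [measurable]: "\<delta> \<in> borel_measurable borel"
proof -
 have "continuous_on UNIV \<delta>" unfolding \<delta>_def by (intro continuous_intros)
 then show ?thesis by (rule borel_measurable_continuous_onI)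
qed

lemma \<delta>_nonneg [simp]: "0 <= \<delta> w"
 by (simp add: \<delta>_def infdist_nonneg)

lemma \<delta>_pos: "w \<in> \<Omega> ==> 0 < \<delta> w"
 using infdist_pos_not_in_closed[of "- \<Omega>" w] open_\<Omega> compl_nonempty by (auto simp: \<delta>_def)

lemma \<delta>_le: "x \<notin> \<Omega> ==> \<delta> w <= norm (x - w)"
 using infdist_le[of x "- \<Omega>" w] by (simp add: \<delta>_def dist_norm norm_minus_commute)

lemma \<delta>_triangle: "\<delta> w <= \<delta> z + norm (w - z)"
 using infdist_triangle[of w "- \<Omega>" z] by (simp add: \<delta>_def dist_norm)

lemma near_in_\<Omega>: "norm (z - w) < \<delta> w ==> z \<in> \<Omega>"
 using \<delta>_le[of z w] by force

lemma \<delta>_attained: "\<exists>x. x \<notin> \<Omega> & norm (x - w) = \<delta> w"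
proof -
 obtain x where "x \<in> - \<Omega>" "infdist w (- \<Omega>) = dist w x"
  using infdist_attains_inf[of "- \<Omega>" w] open_\<Omega> compl_nonempty by auto
 then show ?thesis by (auto simp: \<delta>_def dist_norm norm_minus_commute)
qed

text \<open>The ball of twice the radius contains a nearest point of the complement, so the
  hypothesis on averages applies to it.\<close>

lemma ball_integral_power:
 assumes "w \<in> \<Omega>"
 shows "(\<integral>\<^sup>+v\<in>ball w (\<delta> w). ennreal (\<bar>g v\<bar> powr p) \<partial>lborel) <= ennreal (unit_ball_vol DIM('a) * 2 ^ DIM('a) * \<delta> w ^ DIM('a))"
proof -
 obtain x where x: "x \<notin> \<Omega>" "norm (x - w) = \<delta> w" using \<delta>_attained by blast
 have "(\<integral>\<^sup>+v\<in>ball w (\<delta> w). ennreal (\<bar>g v\<bar> powr p) \<partial>lborel) <= (\<integral>\<^sup>+v\<in>ball w (2 * \<delta> w). ennreal (\<bar>g v\<bar> powr p) \<partial>lborel)"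
  using \<delta>_pos[OF assms] by (intro nn_integral_mono) (auto simp: indicator_def)
 also have "... <= emeasure lborel (ball w (2 * \<delta> w))"
  using x \<delta>_pos[OF assms] by (intro average_le_1[of _ x]) (auto simp: dist_norm norm_minus_commute)
 also have "... = ennreal (unit_ball_vol DIM('a) * 2 ^ DIM('a) * \<delta> w ^ DIM('a))"
  by (simp add: emeasure_ball power_mult_distrib mult_ac)
 finally show ?thesis .
qed

text \<open>A substitute for Hoelder's inequality: |a| is either at most t or dominated by its p-th
  power. The height t remains free.\<close>

lemma abs_le_Young:
 fixes a t :: real
 assumes "0 < t"
 shows "\<bar>a\<bar> <= t + t powr (1 - p) * \<bar>a\<bar> powr p"
proof (cases "\<bar>a\<bar> <= t")
 case True
 then show ?thesis by (simp add: add_increasing2)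
next
 case False
 then have "t powr (p - 1) <= \<bar>a\<bar> powr (p - 1)"
  using assms p_gt_1 by (intro powr_mono2) auto
 then have "t powr (1 - p) * t powr (p - 1) * \<bar>a\<bar> <= t powr (1 - p) * \<bar>a\<bar> powr (p - 1) * \<bar>a\<bar>"
  by (intro mult_right_mono mult_left_mono) auto
 moreover have "t powr (1 - p) * t powr (p - 1) = 1" using assms by (simp flip: powr_add)
 moreover have "\<bar>a\<bar> powr (p - 1) * \<bar>a\<bar> = \<bar>a\<bar> powr p"
  using False assms powr_add[of "\<bar>a\<bar>" "p - 1" 1] by simp
 ultimately show ?thesis using assms by (simp add: mult.assoc)
qed

text \<open>The height t of \<open>abs_le_Young\<close> is left to the user: t = 1 serves for balls
  of radius \<delta> w, and a value depending on r / \<delta> w recovers the exponents of Hoelder's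
  inequality in \<open>hedberg\<close>.\<close>

lemma small_ball_integral:
 assumes "w \<in> \<Omega>" "0 < r" "r <= \<delta> w" "0 < t"
 shows "(\<integral>\<^sup>+v\<in>ball w r. ennreal \<bar>g v\<bar> \<partial>lborel) <= ennreal (unit_ball_vol DIM('a) * (t * r ^ DIM('a) + t powr (1 - p) * 2 ^ DIM('a) * \<delta> w ^ DIM('a)))"
proof -
 have [measurable]: "ball w r \<in> sets borel" by simp
 have "(\<integral>\<^sup>+v\<in>ball w r. ennreal \<bar>g v\<bar> \<partial>lborel) <= (NBINT v. ennreal t * indicator (ball w r) v + ennreal (t powr (1 - p)) * (ennreal (\<bar>g v\<bar> powr p) * indicator (ball w r) v))"
 proof (intro nn_integral_mono)
  fix v
  have "ennreal \<bar>g v\<bar> <= ennreal (t + t powr (1 - p) * \<bar>g v\<bar> powr p)"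
   using abs_le_Young[OF assms(4)] by (rule ennreal_leI)
  also have "... = ennreal t + ennreal (t powr (1 - p)) * ennreal (\<bar>g v\<bar> powr p)"
   using assms by (simp add: ennreal_mult)
  finally show "ennreal \<bar>g v\<bar> * indicator (ball w r) v <= ennreal t * indicator (ball w r) v + ennreal (t powr (1 - p)) * (ennreal (\<bar>g v\<bar> powr p) * indicator (ball w r) v)"
   by (simp add: indicator_def)
 qed
 also have "... = ennreal t * emeasure lborel (ball w r) + ennreal (t powr (1 - p)) * (\<integral>\<^sup>+v\<in>ball w r. ennreal (\<bar>g v\<bar> powr p) \<partial>lborel)"
  by (subst nn_integral_add, measurable) (simp add: nn_integral_cmult nn_integral_cmult_indicator)
 also have "... <= ennreal t * ennreal (unit_ball_vol DIM('a) * r ^ DIM('a)) + ennreal (t powr (1 - p)) * ennreal (unit_ball_vol DIM('a) * 2 ^ DIM('a) * \<delta> w ^ DIM('a))"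
 proof (intro add_mono mult_left_mono)
  show "emeasure lborel (ball w r) <= ennreal (unit_ball_vol (real DIM('a)) * r ^ DIM('a))"
   using assms by (simp add: emeasure_ball)
  show "(\<integral>\<^sup>+v\<in>ball w r. ennreal (\<bar>g v\<bar> powr p) \<partial>lborel) <= ennreal (unit_ball_vol DIM('a) * 2 ^ DIM('a) * \<delta> w ^ DIM('a))"
   by (rule order_trans[OF _ ball_integral_power[OF assms(1)]], intro nn_integral_mono) (use assms in \<open>auto simp: indicator_def\<close>)
 qed auto
 also have "... = ennreal (unit_ball_vol DIM('a) * (t * r ^ DIM('a) + t powr (1 - p) * 2 ^ DIM('a) * \<delta> w ^ DIM('a)))"
  using assms by (subst ennreal_mult_plus_mult) (auto simp: algebra_simps)
 finally show ?thesis .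
qed

text \<open>The normalised indicator of a ball. Its radius is a quarter of the distance to the
  complement, so that \<open>\<delta>\<close> varies by bounded factors on it
  (\<open>bump_comparable\<close>); this plays the part of Whitney cubes.\<close>

definition bump :: "'a => 'a => real" where
 "bump w v = (if w \<in> \<Omega> & norm (v - w) < \<delta> w / 4 then 4 ^ DIM('a) / (unit_ball_vol DIM('a) * \<delta> w ^ DIM('a)) else 0)"

lemma bump_measurable [measurable]: "(\<lambda>(w, v). bump w v) \<in> borel_measurable (borel \<Otimes>\<^sub>M borel)"
 unfolding bump_def by measurable

lemma bump_nonneg [simp]: "0 <= bump w v"
 by (simp add: bump_def)

lemma bump_le: "bump w v <= 4 ^ DIM('a) / (unit_ball_vol DIM('a) * \<delta> w ^ DIM('a))"
 by (simp add: bump_def)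

lemma bump_support: "bump w v ~= 0 ==> w \<in> \<Omega> & norm (v - w) < \<delta> w / 4"
 by (auto simp: bump_def split: if_splits)

lemma bump_integral:
 assumes "w \<in> \<Omega>"
 shows "(NBINT v. ennreal (bump w v)) = 1"
proof -
 have [measurable]: "ball w (\<delta> w / 4) \<in> sets borel" by simp
 have "(NBINT v. ennreal (bump w v)) = (NBINT v. ennreal (4 ^ DIM('a) / (unit_ball_vol DIM('a) * \<delta> w ^ DIM('a))) * indicator (ball w (\<delta> w / 4)) v)"
  using assms by (intro nn_integral_cong) (auto simp: bump_def indicator_def dist_norm norm_minus_commute)
 also have "... = ennreal (4 ^ DIM('a) / (unit_ball_vol DIM('a) * \<delta> w ^ DIM('a))) * emeasure lborel (ball w (\<delta> w / 4))"
  by (rule nn_integral_cmult_indicator) simp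
 also have "... = ennreal (4 ^ DIM('a) / (unit_ball_vol DIM('a) * \<delta> w ^ DIM('a)) * (unit_ball_vol DIM('a) * (\<delta> w / 4) ^ DIM('a)))"
  by (subst emeasure_ball, simp, intro ennreal_mult[symmetric]) auto
 also have "4 ^ DIM('a) / (unit_ball_vol DIM('a) * \<delta> w ^ DIM('a)) * (unit_ball_vol DIM('a) * (\<delta> w / 4) ^ DIM('a)) = 1"
 proof -
  have "unit_ball_vol (real DIM('a)) ~= 0" using unit_ball_vol_pos[of "real DIM('a)"] by linarith
  then show ?thesis using \<delta>_pos[OF assms] by (simp add: power_divide)
 qed
 finally show ?thesis by simp
qed

lemma bump_comparable:
 assumes "bump w v ~= 0"
 shows "v \<in> \<Omega>" "3 / 4 * \<delta> w <= \<delta> v" "\<delta> v <= 5 / 4 * \<delta> w" "norm (v - w) <= \<delta> v / 3"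
proof -
 have w: "w \<in> \<Omega>" "norm (v - w) < \<delta> w / 4" using bump_support[OF assms] by auto
 show "v \<in> \<Omega>" using w by (intro near_in_\<Omega>[of v w]) (use \<delta>_nonneg[of w] in linarith)
 show 1: "3 / 4 * \<delta> w <= \<delta> v" using \<delta>_triangle[of w v] w norm_minus_commute[of v w] by linarith
 show "\<delta> v <= 5 / 4 * \<delta> w" using \<delta>_triangle[of v w] w by linarith
 show "norm (v - w) <= \<delta> v / 3" using 1 w by linarith
qed

text \<open>Roles are exchanged: for fixed v, every w whose bump reaches v lies in the ball of
  radius \<delta> v about v and has \<delta> w comparable to \<delta> v. Hence the integral is an
  average of |g| over that ball, bounded by \<open>small_ball_integral\<close> with t = 1. The
  constant combines 5 ^ n, from comparing the two distances, with 1 + 2 ^ n <= 3 * 2 ^ n.\<close>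

lemma bump_average_bound:
 "(NBINT w. ennreal (\<bar>g w\<bar> * bump w v)) <= ennreal (3 * 10 ^ DIM('a)) * indicator \<Omega> v"
proof (cases "v \<in> \<Omega>")
 case False
 then have "bump w v = 0" for w using bump_comparable(1) by blast
 then show ?thesis by simp
next
 case True
 let ?\<omega> = "unit_ball_vol (real DIM('a))"
 let ?T = "?\<omega> * (1 * \<delta> v ^ DIM('a) + 1 powr (1 - p) * 2 ^ DIM('a) * \<delta> v ^ DIM('a))"
 have "0 < ?\<omega>" by simp
 have dv: "0 < \<delta> v" using \<delta>_pos True by blast
 have "(NBINT w. ennreal (\<bar>g w\<bar> * bump w v)) <= (NBINT w. ennreal (5 ^ DIM('a) / (?\<omega> * \<delta> v ^ DIM('a))) * (ennreal \<bar>g w\<bar> * indicator (ball v (\<delta> v)) w))"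
 proof (intro nn_integral_mono)
  fix w
  show "ennreal (\<bar>g w\<bar> * bump w v) <= ennreal (5 ^ DIM('a) / (?\<omega> * \<delta> v ^ DIM('a))) * (ennreal \<bar>g w\<bar> * indicator (ball v (\<delta> v)) w)"
  proof (cases "bump w v = 0")
   case False
   note c = bump_comparable[OF False]
   have "w \<in> ball v (\<delta> v)" using c(4) dv by (simp add: dist_norm)
   have w: "w \<in> \<Omega>" using bump_support[OF False] by blast
   have "(4 * \<delta> v) ^ DIM('a) <= (5 * \<delta> w) ^ DIM('a)" using c(3) dv by (intro power_mono) auto
   then have "4 ^ DIM('a) * \<delta> v ^ DIM('a) <= 5 ^ DIM('a) * \<delta> w ^ DIM('a)" by (simp add: power_mult_distrib)
   then have "4 ^ DIM('a) / (?\<omega> * \<delta> w ^ DIM('a)) <= 5 ^ DIM('a) / (?\<omega> * \<delta> v ^ DIM('a))"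
    using dv \<delta>_pos[OF w] \<open>0 < ?\<omega>\<close> by (simp add: field_simps)
   then have "bump w v <= 5 ^ DIM('a) / (?\<omega> * \<delta> v ^ DIM('a))"
    using bump_le[of w v] by linarith
   then have "\<bar>g w\<bar> * bump w v <= 5 ^ DIM('a) / (?\<omega> * \<delta> v ^ DIM('a)) * \<bar>g w\<bar>"
    by (subst mult.commute) (intro mult_right_mono, auto)
   then show ?thesis using \<open>w \<in> ball v (\<delta> v)\<close> dv \<open>0 < ?\<omega>\<close> by (simp add: ennreal_mult[symmetric] ennreal_leI)
  qed simp
 qed
 also have "... = ennreal (5 ^ DIM('a) / (?\<omega> * \<delta> v ^ DIM('a))) * (\<integral>\<^sup>+w\<in>ball v (\<delta> v). ennreal \<bar>g w\<bar> \<partial>lborel)"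
 proof (rule nn_integral_cmult)
  have [measurable]: "ball v (\<delta> v) \<in> sets borel" by simp
  show "(\<lambda>x. ennreal \<bar>g x\<bar> * indicator (ball v (\<delta> v)) x) \<in> borel_measurable lborel" by measurable
 qed
 also have "... <= ennreal (5 ^ DIM('a) / (?\<omega> * \<delta> v ^ DIM('a))) * ennreal ?T"
  using True dv by (intro mult_left_mono small_ball_integral) auto
 also have "... = ennreal (5 ^ DIM('a) / (?\<omega> * \<delta> v ^ DIM('a)) * ?T)"
  using dv by (intro ennreal_mult[symmetric]) auto
 also have "5 ^ DIM('a) / (?\<omega> * \<delta> v ^ DIM('a)) * ?T = 5 ^ DIM('a) * (1 + 2 ^ DIM('a))"
 proof -
  have gen: "a / (\<omega> * X) * (\<omega> * (1 * X + 1 * b * X)) = a * (1 + b)" if "\<omega> ~= 0" "X ~= 0" for a b \<omega> X :: real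
   using that by (simp add: field_simps)
  have "?\<omega> ~= 0" using unit_ball_vol_pos[of "real DIM('a)"] by linarith
  moreover have "\<delta> v ^ DIM('a) ~= 0" using dv by simp
  ultimately show ?thesis unfolding powr_one_eq_one by (rule gen)
 qed
 also have "... <= 3 * 10 ^ DIM('a)"
 proof -
  have "(1::real) <= 2 ^ DIM('a)" by simp
  then have "1 + 2 ^ DIM('a) <= 3 * (2 ^ DIM('a) :: real)" by linarith
  then have "5 ^ DIM('a) * (1 + 2 ^ DIM('a)) <= (5::real) ^ DIM('a) * (3 * 2 ^ DIM('a))"
   by (rule mult_left_mono) simp
  also have "... = 3 * 10 ^ DIM('a)" by (simp flip: power_mult_distrib)
  finally show ?thesis .
 qed
 finally show ?thesis using True by (simp add: ennreal_leI)
qed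

text \<open>Inserting the integral of \<open>bump w\<close>, which is 1, and exchanging the order of
  integration replaces |g| on \<open>\<Omega>\<close> by a constant, provided that \<phi> is
  dominated by \<phi>' across each bump.\<close>

lemma averaging:
 fixes \<phi> \<phi>' :: "'a => ennreal"
 assumes [measurable]: "\<phi> \<in> borel_measurable borel" "\<phi>' \<in> borel_measurable borel"
  and le: "!!w v. bump w v ~= 0 ==> \<phi> w <= \<phi>' v"
 shows "(\<integral>\<^sup>+w\<in>\<Omega>. ennreal \<bar>g w\<bar> * \<phi> w \<partial>lborel) <= ennreal (3 * 10 ^ DIM('a)) * (\<integral>\<^sup>+v\<in>\<Omega>. \<phi>' v \<partial>lborel)"
proof -
 have "(\<integral>\<^sup>+w\<in>\<Omega>. ennreal \<bar>g w\<bar> * \<phi> w \<partial>lborel) = (NBINT w. NBINT v. ennreal \<bar>g w\<bar> * \<phi> w * ennreal (bump w v))"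
 proof (intro nn_integral_cong)
  fix w
  show "ennreal \<bar>g w\<bar> * \<phi> w * indicator \<Omega> w = (NBINT v. ennreal \<bar>g w\<bar> * \<phi> w * ennreal (bump w v))"
  proof (cases "w \<in> \<Omega>")
   case True
   have "(NBINT v. ennreal \<bar>g w\<bar> * \<phi> w * ennreal (bump w v)) = ennreal \<bar>g w\<bar> * \<phi> w * (NBINT v. ennreal (bump w v))"
    by (rule nn_integral_cmult) measurable
   then show ?thesis using True by (simp add: bump_integral)
  next
   case False
   then have "bump w v = 0" for v by (simp add: bump_def)
   then show ?thesis using False by simp
  qed
 qed
 also have "... <= (NBINT w. NBINT v. \<phi>' v * ennreal (\<bar>g w\<bar> * bump w v))"
 proof (intro nn_integral_mono)
  fix w v
  show "ennreal \<bar>g w\<bar> * \<phi> w * ennreal (bump w v) <= \<phi>' v * ennreal (\<bar>g w\<bar> * bump w v)"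
  proof (cases "bump w v = 0")
   case False
   have "ennreal \<bar>g w\<bar> * \<phi> w * ennreal (bump w v) = \<phi> w * ennreal (\<bar>g w\<bar> * bump w v)"
    by (simp add: ennreal_mult mult_ac)
   also have "... <= \<phi>' v * ennreal (\<bar>g w\<bar> * bump w v)"
    by (intro mult_right_mono le False) auto
   finally show ?thesis .
  qed simp
 qed
 also have "... = (NBINT v. NBINT w. \<phi>' v * ennreal (\<bar>g w\<bar> * bump w v))"
  by (rule lborel_pair.Fubini'[symmetric]) measurable
 also have "... = (NBINT v. \<phi>' v * (NBINT w. ennreal (\<bar>g w\<bar> * bump w v)))"
  by (intro nn_integral_cong nn_integral_cmult) measurable
 also have "... <= (NBINT v. \<phi>' v * (ennreal (3 * 10 ^ DIM('a)) * indicator \<Omega> v))"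
  by (intro nn_integral_mono mult_left_mono bump_average_bound) auto
 also have "... = (NBINT v. ennreal (3 * 10 ^ DIM('a)) * (\<phi>' v * indicator \<Omega> v))"
  by (simp add: mult_ac)
 also have "... = ennreal (3 * 10 ^ DIM('a)) * (\<integral>\<^sup>+v\<in>\<Omega>. \<phi>' v \<partial>lborel)"
  by (rule nn_integral_cmult) measurable
 finally show ?thesis .
qed

lemma averaging_1:
 "(\<integral>\<^sup>+w\<in>\<Omega>. ennreal \<bar>g w\<bar> \<partial>lborel) <= ennreal (3 * 10 ^ DIM('a)) * emeasure lborel \<Omega>"
 using averaging[of "\<lambda>_. 1" "\<lambda>_. 1"] by simp

text \<open>Each point w spreads its own mass g w by \<open>bump w\<close>; this is not an average
  of \<open>g\<close> with a kernel centred at v. The potential of the difference then splits into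
  single terms, each with a cancelling kernel.\<close>

definition good :: "'a => real" where
 "good v = (if v \<in> \<Omega> then (LBINT w. g w * bump w v) else g v)"

lemma good_measurable [measurable]: "good \<in> borel_measurable borel"
 unfolding good_def[abs_def] by measurable

lemma good_le: "\<bar>good v\<bar> <= 3 * 10 ^ DIM('a)"
proof (cases "v \<in> \<Omega>")
 case True
 have "(NBINT w. ennreal (norm (g w * bump w v))) <= ennreal (3 * 10 ^ DIM('a))"
  using bump_average_bound[of v] True by (simp add: abs_mult)
 then have "norm (LBINT w. g w * bump w v) <= 3 * 10 ^ DIM('a)"
  by (rule norm_integral_le_real) simp
 then show ?thesis using True by (simp add: good_def)
next
 case False
 have "(1::real) <= 10 ^ DIM('a)" by simp
 then have "\<bar>g v\<bar> <= 3 * 10 ^ DIM('a)" using g_le_1[OF False] by linarith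
 then show ?thesis using False by (simp only: good_def if_False)
qed

text \<open>Off \<open>\<Omega>\<close>, |g| <= 1 makes the q-th power at most the p-th; on
  \<open>\<Omega>\<close> the function is bounded and the measure is finite.\<close>

lemma good_Lq:
 assumes "p <= q"
 shows "(NBINT v. ennreal (\<bar>good v\<bar> powr q)) <= (NBINT v. ennreal (\<bar>g v\<bar> powr p)) + ennreal ((3 * 10 ^ DIM('a)) powr q) * emeasure lborel \<Omega>"
proof -
 have "(NBINT v. ennreal (\<bar>good v\<bar> powr q)) <= (NBINT v. ennreal (\<bar>g v\<bar> powr p) + ennreal ((3 * 10 ^ DIM('a)) powr q) * indicator \<Omega> v)"
 proof (intro nn_integral_mono)
  fix v
  show "ennreal (\<bar>good v\<bar> powr q) <= ennreal (\<bar>g v\<bar> powr p) + ennreal ((3 * 10 ^ DIM('a)) powr q) * indicator \<Omega> v"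
  proof (cases "v \<in> \<Omega>")
   case True
   then show ?thesis using good_le[of v] assms p_gt_1
    by (auto intro!: add_increasing ennreal_leI powr_mono2)
  next
   case False
   have "\<bar>g v\<bar> powr q <= \<bar>g v\<bar> powr p"
    using g_le_1[OF False] assms by (intro powr_mono') auto
   then show ?thesis using False by (simp add: good_def ennreal_leI)
  qed
 qed
 also have "... = (NBINT v. ennreal (\<bar>g v\<bar> powr p)) + ennreal ((3 * 10 ^ DIM('a)) powr q) * emeasure lborel \<Omega>"
  by (subst nn_integral_add, measurable) (simp add: nn_integral_cmult_indicator)
 finally show ?thesis .
qed

end

section \<open>Contributions of the bad part near and away from the diagonal\<close>

lemma nn_integral_powr_to_inf_open:
 fixes e R :: real
 assumes "0 < e" "0 < R"
 shows "(NBINT r. ennreal (r powr (- e - 1)) * indicator {r. R < r} r) = ennreal (R powr (- e) / e)"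
proof -
 have "(NBINT r. ennreal (r powr (- e - 1)) * indicator {r. R < r} r) = (NBINT r. ennreal (r powr (- e - 1)) * indicator {R..} r)"
 proof (rule nn_integral_cong_AE)
  show "AE r in lborel. ennreal (r powr (- e - 1)) * indicator {r. R < r} r = ennreal (r powr (- e - 1)) * indicator {R..} r"
   using AE_lborel_singleton[of R] by eventually_elim (auto simp: indicator_def)
 qed
 then show ?thesis using nn_integral_powr_to_inf[OF assms] by simp
qed

lemma ennreal_mult3:
 assumes "0 <= a" "0 <= b" "0 <= c"
 shows "ennreal a * ennreal b * ennreal c = ennreal (a * b * c)"
 using assms by (simp add: ennreal_mult)

context calderon_zygmund
begin

text \<open>What remains of the bad part where the kernel has no cancellation: mass of
  \<open>g\<close> so close to z that only the size of the kernel is available.\<close>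

definition near :: "real => 'a => ennreal" where
 "near s z = (NBINT w. ennreal (\<bar>g w\<bar> * riesz s (z - w)) * indicator {w. norm (z - w) < \<delta> z} w)"

lemma near_measurable [measurable]: "near s \<in> borel_measurable borel"
 unfolding near_def[abs_def] by measurable

text \<open>The kernel is written as an integral over radii r of indicators of balls, which reduces
  the claim to the mass A r of |g| in balls about z. For small r the maximal bound m r^n is the
  better one (\<open>A1\<close>), for large r the bound from the p-th powers on the ball of radius
  \<delta> z (\<open>A2\<close>). Integrating both up to the radius where they balance gives the
  powers of \<delta> z and m.\<close>

lemma hedberg:
 fixes q s m :: real
 assumes "p < q" and s: "s = DIM('a) * (1 / p - 1 / q)" and z: "z \<in> \<Omega>" and "0 < m"
  and avg: "!!r. 0 < r ==> (\<integral>\<^sup>+w\<in>ball z r. ennreal \<bar>g w\<bar> \<partial>lborel) <= ennreal (m * (unit_ball_vol DIM('a) * r ^ DIM('a)))"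
 shows "near s z <= ennreal (DIM('a) * unit_ball_vol DIM('a) * (1 / s + (1 + 2 ^ DIM('a)) * q / DIM('a)) * (\<delta> z powr s * m powr (p / q)))"
proof -
 let ?n = "real DIM('a)" and ?\<omega> = "unit_ball_vol (real DIM('a))"
 have n: "0 < ?n" by simp
 have pq: "0 < p" "0 < q" "1 / q < 1 / p" using p_gt_1 assms(1) by (auto simp: field_simps)
 have s0: "0 < s" using pq n unfolding s by (intro mult_pos_pos) auto
 have nq: "?n / p - s = ?n / q" unfolding s by (simp add: algebra_simps)
 have "?n / p < ?n" using p_gt_1 n by (simp add: field_simps)
 moreover have "0 < ?n / q" using n pq by simp
 ultimately have sn: "s < ?n" using nq by linarith
 define d where "d = \<delta> z"
 let ?k = "?\<omega> * (1 + 2 ^ DIM('a)) * d powr (?n / p)"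
 let ?J = "\<lambda>r w. ennreal (r powr (- (?n - s) - 1)) * indicator {r. 0 < r} r * (ennreal \<bar>g w\<bar> * indicator {w. norm (z - w) < r & norm (z - w) < d} w)"
 have d: "0 < d" using \<delta>_pos[OF z] by (simp add: d_def)
 have "0 < ?\<omega>" by simp
 \<comment> \<open>The radius at which m r^n equals r^(n - n / p) d^(n / p), the powers in
   \<open>A1\<close> and \<open>A2\<close>.\<close>
 define \<rho> where "\<rho> = d * m powr (- p / ?n)"
 have "0 < \<rho>" using d \<open>0 < m\<close> by (simp add: \<rho>_def)
 define A where "A r = (NBINT w. ennreal \<bar>g w\<bar> * indicator {w. norm (z - w) < r & norm (z - w) < d} w)" for r
 have A_eq: "A r = (\<integral>\<^sup>+w\<in>ball z (min r d). ennreal \<bar>g w\<bar> \<partial>lborel)" for r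
  unfolding A_def by (intro nn_integral_cong) (auto simp: indicator_def dist_norm)
 have A1: "A r <= ennreal (m * ?\<omega> * r ^ DIM('a))" if "0 < r" for r
 proof -
  have "A r <= ennreal (m * (?\<omega> * (min r d) ^ DIM('a)))"
   unfolding A_eq using that d by (intro avg) auto
  also have "... <= ennreal (m * ?\<omega> * r ^ DIM('a))"
   using that d \<open>0 < m\<close> by (intro ennreal_leI) (auto simp: mult.assoc intro!: mult_left_mono power_mono)
  finally show ?thesis .
 qed
 have A2: "A r <= ennreal (?\<omega> * (1 + 2 ^ DIM('a)) * (r powr (?n - ?n / p) * d powr (?n / p)))" if "0 < r" for r
 proof -
  \<comment> \<open>The truncation to norm (z - w) < d makes A r the mass of a ball of radius at
    most d, as \<open>small_ball_integral\<close> requires.\<close>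
  define r' where "r' = min r d"
  have r': "0 < r'" "r' <= d" "r' <= r" using that d by (auto simp: r'_def)
  \<comment> \<open>This height makes the two terms of \<open>small_ball_integral\<close> equal up
    to the factor 2 ^ n; see \<open>e1\<close> and \<open>e2\<close>.\<close>
  define t where "t = (d / r') powr (?n / p)"
  have t: "0 < t" using r' d by (simp add: t_def)
  have e1: "t * r' ^ DIM('a) = r' powr (?n - ?n / p) * d powr (?n / p)"
   using r' d by (simp add: t_def powr_divide powr_realpow[symmetric] powr_diff field_simps)
  have e2: "t powr (1 - p) * d ^ DIM('a) = r' powr (?n - ?n / p) * d powr (?n / p)"
  proof -
   have "t powr (1 - p) = (d / r') powr (?n / p - ?n)"
    unfolding t_def powr_powr using pq by (simp add: field_simps)
   also have "... = d powr (?n / p - ?n) * r' powr (?n - ?n / p)"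
    using r' d by (simp add: powr_divide powr_diff field_simps)
   finally have "t powr (1 - p) * d ^ DIM('a) = r' powr (?n - ?n / p) * (d powr (?n / p - ?n) * d powr ?n)"
    using d by (simp add: powr_realpow[symmetric])
   also have "d powr (?n / p - ?n) * d powr ?n = d powr (?n / p)" by (simp flip: powr_add)
   finally show ?thesis .
  qed
  have "A r <= ennreal (?\<omega> * (t * r' ^ DIM('a) + t powr (1 - p) * 2 ^ DIM('a) * d ^ DIM('a)))"
  proof -
   have "(\<integral>\<^sup>+w\<in>ball z r'. ennreal \<bar>g w\<bar> \<partial>lborel) <= ennreal (?\<omega> * (t * r' ^ DIM('a) + t powr (1 - p) * 2 ^ DIM('a) * \<delta> z ^ DIM('a)))"
    using r' z t by (intro small_ball_integral) (auto simp: d_def)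
   then show ?thesis by (simp only: A_eq r'_def d_def)
  qed
  also have "t * r' ^ DIM('a) + t powr (1 - p) * 2 ^ DIM('a) * d ^ DIM('a) = (1 + 2 ^ DIM('a)) * (r' powr (?n - ?n / p) * d powr (?n / p))"
   using e1 e2 by (simp add: algebra_simps)
  also have "?\<omega> * ((1 + 2 ^ DIM('a)) * (r' powr (?n - ?n / p) * d powr (?n / p))) <= ?\<omega> * ((1 + 2 ^ DIM('a)) * (r powr (?n - ?n / p) * d powr (?n / p)))"
   using r' \<open>?n / p < ?n\<close> by (intro mult_left_mono mult_right_mono powr_mono2) auto
  finally show ?thesis by (simp add: mult.assoc ennreal_leI)
 qed
 let ?c = "ennreal (?n - s)"
 \<comment> \<open>The integral of r^(- (n - s) - 1) over r > |z - w| is the Riesz kernel divided by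
   n - s. The point w = z has to be left out.\<close>
 have "near s z <= (NBINT w. NBINT r. ?c * (?J r w))"
  unfolding near_def
 proof (rule nn_integral_mono_AE)
  show "AE w in lborel. ennreal (\<bar>g w\<bar> * riesz s (z - w)) * indicator {w. norm (z - w) < \<delta> z} w
   <= (NBINT r. ?c * (?J r w))"
   using AE_lborel_singleton[of z]
  proof eventually_elim
   case (elim w)
   have R: "0 < norm (z - w)" using elim by simp
   have "(NBINT r. ?c * (?J r w))
    = (NBINT r. (?c * (ennreal \<bar>g w\<bar> * indicator {w. norm (z - w) < \<delta> z} w)) * (ennreal (r powr (- (?n - s) - 1)) * indicator {r. norm (z - w) < r} r))"
    using R by (intro nn_integral_cong) (auto simp: indicator_def d_def mult_ac dest: le_less_trans[OF norm_ge_zero])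
   also have "... = (?c * (ennreal \<bar>g w\<bar> * indicator {w. norm (z - w) < \<delta> z} w)) * (NBINT r. ennreal (r powr (- (?n - s) - 1)) * indicator {r. norm (z - w) < r} r)"
    by (rule nn_integral_cmult) measurable
   also have "(NBINT r. ennreal (r powr (- (?n - s) - 1)) * indicator {r. norm (z - w) < r} r) = ennreal (norm (z - w) powr (- (?n - s)) / (?n - s))"
    using R sn by (intro nn_integral_powr_to_inf_open) auto
   also have "(?c * (ennreal \<bar>g w\<bar> * indicator {w. norm (z - w) < \<delta> z} w)) * ennreal (norm (z - w) powr (- (?n - s)) / (?n - s))
    = ennreal (\<bar>g w\<bar> * riesz s (z - w)) * indicator {w. norm (z - w) < \<delta> z} w"
   proof -
    have "?c * ennreal \<bar>g w\<bar> * ennreal (norm (z - w) powr (- (?n - s)) / (?n - s)) = ennreal ((?n - s) * \<bar>g w\<bar> * (norm (z - w) powr (- (?n - s)) / (?n - s)))"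
     using sn by (simp add: ennreal_mult[symmetric])
    also have "(?n - s) * \<bar>g w\<bar> * (norm (z - w) powr (- (?n - s)) / (?n - s)) = \<bar>g w\<bar> * riesz s (z - w)"
     using sn by (simp add: riesz_def)
    finally show ?thesis by (simp add: indicator_def)
   qed
   finally show ?case by simp
  qed
 qed
 also have "... = (NBINT r. NBINT w. ?c * (?J r w))"
  by (rule lborel_pair.Fubini'[symmetric]) measurable
 also have "... = (NBINT r. ?c * (ennreal (r powr (- (?n - s) - 1)) * indicator {r. 0 < r} r) * A r)"
  unfolding A_def by (intro nn_integral_cong) (simp add: nn_integral_cmult mult.assoc)
 also have "... <= (NBINT r. ennreal ((?n - s) * (m * ?\<omega>)) * (ennreal (r powr (s - 1)) * indicator {0<..<\<rho>} r)
   + ennreal ((?n - s) * ?k) * (ennreal (r powr (- (?n / q) - 1)) * indicator {\<rho>..} r))"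
 proof (rule nn_integral_mono)
  fix r :: real
  show "?c * (ennreal (r powr (- (?n - s) - 1)) * indicator {r. 0 < r} r) * A r <= ennreal ((?n - s) * (m * ?\<omega>)) * (ennreal (r powr (s - 1)) * indicator {0<..<\<rho>} r)
   + ennreal ((?n - s) * ?k) * (ennreal (r powr (- (?n / q) - 1)) * indicator {\<rho>..} r)"
  proof (cases "0 < r")
   case True
   show ?thesis
   proof (cases "r < \<rho>")
    case less: True
    have "?c * (ennreal (r powr (- (?n - s) - 1)) * indicator {r. 0 < r} r) * A r <= ?c * ennreal (r powr (- (?n - s) - 1)) * ennreal (m * ?\<omega> * r ^ DIM('a))"
     using True A1[OF True] by (auto intro!: mult_left_mono)
    also have "... = ennreal ((?n - s) * r powr (- (?n - s) - 1) * (m * ?\<omega> * r ^ DIM('a)))"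
     using sn \<open>0 < m\<close> True by (intro ennreal_mult3) auto
    also have "(?n - s) * r powr (- (?n - s) - 1) * (m * ?\<omega> * r ^ DIM('a)) = (?n - s) * (m * ?\<omega>) * (r powr (- (?n - s) - 1) * r powr ?n)"
     using True by (simp add: powr_realpow)
    also have "r powr (- (?n - s) - 1) * r powr ?n = r powr (s - 1)" by (simp flip: powr_add)
    also have "ennreal ((?n - s) * (m * ?\<omega>) * r powr (s - 1)) = ennreal ((?n - s) * (m * ?\<omega>)) * ennreal (r powr (s - 1))"
     using sn \<open>0 < m\<close> by (intro ennreal_mult) auto
    finally show ?thesis using True less by simp
   next
    case False
    have "?c * (ennreal (r powr (- (?n - s) - 1)) * indicator {r. 0 < r} r) * A r <= ?c * ennreal (r powr (- (?n - s) - 1)) * ennreal (?\<omega> * (1 + 2 ^ DIM('a)) * (r powr (?n - ?n / p) * d powr (?n / p)))"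
     using True A2[OF True] by (auto intro!: mult_left_mono)
    also have "... = ennreal ((?n - s) * r powr (- (?n - s) - 1) * (?\<omega> * (1 + 2 ^ DIM('a)) * (r powr (?n - ?n / p) * d powr (?n / p))))"
     using sn by (intro ennreal_mult3) auto
    also have "(?n - s) * r powr (- (?n - s) - 1) * (?\<omega> * (1 + 2 ^ DIM('a)) * (r powr (?n - ?n / p) * d powr (?n / p)))
     = (?n - s) * ?k * (r powr (- (?n - s) - 1) * r powr (?n - ?n / p))"
     by (simp only: mult_ac)
    also have "r powr (- (?n - s) - 1) * r powr (?n - ?n / p) = r powr (- (?n / q) - 1)"
     unfolding powr_add[symmetric] nq[symmetric] by (simp add: algebra_simps)
    also have "ennreal ((?n - s) * ?k * r powr (- (?n / q) - 1)) = ennreal ((?n - s) * ?k) * ennreal (r powr (- (?n / q) - 1))"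
     using sn by (intro ennreal_mult) auto
    finally show ?thesis using True False by simp
   qed
  qed simp
 qed
 also have "... = ennreal ((?n - s) * (m * ?\<omega>)) * ennreal (\<rho> powr s / s) + ennreal ((?n - s) * ?k) * ennreal (\<rho> powr (- (?n / q)) / (?n / q))"
  using nn_integral_powr_from_0[OF s0, of \<rho>] nn_integral_powr_to_inf[of "?n / q" \<rho>] \<open>0 < \<rho>\<close> \<open>0 < ?n / q\<close>
  by (subst nn_integral_add, measurable) (simp add: nn_integral_cmult)
 also have "... = ennreal ((?n - s) * (m * ?\<omega>) * (\<rho> powr s / s) + (?n - s) * ?k * (\<rho> powr (- (?n / q)) / (?n / q)))"
  using sn \<open>0 < m\<close> s0 pq n by (intro ennreal_mult_plus_mult) auto
 also have "(?n - s) * (m * ?\<omega>) * (\<rho> powr s / s) + (?n - s) * ?k * (\<rho> powr (- (?n / q)) / (?n / q))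
  = (?n - s) * (?\<omega> * (1 / s + (1 + 2 ^ DIM('a)) * q / ?n) * (d powr s * m powr (p / q)))"
 proof -
  have ps: "p / ?n * s = 1 - p / q" using pq n unfolding s by (simp add: field_simps)
  have "- p / ?n * s + 1 = p / q" using ps by simp
  then have r1: "m * \<rho> powr s = d powr s * m powr (p / q)"
   using \<open>0 < m\<close> d powr_add[of m "- p / ?n * s" 1] by (simp add: \<rho>_def powr_mult powr_powr mult_ac)
  have "- p / ?n * (- (?n / q)) = p / q" using n pq by (simp add: field_simps)
  moreover have "d powr (?n / p) * d powr (- (?n / q)) = d powr s"
   unfolding powr_add[symmetric] using nq by (simp add: algebra_simps)
  ultimately have r2: "d powr (?n / p) * \<rho> powr (- (?n / q)) = d powr s * m powr (p / q)"
   using \<open>0 < m\<close> d by (simp only: \<rho>_def powr_mult powr_powr mult.assoc[symmetric] powr_ge_zero less_imp_le)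
  have "(?n - s) * (m * ?\<omega>) * (\<rho> powr s / s) + (?n - s) * ?k * (\<rho> powr (- (?n / q)) / (?n / q))
   = (?n - s) * ?\<omega> * (1 / s) * (m * \<rho> powr s) + (?n - s) * ?\<omega> * ((1 + 2 ^ DIM('a)) * q / ?n) * (d powr (?n / p) * \<rho> powr (- (?n / q)))"
   by (simp add: field_simps)
  also have "... = (?n - s) * (?\<omega> * (1 / s + (1 + 2 ^ DIM('a)) * q / ?n) * (d powr s * m powr (p / q)))"
   unfolding r1 r2 by (simp only: distrib_left distrib_right mult_ac)
  finally show ?thesis .
 qed
 also have "... <= ?n * (?\<omega> * (1 / s + (1 + 2 ^ DIM('a)) * q / ?n) * (d powr s * m powr (p / q)))"
  using s0 sn pq by (intro mult_right_mono mult_nonneg_nonneg add_nonneg_nonneg) auto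
 finally show ?thesis by (simp only: d_def mult.assoc ennreal_leI)
qed

text \<open>The q-th power of Hedberg's inequality with m the value of the maximal function at z. An
  infinite m is trivial; for m = 0, which \<open>hedberg\<close> excludes, \<open>g\<close> vanishes
  almost everywhere near z.\<close>

lemma near_power:
 fixes q s :: real
 assumes "p < q" and s: "s = DIM('a) * (1 / p - 1 / q)"
 defines "C \<equiv> DIM('a) * unit_ball_vol DIM('a) * (1 / s + (1 + 2 ^ DIM('a)) * q / DIM('a))"
 assumes z: "z \<in> \<Omega>"
 shows "epow (near s z) q <= ennreal (C powr q * \<delta> z powr (s * q)) * epow (maximal (\<lambda>w. ennreal \<bar>g w\<bar>) z) p"
proof -
 have pq: "0 < p" "0 < q" "1 / q < 1 / p" using p_gt_1 assms(1) by (auto simp: field_simps)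
 have s0: "0 < s" using pq unfolding s by (intro mult_pos_pos) auto
 have "unit_ball_vol (real DIM('a)) > 0" by simp
 then have "0 < C" unfolding C_def using s0 pq by (intro mult_pos_pos add_pos_pos divide_pos_pos) (auto simp: add_pos_pos)
 have d: "0 < \<delta> z" using \<delta>_pos[OF z] .
 show ?thesis
 proof (cases "maximal (\<lambda>w. ennreal \<bar>g w\<bar>) z")
  case top
  then show ?thesis using \<open>0 < C\<close> d by (simp add: epow_def ennreal_mult_top)
 next
  case (real m)
  have avg: "(\<integral>\<^sup>+w\<in>ball z r. ennreal \<bar>g w\<bar> \<partial>lborel) <= ennreal (m * (unit_ball_vol DIM('a) * r ^ DIM('a)))" if "0 < r" for r
   using average_le_maximal[of r z z "\<lambda>w. ennreal \<bar>g w\<bar>"] that real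
   by (simp add: emeasure_ball ennreal_mult)
  show ?thesis
  proof (cases "m = 0")
   case True
   have "(\<integral>\<^sup>+w\<in>ball z (\<delta> z). ennreal \<bar>g w\<bar> \<partial>lborel) = 0"
    using avg[OF d] True by simp
   moreover have [measurable]: "ball z (\<delta> z) \<in> sets borel" by simp
   ultimately have "AE w in lborel. ennreal \<bar>g w\<bar> * indicator (ball z (\<delta> z)) w = 0"
    by (subst (asm) nn_integral_0_iff_AE) auto
   then have "near s z = (\<integral>\<^sup>+w. 0 \<partial>(lborel :: 'a measure))"
    unfolding near_def by (intro nn_integral_cong_AE) (auto simp: indicator_def dist_norm elim!: eventually_mono split: if_splits)
   then have "near s z = ennreal 0" by simp
   then show ?thesis by (simp only: epow_ennreal order_refl) simp
  next
   case False
   then have "0 < m" using real by simp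
   have "near s z <= ennreal (C * (\<delta> z powr s * m powr (p / q)))"
    unfolding C_def by (rule hedberg[OF assms(1) s z \<open>0 < m\<close> avg])
   then obtain N where N: "near s z = ennreal N" "0 <= N" "N <= C * (\<delta> z powr s * m powr (p / q))"
    using \<open>0 < C\<close> by (cases "near s z") (auto simp: top_unique)
   have "N powr q <= (C * (\<delta> z powr s * m powr (p / q))) powr q"
    using N pq by (intro powr_mono2) auto
   also have "... = C powr q * \<delta> z powr (s * q) * m powr p"
    using \<open>0 < C\<close> d \<open>0 < m\<close> pq by (simp add: powr_mult powr_powr)
   finally have "ennreal (N powr q) <= ennreal (C powr q * \<delta> z powr (s * q) * m powr p)"
    by (rule ennreal_leI)
   then show ?thesis using N real by (simp add: ennreal_mult)
  qed
 qed
qed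

text \<open>The remaining part of the bad kernel, from w at distance at least \<delta> w / 2, where
  cancellation supplies the factor min t (\<delta> w) and one more power of decay. The parameter t
  stands for the distance of the two points being compared.\<close>

definition far :: "real => 'a => real => ennreal" where
 "far s z t = (NBINT w. ennreal \<bar>g w\<bar> * ennreal (min t (\<delta> w) * norm (z - w) powr (s - DIM('a) - 1) * indicator {w. \<delta> w / 2 <= norm (z - w)} w) * indicator \<Omega> w)"

lemma far_measurable [measurable]: "(\<lambda>(z, t). far s z t) \<in> borel_measurable (borel \<Otimes>\<^sub>M borel)"
 unfolding far_def by measurable

text \<open>After \<open>averaging\<close> has removed |g|, a pure power integral is left. The
  factor linear in the distance makes it converge near z, the extra decay makes it converge at
  infinity, and cutting at distance t gives t^s on both sides.\<close>

lemma far_le: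
 fixes s t :: real
 assumes s: "0 < s" "s < 1" and "0 < t"
 shows "far s z t <= ennreal (3 * 10 ^ DIM('a) * ((2 / 3) powr (s - DIM('a) - 1) * (4 * sph TYPE('a) / s + sph TYPE('a) / (1 - s))) * t powr s)"
proof -
 let ?n = "real DIM('a)" and ?c = "sph TYPE('a)"
 define B where "B = (2 / 3) powr (s - ?n - 1)"
 \<comment> \<open>The majorant across a bump: on the support of the indicator, \<delta> w <= 2 |z -
   w| <= 4 |z - v|, and |z - v| <= 3 / 2 |z - w| yields the constant B.\<close>
 define \<phi>' where "\<phi>' v = ennreal (B * (min t (4 * norm (z - v)) * norm (z - v) powr (s - ?n - 1)))" for v
 have "0 <= B" by (simp add: B_def)
 have n1: "1 <= ?n" by (rule DIM_ge_1)
 have "far s z t <= ennreal (3 * 10 ^ DIM('a)) * (\<integral>\<^sup>+v\<in>\<Omega>. \<phi>' v \<partial>lborel)"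
  unfolding far_def
 proof (rule averaging)
  show "\<phi>' \<in> borel_measurable borel" unfolding \<phi>'_def[abs_def] by measurable
  fix w v assume b: "bump w v ~= 0"
  have vw: "norm (v - w) < \<delta> w / 4" and w: "w \<in> \<Omega>" using bump_support[OF b] by auto
  show "ennreal (min t (\<delta> w) * norm (z - w) powr (s - ?n - 1) * indicator {w. \<delta> w / 2 <= norm (z - w)} w) <= \<phi>' v"
  proof (cases "\<delta> w / 2 <= norm (z - w)")
   case True
   have "norm (z - w) <= norm (z - v) + norm (v - w)" using norm_triangle_ineq[of "z - v" "v - w"] by simp
   moreover have "norm (z - v) <= norm (z - w) + norm (v - w)"
    using norm_triangle_ineq[of "z - w" "w - v"] by (simp add: norm_minus_commute[of w v])
   ultimately have zv: "norm (z - w) <= 2 * norm (z - v)" "norm (z - v) <= 3 / 2 * norm (z - w)" using vw True by linarith+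
   have "0 < \<delta> w" using \<delta>_pos[OF w] .
   then have pos: "0 < norm (z - w)" "0 < norm (z - v)" using True zv by linarith+
   have "norm (z - w) powr (s - ?n - 1) <= (2 / 3 * norm (z - v)) powr (s - ?n - 1)"
    using zv pos s n1 by (intro powr_mono2') auto
   also have "... = B * norm (z - v) powr (s - ?n - 1)"
    using powr_mult[of "2/3" "norm (z - v)" "s - ?n - 1"] by (simp add: B_def)
   finally have 1: "norm (z - w) powr (s - ?n - 1) <= B * norm (z - v) powr (s - ?n - 1)" .
   have 2: "min t (\<delta> w) <= min t (4 * norm (z - v))" using True zv by linarith
   have "min t (\<delta> w) * norm (z - w) powr (s - ?n - 1) <= min t (4 * norm (z - v)) * (B * norm (z - v) powr (s - ?n - 1))"
    using 1 2 \<open>0 < t\<close> by (intro mult_mono) auto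
   then show ?thesis using True by (simp add: \<phi>'_def mult_ac ennreal_leI)
  qed simp
 qed measurable
 also have "... <= ennreal (3 * 10 ^ DIM('a)) * (NBINT v. ennreal (4 * B) * (ennreal (norm (z - v) powr (s - ?n)) * indicator {v. norm (z - v) < t} v)
   + ennreal (B * t) * (ennreal (norm (z - v) powr (- (1 - s) - ?n)) * indicator {v. t <= norm (z - v)} v))"
 proof (intro mult_left_mono nn_integral_mono)
  fix v
  have le: "\<phi>' v * indicator \<Omega> v <= \<phi>' v" by (simp add: indicator_def)
  show "\<phi>' v * indicator \<Omega> v <= ennreal (4 * B) * (ennreal (norm (z - v) powr (s - ?n)) * indicator {v. norm (z - v) < t} v)
   + ennreal (B * t) * (ennreal (norm (z - v) powr (- (1 - s) - ?n)) * indicator {v. t <= norm (z - v)} v)"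
  proof (cases "norm (z - v) < t")
   case True
   have "norm (z - v) * norm (z - v) powr (s - ?n - 1) = norm (z - v) powr (s - ?n)"
    using powr_add[of "norm (z - v)" 1 "s - ?n - 1"] by (cases "z = v") auto
   moreover have "min t (4 * norm (z - v)) * norm (z - v) powr (s - ?n - 1) <= 4 * norm (z - v) * norm (z - v) powr (s - ?n - 1)"
    by (intro mult_right_mono) auto
   ultimately have "B * (min t (4 * norm (z - v)) * norm (z - v) powr (s - ?n - 1)) <= 4 * B * norm (z - v) powr (s - ?n)"
    using \<open>0 <= B\<close> mult_left_mono[of "min t (4 * norm (z - v)) * norm (z - v) powr (s - ?n - 1)" "4 * norm (z - v) powr (s - ?n)" B] by (simp add: mult_ac)
   then have *: "\<phi>' v <= ennreal (4 * B) * ennreal (norm (z - v) powr (s - ?n))"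
    using \<open>0 <= B\<close> unfolding \<phi>'_def by (subst ennreal_mult[symmetric]) (auto intro: ennreal_leI)
   then show ?thesis using True order_trans[OF le *] by simp
  next
   case False
   have "min t (4 * norm (z - v)) * norm (z - v) powr (s - ?n - 1) <= t * norm (z - v) powr (- (1 - s) - ?n)"
    by (intro mult_mono) (auto simp: \<open>0 < t\<close> less_imp_le algebra_simps)
   then have "B * (min t (4 * norm (z - v)) * norm (z - v) powr (s - ?n - 1)) <= B * t * norm (z - v) powr (- (1 - s) - ?n)"
    using \<open>0 <= B\<close> unfolding mult.assoc by (rule mult_left_mono)
   then have *: "\<phi>' v <= ennreal (B * t) * ennreal (norm (z - v) powr (- (1 - s) - ?n))"
    using \<open>0 <= B\<close> \<open>0 < t\<close> unfolding \<phi>'_def by (subst ennreal_mult[symmetric]) (auto intro: ennreal_leI)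
   then show ?thesis using False order_trans[OF le *] by simp
  qed
 qed auto
 also have "(NBINT v. ennreal (4 * B) * (ennreal (norm (z - v) powr (s - ?n)) * indicator {v. norm (z - v) < t} v)
   + ennreal (B * t) * (ennreal (norm (z - v) powr (- (1 - s) - ?n)) * indicator {v. t <= norm (z - v)} v))
  = ennreal (4 * B) * ennreal (?c / s * t powr s) + ennreal (B * t) * ennreal (?c / (1 - s) * t powr (- (1 - s)))"
  using nn_integral_ball_powr[of s t z] nn_integral_outside_powr[of "1 - s" t z] s \<open>0 < t\<close>
  by (subst nn_integral_add, measurable) (simp add: nn_integral_cmult)
 also have "... = ennreal (4 * B * (?c / s * t powr s) + B * t * (?c / (1 - s) * t powr (- (1 - s))))"
  using \<open>0 <= B\<close> \<open>0 < t\<close> s by (intro ennreal_mult_plus_mult) auto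
 also have "4 * B * (?c / s * t powr s) + B * t * (?c / (1 - s) * t powr (- (1 - s))) = B * (4 * ?c / s + ?c / (1 - s)) * t powr s"
 proof -
  have t: "t * t powr (- (1 - s)) = t powr s" using powr_add[of t 1 "- (1 - s)"] \<open>0 < t\<close> by simp
  have "B * t * (?c / (1 - s) * t powr (- (1 - s))) = B * (?c / (1 - s)) * (t * t powr (- (1 - s)))" by (simp only: mult_ac)
  then show ?thesis unfolding t by (simp add: algebra_simps)
 qed
 also have "ennreal (3 * 10 ^ DIM('a)) * ennreal (B * (4 * ?c / s + ?c / (1 - s)) * t powr s) = ennreal (3 * 10 ^ DIM('a) * (B * (4 * ?c / s + ?c / (1 - s)) * t powr s))"
  using \<open>0 <= B\<close> s by (intro ennreal_mult[symmetric]) auto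
 finally show ?thesis by (simp only: B_def mult.assoc)
qed

text \<open>For fixed w the integrals in z and in y separate. They are multiples of \<delta> w to
  the powers - (1 - s) and 1 - s, which cancel; what remains is the integral of |g| over
  \<open>\<Omega>\<close>, controlled by \<open>averaging_1\<close>.\<close>

lemma far_integral:
 fixes s :: real
 assumes s: "0 < s" "s < 1"
 shows "(NBINT z. \<integral>\<^sup>+y. far s z (norm y) * ennreal (norm y powr (- s - DIM('a))) \<partial>(lborel::'a measure))
  <= ennreal (2 powr (1 - s) * (sph TYPE('a) / (1 - s)) * (sph TYPE('a) / (1 - s) + sph TYPE('a) / s) * (3 * 10 ^ DIM('a))) * emeasure lborel \<Omega>"
proof -
 let ?n = "real DIM('a)" and ?c = "sph TYPE('a)"
 let ?K = "2 powr (1 - s) * (?c / (1 - s)) * (?c / (1 - s) + ?c / s)"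
 let ?k = "\<lambda>w z::'a. ennreal (norm (w - z) powr (- (1 - s) - ?n)) * indicator {z. \<delta> w / 2 <= norm (w - z)} z"
 let ?h = "\<lambda>w y::'a. ennreal (min (norm y) (\<delta> w) * norm y powr (- s - ?n))"
 have K: "(NBINT z. ?k w z) = ennreal (?c / (1 - s) * (\<delta> w / 2) powr (- (1 - s)))" if "w \<in> \<Omega>" for w
  using s \<delta>_pos[OF that] by (intro nn_integral_outside_powr) auto
 have H: "(NBINT y. ?h w y) <= ennreal ((?c / (1 - s) + ?c / s) * \<delta> w powr (1 - s))" if w: "w \<in> \<Omega>" for w
 proof -
  have d: "0 < \<delta> w" using \<delta>_pos[OF w] .
  have "(NBINT y. ?h w y) <= (\<integral>\<^sup>+y. ennreal (norm (0 - y) powr ((1 - s) - ?n)) * indicator {y. norm (0 - y) < \<delta> w} y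
   + ennreal (\<delta> w) * (ennreal (norm (0 - y) powr (- s - ?n)) * indicator {y. \<delta> w <= norm (0 - y)} y) \<partial>(lborel::'a measure))"
  proof (rule nn_integral_mono)
   fix y :: 'a
   have "norm y * norm y powr (- s - ?n) = norm y powr ((1 - s) - ?n)"
    using powr_add[of "norm y" 1 "- s - ?n"] by (cases "y = 0") (auto simp: algebra_simps)
   then show "?h w y <= ennreal (norm (0 - y) powr ((1 - s) - ?n)) * indicator {y. norm (0 - y) < \<delta> w} y
   + ennreal (\<delta> w) * (ennreal (norm (0 - y) powr (- s - ?n)) * indicator {y. \<delta> w <= norm (0 - y)} y)"
    using d by (cases "norm y < \<delta> w") (auto simp: ennreal_mult[symmetric] min_def)
  qed
  also have "... = ennreal (?c / (1 - s) * \<delta> w powr (1 - s)) + ennreal (\<delta> w) * ennreal (?c / s * \<delta> w powr (- s))"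
   using nn_integral_ball_powr[of "1 - s" "\<delta> w" "0::'a"] nn_integral_outside_powr[of s "\<delta> w" "0::'a"] s d
   by (subst nn_integral_add, measurable) (simp add: nn_integral_cmult)
  also have "... = ennreal (?c / (1 - s) * \<delta> w powr (1 - s) + ?c / s * (\<delta> w * \<delta> w powr (- s)))"
   using s d by (simp add: ennreal_mult[symmetric] mult_ac flip: ennreal_plus)
  also have "\<delta> w * \<delta> w powr (- s) = \<delta> w powr (1 - s)" using powr_add[of "\<delta> w" 1 "- s"] d by simp
  finally show ?thesis by (simp add: algebra_simps)
 qed
 have "(NBINT z. \<integral>\<^sup>+y. far s z (norm y) * ennreal (norm y powr (- s - ?n)) \<partial>(lborel::'a measure))
  = (NBINT z. NBINT y. NBINT w. ennreal \<bar>g w\<bar> * indicator \<Omega> w * (?k w z * ?h w y))"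
 proof (intro nn_integral_cong)
  fix z y :: 'a
  have "far s z (norm y) * ennreal (norm y powr (- s - ?n)) = (NBINT w. (ennreal \<bar>g w\<bar> * ennreal (min (norm y) (\<delta> w) * norm (z - w) powr (s - ?n - 1) * indicator {w. \<delta> w / 2 <= norm (z - w)} w) * indicator \<Omega> w) * ennreal (norm y powr (- s - ?n)))"
   unfolding far_def by (rule nn_integral_multc[symmetric]) measurable
  also have "... = (NBINT w. ennreal \<bar>g w\<bar> * indicator \<Omega> w * (?k w z * ?h w y))"
  proof (rule nn_integral_cong)
   fix w
   have e: "s - ?n - 1 = - (1 - s) - ?n" by simp
   show "(ennreal \<bar>g w\<bar> * ennreal (min (norm y) (\<delta> w) * norm (z - w) powr (s - ?n - 1) * indicator {w. \<delta> w / 2 <= norm (z - w)} w) * indicator \<Omega> w) * ennreal (norm y powr (- s - ?n))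
    = ennreal \<bar>g w\<bar> * indicator \<Omega> w * (?k w z * ?h w y)"
    unfolding e norm_minus_commute[of z w]
    by (cases "\<delta> w / 2 <= norm (w - z)") (auto simp: ennreal_mult mult_ac min_def indicator_def norm_minus_commute[of z w])
  qed
  finally show "far s z (norm y) * ennreal (norm y powr (- s - ?n)) = (NBINT w. ennreal \<bar>g w\<bar> * indicator \<Omega> w * (?k w z * ?h w y))" .
 qed
 also have "... = (NBINT z. NBINT w. NBINT y. ennreal \<bar>g w\<bar> * indicator \<Omega> w * (?k w z * ?h w y))"
  by (intro nn_integral_cong lborel_pair.Fubini') measurable
 also have "... = (NBINT w. NBINT z. NBINT y. ennreal \<bar>g w\<bar> * indicator \<Omega> w * (?k w z * ?h w y))"
  by (rule lborel_pair.Fubini'[symmetric]) measurable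
 also have "... = (NBINT w. ennreal \<bar>g w\<bar> * indicator \<Omega> w * ((NBINT z. ?k w z) * (NBINT y. ?h w y)))"
 proof (rule nn_integral_cong)
  fix w
  let ?a = "ennreal \<bar>g w\<bar> * indicator \<Omega> w"
  let ?H = "NBINT y. ?h w y"
  have "(NBINT y. ?a * (?k w z * ?h w y)) = ?a * ?H * ?k w z" for z
  proof -
   have "(NBINT y. ?a * (?k w z * ?h w y)) = (NBINT y. (?a * ?k w z) * ?h w y)"
    by (simp only: mult.assoc)
   also have "... = (?a * ?k w z) * ?H" by (rule nn_integral_cmult) measurable
   finally show ?thesis by (simp only: mult_ac)
  qed
  then have "(NBINT z. NBINT y. ?a * (?k w z * ?h w y)) = (NBINT z. ?a * ?H * ?k w z)"
   by (simp only:)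
  also have "... = ?a * ?H * (NBINT z. ?k w z)" by (rule nn_integral_cmult) measurable
  finally show "(NBINT z. NBINT y. ?a * (?k w z * ?h w y)) = ?a * ((NBINT z. ?k w z) * ?H)"
   by (simp only: mult_ac)
 qed
 also have "... <= (NBINT w. ennreal ?K * (ennreal \<bar>g w\<bar> * indicator \<Omega> w))"
 proof (rule nn_integral_mono)
  fix w
  show "ennreal \<bar>g w\<bar> * indicator \<Omega> w * ((NBINT z. ?k w z) * (NBINT y. ?h w y))
   <= ennreal ?K * (ennreal \<bar>g w\<bar> * indicator \<Omega> w)"
  proof (cases "w \<in> \<Omega>")
   case True
   have d: "0 < \<delta> w" using \<delta>_pos[OF True] .
   have "(NBINT z. ?k w z) * (NBINT y. ?h w y) <= ennreal (?c / (1 - s) * (\<delta> w / 2) powr (- (1 - s))) * ennreal ((?c / (1 - s) + ?c / s) * \<delta> w powr (1 - s))"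
    unfolding K[OF True] by (intro mult_left_mono H True) auto
   also have "... = ennreal (?c / (1 - s) * (\<delta> w / 2) powr (- (1 - s)) * ((?c / (1 - s) + ?c / s) * \<delta> w powr (1 - s)))"
    using s by (intro ennreal_mult[symmetric]) auto
   also have "?c / (1 - s) * (\<delta> w / 2) powr (- (1 - s)) * ((?c / (1 - s) + ?c / s) * \<delta> w powr (1 - s))
    = 2 powr (1 - s) * (?c / (1 - s)) * (?c / (1 - s) + ?c / s)"
   proof -
    have "(\<delta> w / 2) powr (- (1 - s)) * \<delta> w powr (1 - s) = 2 powr (1 - s)"
     using d by (simp only: powr_minus) (simp add: powr_divide)
    moreover have "a * x * (b * y) = X * a * b" if "x * y = X" for a b x y X :: real
     using that by (simp add: mult_ac flip: that)
    ultimately show ?thesis by blast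
   qed
   finally show ?thesis using True by (subst mult.commute) (auto intro: mult_right_mono)
  qed simp
 qed
 also have "... = ennreal ?K * (\<integral>\<^sup>+w\<in>\<Omega>. ennreal \<bar>g w\<bar> \<partial>lborel)"
  by (rule nn_integral_cmult) measurable
 also have "... <= ennreal ?K * (ennreal (3 * 10 ^ DIM('a)) * emeasure lborel \<Omega>)"
  by (intro mult_left_mono averaging_1) auto
 also have "... = ennreal (2 powr (1 - s) * (?c / (1 - s)) * (?c / (1 - s) + ?c / s) * (3 * 10 ^ DIM('a))) * emeasure lborel \<Omega>"
 proof -
  have "ennreal (2 powr (1 - s) * (?c / (1 - s)) * (?c / (1 - s) + ?c / s) * (3 * 10 ^ DIM('a))) = ennreal ?K * ennreal (3 * 10 ^ DIM('a))"
   using s by (intro ennreal_mult) auto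
  then show ?thesis by (simp only: mult.assoc)
 qed
 finally show ?thesis .
qed

end

section \<open>Convergence of Riesz potentials and choice of the exceptional set\<close>

lemma Young_mult_le:
 fixes a b p :: real
 assumes "0 <= a" "0 <= b" "1 < p"
 shows "a * b <= a powr p + b powr (p / (p - 1))"
proof (cases "a = 0 \<or> b = 0")
 case False
 then have ab: "0 < a" "0 < b" using assms by auto
 show ?thesis
 proof (cases "b <= a powr (p - 1)")
  case True
  then have "a * b <= a * a powr (p - 1)" using ab by (intro mult_left_mono) auto
  also have "... = a powr p" using powr_add[of a 1 "p - 1"] ab by simp
  finally show ?thesis by (simp add: add_increasing2)
 next
  case False
  then have "(a powr (p - 1)) powr (1 / (p - 1)) <= b powr (1 / (p - 1))"
   using assms by (intro powr_mono2) auto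
  then have "a <= b powr (1 / (p - 1))" using assms ab by (simp add: powr_powr)
  then have "a * b <= b powr (1 / (p - 1)) * b" using ab by (intro mult_right_mono) auto
  also have "... = b powr (1 / (p - 1) + 1)" using ab by (simp add: powr_add)
  also have "1 / (p - 1) + 1 = p / (p - 1)" using assms by (simp add: field_simps)
  finally show ?thesis by (simp add: add_increasing)
 qed
qed auto

text \<open>\<open>riesz_pot\<close> is a Bochner integral with default value 0 where it does not
  converge; finiteness of \<open>riesz_abs\<close> singles out the points where it is
  meaningful.\<close>

definition riesz_abs :: "real => ('a::euclidean_space => real) => 'a => ennreal" where
 "riesz_abs s g x = (NBINT w. ennreal (riesz s (x - w) * \<bar>g w\<bar>))"

definition riesz_pot :: "real => ('a::euclidean_space => real) => 'a => real" where
 "riesz_pot s g x = (LBINT w. riesz s (x - w) * g w)"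

lemma riesz_abs_measurable [measurable]:
 assumes [measurable]: "g \<in> borel_measurable borel"
 shows "riesz_abs s g \<in> borel_measurable borel"
 unfolding riesz_abs_def[abs_def] by measurable

lemma riesz_pot_measurable [measurable]:
 assumes [measurable]: "g \<in> borel_measurable borel"
 shows "riesz_pot s g \<in> borel_measurable borel"
 unfolding riesz_pot_def[abs_def] by measurable

lemma riesz_integrable:
 fixes g :: "'a::euclidean_space => real"
 assumes [measurable]: "g \<in> borel_measurable borel" and "riesz_abs s g x < \<infinity>"
 shows "integrable lborel (\<lambda>w. riesz s (x - w) * g w)"
proof (rule integrableI_bounded)
 show "(NBINT w. ennreal (norm (riesz s (x - w) * g w))) < \<infinity>"
  using assms(2) by (simp add: riesz_abs_def abs_mult)
qed measurable

text \<open>Near x, |g| <= 1 + |g|^p and the truncated kernel is integrable, so Tonelli bounds the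
  integral in x of the singular term \<open>V\<close>. Away from x, Young's inequality separates
  |g|^p from the kernel to the conjugate power, which is integrable at infinity since s < n /
  p.\<close>

lemma riesz_abs_AE_finite:
 fixes g :: "'a::euclidean_space => real" and p s :: real
 assumes "1 < p" "0 < s" "s < DIM('a) / p" and [measurable]: "g \<in> borel_measurable borel"
  and I: "(NBINT w. ennreal (\<bar>g w\<bar> powr p)) < \<infinity>"
 shows "AE x in lborel. riesz_abs s g x < \<infinity>"
proof -
 let ?n = "real DIM('a)"
 let ?I = "NBINT w. ennreal (\<bar>g w\<bar> powr p)"
 \<comment> \<open>The excess of the decay exponent of the kernel, raised to the conjugate exponent
   of p, over the critical value n.\<close>
 define e where "e = (?n - s) * (p / (p - 1)) - ?n"
 have "s * p < ?n" using assms by (simp add: field_simps)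
 then have "0 < e" using assms by (simp add: e_def field_simps)
 let ?k = "\<lambda>x w::'a. ennreal (norm (x - w) powr (s - ?n)) * indicator {w. norm (x - w) < 1} w"
 define V where "V x = (NBINT w. ?k x w * ennreal (\<bar>g w\<bar> powr p))" for x
 have [measurable]: "V \<in> borel_measurable borel" unfolding V_def[abs_def] by measurable
 have "(NBINT x. V x) = (NBINT w. NBINT x. ?k w x * ennreal (\<bar>g w\<bar> powr p))"
  unfolding V_def by (subst lborel_pair.Fubini'[symmetric], measurable) (intro nn_integral_cong, simp add: norm_minus_commute indicator_def)
 also have "... = (NBINT w. ennreal (sph TYPE('a) / s) * ennreal (\<bar>g w\<bar> powr p))"
 proof (rule nn_integral_cong)
  fix w
  have "(NBINT x. ?k w x * ennreal (\<bar>g w\<bar> powr p)) = (NBINT x. ?k w x) * ennreal (\<bar>g w\<bar> powr p)"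
   by (rule nn_integral_multc) measurable
  then show "(NBINT x. ?k w x * ennreal (\<bar>g w\<bar> powr p)) = ennreal (sph TYPE('a) / s) * ennreal (\<bar>g w\<bar> powr p)"
   using nn_integral_ball_powr[of s 1 w] assms by simp
 qed
 also have "... = ennreal (sph TYPE('a) / s) * ?I" by (rule nn_integral_cmult) measurable
 also have "... < \<infinity>" using I by (simp add: ennreal_mult_less_top)
 finally have "AE x in lborel. V x ~= \<infinity>" by (intro nn_integral_PInf_AE) auto
 then show ?thesis
 proof eventually_elim
  case (elim x)
  let ?f = "\<lambda>w::'a. ennreal (norm (x - w) powr (- e - ?n)) * indicator {w. 1 <= norm (x - w)} w"
  have "riesz_abs s g x <= (NBINT w. ?k x w + ?k x w * ennreal (\<bar>g w\<bar> powr p) + ennreal (\<bar>g w\<bar> powr p) + ?f w)"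
   unfolding riesz_abs_def
  proof (rule nn_integral_mono)
   fix w
   show "ennreal (riesz s (x - w) * \<bar>g w\<bar>) <= ?k x w + ?k x w * ennreal (\<bar>g w\<bar> powr p) + ennreal (\<bar>g w\<bar> powr p) + ?f w"
   proof (cases "norm (x - w) < 1")
    case True
    have "\<bar>g w\<bar> <= 1 + \<bar>g w\<bar> powr p"
    proof (cases "\<bar>g w\<bar> <= 1")
     case False
     then have "\<bar>g w\<bar> powr 1 <= \<bar>g w\<bar> powr p" using assms by (intro powr_mono) auto
     then show ?thesis by simp
    qed (simp add: add_increasing2)
    then have "riesz s (x - w) * \<bar>g w\<bar> <= riesz s (x - w) * (1 + \<bar>g w\<bar> powr p)"
     by (intro mult_left_mono) auto
    then have "ennreal (riesz s (x - w) * \<bar>g w\<bar>) <= ennreal (riesz s (x - w)) + ennreal (riesz s (x - w)) * ennreal (\<bar>g w\<bar> powr p)"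
     by (simp add: distrib_left flip: ennreal_mult ennreal_plus)
    then show ?thesis using True by (auto simp: riesz_def intro: order_trans)
   next
    case False
    have "\<bar>g w\<bar> * riesz s (x - w) <= \<bar>g w\<bar> powr p + riesz s (x - w) powr (p / (p - 1))"
     using assms by (intro Young_mult_le) auto
    moreover have "riesz s (x - w) powr (p / (p - 1)) = norm (x - w) powr (- e - ?n)"
    proof -
     have "(s - ?n) * k = - ((?n - s) * k - ?n) - ?n" for k :: real by (simp add: algebra_simps)
     then show ?thesis unfolding riesz_def powr_powr e_def by (simp only:)
    qed
    ultimately have "riesz s (x - w) * \<bar>g w\<bar> <= \<bar>g w\<bar> powr p + norm (x - w) powr (- e - ?n)"
     by (simp add: mult.commute)
    then have "ennreal (riesz s (x - w) * \<bar>g w\<bar>) <= ennreal (\<bar>g w\<bar> powr p) + ennreal (norm (x - w) powr (- e - ?n))"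
     by (simp flip: ennreal_plus)
    then show ?thesis using False by simp
   qed
  qed
  also have "... = (NBINT w. ?k x w) + V x + ?I + (NBINT w. ?f w)"
   unfolding V_def by (simp add: nn_integral_add)
  also have "... < \<infinity>"
   using nn_integral_ball_powr[of s 1 x] nn_integral_outside_powr[of e 1 x] assms \<open>0 < e\<close> elim I by (simp add: less_top)
  finally show ?case .
 qed
qed

text \<open>The bound |g| <= 1 must hold at every point of the complement, not just almost
  everywhere. Instead of differentiating integrals, an open neighbourhood U of {|g| > 1} is
  adjoined; outer regularity makes this cost at most \<eta> beyond Chebyshev's bound.\<close>

lemma calderon_zygmund_exists:
 fixes g :: "'a::euclidean_space => real" and p \<eta> :: real
 assumes "1 < p" and [measurable]: "g \<in> borel_measurable borel" and "0 < \<eta>"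
  and I: "(NBINT w. ennreal (\<bar>g w\<bar> powr p)) < \<infinity>"
 shows "\<exists>\<Omega>. calderon_zygmund p g \<Omega> & emeasure lborel \<Omega> <= ennreal (5 ^ DIM('a) + 1) * (NBINT w. ennreal (\<bar>g w\<bar> powr p)) + ennreal \<eta>"
proof -
 let ?I = "NBINT w. ennreal (\<bar>g w\<bar> powr p)"
 let ?\<gamma> = "\<lambda>w. ennreal (\<bar>g w\<bar> powr p)"
 define A where "A = {w. 1 < \<bar>g w\<bar>}"
 have A[measurable]: "A \<in> sets borel" unfolding A_def by measurable
 obtain U where U: "open U" "A \<subseteq> U" "emeasure lborel (U - A) < ennreal \<eta>"
  using outer_regular_lborel[OF A \<open>0 < \<eta>\<close>] by blast
 define M where "M = {z. ennreal 1 < maximal ?\<gamma> z}"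
 have M: "open M" unfolding M_def by (rule open_maximal_superlevel)
 have [measurable]: "U \<in> sets borel" "M \<in> sets borel" using U(1) M by auto
 have "emeasure lborel A = (NBINT w. indicator A w)" by simp
 also have "... <= ?I"
  using \<open>1 < p\<close> by (intro nn_integral_mono) (auto simp: indicator_def A_def ge_one_powr_ge_zero)
 finally have eA: "emeasure lborel A <= ?I" .
 have eM: "emeasure lborel M <= ennreal (5 ^ DIM('a) / 1) * ?I"
  unfolding M_def by (rule maximal_weak_type) auto
 have "emeasure lborel (M \<union> U) <= emeasure lborel M + emeasure lborel U" by (rule emeasure_subadditive) auto
 also have "emeasure lborel U <= emeasure lborel A + emeasure lborel (U - A)"
  using emeasure_subadditive[of A lborel "U - A"] U(2) by (simp add: Un_absorb1)
 also have "emeasure lborel M + (emeasure lborel A + emeasure lborel (U - A)) <= ennreal (5 ^ DIM('a) / 1) * ?I + (?I + ennreal \<eta>)"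
  using eA eM U(3) by (intro add_mono) auto
 also have "... = ennreal (5 ^ DIM('a) + 1) * ?I + ennreal \<eta>"
  by (simp add: distrib_right add.assoc)
 finally have e: "emeasure lborel (M \<union> U) <= ennreal (5 ^ DIM('a) + 1) * ?I + ennreal \<eta>"
  by (simp add: add_left_mono)
 have "calderon_zygmund p g (M \<union> U)"
 proof
  show "1 < p" "g \<in> borel_measurable borel" by fact+
  show "open (M \<union> U)" using M U by auto
  show "emeasure lborel (M \<union> U) < \<infinity>"
   by (rule le_less_trans[OF e]) (use I in \<open>simp add: ennreal_mult_less_top\<close>)
  show "(\<integral>\<^sup>+w\<in>ball c r. ?\<gamma> w \<partial>lborel) <= emeasure lborel (ball c r)" if "0 < r" "x \<notin> M \<union> U" "x \<in> ball c r" for c r x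
  proof -
   have "maximal ?\<gamma> x <= 1" using that(2) by (auto simp: M_def not_less)
   have "(\<integral>\<^sup>+w\<in>ball c r. ?\<gamma> w \<partial>lborel) <= maximal ?\<gamma> x * emeasure lborel (ball c r)"
    by (rule average_le_maximal[OF that(1,3)])
   also have "... <= 1 * emeasure lborel (ball c r)"
    using \<open>maximal ?\<gamma> x <= 1\<close> by (intro mult_right_mono) auto
   finally show ?thesis by simp
  qed
  show "\<bar>g w\<bar> <= 1" if "w \<notin> M \<union> U" for w
  proof (rule ccontr)
   assume "\<not> \<bar>g w\<bar> <= 1"
   then have "w \<in> A" by (simp add: A_def)
   then show False using U(2) that by blast
  qed
 qed
 with e show ?thesis by blast
qed

lemma epow_mono: "x <= y ==> 0 <= q ==> epow x q <= epow y q"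
 by (cases x; cases y) (auto simp: epow_def top_unique intro!: ennreal_leI powr_mono2)

lemma epow_measurable [measurable]: "(\<lambda>x. epow x q) \<in> borel_measurable borel"
 unfolding epow_def by measurable

lemma epow_cmult:
 assumes "0 < C" "0 <= q"
 shows "epow (ennreal C * x) q = ennreal (C powr q) * epow x q"
proof (cases x)
 case (real t)
 then show ?thesis using assms by (simp add: ennreal_mult[symmetric] powr_mult)
next
 case top
 then show ?thesis using assms by (simp add: epow_def ennreal_mult_top)
qed

lemma epow_add_le:
 assumes "0 <= q"
 shows "epow (a + b) q <= ennreal (2 powr q) * (epow a q + epow b q)"
proof -
 have "a + b <= ennreal 2 * max a b"
 proof -
  have "a + b <= max a b + max a b" by (intro add_mono) auto
  also have "... = (1 + 1) * max a b" by (simp only: distrib_right mult_1)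
  also have "(1 + 1 :: ennreal) = ennreal 2" by simp
  finally show ?thesis .
 qed
 then have "epow (a + b) q <= epow (ennreal 2 * max a b) q"
  using assms by (rule epow_mono)
 also have "... = ennreal (2 powr q) * epow (max a b) q"
  using assms by (intro epow_cmult) auto
 also have "... <= ennreal (2 powr q) * (epow a q + epow b q)"
  by (intro mult_left_mono) (auto simp: max_def)
 finally show ?thesis .
qed

section \<open>Pointwise decomposition of the increment of a Riesz potential\<close>

context calderon_zygmund
begin

lemma riesz_abs_\<Omega>_finite:
 fixes s :: real
 assumes "0 < s" "s < DIM('a)"
 shows "(NBINT v. ennreal (riesz s (z - v)) * indicator \<Omega> v) < \<infinity>"
proof -
 have "(NBINT v. ennreal (riesz s (z - v)) * indicator \<Omega> v) <= (NBINT v. ennreal (norm (z - v) powr (s - DIM('a))) * indicator {v. norm (z - v) < 1} v + indicator \<Omega> v)"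
 proof (rule nn_integral_mono)
  fix v
  show "ennreal (riesz s (z - v)) * indicator \<Omega> v <= ennreal (norm (z - v) powr (s - DIM('a))) * indicator {v. norm (z - v) < 1} v + indicator \<Omega> v"
  proof (cases "norm (z - v) < 1")
   case False
   then have "norm (z - v) powr (s - DIM('a)) <= 1 powr (s - DIM('a))"
    using assms by (intro powr_mono2') auto
   then show ?thesis using False by (simp add: riesz_def indicator_def)
  qed (simp add: riesz_def indicator_def)
 qed
 also have "... = ennreal (sph TYPE('a) / s * 1 powr s) + emeasure lborel \<Omega>"
  using nn_integral_ball_powr[of s 1 z] assms by (simp add: nn_integral_add)
 also have "... < \<infinity>" using \<Omega>_finite by simp
 finally show ?thesis .
qed

lemma riesz_abs_good_finite:
 fixes s :: real
 assumes "0 < s" "s < DIM('a)" and fin: "riesz_abs s g z < \<infinity>"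
 shows "riesz_abs s good z < \<infinity>"
proof -
 have "riesz_abs s good z <= (NBINT v. ennreal (riesz s (z - v) * \<bar>g v\<bar>) + ennreal (3 * 10 ^ DIM('a)) * (ennreal (riesz s (z - v)) * indicator \<Omega> v))"
  unfolding riesz_abs_def
 proof (rule nn_integral_mono)
  fix v
  show "ennreal (riesz s (z - v) * \<bar>good v\<bar>) <= ennreal (riesz s (z - v) * \<bar>g v\<bar>) + ennreal (3 * 10 ^ DIM('a)) * (ennreal (riesz s (z - v)) * indicator \<Omega> v)"
  proof (cases "v \<in> \<Omega>")
   case True
   have "riesz s (z - v) * \<bar>good v\<bar> <= riesz s (z - v) * (3 * 10 ^ DIM('a))"
    by (intro mult_left_mono good_le) auto
   then have "ennreal (riesz s (z - v) * \<bar>good v\<bar>) <= ennreal (3 * 10 ^ DIM('a)) * ennreal (riesz s (z - v))"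
    by (subst ennreal_mult[symmetric]) (auto simp: mult.commute intro: ennreal_leI)
   then show ?thesis using True by (simp add: add_increasing)
  qed (simp add: good_def)
 qed
 also have "... = riesz_abs s g z + ennreal (3 * 10 ^ DIM('a)) * (NBINT v. ennreal (riesz s (z - v)) * indicator \<Omega> v)"
  unfolding riesz_abs_def by (subst nn_integral_add, measurable) (subst nn_integral_cmult, measurable)
 also have "... < \<infinity>"
  using fin riesz_abs_\<Omega>_finite[OF assms(1,2), of z] by (simp add: ennreal_mult_less_top)
 finally show ?thesis .
qed

definition bad_kernel :: "real => 'a => 'a => real" where
 "bad_kernel s w z = riesz s (z - w) - (LBINT v. riesz s (z - v) * bump w v)"

text \<open>Off \<open>\<Omega>\<close> the two densities coincide. On \<open>\<Omega>\<close>,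
  Fubini turns the potential of \<open>good\<close> into an integral over the sources w of g w times
  the spread kernel; its absolute convergence comes from \<open>bump_average_bound\<close> and the
  finite measure of \<open>\<Omega>\<close>.\<close>

lemma riesz_pot_bad:
 fixes s :: real
 assumes s: "0 < s" "s < DIM('a)" and fin: "riesz_abs s g z < \<infinity>"
 shows "riesz_pot s g z - riesz_pot s good z = (LBINT w. indicator \<Omega> w * g w * bad_kernel s w z)"
  and "integrable lborel (\<lambda>w. indicator \<Omega> w * g w * bad_kernel s w z)"
proof -
 have ig: "integrable lborel (\<lambda>w. riesz s (z - w) * g w)"
  by (rule riesz_integrable[OF _ fin]) simp
 have igood: "integrable lborel (\<lambda>w. riesz s (z - w) * good w)"
  by (rule riesz_integrable[OF _ riesz_abs_good_finite[OF s fin]]) simp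
 have \<Omega>g: "integrable lborel (\<lambda>w. indicator \<Omega> w * (riesz s (z - w) * u w))" if "integrable lborel (\<lambda>w. riesz s (z - w) * u w)" for u
  using integrable_mult_indicator[OF _ that, of \<Omega>] by simp
 have F: "(NBINT v. NBINT w. ennreal (norm (riesz s (z - v) * (g w * bump w v)))) < \<infinity>"
 proof -
  have "(NBINT v. NBINT w. ennreal (norm (riesz s (z - v) * (g w * bump w v))))
   = (NBINT v. ennreal (riesz s (z - v)) * (NBINT w. ennreal (\<bar>g w\<bar> * bump w v)))"
   by (intro nn_integral_cong, subst nn_integral_cmult[symmetric]) (auto simp: abs_mult ennreal_mult intro!: nn_integral_cong)
  also have "... <= (NBINT v. ennreal (riesz s (z - v)) * (ennreal (3 * 10 ^ DIM('a)) * indicator \<Omega> v))"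
   by (intro nn_integral_mono mult_left_mono bump_average_bound) auto
  also have "... = (NBINT v. ennreal (3 * 10 ^ DIM('a)) * (ennreal (riesz s (z - v)) * indicator \<Omega> v))"
   by (simp only: mult_ac)
  also have "... = ennreal (3 * 10 ^ DIM('a)) * (NBINT v. ennreal (riesz s (z - v)) * indicator \<Omega> v)"
   by (rule nn_integral_cmult) measurable
  also have "... < \<infinity>" using riesz_abs_\<Omega>_finite[OF s, of z] by (simp add: ennreal_mult_less_top)
  finally show ?thesis .
 qed
 have Fm: "(\<lambda>(v, w). riesz s (z - v) * (g w * bump w v)) \<in> borel_measurable (lborel \<Otimes>\<^sub>M lborel)" by measurable
 note fub = Fubini_nn[OF lborel.sigma_finite_measure_axioms lborel.sigma_finite_measure_axioms Fm F]
 have b0: "bump w v = 0" if "w \<notin> \<Omega> \<or> v \<notin> \<Omega>" for w v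
  using that bump_support[of w v] bump_comparable(1)[of w v] by blast
 have inner: "(LBINT v. riesz s (z - v) * (g w * bump w v)) = indicator \<Omega> w * g w * (LBINT v. riesz s (z - v) * bump w v)" for w
 proof (cases "w \<in> \<Omega>")
  case True
  have "(LBINT v. riesz s (z - v) * (g w * bump w v)) = (LBINT v. g w * (riesz s (z - v) * bump w v))"
   by (simp only: mult_ac)
  also have "... = g w * (LBINT v. riesz s (z - v) * bump w v)" by simp
  finally show ?thesis using True by simp
 next
  case False
  then show ?thesis using b0[of w] by simp
 qed
 have avi: "integrable lborel (\<lambda>w. indicator \<Omega> w * g w * (LBINT v. riesz s (z - v) * bump w v))"
  using fub(2) unfolding inner .
 have av: "(LBINT w. indicator \<Omega> w * g w * (LBINT v. riesz s (z - v) * bump w v)) = (LBINT v. indicator \<Omega> v * (riesz s (z - v) * good v))"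
 proof -
  have "(LBINT w. indicator \<Omega> w * g w * (LBINT v. riesz s (z - v) * bump w v)) = (LBINT v. LBINT w. riesz s (z - v) * (g w * bump w v))"
   using fub(1) unfolding inner by simp
  also have "... = (LBINT v. indicator \<Omega> v * (riesz s (z - v) * good v))"
   by (intro Bochner_Integration.integral_cong refl) (auto simp: good_def b0 indicator_def)
  finally show ?thesis .
 qed
 have split: "(LBINT w. riesz s (z - w) * u w) = (LBINT w. indicator \<Omega> w * (riesz s (z - w) * u w)) + (LBINT w. indicator (- \<Omega>) w * (riesz s (z - w) * u w))"
  if "integrable lborel (\<lambda>w. riesz s (z - w) * u w)" for u
 proof -
  have "integrable lborel (\<lambda>w. indicator (- \<Omega>) w * (riesz s (z - w) * u w))"
   using integrable_mult_indicator[OF _ that, of "- \<Omega>"] by simp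
  then have "(LBINT w. indicator \<Omega> w * (riesz s (z - w) * u w) + indicator (- \<Omega>) w * (riesz s (z - w) * u w))
   = (LBINT w. indicator \<Omega> w * (riesz s (z - w) * u w)) + (LBINT w. indicator (- \<Omega>) w * (riesz s (z - w) * u w))"
   by (intro Bochner_Integration.integral_add \<Omega>g that)
  moreover have "(\<lambda>w. indicator \<Omega> w * (riesz s (z - w) * u w) + indicator (- \<Omega>) w * (riesz s (z - w) * u w)) = (\<lambda>w. riesz s (z - w) * u w)"
   by (auto simp: indicator_def)
  ultimately show ?thesis by simp
 qed
 have out: "(LBINT w. indicator (- \<Omega>) w * (riesz s (z - w) * good w)) = (LBINT w. indicator (- \<Omega>) w * (riesz s (z - w) * g w))"
  by (intro Bochner_Integration.integral_cong refl) (auto simp: indicator_def good_def)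
 have eq: "indicator \<Omega> w * g w * bad_kernel s w z = indicator \<Omega> w * (riesz s (z - w) * g w) - indicator \<Omega> w * g w * (LBINT v. riesz s (z - v) * bump w v)" for w
  by (simp add: bad_kernel_def algebra_simps)
 show "integrable lborel (\<lambda>w. indicator \<Omega> w * g w * bad_kernel s w z)"
  unfolding eq by (intro Bochner_Integration.integrable_diff \<Omega>g ig avi)
 have "(LBINT w. indicator \<Omega> w * g w * bad_kernel s w z) = (LBINT w. indicator \<Omega> w * (riesz s (z - w) * g w)) - (LBINT v. indicator \<Omega> v * (riesz s (z - v) * good v))"
  unfolding eq av[symmetric] by (intro Bochner_Integration.integral_diff \<Omega>g ig avi)
 then show "riesz_pot s g z - riesz_pot s good z = (LBINT w. indicator \<Omega> w * g w * bad_kernel s w z)"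
  unfolding riesz_pot_def split[OF ig] split[OF igood] out by simp
qed

text \<open>The base point x lies off \<open>\<Omega>\<close>, so \<delta> w <= |x - w| for every
  source w, and \<open>cancellation_const\<close> applies with u = \<open>bump w\<close>. Almost
  every w differs from z, as it also requires.\<close>

lemma riesz_pot_decomposition:
 fixes s :: real
 assumes s: "0 < s" "s < 1" and C: "cancellation_const TYPE('a) s C" "0 < C"
  and x: "x \<notin> \<Omega>" and fin: "riesz_abs s g x < \<infinity>" "riesz_abs s g z < \<infinity>"
 shows "ennreal \<bar>riesz_pot s g z - riesz_pot s g x\<bar> <= ennreal \<bar>(LBINT w. riesz_diff s (z - x) (x - w) * good w)\<bar>
  + ennreal C * (indicator \<Omega> z * near s z + (far s z (norm (z - x)) + far s x (norm (z - x))))"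
proof -
 let ?J = "\<lambda>z w. ennreal (\<bar>g w\<bar> * riesz s (z - w)) * indicator {w. norm (z - w) < \<delta> z} w"
 have sn: "s < DIM('a)" using s DIM_ge_1[where 'a='a] by linarith
 have gz: "integrable lborel (\<lambda>w. riesz s (z - w) * good w)" and gx: "integrable lborel (\<lambda>w. riesz s (x - w) * good w)"
  using riesz_integrable[OF good_measurable riesz_abs_good_finite[OF s(1) sn fin(2)]] riesz_integrable[OF good_measurable riesz_abs_good_finite[OF s(1) sn fin(1)]] by auto
 have good: "riesz_pot s good z - riesz_pot s good x = (LBINT w. riesz_diff s (z - x) (x - w) * good w)"
  unfolding riesz_pot_def Bochner_Integration.integral_diff[OF gz gx, symmetric]
  by (intro Bochner_Integration.integral_cong) (auto simp: riesz_diff_def algebra_simps)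
 note bz = riesz_pot_bad[OF s(1) sn fin(2)] and bx = riesz_pot_bad[OF s(1) sn fin(1)]
 let ?B = "LBINT w. indicator \<Omega> w * g w * bad_kernel s w z - indicator \<Omega> w * g w * bad_kernel s w x"
 have "riesz_pot s g z - riesz_pot s g x = (LBINT w. riesz_diff s (z - x) (x - w) * good w) + ?B"
  unfolding good[symmetric] Bochner_Integration.integral_diff[OF bz(2) bx(2)] bz(1)[symmetric] bx(1)[symmetric] by simp
 then have "ennreal \<bar>riesz_pot s g z - riesz_pot s g x\<bar> <= ennreal \<bar>(LBINT w. riesz_diff s (z - x) (x - w) * good w)\<bar> + ennreal (norm ?B)"
  by (simp flip: ennreal_plus)
 also have "ennreal (norm ?B) <= (NBINT w. ennreal (norm (indicator \<Omega> w * g w * bad_kernel s w z - indicator \<Omega> w * g w * bad_kernel s w x)))"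
  by (rule norm_integral_le_nn)
 also have "... <= (NBINT w. ennreal C * (indicator \<Omega> z * (?J z w)
  + (ennreal \<bar>g w\<bar> * ennreal (min (norm (z - x)) (\<delta> w) * norm (z - w) powr (s - DIM('a) - 1) * indicator {w. \<delta> w / 2 <= norm (z - w)} w) * indicator \<Omega> w
  + ennreal \<bar>g w\<bar> * ennreal (min (norm (z - x)) (\<delta> w) * norm (x - w) powr (s - DIM('a) - 1) * indicator {w. \<delta> w / 2 <= norm (x - w)} w) * indicator \<Omega> w)))"
 proof (rule nn_integral_mono_AE)
  show "AE w in lborel. ennreal (norm (indicator \<Omega> w * g w * bad_kernel s w z - indicator \<Omega> w * g w * bad_kernel s w x))
   <= ennreal C * (indicator \<Omega> z * (?J z w)
  + (ennreal \<bar>g w\<bar> * ennreal (min (norm (z - x)) (\<delta> w) * norm (z - w) powr (s - DIM('a) - 1) * indicator {w. \<delta> w / 2 <= norm (z - w)} w) * indicator \<Omega> w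
  + ennreal \<bar>g w\<bar> * ennreal (min (norm (z - x)) (\<delta> w) * norm (x - w) powr (s - DIM('a) - 1) * indicator {w. \<delta> w / 2 <= norm (x - w)} w) * indicator \<Omega> w))"
   using AE_lborel_singleton[of z]
  proof eventually_elim
   case (elim w)
   show ?case
   proof (cases "w \<in> \<Omega>")
    case True
    have d: "0 < \<delta> w" using \<delta>_pos[OF True] .
    have dx: "\<delta> w <= norm (x - w)" using \<delta>_le[OF x] .
    let ?N = "indicator {z. norm (z - w) < \<delta> w / 2} z * riesz s (z - w) :: real"
    let ?Fz = "min (norm (z - x)) (\<delta> w) * norm (z - w) powr (s - DIM('a) - 1) * indicator {w. \<delta> w / 2 <= norm (z - w)} w :: real"
    let ?Fx = "min (norm (z - x)) (\<delta> w) * norm (x - w) powr (s - DIM('a) - 1) * indicator {w. \<delta> w / 2 <= norm (x - w)} w :: real"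
    have "\<bar>bad_kernel s w z - bad_kernel s w x\<bar> <= C * (?N + min (norm (z - x)) (\<delta> w) * (indicator {z. \<delta> w / 2 <= norm (z - w)} z * norm (z - w) powr (s - DIM('a) - 1) + norm (x - w) powr (s - DIM('a) - 1)))"
     unfolding bad_kernel_def
     by (rule C(1)[unfolded cancellation_const_def, rule_format, of "bump w" "\<delta> w" x w z])
       (use d dx elim bump_le[of w] bump_support[of w] bump_integral[OF True] in auto)
    also have "?N + min (norm (z - x)) (\<delta> w) * (indicator {z. \<delta> w / 2 <= norm (z - w)} z * norm (z - w) powr (s - DIM('a) - 1) + norm (x - w) powr (s - DIM('a) - 1)) = ?N + (?Fz + ?Fx)"
     using dx d by (simp add: indicator_def algebra_simps)
    finally have "\<bar>g w\<bar> * \<bar>bad_kernel s w z - bad_kernel s w x\<bar> <= \<bar>g w\<bar> * (C * (?N + (?Fz + ?Fx)))"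
     by (intro mult_left_mono) auto
    also have "... = C * (\<bar>g w\<bar> * ?N + (\<bar>g w\<bar> * ?Fz + \<bar>g w\<bar> * ?Fx))" by (simp add: algebra_simps)
    finally have "ennreal (\<bar>g w\<bar> * \<bar>bad_kernel s w z - bad_kernel s w x\<bar>) <= ennreal (C * (\<bar>g w\<bar> * ?N + (\<bar>g w\<bar> * ?Fz + \<bar>g w\<bar> * ?Fx)))"
     by (rule ennreal_leI)
    also have "... = ennreal C * (ennreal (\<bar>g w\<bar> * ?N) + (ennreal \<bar>g w\<bar> * ennreal ?Fz + ennreal \<bar>g w\<bar> * ennreal ?Fx))"
    proof -
     have nn: "0 <= ?N" "0 <= ?Fz" "0 <= ?Fx" using d by auto
     then have "ennreal (C * (\<bar>g w\<bar> * ?N + (\<bar>g w\<bar> * ?Fz + \<bar>g w\<bar> * ?Fx))) = ennreal C * ennreal (\<bar>g w\<bar> * ?N + (\<bar>g w\<bar> * ?Fz + \<bar>g w\<bar> * ?Fx))"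
      using C(2) by (intro ennreal_mult) (auto intro!: add_nonneg_nonneg mult_nonneg_nonneg)
     also have "ennreal (\<bar>g w\<bar> * ?N + (\<bar>g w\<bar> * ?Fz + \<bar>g w\<bar> * ?Fx)) = ennreal (\<bar>g w\<bar> * ?N) + (ennreal (\<bar>g w\<bar> * ?Fz) + ennreal (\<bar>g w\<bar> * ?Fx))"
      using nn by (subst ennreal_plus, (auto intro!: add_nonneg_nonneg mult_nonneg_nonneg)[2], subst ennreal_plus) (auto intro!: mult_nonneg_nonneg)
     also have "ennreal (\<bar>g w\<bar> * ?Fz) = ennreal \<bar>g w\<bar> * ennreal ?Fz" using nn by (intro ennreal_mult) auto
     also have "ennreal (\<bar>g w\<bar> * ?Fx) = ennreal \<bar>g w\<bar> * ennreal ?Fx" using nn by (intro ennreal_mult) auto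
     finally show ?thesis .
    qed
    also have "... <= ennreal C * (indicator \<Omega> z * (?J z w) + (ennreal \<bar>g w\<bar> * ennreal ?Fz + ennreal \<bar>g w\<bar> * ennreal ?Fx))"
    proof (intro mult_left_mono add_right_mono)
     \<comment> \<open>If |z - w| < \<delta> w / 2, then z is in \<open>\<Omega>\<close> and the
       triangle inequality gives \<delta> z > \<delta> w / 2 > |z - w|. Thus a region described by
       \<delta> w is covered by the one described by \<delta> z that \<open>near\<close>
       uses.\<close>
     show "ennreal (\<bar>g w\<bar> * ?N) <= indicator \<Omega> z * (?J z w)"
     proof (cases "norm (z - w) < \<delta> w / 2")
      case nr: True
      have "z \<in> \<Omega>" using nr d by (intro near_in_\<Omega>[of z w]) linarith
      moreover have "norm (z - w) < \<delta> z"
       using nr \<delta>_triangle[of w z] norm_minus_commute[of w z] by linarith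
      ultimately show ?thesis using nr by simp
     qed simp
    qed auto
    finally show ?thesis using True by (simp add: abs_mult flip: right_diff_distrib)
   qed simp
  qed
 qed
 also have "... = ennreal C * (indicator \<Omega> z * near s z + (far s z (norm (z - x)) + far s x (norm (z - x))))"
 proof -
  have 1: "(NBINT w. indicator \<Omega> z * (?J z w)) = indicator \<Omega> z * near s z"
   unfolding near_def by (rule nn_integral_cmult) measurable
  have 2: "(NBINT w. ennreal C * (a w + (b w + c w))) = ennreal C * ((NBINT w. a w) + ((NBINT w. b w) + (NBINT w. c w)))"
   if [measurable]: "a \<in> borel_measurable borel" "b \<in> borel_measurable borel" "c \<in> borel_measurable borel" for a b c :: "'a => ennreal"
  proof -
   have "(NBINT w. ennreal C * (a w + (b w + c w))) = ennreal C * (NBINT w. a w + (b w + c w))"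
    by (rule nn_integral_cmult) measurable
   also have "(NBINT w. a w + (b w + c w)) = (NBINT w. a w) + (NBINT w. b w + c w)"
    by (rule nn_integral_add) measurable
   also have "(NBINT w. b w + c w) = (NBINT w. b w) + (NBINT w. c w)"
    by (rule nn_integral_add) measurable
   finally show ?thesis .
  qed
  show ?thesis
   unfolding far_def 1[symmetric] by (rule 2) measurable
 qed
 finally show ?thesis by (simp add: add_left_mono)
qed

end

section \<open>Integration of the pieces and the weak type bound at level 1\<close>

context calderon_zygmund
begin

text \<open>Of the q factors, q - 1 are bounded by \<open>far_le\<close> and one is kept for
  \<open>far_integral\<close>; the powers of t combine to the exponent - s - n needed there.\<close>

lemma far_power:
 fixes s q t :: real
 assumes s: "0 < s" "s < 1" and "1 <= q" and t: "0 < t"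
 defines "C \<equiv> 3 * 10 ^ DIM('a) * ((2 / 3) powr (s - DIM('a) - 1) * (4 * sph TYPE('a) / s + sph TYPE('a) / (1 - s)))"
 shows "epow (far s z t) q * ennreal (t powr (- DIM('a) - s * q)) <= ennreal (C powr (q - 1)) * (far s z t * ennreal (t powr (- s - DIM('a))))"
proof -
 have "far s z t <= ennreal (C * t powr s)" unfolding C_def by (rule far_le[OF s t])
 moreover have "0 <= C" using s unfolding C_def by (intro mult_nonneg_nonneg add_nonneg_nonneg divide_nonneg_nonneg) auto
 ultimately obtain f where f: "far s z t = ennreal f" "0 <= f" "f <= C * t powr s"
  by (cases "far s z t") (auto simp: top_unique)
 have "f powr q = f * f powr (q - 1)"
  using f(2) powr_add[of f 1 "q - 1"] by (cases "f = 0") auto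
 also have "... <= f * (C * t powr s) powr (q - 1)"
  using f assms by (intro mult_left_mono powr_mono2) auto
 also have "... = f * (C powr (q - 1) * t powr (s * (q - 1)))"
  using \<open>0 <= C\<close> t by (simp add: powr_mult powr_powr)
 finally have "f powr q * t powr (- DIM('a) - s * q) <= f * (C powr (q - 1) * t powr (s * (q - 1))) * t powr (- DIM('a) - s * q)"
  by (intro mult_right_mono) auto
 also have "... = C powr (q - 1) * (f * (t powr (s * (q - 1)) * t powr (- DIM('a) - s * q)))" by simp
 also have "t powr (s * (q - 1)) * t powr (- DIM('a) - s * q) = t powr (- s - DIM('a))"
  unfolding powr_add[symmetric] by (simp add: algebra_simps)
 finally have "ennreal (f powr q * t powr (- DIM('a) - s * q)) <= ennreal (C powr (q - 1) * (f * t powr (- s - DIM('a))))"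
  by (rule ennreal_leI)
 then show ?thesis using f by (simp add: ennreal_mult)
qed

text \<open>A point x off \<open>\<Omega>\<close> has distance at least \<delta> z from z, so
  integrating |z - x|^(- n - s q) over such x gives a multiple of \<delta> z powr (- s q). This
  cancels the power of \<delta> z in \<open>near_power\<close> and leaves the p-th power of the
  maximal function.\<close>

lemma near_integral:
 fixes q s CM :: real
 assumes "p < q" and s: "s = DIM('a) * (1 / p - 1 / q)"
  and CM: "(NBINT z. epow (maximal (\<lambda>w. ennreal \<bar>g w\<bar>) z) p) <= ennreal CM * (NBINT w. ennreal (\<bar>g w\<bar> powr p))"
 defines "C \<equiv> DIM('a) * unit_ball_vol DIM('a) * (1 / s + (1 + 2 ^ DIM('a)) * q / DIM('a))"
 shows "(NBINT x. NBINT y. indicator (- \<Omega>) x * (epow (indicator \<Omega> (x + y) * near s (x + y)) q * ennreal (norm y powr (- DIM('a) - s * q))))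
  <= ennreal (C powr q) * (ennreal (sph TYPE('a) / (s * q)) * (ennreal CM * (NBINT w. ennreal (\<bar>g w\<bar> powr p))))"
proof -
 let ?S = "\<lambda>z. sph TYPE('a) / (s * q) * \<delta> z powr (- (s * q))"
 let ?E = "\<lambda>z x. epow (indicator \<Omega> z * near s z) q * ennreal (norm (z - x) powr (- DIM('a) - s * q))"
 let ?m = "\<lambda>z. epow (maximal (\<lambda>w. ennreal \<bar>g w\<bar>) z) p"
 have pq: "0 < p" "0 < q" "1 / q < 1 / p" using p_gt_1 assms(1) by (auto simp: field_simps)
 have s0: "0 < s" using pq unfolding s by (intro mult_pos_pos) auto
 have nm[measurable]: "near s \<in> borel_measurable borel" by (rule near_measurable)
 have mm[measurable]: "?m \<in> borel_measurable borel"
  by (rule measurable_compose[OF maximal_measurable epow_measurable])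
 have [measurable]: "(\<lambda>z. epow (indicator \<Omega> z * near s z) q) \<in> borel_measurable borel"
  by (rule measurable_compose[OF _ epow_measurable]) measurable
 have "(NBINT x. NBINT y. indicator (- \<Omega>) x * (epow (indicator \<Omega> (x + y) * near s (x + y)) q * ennreal (norm y powr (- DIM('a) - s * q))))
  = (NBINT x. NBINT z. indicator (- \<Omega>) x * (?E z x))"
 proof (rule nn_integral_cong)
  fix x
  have "(NBINT y. indicator (- \<Omega>) x * (epow (indicator \<Omega> (x + y) * near s (x + y)) q * ennreal (norm ((x + y) - x) powr (- DIM('a) - s * q))))
   = (NBINT z. indicator (- \<Omega>) x * (?E z x))"
   by (rule nn_integral_lborel_shift) measurable
  then show "(NBINT y. indicator (- \<Omega>) x * (epow (indicator \<Omega> (x + y) * near s (x + y)) q * ennreal (norm y powr (- DIM('a) - s * q))))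
   = (NBINT z. indicator (- \<Omega>) x * (?E z x))"
   by simp
 qed
 also have "... = (NBINT z. NBINT x. indicator (- \<Omega>) x * (?E z x))"
  by (rule lborel_pair.Fubini'[symmetric]) measurable
 also have "... <= (NBINT z. ennreal (C powr q) * (ennreal (sph TYPE('a) / (s * q)) * ?m z))"
 proof (rule nn_integral_mono)
  fix z
  show "(NBINT x. indicator (- \<Omega>) x * (?E z x)) <= ennreal (C powr q) * (ennreal (sph TYPE('a) / (s * q)) * ?m z)"
  proof (cases "z \<in> \<Omega>")
   case False
   then have "epow (indicator \<Omega> z * near s z) q = 0" using epow_ennreal[of 0 q] by simp
   then show ?thesis by simp
  next
   case True
   have d: "0 < \<delta> z" using \<delta>_pos[OF True] .
   have "(NBINT x. indicator (- \<Omega>) x * (?E z x))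
    <= (NBINT x. epow (near s z) q * (ennreal (norm (z - x) powr (- (s * q) - DIM('a))) * indicator {x. \<delta> z <= norm (z - x)} x))"
   proof (rule nn_integral_mono)
    fix x
    have e: "t powr (- real DIM('a) - s * q) = t powr (- (s * q) - DIM('a))" for t
     by (rule arg_cong[where f="\<lambda>e. t powr e"]) simp
    show "indicator (- \<Omega>) x * (?E z x)
     <= epow (near s z) q * (ennreal (norm (z - x) powr (- (s * q) - DIM('a))) * indicator {x. \<delta> z <= norm (z - x)} x)"
     using True \<delta>_le[of x z] by (auto simp: e indicator_def norm_minus_commute)
   qed
   also have "... = epow (near s z) q * (NBINT x. ennreal (norm (z - x) powr (- (s * q) - DIM('a))) * indicator {x. \<delta> z <= norm (z - x)} x)"
    by (rule nn_integral_cmult) measurable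
   also have "(NBINT x. ennreal (norm (z - x) powr (- (s * q) - DIM('a))) * indicator {x. \<delta> z <= norm (z - x)} x) = ennreal (?S z)"
    using s0 pq d by (intro nn_integral_outside_powr) auto
   also have "epow (near s z) q * ennreal (?S z) <= (ennreal (C powr q * \<delta> z powr (s * q)) * ?m z) * ennreal (?S z)"
    unfolding C_def by (intro mult_right_mono near_power[OF assms(1) s True]) auto
   also have "... = (ennreal (C powr q * \<delta> z powr (s * q)) * ennreal (?S z)) * ?m z"
    by (simp only: mult_ac)
   also have "ennreal (C powr q * \<delta> z powr (s * q)) * ennreal (?S z) = ennreal (C powr q * \<delta> z powr (s * q) * (?S z))"
    using s0 pq by (intro ennreal_mult[symmetric]) auto
   also have "C powr q * \<delta> z powr (s * q) * (?S z) = C powr q * (sph TYPE('a) / (s * q)) * (\<delta> z powr (s * q) * \<delta> z powr (- (s * q)))"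
    by (simp only: mult_ac)
   also have "\<delta> z powr (s * q) * \<delta> z powr (- (s * q)) = 1" using d by (simp flip: powr_add)
   also have "ennreal (C powr q * (sph TYPE('a) / (s * q)) * 1) = ennreal (C powr q) * ennreal (sph TYPE('a) / (s * q))"
    using s0 pq by (simp only: mult_1_right) (intro ennreal_mult, auto)
   finally show ?thesis by (simp only: mult.assoc)
  qed
 qed
 also have "... = ennreal (C powr q) * (ennreal (sph TYPE('a) / (s * q)) * (NBINT z. ?m z))"
  by (simp add: nn_integral_cmult)
 also have "... <= ennreal (C powr q) * (ennreal (sph TYPE('a) / (s * q)) * (ennreal CM * (NBINT w. ennreal (\<bar>g w\<bar> powr p))))"
  by (intro mult_left_mono CM) auto
 finally show ?thesis .
qed

lemma far_integral_shift:
 "(NBINT x. NBINT y. far s (x + y) (norm y) * ennreal (norm y powr e)) = (NBINT z. \<integral>\<^sup>+y. far s z (norm y) * ennreal (norm y powr e) \<partial>(lborel::'a measure))"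
proof -
 have "(NBINT x. NBINT y. far s (x + y) (norm y) * ennreal (norm y powr e)) = (NBINT y. NBINT x. far s (x + y) (norm y) * ennreal (norm y powr e))"
  by (rule lborel_pair.Fubini'[symmetric]) measurable
 also have "... = (\<integral>\<^sup>+y. (NBINT z. far s z (norm y) * ennreal (norm y powr e)) \<partial>(lborel::'a measure))"
 proof (rule nn_integral_cong)
  fix y :: 'a
  have "(NBINT x. far s (y + x) (norm y) * ennreal (norm y powr e)) = (NBINT z. far s z (norm y) * ennreal (norm y powr e))"
   by (rule nn_integral_lborel_shift) measurable
  then show "(NBINT x. far s (x + y) (norm y) * ennreal (norm y powr e)) = (NBINT z. far s z (norm y) * ennreal (norm y powr e))"
   by (simp only: add.commute)
 qed
 also have "... = (NBINT z. \<integral>\<^sup>+y. far s z (norm y) * ennreal (norm y powr e) \<partial>(lborel::'a measure))"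
  by (rule lborel_pair.Fubini') measurable
 finally show ?thesis .
qed

text \<open>The estimates of the good, near and far parts are added up. The constants are handed in
  through their defining equations so that the prefactor visibly depends on neither \<open>g\<close>
  nor \<open>\<Omega>\<close>, which is vital when a new \<open>\<Omega>\<close> is chosen for each
  \<open>g\<close>.\<close>

lemma off_\<Omega>_estimate:
 fixes q s C CM C2 CF CN KF :: real
 assumes pq: "p < q" "2 <= q" and s: "s = DIM('a) * (1 / p - 1 / q)" "0 < s" "s < 1"
  and can: "cancellation_const TYPE('a) s C" "0 < C"
  and CM: "(NBINT z. epow (maximal (\<lambda>w. ennreal \<bar>g w\<bar>) z) p) <= ennreal CM * (NBINT w. ennreal (\<bar>g w\<bar> powr p))"
  and C2: "(\<integral>\<^sup>+e. haar_weight e * ennreal (\<bar>riesz_op s good e\<bar> powr q) \<partial>(lborel \<Otimes>\<^sub>M lborel)) <= ennreal C2 * (NBINT w. ennreal (\<bar>good w\<bar> powr q))"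
  and fin: "AE x in lborel. riesz_abs s g x < \<infinity>"
  and CF: "CF = 3 * 10 ^ DIM('a) * ((2 / 3) powr (s - DIM('a) - 1) * (4 * sph TYPE('a) / s + sph TYPE('a) / (1 - s)))"
  and CN: "CN = DIM('a) * unit_ball_vol DIM('a) * (1 / s + (1 + 2 ^ DIM('a)) * q / DIM('a))"
  and KF: "KF = 2 powr (1 - s) * (sph TYPE('a) / (1 - s)) * (sph TYPE('a) / (1 - s) + sph TYPE('a) / s) * (3 * 10 ^ DIM('a))"
 shows "(NBINT x. indicator {x. x \<notin> \<Omega> & riesz_abs s g x < \<infinity>} x * (NBINT y. ennreal (\<bar>riesz_pot s g (x + y) - riesz_pot s g x\<bar> powr q * norm y powr (- DIM('a) - s * q))))
  <= (ennreal (2 powr q) * (ennreal C2 * (1 + ennreal ((3 * 10 ^ DIM('a)) powr q)) + ennreal (C powr q) * (ennreal (2 powr q) * (ennreal (CN powr q) * (ennreal (sph TYPE('a) / (s * q)) * ennreal CM)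
    + ennreal (2 powr q) * (ennreal (CF powr (q - 1)) * (ennreal KF + ennreal KF))))))
   * ((NBINT w. ennreal (\<bar>g w\<bar> powr p)) + emeasure lborel \<Omega>)"
proof -
 let ?J = "\<lambda>x y. \<bar>riesz_pot s g (x + y) - riesz_pot s g x\<bar> powr q * norm y powr (- DIM('a) - s * q)"
 let ?I = "NBINT w. ennreal (\<bar>g w\<bar> powr p)"
 let ?w = "\<lambda>y::'a. ennreal (norm y powr (- DIM('a) - s * q))" and ?v = "\<lambda>y::'a. ennreal (norm y powr (- s - DIM('a)))"
 let ?f1 = "\<lambda>x y. haar_weight (x, y) * ennreal (\<bar>riesz_op s good (x, y)\<bar> powr q)"
 let ?f2 = "\<lambda>x y. indicator (- \<Omega>) x * (epow (indicator \<Omega> (x + y) * near s (x + y)) q * ?w y)"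
 let ?f3 = "\<lambda>x y. far s (x + y) (norm y) * ?v y" and ?f4 = "\<lambda>x y. far s x (norm y) * ?v y"
 let ?S = "{x. x \<notin> \<Omega> & riesz_abs s g x < \<infinity>}"
 let ?a = "ennreal (2 powr q)" and ?c = "ennreal (C powr q)" and ?d = "ennreal (CF powr (q - 1))"
 have nm[measurable]: "near s \<in> borel_measurable borel" by (rule near_measurable)
 have [measurable]: "(\<lambda>z. epow (indicator \<Omega> z * near s z) q) \<in> borel_measurable borel"
  by (rule measurable_compose[OF _ epow_measurable]) measurable
 have [measurable]: "(\<lambda>(x, y). ?f1 x y) \<in> borel_measurable (lborel \<Otimes>\<^sub>M lborel)" by measurable
 have "(NBINT x. indicator ?S x * (NBINT y. ennreal (?J x y)))
  <= (NBINT x. NBINT y. ?a * (?f1 x y + ?c * (?a * (?f2 x y + ?a * (?d * (?f3 x y + ?f4 x y))))))"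
 proof (rule nn_integral_mono)
  fix x
  show "indicator ?S x * (NBINT y. ennreal (?J x y))
   <= (NBINT y. ?a * (?f1 x y + ?c * (?a * (?f2 x y + ?a * (?d * (?f3 x y + ?f4 x y))))))"
  proof (cases "x \<in> ?S")
   case True
   then have x: "x \<notin> \<Omega>" "riesz_abs s g x < \<infinity>" by auto
   have "(NBINT y. ennreal (?J x y))
    <= (NBINT y. ?a * (?f1 x y + ?c * (?a * (?f2 x y + ?a * (?d * (?f3 x y + ?f4 x y))))))"
   proof (rule nn_integral_mono_AE)
    show "AE y in lborel. ennreal (?J x y)
     <= ?a * (?f1 x y + ?c * (?a * (?f2 x y + ?a * (?d * (?f3 x y + ?f4 x y)))))"
     using AE_lborel_shift[OF fin, of x] AE_lborel_singleton[of 0]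
    proof eventually_elim
     case (elim y)
     let ?D = "\<bar>riesz_pot s g (x + y) - riesz_pot s g x\<bar>"
     let ?A = "\<bar>(LBINT w. riesz_diff s y (x - w) * good w)\<bar>"
     let ?N = "indicator \<Omega> (x + y) * near s (x + y)" and ?F1 = "far s (x + y) (norm y)" and ?F2 = "far s x (norm y)"
     have q0: "0 <= q" "1 <= q" using pq by auto
     have y: "0 < norm y" using elim by simp
     have le: "ennreal ?D <= ennreal ?A + ennreal C * (?N + (?F1 + ?F2))"
      using riesz_pot_decomposition[OF s(2,3) can x elim(1)] by simp
     have "ennreal (?D powr q) = epow (ennreal ?D) q" by simp
     also have "... <= epow (ennreal ?A + ennreal C * (?N + (?F1 + ?F2))) q"
      by (rule epow_mono[OF le q0(1)])
     also have "... <= ?a * (epow (ennreal ?A) q + epow (ennreal C * (?N + (?F1 + ?F2))) q)"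
      by (rule epow_add_le[OF q0(1)])
     also have "epow (ennreal C * (?N + (?F1 + ?F2))) q = ?c * epow (?N + (?F1 + ?F2)) q"
      by (rule epow_cmult[OF can(2) q0(1)])
     also have "?a * (epow (ennreal ?A) q + ?c * epow (?N + (?F1 + ?F2)) q) <= ?a * (epow (ennreal ?A) q + ?c * (?a * (epow ?N q + ?a * (epow ?F1 q + epow ?F2 q))))"
      by (intro mult_left_mono add_left_mono order_trans[OF epow_add_le[OF q0(1)]] epow_add_le[OF q0(1)]) auto
     finally have "ennreal (?D powr q) * ?w y <= (?a * (epow (ennreal ?A) q + ?c * (?a * (epow ?N q + ?a * (epow ?F1 q + epow ?F2 q))))) * ?w y"
      by (intro mult_right_mono) auto
     also have "... = ?a * (epow (ennreal ?A) q * ?w y + ?c * (?a * (epow ?N q * ?w y + ?a * (epow ?F1 q * ?w y + epow ?F2 q * ?w y))))"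
      by (simp only: distrib_right distrib_left mult_ac)
     also have "... <= ?a * (?f1 x y + ?c * (?a * (?f2 x y + ?a * (?d * (?f3 x y + ?f4 x y)))))"
     proof (intro mult_left_mono add_mono)
      have "?A = norm y powr s * \<bar>riesz_op s good (x, y)\<bar>"
       using y by (simp add: riesz_op_def abs_mult powr_minus)
      then have "?A powr q * norm y powr (- DIM('a) - s * q) = \<bar>riesz_op s good (x, y)\<bar> powr q * (norm y powr (s * q) * norm y powr (- DIM('a) - s * q))"
       by (simp add: powr_mult powr_powr)
      also have "norm y powr (s * q) * norm y powr (- DIM('a) - s * q) = norm y powr (- real DIM('a))"
       by (simp flip: powr_add)
      finally show "epow (ennreal ?A) q * ?w y <= ?f1 x y"
       by (simp add: haar_weight_def ennreal_mult[symmetric] mult.commute)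
      show "epow ?N q * ?w y <= ?f2 x y" using x by simp
      have "epow ?F1 q * ?w y <= ?d * ?f3 x y" "epow ?F2 q * ?w y <= ?d * ?f4 x y"
       unfolding CF using s y q0 by (intro far_power; simp)+
      then show "epow ?F1 q * ?w y + epow ?F2 q * ?w y <= ?d * (?f3 x y + ?f4 x y)"
       unfolding distrib_left by (rule add_mono)
     qed auto
     finally show ?case by (simp add: ennreal_mult)
    qed
   qed
   then show ?thesis using True by simp
  qed simp
 qed
 also have "... = ?a * ((NBINT x. NBINT y. ?f1 x y) + ?c * (?a * ((NBINT x. NBINT y. ?f2 x y) + ?a * (?d * ((NBINT x. NBINT y. ?f3 x y) + (NBINT x. NBINT y. ?f4 x y))))))"
 proof -
  have add: "(NBINT x. NBINT y. F x y + G x y) = (NBINT x. NBINT y. F x y) + (NBINT x. NBINT y. G x y)"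
   if [measurable]: "(\<lambda>(x, y). F x y) \<in> borel_measurable (lborel \<Otimes>\<^sub>M lborel)" "(\<lambda>(x, y). G x y) \<in> borel_measurable (lborel \<Otimes>\<^sub>M lborel)" for F G :: "'a => 'a => ennreal"
  proof -
   have "(NBINT x. NBINT y. F x y + G x y) = (NBINT x. (NBINT y. F x y) + (NBINT y. G x y))"
    by (intro nn_integral_cong nn_integral_add) measurable
   also have "... = (NBINT x. NBINT y. F x y) + (NBINT x. NBINT y. G x y)"
    by (intro nn_integral_add) measurable
   finally show ?thesis .
  qed
  have cm: "(NBINT x. NBINT y. k * F x y) = k * (NBINT x. NBINT y. F x y)"
   if [measurable]: "(\<lambda>(x, y). F x y) \<in> borel_measurable (lborel \<Otimes>\<^sub>M lborel)" for F :: "'a => 'a => ennreal" and k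
  proof -
   have "(NBINT x. NBINT y. k * F x y) = (NBINT x. k * (NBINT y. F x y))"
    by (intro nn_integral_cong nn_integral_cmult) measurable
   also have "... = k * (NBINT x. NBINT y. F x y)"
    by (intro nn_integral_cmult) measurable
   finally show ?thesis .
  qed
  have m2[measurable]: "(\<lambda>(x, y). ?f2 x y) \<in> borel_measurable (lborel \<Otimes>\<^sub>M lborel)"
   and m3[measurable]: "(\<lambda>(x, y). ?f3 x y) \<in> borel_measurable (lborel \<Otimes>\<^sub>M lborel)"
   and m4[measurable]: "(\<lambda>(x, y). ?f4 x y) \<in> borel_measurable (lborel \<Otimes>\<^sub>M lborel)" by measurable
  have gen: "(NBINT x. NBINT y. ?a * (F1 x y + ?c * (?a * (F2 x y + ?a * (?d * (F3 x y + F4 x y))))))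
   = ?a * ((NBINT x. NBINT y. F1 x y) + ?c * (?a * ((NBINT x. NBINT y. F2 x y) + ?a * (?d * ((NBINT x. NBINT y. F3 x y) + (NBINT x. NBINT y. F4 x y))))))"
   if [measurable]: "(\<lambda>(x, y). F1 x y) \<in> borel_measurable (lborel \<Otimes>\<^sub>M lborel)" "(\<lambda>(x, y). F2 x y) \<in> borel_measurable (lborel \<Otimes>\<^sub>M lborel)"
    "(\<lambda>(x, y). F3 x y) \<in> borel_measurable (lborel \<Otimes>\<^sub>M lborel)" "(\<lambda>(x, y). F4 x y) \<in> borel_measurable (lborel \<Otimes>\<^sub>M lborel)"
   for F1 F2 F3 F4 :: "'a => 'a => ennreal"
   apply (subst cm, measurable)
   apply (subst add, measurable)
   apply (subst cm, measurable)
   apply (subst cm, measurable)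
   apply (subst add, measurable)
   apply (subst cm, measurable)
   apply (subst cm, measurable)
   apply (subst add, measurable)
   done
  show ?thesis by (rule gen) measurable
 qed
 also have "... <= ?a * (ennreal C2 * (?I + ennreal ((3 * 10 ^ DIM('a)) powr q) * emeasure lborel \<Omega>) + ?c * (?a * (ennreal (CN powr q) * (ennreal (sph TYPE('a) / (s * q)) * (ennreal CM * ?I)) + ?a * (?d * (ennreal KF * emeasure lborel \<Omega> + ennreal KF * emeasure lborel \<Omega>)))))"
 proof (intro mult_left_mono add_mono)
  have "(NBINT x. NBINT y. ?f1 x y) = (\<integral>\<^sup>+e. haar_weight e * ennreal (\<bar>riesz_op s good e\<bar> powr q) \<partial>(lborel \<Otimes>\<^sub>M lborel))"
   by (rule lborel.nn_integral_fst) measurable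
  also note C2
  also have "ennreal C2 * (NBINT w. ennreal (\<bar>good w\<bar> powr q)) <= ennreal C2 * (?I + ennreal ((3 * 10 ^ DIM('a)) powr q) * emeasure lborel \<Omega>)"
   using pq by (intro mult_left_mono good_Lq) auto
  finally show "(NBINT x. NBINT y. ?f1 x y) <= ennreal C2 * (?I + ennreal ((3 * 10 ^ DIM('a)) powr q) * emeasure lborel \<Omega>)" .
  show "(NBINT x. NBINT y. ?f2 x y) <= ennreal (CN powr q) * (ennreal (sph TYPE('a) / (s * q)) * (ennreal CM * ?I))"
   unfolding CN by (rule near_integral[OF pq(1) s(1) CM])
  show "(NBINT x. NBINT y. ?f4 x y) <= ennreal KF * emeasure lborel \<Omega>"
   unfolding KF by (rule far_integral[OF s(2,3)])
  then show "(NBINT x. NBINT y. ?f3 x y) <= ennreal KF * emeasure lborel \<Omega>"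
   unfolding far_integral_shift .
 qed auto
 also have "... <= ?a * (ennreal C2 * ((?I + emeasure lborel \<Omega>) + ennreal ((3 * 10 ^ DIM('a)) powr q) * (?I + emeasure lborel \<Omega>)) + ?c * (?a * (ennreal (CN powr q) * (ennreal (sph TYPE('a) / (s * q)) * (ennreal CM * (?I + emeasure lborel \<Omega>))) + ?a * (?d * (ennreal KF * (?I + emeasure lborel \<Omega>) + ennreal KF * (?I + emeasure lborel \<Omega>))))))"
  by (intro mult_left_mono add_mono) auto
 also have "... = (?a * (ennreal C2 * (1 + ennreal ((3 * 10 ^ DIM('a)) powr q)) + ?c * (?a * (ennreal (CN powr q) * (ennreal (sph TYPE('a) / (s * q)) * ennreal CM)
    + ?a * (?d * (ennreal KF + ennreal KF)))))) * (?I + emeasure lborel \<Omega>)"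
 proof -
  have "a * (b * (X + e * X) + c * (a * (f * (h * (i * X)) + a * (d * (k * X + k * X))))) = (a * (b * (1 + e) + c * (a * (f * (h * i) + a * (d * (k + k)))))) * X" for a b c d e f h i k X :: ennreal
   by (simp only: distrib_left distrib_right mult_ac mult_1_right mult_1_left)
  then show ?thesis .
 qed
 finally show ?thesis .
qed

end

text \<open>Level 1 is enough, both sides being homogeneous under rescaling of \<open>g\<close>.
  Points of \<open>\<Omega>\<close> are paid for by its measure; off \<open>\<Omega>\<close>,
  Chebyshev's inequality reduces the claim to the integral bounded in
  \<open>off_\<Omega>_estimate\<close>.\<close>

theorem riesz_weak_type:
 fixes p q s :: real
 assumes "1 < p" "p < q" "2 <= q" and s: "s = DIM('a::euclidean_space) * (1 / p - 1 / q)" "0 < s" "s < 1"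
 shows "\<exists>K>0. \<forall>g::'a => real. g \<in> borel_measurable borel \<longrightarrow> (NBINT w. ennreal (\<bar>g w\<bar> powr p)) < \<infinity> \<longrightarrow>
  emeasure lborel {x. riesz_abs s g x < \<infinity> & 1 < (NBINT y. ennreal (\<bar>riesz_pot s g (x + y) - riesz_pot s g x\<bar> powr q * norm y powr (- DIM('a) - s * q)))}
   <= ennreal K * (NBINT w. ennreal (\<bar>g w\<bar> powr p))"
proof -
 obtain C where C: "0 < C" "cancellation_const TYPE('a) s C"
  using riesz_cancellation_bound[OF s(2,3), where 'a='a] by blast
 obtain CM where CM: "!!\<gamma>::'a => real. \<gamma> \<in> borel_measurable borel ==> (!!w. 0 <= \<gamma> w) ==>
  (NBINT z. epow (maximal (\<lambda>w. ennreal (\<gamma> w)) z) p) <= ennreal CM * (NBINT w. ennreal (\<gamma> w powr p))"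
  using maximal_strong_type[OF assms(1), where 'a='a] by blast
 obtain C2 where C2: "!!(h::'a => real) H. h \<in> borel_measurable borel ==> (!!w. \<bar>h w\<bar> <= H) ==>
  (\<integral>\<^sup>+e. haar_weight e * ennreal (\<bar>riesz_op s h e\<bar> powr q) \<partial>(lborel \<Otimes>\<^sub>M lborel)) <= ennreal C2 * (NBINT w. ennreal (\<bar>h w\<bar> powr q))"
  using riesz_op_Lq[OF s(2,3) assms(3), where 'a='a] by blast
 define CF where "CF = 3 * 10 ^ DIM('a) * ((2 / 3) powr (s - DIM('a) - 1) * (4 * sph TYPE('a) / s + sph TYPE('a) / (1 - s)))"
 define CN where "CN = DIM('a) * unit_ball_vol DIM('a) * (1 / s + (1 + 2 ^ DIM('a)) * q / DIM('a))"
 define KF where "KF = 2 powr (1 - s) * (sph TYPE('a) / (1 - s)) * (sph TYPE('a) / (1 - s) + sph TYPE('a) / s) * (3 * 10 ^ DIM('a))"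
 define T where "T = ennreal (2 powr q) * (ennreal C2 * (1 + ennreal ((3 * 10 ^ DIM('a)) powr q)) + ennreal (C powr q) * (ennreal (2 powr q) * (ennreal (CN powr q) * (ennreal (sph TYPE('a) / (s * q)) * ennreal CM)
    + ennreal (2 powr q) * (ennreal (CF powr (q - 1)) * (ennreal KF + ennreal KF)))))"
 have "T < \<infinity>" unfolding T_def by (simp add: ennreal_mult_less_top)
 then have "1 + T < \<infinity>" by simp
 then obtain R where R: "1 + T = ennreal R" "0 <= R" by (cases "1 + T") auto
 have "ennreal 1 <= ennreal R" unfolding R(1)[symmetric] by simp
 then have "1 <= R" using R(2) by simp
 \<comment> \<open>\<open>R\<close> is the constant in front of the integral of |g|^p plus the
   measure of \<open>\<Omega>\<close>; the latter is at most 5 ^ n + 1 times that integral up to a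
   small error, whence 1 + (5 ^ n + 1).\<close>
 define K where "K = R * (5 ^ DIM('a) + 2)"
 have "0 < K" using \<open>1 <= R\<close> by (simp add: K_def add_pos_pos)
 have "s < DIM('a) / p"
 proof -
  have "DIM('a) / p = s + DIM('a) / q" unfolding s by (simp add: algebra_simps)
  moreover have "0 < DIM('a) / q" using assms by simp
  ultimately show ?thesis by linarith
 qed
 have "emeasure lborel {x. riesz_abs s g x < \<infinity> & 1 < (NBINT y. ennreal (\<bar>riesz_pot s g (x + y) - riesz_pot s g x\<bar> powr q * norm y powr (- DIM('a) - s * q)))}
   <= ennreal K * (NBINT w. ennreal (\<bar>g w\<bar> powr p))"
  if g[measurable]: "g \<in> borel_measurable borel" and I: "(NBINT w. ennreal (\<bar>g w\<bar> powr p)) < \<infinity>" for g :: "'a => real"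
 proof -
  let ?I = "NBINT w. ennreal (\<bar>g w\<bar> powr p)"
  let ?G = "\<lambda>x. NBINT y. ennreal (\<bar>riesz_pot s g (x + y) - riesz_pot s g x\<bar> powr q * norm y powr (- DIM('a) - s * q))"
  let ?S = "{x. riesz_abs s g x < \<infinity> & 1 < ?G x}"
  have [measurable]: "riesz_abs s g \<in> borel_measurable borel" "riesz_pot s g \<in> borel_measurable borel" by measurable
  have Gm[measurable]: "?G \<in> borel_measurable borel" by measurable
  have [measurable]: "?S \<in> sets borel" by measurable
  have fin: "AE x in lborel. riesz_abs s g x < \<infinity>"
   by (rule riesz_abs_AE_finite[OF assms(1) s(2) \<open>s < DIM('a) / p\<close> g I])
  show ?thesis
  proof (rule ennreal_le_epsilon)
   fix e :: real assume "0 < e"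
   \<comment> \<open>The error allowed in the measure of \<open>\<Omega>\<close>; after
     multiplication by \<open>R\<close> it becomes the arbitrary \<open>e\<close>.\<close>
   then have "0 < e / R" using \<open>1 <= R\<close> by simp
   obtain \<Omega> where cz: "calderon_zygmund p g \<Omega>" and e\<Omega>: "emeasure lborel \<Omega> <= ennreal (5 ^ DIM('a) + 1) * ?I + ennreal (e / R)"
    using calderon_zygmund_exists[OF assms(1) g \<open>0 < e / R\<close> I] by blast
   interpret calderon_zygmund p g \<Omega> by (rule cz)
   have "emeasure lborel ?S = (NBINT x. indicator ?S x)" by simp
   also have "... <= (NBINT x. indicator \<Omega> x + indicator {x. x \<notin> \<Omega> & riesz_abs s g x < \<infinity>} x * ?G x)"
    by (rule nn_integral_mono) (auto simp: indicator_def)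
   also have "... = emeasure lborel \<Omega> + (NBINT x. indicator {x. x \<notin> \<Omega> & riesz_abs s g x < \<infinity>} x * ?G x)"
    by (subst nn_integral_add) auto
   also have "... <= emeasure lborel \<Omega> + T * (?I + emeasure lborel \<Omega>)"
    unfolding T_def using CM[of "\<lambda>w. \<bar>g w\<bar>"] C2[OF good_measurable good_le]
    by (intro add_left_mono off_\<Omega>_estimate[OF assms(2,3) s C(2,1) _ _ fin CF_def CN_def KF_def]) auto
   also have "... <= (?I + emeasure lborel \<Omega>) + T * (?I + emeasure lborel \<Omega>)"
    by (intro add_right_mono) auto
   also have "... = ennreal R * (?I + emeasure lborel \<Omega>)"
    unfolding R(1)[symmetric] by (simp only: distrib_right mult_1_left)
   also have "... <= ennreal R * (?I + (ennreal (5 ^ DIM('a) + 1) * ?I + ennreal (e / R)))"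
    by (intro mult_left_mono add_left_mono e\<Omega>) auto
   also have "... = ennreal R * ((1 + ennreal (5 ^ DIM('a) + 1)) * ?I) + ennreal R * ennreal (e / R)"
    by (simp only: distrib_left distrib_right mult_1_left add.assoc)
   also have "ennreal R * ennreal (e / R) = ennreal e"
    using \<open>1 <= R\<close> \<open>0 < e\<close> by (simp add: ennreal_mult[symmetric])
   also have "ennreal R * ((1 + ennreal (5 ^ DIM('a) + 1)) * ?I) = ennreal K * ?I"
   proof -
    have "1 + ennreal (5 ^ DIM('a) + 1) = ennreal 1 + ennreal (5 ^ DIM('a) + 1)" by simp
    also have "... = ennreal (1 + (5 ^ DIM('a) + 1))" by (rule ennreal_plus[symmetric]) auto
    also have "1 + (5 ^ DIM('a) + 1) = (5 ^ DIM('a) + 2 :: real)" by simp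
    finally have "ennreal R * (1 + ennreal (5 ^ DIM('a) + 1)) = ennreal K"
     unfolding K_def using R(2) by (simp only:) (intro ennreal_mult[symmetric], auto)
    then show ?thesis by (simp only: mult.assoc[symmetric])
   qed
   finally show "emeasure lborel ?S <= ennreal K * ?I + ennreal e" .
  qed
 qed
 then show ?thesis using \<open>0 < K\<close> by blast
qed

section \<open>Integrals of products over the coordinates\<close>

lemma
 fixes F :: "'a::euclidean_space => real => 'b::{real_normed_field,banach,second_countable_topology}"
 assumes F: "!!i. i \<in> Basis ==> integrable lborel (F i)"
 shows integrable_prod_Basis: "integrable lborel (\<lambda>x. \<Prod>i\<in>Basis. F i (x \<bullet> i))"
  and integral_prod_Basis: "(LBINT x. (\<Prod>i\<in>Basis. F i (x \<bullet> i))) = (\<Prod>i\<in>Basis. LBINT y. F i y)"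
proof -
 interpret product_sigma_finite "\<lambda>_::'a. lborel :: real measure" by standard
 let ?T = "\<lambda>f. \<Sum>b\<in>Basis. f b *\<^sub>R (b::'a)"
 have F'[measurable]: "F i \<in> borel_measurable borel" if "i \<in> Basis" for i
  using borel_measurable_integrable[OF F[OF that]] by simp
 have m: "(\<lambda>x. \<Prod>i\<in>Basis. F i (x \<bullet> i)) \<in> borel_measurable borel"
  by (intro borel_measurable_prod measurable_compose[OF _ F']) auto
 have T: "?T \<in> measurable (\<Pi>\<^sub>M b\<in>(Basis::'a set). (lborel :: real measure)) borel"
  by measurable
 have eq: "(\<Prod>i\<in>Basis. F i (?T f \<bullet> i)) = (\<Prod>i\<in>Basis. F i (f i))" for f
  by (intro prod.cong) (auto simp: inner_sum_left inner_Basis if_distrib[of "(*) _"] sum.delta cong: if_cong)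
 have "integrable (\<Pi>\<^sub>M b\<in>(Basis::'a set). lborel) (\<lambda>f. \<Prod>i\<in>Basis. F i (f i))"
  by (rule product_integrable_prod) (use F in auto)
 then show "integrable lborel (\<lambda>x. \<Prod>i\<in>Basis. F i (x \<bullet> i))"
  unfolding lborel_eq[where 'a='a] by (subst integrable_distr_eq[OF T m]) (simp only: eq)
 have "(LBINT x. (\<Prod>i\<in>Basis. F i (x \<bullet> i))) = (\<integral>f. (\<Prod>i\<in>Basis. F i (f i)) \<partial>(\<Pi>\<^sub>M b\<in>(Basis::'a set). lborel))"
  by (subst (1) lborel_eq[where 'a='a], subst integral_distr[OF T m]) (simp only: eq)
 also have "... = (\<Prod>i\<in>Basis. LBINT y. F i y)"
  by (rule product_integral_prod) (use F in auto)
 finally show "(LBINT x. (\<Prod>i\<in>Basis. F i (x \<bullet> i))) = (\<Prod>i\<in>Basis. LBINT y. F i y)" .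
qed

section \<open>Heat kernels and test functions with vanishing moments\<close>

text \<open>The Gaussian density with variance t / (2 pi) in every coordinate. With this time
  normalisation the Fourier transform is exp (- pi t |xi|^2), with no further constants.\<close>

definition heat :: "real => 'a::euclidean_space => real" where
 "heat t z = t powr (- real DIM('a) / 2) * exp (- pi * (norm z)\<^sup>2 / t)"

lemma heat_measurable [measurable]: "(\<lambda>(t, z). heat t (z::'a::euclidean_space)) \<in> borel_measurable (borel \<Otimes>\<^sub>M borel)"
 unfolding heat_def by measurable

lemma heat_nonneg [simp]: "0 <= heat t z"
 by (simp add: heat_def)

lemma heat_minus: "heat t (- z) = heat t z"
 by (simp add: heat_def)

lemma cis_measurable [measurable]: "cis \<in> borel_measurable borel"
 by (intro borel_measurable_continuous_onI continuous_intros)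

abbreviation heat_sd :: "real => real" where
 "heat_sd t \<equiv> sqrt (t / (2 * pi))"

lemma norm_power2_Basis: "(norm (x::'a::euclidean_space))\<^sup>2 = (\<Sum>i\<in>Basis. (x \<bullet> i)\<^sup>2)"
 unfolding power2_norm_eq_inner by (subst euclidean_inner) (simp add: power2_eq_square)

lemma heat_eq_prod:
 fixes x y :: "'a::euclidean_space"
 assumes "0 < t"
 shows "heat t (y - x) = (\<Prod>i\<in>Basis. normal_density (x \<bullet> i) (heat_sd t) (y \<bullet> i))"
proof -
 have nd: "normal_density \<mu> (heat_sd t) u = t powr (- 1 / 2) * exp (- pi * (u - \<mu>)\<^sup>2 / t)" for \<mu> u
  using assms by (simp add: normal_density_def powr_minus powr_half_sqrt divide_simps)
 have "(\<Prod>i\<in>Basis. normal_density (x \<bullet> i) (heat_sd t) (y \<bullet> i)) = (\<Prod>i\<in>(Basis::'a set). t powr (- 1 / 2)) * (\<Prod>i\<in>Basis. exp (- pi * (y \<bullet> i - x \<bullet> i)\<^sup>2 / t))"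
  unfolding nd by (rule prod.distrib)
 also have "(\<Prod>i\<in>(Basis::'a set). t powr (- 1 / 2)) = t powr (- real DIM('a) / 2)"
  using assms by (simp add: powr_power)
 also have "(\<Prod>i\<in>Basis. exp (- pi * (y \<bullet> i - x \<bullet> i)\<^sup>2 / t)) = exp (\<Sum>i\<in>Basis. - pi * (y \<bullet> i - x \<bullet> i)\<^sup>2 / t)"
  by (simp add: exp_sum)
 also have "(\<Sum>i\<in>Basis. - pi * (y \<bullet> i - x \<bullet> i)\<^sup>2 / t) = - pi * (norm (y - x))\<^sup>2 / t"
  unfolding norm_power2_Basis by (simp add: inner_diff_left sum_distrib_left sum_divide_distrib sum_negf)
 finally show ?thesis by (simp add: heat_def)
qed

lemma heat_sd_pos: "0 < t ==> 0 < heat_sd t"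
 by simp

lemma
 fixes x :: "'a::euclidean_space"
 assumes "0 < t"
 shows heat_integrable: "integrable lborel (\<lambda>y. heat t (y - x))"
  and heat_integral: "(LBINT y. heat t (y - x)) = 1"
  and heat_nn_integral: "(NBINT y. ennreal (heat t (y - x))) = 1"
proof -
 have i: "integrable lborel (normal_density (x \<bullet> i) (heat_sd t))" for i
  using assms by (intro integrable_normal_density) auto
 show a: "integrable lborel (\<lambda>y. heat t (y - x))"
  unfolding heat_eq_prod[OF assms] by (rule integrable_prod_Basis[OF i])
 show b: "(LBINT y. heat t (y - x)) = 1"
  unfolding heat_eq_prod[OF assms] using assms by (subst integral_prod_Basis[OF i]) (simp add: integral_normal_density)
 show "(NBINT y. ennreal (heat t (y - x))) = 1"
  by (subst nn_integral_eq_integral[OF a]) (auto simp: b)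
qed

lemma
 fixes \<mu> \<sigma> \<theta> :: real
 assumes "0 < \<sigma>"
 shows normal_density_cis_integrable: "integrable lborel (\<lambda>y. complex_of_real (normal_density \<mu> \<sigma> y) * cis (\<theta> * y))"
  and normal_density_cis_integral: "(LBINT y. complex_of_real (normal_density \<mu> \<sigma> y) * cis (\<theta> * y))
   = cis (\<theta> * \<mu>) * complex_of_real (exp (- (\<sigma> * \<theta>)\<^sup>2 / 2))"
proof -
 show "integrable lborel (\<lambda>y. complex_of_real (normal_density \<mu> \<sigma> y) * cis (\<theta> * y))"
 proof (rule Bochner_Integration.integrable_bound)
  show "integrable lborel (normal_density \<mu> \<sigma>)" using assms by (rule integrable_normal_density)
 qed (auto simp: norm_mult)
 have "(LBINT y. complex_of_real (normal_density \<mu> \<sigma> y) * cis (\<theta> * y))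
  = \<sigma> *\<^sub>R (LBINT x. complex_of_real (normal_density \<mu> \<sigma> (\<mu> + \<sigma> * x)) * cis (\<theta> * (\<mu> + \<sigma> * x)))"
  using lborel_integral_real_affine[of \<sigma> "\<lambda>y. complex_of_real (normal_density \<mu> \<sigma> y) * cis (\<theta> * y)" \<mu>] assms by (simp only: abs_of_pos)
 also have "... = (LBINT x. cis (\<theta> * \<mu>) * (std_normal_density x *\<^sub>R iexp ((\<sigma> * \<theta>) * x)))"
 proof (subst integral_scaleR_right[symmetric], intro Bochner_Integration.integral_cong refl)
  fix x
  have 1: "sqrt (2 * pi * \<sigma>\<^sup>2) = sqrt (2 * pi) * \<sigma>"
   unfolding real_sqrt_mult[of "2 * pi"] using assms by simp
  have 2: "- (\<mu> + \<sigma> * x - \<mu>)\<^sup>2 / (2 * \<sigma>\<^sup>2) = - x\<^sup>2 / 2"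
   using assms by (simp add: power_mult_distrib)
  have "normal_density \<mu> \<sigma> (\<mu> + \<sigma> * x) = 1 / (sqrt (2 * pi) * \<sigma>) * exp (- x\<^sup>2 / 2)"
   unfolding normal_density_def 1 2 ..
  then have "\<sigma> * normal_density \<mu> \<sigma> (\<mu> + \<sigma> * x) = std_normal_density x"
   using assms by (simp only: std_normal_density_def) simp
  moreover have "\<sigma> *\<^sub>R (complex_of_real N * c) = (\<sigma> * N) *\<^sub>R c" for N c
   by (simp add: scaleR_conv_of_real)
  ultimately have 3: "\<sigma> *\<^sub>R (complex_of_real (normal_density \<mu> \<sigma> (\<mu> + \<sigma> * x)) * cis (\<theta> * (\<mu> + \<sigma> * x)))
   = std_normal_density x *\<^sub>R cis (\<theta> * (\<mu> + \<sigma> * x))"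
   by (simp only:)
  have 4: "cis (\<theta> * (\<mu> + \<sigma> * x)) = cis (\<theta> * \<mu>) * iexp ((\<sigma> * \<theta>) * x)"
   unfolding cis_conv_exp[symmetric] cis_mult by (simp add: algebra_simps)
  show "\<sigma> *\<^sub>R (complex_of_real (normal_density \<mu> \<sigma> (\<mu> + \<sigma> * x)) * cis (\<theta> * (\<mu> + \<sigma> * x)))
   = cis (\<theta> * \<mu>) * (std_normal_density x *\<^sub>R iexp ((\<sigma> * \<theta>) * x))"
   unfolding 3 unfolding 4 mult_scaleR_right ..
 qed
 also have "... = cis (\<theta> * \<mu>) * char std_normal_distribution (\<sigma> * \<theta>)"
  unfolding integral_mult_right_zero char_def by (subst integral_density) auto
 finally show "(LBINT y. complex_of_real (normal_density \<mu> \<sigma> y) * cis (\<theta> * y))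
   = cis (\<theta> * \<mu>) * complex_of_real (exp (- (\<sigma> * \<theta>)\<^sup>2 / 2))"
  by (simp add: char_std_normal_distribution)
qed

lemma cis_sum: "finite A ==> cis (\<Sum>i\<in>A. f i) = (\<Prod>i\<in>A. cis (f i))"
 by (induction A rule: finite_induct) (auto simp: cis_mult[symmetric])

lemma
 fixes x \<xi> :: "'a::euclidean_space"
 assumes "0 < t"
 shows heat_cis_integrable: "integrable lborel (\<lambda>y. complex_of_real (heat t (y - x)) * cis (2 * pi * (y \<bullet> \<xi>)))"
  and heat_cis_integral: "(LBINT y. complex_of_real (heat t (y - x)) * cis (2 * pi * (y \<bullet> \<xi>)))
   = cis (2 * pi * (x \<bullet> \<xi>)) * complex_of_real (exp (- pi * t * (norm \<xi>)\<^sup>2))"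
proof -
 let ?F = "\<lambda>i y. complex_of_real (normal_density (x \<bullet> i) (heat_sd t) y) * cis ((2 * pi * (\<xi> \<bullet> i)) * y)"
 have i: "integrable lborel (?F i)" for i
  by (rule normal_density_cis_integrable[OF heat_sd_pos[OF assms]])
 have c: "cis (2 * pi * (y \<bullet> \<xi>)) = (\<Prod>i\<in>Basis. cis ((2 * pi * (\<xi> \<bullet> i)) * (y \<bullet> i)))" for y
 proof -
  have "2 * pi * (y \<bullet> \<xi>) = (\<Sum>i\<in>Basis. (2 * pi * (\<xi> \<bullet> i)) * (y \<bullet> i))"
   by (subst euclidean_inner) (simp add: sum_distrib_left mult_ac)
  then show ?thesis by (simp only: cis_sum[OF finite_Basis])
 qed
 have eq: "complex_of_real (heat t (y - x)) * cis (2 * pi * (y \<bullet> \<xi>)) = (\<Prod>i\<in>Basis. ?F i (y \<bullet> i))" for y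
  unfolding heat_eq_prod[OF assms] c of_real_prod by (rule prod.distrib[symmetric])
 show "integrable lborel (\<lambda>y. complex_of_real (heat t (y - x)) * cis (2 * pi * (y \<bullet> \<xi>)))"
  unfolding eq by (rule integrable_prod_Basis[OF i])
 have "(LBINT y. complex_of_real (heat t (y - x)) * cis (2 * pi * (y \<bullet> \<xi>)))
  = (\<Prod>i\<in>Basis. cis ((2 * pi * (\<xi> \<bullet> i)) * (x \<bullet> i)) * complex_of_real (exp (- (heat_sd t * (2 * pi * (\<xi> \<bullet> i)))\<^sup>2 / 2)))"
  unfolding eq integral_prod_Basis[OF i] normal_density_cis_integral[OF heat_sd_pos[OF assms]] ..
 also have "... = cis (2 * pi * (x \<bullet> \<xi>)) * complex_of_real (\<Prod>i\<in>Basis. exp (- (heat_sd t * (2 * pi * (\<xi> \<bullet> i)))\<^sup>2 / 2))"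
  unfolding c prod.distrib of_real_prod ..
 also have "(\<Prod>i\<in>Basis. exp (- (heat_sd t * (2 * pi * (\<xi> \<bullet> i)))\<^sup>2 / 2)) = exp (\<Sum>i\<in>Basis. - (heat_sd t * (2 * pi * (\<xi> \<bullet> i)))\<^sup>2 / 2)"
  by (simp add: exp_sum)
 also have "(\<Sum>i\<in>Basis. - (heat_sd t * (2 * pi * (\<xi> \<bullet> i)))\<^sup>2 / 2) = (\<Sum>i\<in>Basis. - pi * t * (\<xi> \<bullet> i)\<^sup>2)"
  using assms by (intro sum.cong) (auto simp: power_mult_distrib power2_eq_square)
 also have "... = - pi * t * (norm \<xi>)\<^sup>2"
  unfolding norm_power2_Basis by (simp add: sum_distrib_left)
 finally show "(LBINT y. complex_of_real (heat t (y - x)) * cis (2 * pi * (y \<bullet> \<xi>)))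
   = cis (2 * pi * (x \<bullet> \<xi>)) * complex_of_real (exp (- pi * t * (norm \<xi>)\<^sup>2))" .
qed

text \<open>The Gaussian in the frequency variable is a multiple of \<open>heat (1 / t)\<close>, so
  the forward formula also gives the inverse transform.\<close>

lemma
 fixes z :: "'a::euclidean_space"
 assumes "0 < t"
 shows gauss_cis_integrable: "integrable lborel (\<lambda>\<xi>. complex_of_real (exp (- pi * t * (norm \<xi>)\<^sup>2)) * cis (2 * pi * (\<xi> \<bullet> z)))"
  and gauss_cis_integral: "(LBINT \<xi>. complex_of_real (exp (- pi * t * (norm \<xi>)\<^sup>2)) * cis (2 * pi * (\<xi> \<bullet> z))) = complex_of_real (heat t z)"
proof -
 have t: "0 < 1 / t" using assms by simp
 have eq: "complex_of_real (exp (- pi * t * (norm \<xi>)\<^sup>2)) * cis (2 * pi * (\<xi> \<bullet> z))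
  = complex_of_real (t powr (- real DIM('a) / 2)) * (complex_of_real (heat (1 / t) (\<xi> - 0)) * cis (2 * pi * (\<xi> \<bullet> z)))" for \<xi>
 proof -
  have "t powr (- real DIM('a) / 2) * heat (1 / t) \<xi> = (t powr (- real DIM('a) / 2) * t powr (real DIM('a) / 2)) * exp (- pi * t * (norm \<xi>)\<^sup>2)"
   using assms by (simp add: heat_def powr_divide powr_minus divide_simps)
  also have "t powr (- real DIM('a) / 2) * t powr (real DIM('a) / 2) = 1"
   using assms by (simp flip: powr_add)
  finally have "exp (- pi * t * (norm \<xi>)\<^sup>2) = t powr (- real DIM('a) / 2) * heat (1 / t) (\<xi> - 0)" by simp
  then show ?thesis by (simp only: of_real_mult mult.assoc)
 qed
 show "integrable lborel (\<lambda>\<xi>. complex_of_real (exp (- pi * t * (norm \<xi>)\<^sup>2)) * cis (2 * pi * (\<xi> \<bullet> z)))"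
  unfolding eq by (intro integrable_mult_right heat_cis_integrable t)
 show "(LBINT \<xi>. complex_of_real (exp (- pi * t * (norm \<xi>)\<^sup>2)) * cis (2 * pi * (\<xi> \<bullet> z))) = complex_of_real (heat t z)"
  unfolding eq integral_mult_right_zero heat_cis_integral[OF t] by (simp add: heat_def)
qed

definition osc :: "real => real" where
 "osc v = exp (- v\<^sup>2) * sin (2 * pi * v)"

lemma osc_measurable [measurable]: "osc \<in> borel_measurable borel"
 unfolding osc_def[abs_def] by measurable

lemma exp_minus_square_eq: "exp (- (v\<^sup>2)) = sqrt pi * normal_density 0 (sqrt (1 / 2)) v"
 by (simp add: normal_density_def)

lemma integrable_exp_minus_square: "integrable lborel (\<lambda>v::real. exp (- v\<^sup>2) * exp (k * v))"
proof -
 have e: "exp (- v\<^sup>2) * exp (k * v) = exp (k\<^sup>2 / 4) * exp (- (- (k / 2) + v)\<^sup>2)" for v :: real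
  by (simp add: power2_eq_square field_simps flip: exp_add)
 have "integrable lborel (\<lambda>v::real. exp (- v\<^sup>2))"
  unfolding exp_minus_square_eq by (intro integrable_mult_right integrable_normal_density) simp
 then show ?thesis
  unfolding e by (intro integrable_mult_right integrable_lborel_shift)
qed

lemma osc_abs_le: "\<bar>osc v\<bar> <= exp (- v\<^sup>2)"
 by (simp add: osc_def abs_mult mult_left_le)

lemma osc_exp_integrable: "integrable lborel (\<lambda>v. osc v * exp (k * v))"
proof (rule Bochner_Integration.integrable_bound[OF integrable_exp_minus_square[of k]])
 show "AE v in lborel. norm (osc v * exp (k * v)) <= norm (exp (- v\<^sup>2) * exp (k * v))"
  using osc_abs_le by (intro AE_I2) (auto simp: abs_mult intro!: mult_right_mono)
qed measurable

text \<open>Shifting v by k / 2 completes the square and splits the sine by its addition formula;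
  the odd part integrates to 0. The factor sin (pi k) carries the whole construction: it vanishes at
  the integers and at no other exponent.\<close>

lemma osc_exp_integral: "(LBINT v. osc v * exp (k * v)) = exp (k\<^sup>2 / 4) * sin (pi * k) * (sqrt pi * exp (- pi\<^sup>2))"
proof -
 let ?E = "\<lambda>v. complex_of_real (exp (- v\<^sup>2)) * cis (2 * pi * v)"
 have E: "?E = (\<lambda>v. complex_of_real (sqrt pi) * (complex_of_real (normal_density 0 (sqrt (1 / 2)) v) * cis ((2 * pi) * v)))"
  unfolding exp_minus_square_eq of_real_mult mult.assoc ..
 have Ei: "integrable lborel ?E"
  unfolding E by (intro integrable_mult_right normal_density_cis_integrable) simp
 have EI: "(LBINT v. ?E v) = complex_of_real (sqrt pi * exp (- pi\<^sup>2))"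
  unfolding E integral_mult_right_zero
  by (subst normal_density_cis_integral) (auto simp: power_mult_distrib real_sqrt_divide power_divide)
 have s: "integrable lborel (\<lambda>v. exp (- v\<^sup>2) * sin (2 * pi * v))" "(LBINT v. exp (- v\<^sup>2) * sin (2 * pi * v)) = 0"
  using integrable_Im[OF Ei] integral_Im[OF Ei] EI by simp_all
 have c: "integrable lborel (\<lambda>v. exp (- v\<^sup>2) * cos (2 * pi * v))" "(LBINT v. exp (- v\<^sup>2) * cos (2 * pi * v)) = sqrt pi * exp (- pi\<^sup>2)"
  using integrable_Re[OF Ei] integral_Re[OF Ei] EI by simp_all
 have "(LBINT v. osc v * exp (k * v)) = (LBINT v. osc (k / 2 + v) * exp (k * (k / 2 + v)))"
  by (rule integral_lborel_shift[symmetric]) measurable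
 also have "... = (LBINT v. exp (k\<^sup>2 / 4) * sin (pi * k) * (exp (- v\<^sup>2) * cos (2 * pi * v)) + exp (k\<^sup>2 / 4) * cos (pi * k) * (exp (- v\<^sup>2) * sin (2 * pi * v)))"
 proof (intro Bochner_Integration.integral_cong refl)
  fix v
  have "- (k / 2 + v)\<^sup>2 + k * (k / 2 + v) = k\<^sup>2 / 4 + - v\<^sup>2" by (simp add: power2_eq_square field_simps)
  then have 1: "exp (- (k / 2 + v)\<^sup>2) * exp (k * (k / 2 + v)) = exp (k\<^sup>2 / 4) * exp (- v\<^sup>2)"
   by (simp only: exp_add[symmetric])
  have 2: "sin (2 * pi * (k / 2 + v)) = sin (pi * k) * cos (2 * pi * v) + cos (pi * k) * sin (2 * pi * v)"
   unfolding sin_add[symmetric] by (simp add: algebra_simps)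
  have "osc (k / 2 + v) * exp (k * (k / 2 + v)) = (exp (- (k / 2 + v)\<^sup>2) * exp (k * (k / 2 + v))) * sin (2 * pi * (k / 2 + v))"
   by (simp only: osc_def mult_ac)
  also note 1
  also note 2
  finally have "osc (k / 2 + v) * exp (k * (k / 2 + v)) = exp (k\<^sup>2 / 4) * exp (- v\<^sup>2) * (sin (pi * k) * cos (2 * pi * v) + cos (pi * k) * sin (2 * pi * v))" .
  then show "osc (k / 2 + v) * exp (k * (k / 2 + v)) = exp (k\<^sup>2 / 4) * sin (pi * k) * (exp (- v\<^sup>2) * cos (2 * pi * v)) + exp (k\<^sup>2 / 4) * cos (pi * k) * (exp (- v\<^sup>2) * sin (2 * pi * v))"
   by (simp add: algebra_simps)
 qed
 also have "... = exp (k\<^sup>2 / 4) * sin (pi * k) * (sqrt pi * exp (- pi\<^sup>2))"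
  using s c by (subst Bochner_Integration.integral_add) auto
 finally show ?thesis .
qed

lemma osc_poly_integral:
 fixes P :: "real poly"
 shows "(LBINT v. osc v * poly P (r * exp v)) = 0" and "integrable lborel (\<lambda>v. osc v * poly P (r * exp v))"
proof -
 have e: "osc v * poly P (r * exp v) = (\<Sum>i\<le>degree P. coeff P i * r ^ i * (osc v * exp (real i * v)))" for v
  unfolding poly_altdef by (simp add: sum_distrib_left power_mult_distrib exp_of_nat2_mult mult_ac)
 show "integrable lborel (\<lambda>v. osc v * poly P (r * exp v))"
  unfolding e by (intro Bochner_Integration.integrable_sum integrable_mult_right osc_exp_integrable)
 have z: "(LBINT v. osc v * exp (real i * v)) = 0" for i
  unfolding osc_exp_integral by simp
 show "(LBINT v. osc v * poly P (r * exp v)) = 0"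
  unfolding e by (subst Bochner_Integration.integral_sum) (auto simp: z intro!: integrable_mult_right osc_exp_integrable)
qed

text \<open>For suitable \<beta> and c this is, up to a factor, the mixture of heat kernels over
  scales. The exponent \<beta> is free because differentiation raises it by 1, so that the family
  reproduces itself up to factors linear in z.\<close>

definition osc_mix :: "real => real => 'a::euclidean_space => real" where
 "osc_mix \<beta> c z = (LBINT v. osc v * exp (- \<beta> * v) * exp (- c * (norm z)\<^sup>2 * exp (- v)))"

lemma osc_mult_integrable:
 assumes [measurable]: "f \<in> borel_measurable borel" and "!!v. \<bar>f v\<bar> <= B * exp (k * v)"
 shows "integrable lborel (\<lambda>v. osc v * f v)" and "\<bar>(LBINT v. osc v * f v)\<bar> <= B * (LBINT v. exp (- v\<^sup>2) * exp (k * v))"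
proof -
 have i: "integrable lborel (\<lambda>v. B * (exp (- v\<^sup>2) * exp (k * v)))"
  by (intro integrable_mult_right integrable_exp_minus_square)
 have le: "\<bar>osc v * f v\<bar> <= B * (exp (- v\<^sup>2) * exp (k * v))" for v
  using mult_mono[OF osc_abs_le[of v] assms(2)[of v]] by (simp add: abs_mult mult_ac)
 show a: "integrable lborel (\<lambda>v. osc v * f v)"
  by (rule Bochner_Integration.integrable_bound[OF i]) (use le in \<open>auto intro: order_trans[OF _ abs_ge_self]\<close>)
 have "norm (LBINT v. osc v * f v) <= (LBINT v. norm (osc v * f v))" by (rule integral_norm_bound)
 also have "... <= (LBINT v. B * (exp (- v\<^sup>2) * exp (k * v)))"
  using a i le by (intro integral_mono) auto
 finally show "\<bar>(LBINT v. osc v * f v)\<bar> <= B * (LBINT v. exp (- v\<^sup>2) * exp (k * v))" by simp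
qed

lemma power_mult_exp_minus_le:
 fixes x :: real
 assumes "0 <= x"
 shows "x ^ M * exp (- x) <= real M ^ M"
proof (cases "M = 0")
 case False
 have "x / M <= exp (x / M)" using exp_ge_add_one_self[of "x / M"] by linarith
 then have "x <= M * exp (x / M)" using False by (simp add: field_simps)
 then have "x ^ M <= (M * exp (x / M)) ^ M" using assms by (rule power_mono)
 also have "... = real M ^ M * exp x" using False by (simp add: power_mult_distrib flip: exp_of_nat_mult)
 finally show ?thesis by (simp add: exp_minus field_simps)
qed (use assms in simp)

text \<open>The bound M^M for x^M exp (- x) trades |z|^(2 M) for exp (M v), which the Gaussian
  factor in \<open>osc\<close> absorbs for every M. A single heat kernel would have better decay;
  here all scales exp v occur at once.\<close>

lemma osc_mix_decay:
 assumes "0 < c"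
 shows "\<exists>B. \<forall>z::'a::euclidean_space. ((norm z)\<^sup>2) ^ M * \<bar>osc_mix \<beta> c z\<bar> <= B"
proof (intro exI allI)
 fix z :: 'a
 let ?r = "(norm z)\<^sup>2"
 have le: "\<bar>?r ^ M * (exp (- \<beta> * v) * exp (- c * ?r * exp (- v)))\<bar> <= (real M ^ M / c ^ M) * exp ((M - \<beta>) * v)" for v
 proof -
  have "(c * ?r * exp (- v)) ^ M * exp (- (c * ?r * exp (- v))) <= real M ^ M"
   using assms by (intro power_mult_exp_minus_le) auto
  then have "c ^ M * (?r ^ M * exp (- c * ?r * exp (- v))) * exp (- v) ^ M <= real M ^ M"
   by (simp add: power_mult_distrib mult_ac)
  then have "?r ^ M * exp (- c * ?r * exp (- v)) <= real M ^ M / c ^ M * exp (M * v)"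
   using assms by (simp add: exp_minus exp_of_nat_mult exp_of_nat2_mult power_inverse divide_simps mult_ac)
  then have "exp (- \<beta> * v) * (?r ^ M * exp (- c * ?r * exp (- v))) <= exp (- \<beta> * v) * (real M ^ M / c ^ M * exp (M * v))"
   by (intro mult_left_mono) auto
  also have "... = real M ^ M / c ^ M * exp ((M - \<beta>) * v)"
  proof -
   have "exp ((M - \<beta>) * v) = exp (- \<beta> * v) * exp (M * v)" by (simp add: algebra_simps flip: exp_add)
   then show ?thesis by simp
  qed
  finally show ?thesis by (simp add: abs_mult mult_ac)
 qed
 have "?r ^ M * osc_mix \<beta> c z = (LBINT v. osc v * (?r ^ M * (exp (- \<beta> * v) * exp (- c * ?r * exp (- v)))))"
  unfolding osc_mix_def integral_mult_right_zero[symmetric] by (simp only: mult_ac)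
 then have "\<bar>?r ^ M * osc_mix \<beta> c z\<bar> <= (real M ^ M / c ^ M) * (LBINT v. exp (- v\<^sup>2) * exp ((M - \<beta>) * v))"
  using osc_mult_integrable(2)[OF _ le] by simp
 then show "?r ^ M * \<bar>osc_mix \<beta> c z\<bar> <= (real M ^ M / c ^ M) * (LBINT v. exp (- v\<^sup>2) * exp ((M - \<beta>) * v))"
  by (simp add: abs_mult)
qed

lemma exp_second_order:
 fixes a b :: real
 assumes "a <= 0" "b <= 0"
 shows "\<bar>exp b - exp a - (b - a) * exp a\<bar> <= (b - a)\<^sup>2"
proof -
 have 1: "(b - a) * exp a <= exp b - exp a"
  using mult_left_mono[OF exp_ge_add_one_self[of "b - a"], of "exp a"] by (simp add: algebra_simps flip: exp_add)
 have 2: "exp b - exp a <= (b - a) * exp b"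
  using mult_left_mono[OF exp_ge_add_one_self[of "a - b"], of "exp b"] by (simp add: algebra_simps flip: exp_add)
 have "exp b - exp a - (b - a) * exp a <= (b - a) * (exp b - exp a)"
  using 2 by (simp add: algebra_simps)
 also have "... <= (b - a)\<^sup>2"
 proof (cases "a <= b")
  case True
  have "(b - a) * exp b <= b - a" using True assms by (simp add: mult_left_le)
  then show ?thesis using 2 True by (auto simp: power2_eq_square intro!: mult_left_mono)
 next
  case False
  have "0 <= (a - b) * (1 - exp a)" using False assms by (intro mult_nonneg_nonneg) auto
  then have "b - a <= exp b - exp a" using 1 by (simp add: algebra_simps)
  then have "(b - a) * (exp b - exp a) <= (b - a) * (b - a)" using False by (intro mult_left_mono_neg) auto
  then show ?thesis by (simp add: power2_eq_square)
 qed
 finally show ?thesis using 1 by simp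
qed

lemma osc_mix_integrable:
 assumes "0 < c"
 shows "integrable lborel (\<lambda>v. osc v * (exp (- \<beta> * v) * exp (- c * (norm z)\<^sup>2 * exp (- v))))"
proof (rule osc_mult_integrable(1)[where B=1 and k="- \<beta>"])
 fix v
 have "exp (- c * (norm z)\<^sup>2 * exp (- v)) <= 1" using assms by (simp add: mult_nonneg_nonneg)
 then show "\<bar>exp (- \<beta> * v) * exp (- c * (norm z)\<^sup>2 * exp (- v))\<bar> <= 1 * exp (- \<beta> * v)"
  by (simp add: abs_mult mult_left_le)
qed measurable

text \<open>Differentiation under the integral with a quantitative remainder: pointwise in v it is
  at most |h|^2 times exponentials in v, whose integrals against \<open>osc\<close>
  converge.\<close>

lemma osc_mix_has_derivative:
 fixes z :: "'a::euclidean_space"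
 assumes c: "0 < c"
 shows "(osc_mix \<beta> c has_derivative (\<lambda>h. - 2 * c * (z \<bullet> h) * osc_mix (\<beta> + 1) c z)) (at z)"
proof -
 let ?m = "\<lambda>k. LBINT v. exp (- v\<^sup>2) * exp (k * v)"
 define K where "K = (c * (2 * norm z + 1))\<^sup>2 * ?m (- \<beta> - 2) + c * ?m (- \<beta> - 1)"
 have bound: "\<bar>osc_mix \<beta> c y - osc_mix \<beta> c z - (- 2 * c * (z \<bullet> (y - z)) * osc_mix (\<beta> + 1) c z)\<bar> <= K * (norm (y - z))\<^sup>2" if "norm (y - z) < 1" for y
 proof -
  define h where "h = y - z"
  have y: "y = z + h" by (simp add: h_def)
  define a where "a v = - c * (norm z)\<^sup>2 * exp (- v)" for v
  define b where "b v = - c * (norm y)\<^sup>2 * exp (- v)" for v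
  have [measurable]: "a \<in> borel_measurable borel" "b \<in> borel_measurable borel" unfolding a_def[abs_def] b_def[abs_def] by measurable
  have ab0: "a v <= 0" "b v <= 0" for v using c by (auto simp: a_def b_def)
  have ba: "b v - a v = - c * exp (- v) * (2 * (z \<bullet> h) + (norm h)\<^sup>2)" for v
   unfolding a_def b_def y power2_norm_eq_inner by (simp add: inner_add_left inner_add_right inner_commute algebra_simps)
  \<comment> \<open>The remainder in two pieces: \<open>?f1\<close> is the second order error of the
    exponential between the exponents a v and b v, and \<open>?f2\<close> comes from the term |h|^2
    in b v - a v.\<close>
  let ?f1 = "\<lambda>v. exp (- \<beta> * v) * (exp (b v) - exp (a v) - (b v - a v) * exp (a v))"
  let ?f2 = "\<lambda>v. - c * (norm h)\<^sup>2 * exp (- (\<beta> + 1) * v) * exp (a v)"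
  have e1: "exp (- (\<beta> + 1) * v) = exp (- \<beta> * v) * exp (- v)" for v by (simp add: algebra_simps flip: exp_add)
  have h1: "\<bar>2 * (z \<bullet> h) + (norm h)\<^sup>2\<bar> <= (2 * norm z + 1) * norm h"
  proof -
   have "\<bar>z \<bullet> h\<bar> <= norm z * norm h" by (rule Cauchy_Schwarz_ineq2)
   moreover have "(norm h)\<^sup>2 <= norm h" using that by (simp add: h_def power2_eq_square mult_left_le)
   moreover have "0 <= (norm h)\<^sup>2" by simp
   moreover have "(2 * norm z + 1) * norm h = 2 * (norm z * norm h) + norm h" by (simp add: algebra_simps)
   ultimately show ?thesis by linarith
  qed
  have b1: "\<bar>?f1 v\<bar> <= ((c * (2 * norm z + 1))\<^sup>2 * (norm h)\<^sup>2) * exp ((- \<beta> - 2) * v)" for v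
  proof -
   have "\<bar>exp (b v) - exp (a v) - (b v - a v) * exp (a v)\<bar> <= (b v - a v)\<^sup>2" by (intro exp_second_order ab0)
   also have "\<bar>b v - a v\<bar> <= c * exp (- v) * ((2 * norm z + 1) * norm h)"
    unfolding ba abs_mult using c h1 by (auto intro!: mult_left_mono)
   then have "(b v - a v)\<^sup>2 <= (c * exp (- v) * ((2 * norm z + 1) * norm h))\<^sup>2"
    by (rule power2_le_iff_abs_le[THEN iffD2, rotated]) (use c in auto)
   finally have "exp (- \<beta> * v) * \<bar>exp (b v) - exp (a v) - (b v - a v) * exp (a v)\<bar> <= exp (- \<beta> * v) * (c * exp (- v) * ((2 * norm z + 1) * norm h))\<^sup>2"
    by (intro mult_left_mono) auto
   also have "... = ((c * (2 * norm z + 1))\<^sup>2 * (norm h)\<^sup>2) * (exp (- \<beta> * v) * exp (- v) * exp (- v))"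
    by (simp add: power2_eq_square mult_ac)
   also have "exp (- \<beta> * v) * exp (- v) * exp (- v) = exp ((- \<beta> - 2) * v)" by (simp add: algebra_simps flip: exp_add)
   finally show ?thesis by (simp add: abs_mult)
  qed
  have b2: "\<bar>?f2 v\<bar> <= (c * (norm h)\<^sup>2) * exp ((- \<beta> - 1) * v)" for v
  proof -
   have "exp (a v) <= 1" using ab0 by simp
   then have "(c * (norm h)\<^sup>2) * exp (- (\<beta> + 1) * v) * exp (a v) <= (c * (norm h)\<^sup>2) * exp (- (\<beta> + 1) * v)"
    using c by (simp add: mult_left_le)
   moreover have "- (\<beta> + 1) * v = (- \<beta> - 1) * v" by simp
   ultimately show ?thesis using c by (simp add: abs_mult)
  qed
  note i1 = osc_mult_integrable[OF _ b1] and i2 = osc_mult_integrable[OF _ b2]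
  have iy: "integrable lborel (\<lambda>v. osc v * (exp (- \<beta> * v) * exp (b v)))"
   unfolding b_def by (rule osc_mix_integrable[OF c])
  have iz: "integrable lborel (\<lambda>v. osc v * (exp (- \<beta> * v) * exp (a v)))"
   unfolding a_def by (rule osc_mix_integrable[OF c])
  have iz1: "integrable lborel (\<lambda>v. osc v * (exp (- (\<beta> + 1) * v) * exp (a v)))"
   unfolding a_def by (rule osc_mix_integrable[OF c])
  have "osc_mix \<beta> c y - osc_mix \<beta> c z - (- 2 * c * (z \<bullet> h) * osc_mix (\<beta> + 1) c z)
   = (LBINT v. osc v * (exp (- \<beta> * v) * exp (b v)) - osc v * (exp (- \<beta> * v) * exp (a v)) - (- 2 * c * (z \<bullet> h)) * (osc v * (exp (- (\<beta> + 1) * v) * exp (a v))))"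
   using iy iz iz1 by (simp add: osc_mix_def a_def b_def mult.assoc)
  also have "... = (LBINT v. osc v * ?f1 v + osc v * ?f2 v)"
   by (intro Bochner_Integration.integral_cong refl) (unfold ba e1, algebra)
  also have "... = (LBINT v. osc v * ?f1 v) + (LBINT v. osc v * ?f2 v)"
   by (intro Bochner_Integration.integral_add i1 i2) measurable
  finally have "\<bar>osc_mix \<beta> c y - osc_mix \<beta> c z - (- 2 * c * (z \<bullet> h) * osc_mix (\<beta> + 1) c z)\<bar> <= \<bar>(LBINT v. osc v * ?f1 v)\<bar> + \<bar>(LBINT v. osc v * ?f2 v)\<bar>"
   by simp
  also have "... <= ((c * (2 * norm z + 1))\<^sup>2 * (norm h)\<^sup>2) * ?m (- \<beta> - 2) + (c * (norm h)\<^sup>2) * ?m (- \<beta> - 1)"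
   by (intro add_mono i1 i2) measurable
  finally show ?thesis by (simp add: K_def h_def algebra_simps)
 qed
 show ?thesis
 proof (rule has_derivativeI_sandwich[of 1 _ _ _ _ "\<lambda>y. K * norm (y - z)"])
  show "bounded_linear (\<lambda>h. - 2 * c * (z \<bullet> h) * osc_mix (\<beta> + 1) c z)"
   by (intro bounded_linear_intros bounded_linear_mult_const bounded_linear_const_mult bounded_linear_inner_right)
  show "norm (osc_mix \<beta> c y - osc_mix \<beta> c z - (- 2 * c * (z \<bullet> (y - z)) * osc_mix (\<beta> + 1) c z)) / norm (y - z) <= K * norm (y - z)"
   if "y \<in> UNIV" "y ~= z" "dist y z < 1" for y
   using bound[of y] that by (simp add: dist_norm divide_le_eq power2_eq_square mult.assoc)
  show "((\<lambda>y. K * norm (y - z)) \<longlongrightarrow> 0) (at z)"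
   by (auto intro!: tendsto_eq_intros)
 qed simp
qed

text \<open>A class of functions of rapid decay which is closed under partial derivatives.\<close>

inductive osc_class :: "real => 'a::euclidean_space => ('a => complex) => bool" for c x where
 base: "osc_class c x (\<lambda>y. of_real (k * osc_mix \<beta> c (y - x)))"
| mult: "osc_class c x F ==> i \<in> Basis ==> osc_class c x (\<lambda>y. of_real ((y - x) \<bullet> i) * F y)"
| add: "osc_class c x F ==> osc_class c x G ==> osc_class c x (\<lambda>y. F y + G y)"

lemma osc_class_derivative:
 assumes c: "0 < c" and "osc_class c x F"
 shows "\<exists>F'. (\<forall>y. (F has_derivative F' y) (at y)) & (\<forall>j\<in>Basis. osc_class c x (\<lambda>y. F' y j))"
 using assms(2)
proof induction
 case (base k \<beta>)
 let ?F' = "\<lambda>y h. complex_of_real (k * (- 2 * c * ((y - x) \<bullet> h) * osc_mix (\<beta> + 1) c (y - x)))"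
 have "((\<lambda>y. complex_of_real (k * osc_mix \<beta> c (y - x))) has_derivative ?F' y) (at y)" for y
 proof -
  have "((\<lambda>y. osc_mix \<beta> c (y - x)) has_derivative (\<lambda>h. - 2 * c * ((y - x) \<bullet> h) * osc_mix (\<beta> + 1) c (y - x))) (at y)"
  proof -
   have "((\<lambda>y. y - x) has_derivative (\<lambda>h. h)) (at y)" by (auto intro!: derivative_eq_intros)
   then show ?thesis by (rule has_derivative_compose[OF _ osc_mix_has_derivative[OF c]])
  qed
  then show ?thesis by (intro has_derivative_of_real has_derivative_mult_right)
 qed
 moreover have "osc_class c x (\<lambda>y. ?F' y j)" if "j \<in> Basis" for j
 proof -
  have "osc_class c x (\<lambda>y. of_real ((y - x) \<bullet> j) * of_real ((- 2 * c * k) * osc_mix (\<beta> + 1) c (y - x)))"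
   by (intro osc_class.mult osc_class.base that)
  then show ?thesis by (simp add: mult_ac)
 qed
 ultimately show ?case by (intro exI[of _ ?F']) blast
next
 case (mult F i)
 then obtain F' where F': "!!y. (F has_derivative F' y) (at y)" "!!j. j \<in> Basis ==> osc_class c x (\<lambda>y. F' y j)" by blast
 let ?G = "\<lambda>y h. of_real ((y - x) \<bullet> i) * F' y h + of_real (h \<bullet> i) * F y"
 have "((\<lambda>y. of_real ((y - x) \<bullet> i) * F y) has_derivative ?G y) (at y)" for y
  by (rule has_derivative_mult[OF has_derivative_of_real F'(1), THEN has_derivative_eq_rhs]) (auto intro!: derivative_eq_intros)
 moreover have "osc_class c x (\<lambda>y. ?G y j)" if j: "j \<in> Basis" for j
 proof (cases "j = i")
  case True
  then show ?thesis using mult(2) osc_class.add[OF osc_class.mult[OF F'(2)[OF j] mult(2)] mult(1)] by simp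
 next
  case False
  then show ?thesis using osc_class.mult[OF F'(2)[OF j] mult(2)] j mult(2) by (simp add: inner_Basis)
 qed
 ultimately show ?case by (intro exI[of _ ?G]) blast
next
 case (add F G)
 then obtain F' G' where "!!y. (F has_derivative F' y) (at y)" "!!j. j \<in> Basis ==> osc_class c x (\<lambda>y. F' y j)"
  "!!y. (G has_derivative G' y) (at y)" "!!j. j \<in> Basis ==> osc_class c x (\<lambda>y. G' y j)" by blast
 then show ?case
  by (intro exI[of _ "\<lambda>y h. F' y h + G' y h"]) (auto intro: has_derivative_add osc_class.add)
qed

lemma osc_class_decay:
 assumes c: "0 < c" and "osc_class c x F"
 shows "\<exists>B. \<forall>y. (1 + norm (y - x)) ^ N * norm (F y) <= B"
 using assms(2)
proof (induction arbitrary: N)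
 case (base k \<beta>)
 obtain B0 where B0: "!!z::'a. ((norm z)\<^sup>2) ^ 0 * \<bar>osc_mix \<beta> c z\<bar> <= B0" using osc_mix_decay[OF c] by blast
 obtain B1 where B1: "!!z::'a. ((norm z)\<^sup>2) ^ N * \<bar>osc_mix \<beta> c z\<bar> <= B1" using osc_mix_decay[OF c] by blast
 have "(1 + norm z) ^ N * \<bar>osc_mix \<beta> c z\<bar> <= 2 ^ N * (B0 + B1)" for z :: 'a
 proof -
  have "(1 + norm z) ^ N <= 2 ^ N * (1 + ((norm z)\<^sup>2) ^ N)"
  proof (cases "norm z <= 1")
   case True
   then have "(1 + norm z) ^ N <= 2 ^ N" by (intro power_mono) auto
   also have "... <= 2 ^ N * (1 + ((norm z)\<^sup>2) ^ N)" by simp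
   finally show ?thesis .
  next
   case False
   then have "norm z * 1 <= norm z * norm z" by (intro mult_left_mono) auto
   then have "(1 + norm z) ^ N <= (2 * (norm z)\<^sup>2) ^ N" using False by (intro power_mono) (auto simp: power2_eq_square)
   also have "... <= 2 ^ N * (1 + ((norm z)\<^sup>2) ^ N)" by (simp add: power_mult_distrib)
   finally show ?thesis .
  qed
  then have "(1 + norm z) ^ N * \<bar>osc_mix \<beta> c z\<bar> <= 2 ^ N * (1 + ((norm z)\<^sup>2) ^ N) * \<bar>osc_mix \<beta> c z\<bar>" by (intro mult_right_mono) auto
  also have "... = 2 ^ N * (((norm z)\<^sup>2) ^ 0 * \<bar>osc_mix \<beta> c z\<bar> + ((norm z)\<^sup>2) ^ N * \<bar>osc_mix \<beta> c z\<bar>)" by (simp add: algebra_simps)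
  also have "... <= 2 ^ N * (B0 + B1)" by (intro mult_left_mono add_mono B0 B1) auto
  finally show ?thesis .
 qed
 then have "\<bar>k\<bar> * ((1 + norm (y - x)) ^ N * \<bar>osc_mix \<beta> c (y - x)\<bar>) <= \<bar>k\<bar> * (2 ^ N * (B0 + B1))" for y
  by (intro mult_left_mono) auto
 moreover have "norm (complex_of_real (k * m)) = \<bar>k\<bar> * \<bar>m\<bar>" for m by (simp only: norm_of_real abs_mult)
 ultimately show ?case by (intro exI[of _ "\<bar>k\<bar> * (2 ^ N * (B0 + B1))"]) (simp only: mult.left_commute simp_thms)
next
 case (mult F i)
 obtain B where B: "!!y. (1 + norm (y - x)) ^ Suc N * norm (F y) <= B" using mult(3) by blast
 have "(1 + norm (y - x)) ^ N * norm (of_real ((y - x) \<bullet> i) * F y) <= B" for y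
 proof -
  have "\<bar>(y - x) \<bullet> i\<bar> <= 1 + norm (y - x)" using Basis_le_norm[OF mult(2), of "y - x"] by simp
  then have "(1 + norm (y - x)) ^ N * (\<bar>(y - x) \<bullet> i\<bar> * norm (F y)) <= (1 + norm (y - x)) ^ N * ((1 + norm (y - x)) * norm (F y))"
   by (intro mult_left_mono mult_right_mono) auto
  then show ?thesis using B[of y] by (simp add: norm_mult mult_ac)
 qed
 then show ?case by blast
next
 case (add F G)
 obtain B1 B2 where B: "!!y. (1 + norm (y - x)) ^ N * norm (F y) <= B1" "!!y. (1 + norm (y - x)) ^ N * norm (G y) <= B2"
  using add(3)[of N] add(4)[of N] by blast
 have "(1 + norm (y - x)) ^ N * norm (F y + G y) <= B1 + B2" for y
 proof -
  have "(1 + norm (y - x)) ^ N * norm (F y + G y) <= (1 + norm (y - x)) ^ N * (norm (F y) + norm (G y))"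
   by (intro mult_left_mono norm_triangle_ineq) auto
  then show ?thesis using B[of y] by (simp add: distrib_left)
 qed
 then show ?case by blast
qed

lemma osc_class_schwartz:
 assumes c: "0 < c" and F: "osc_class c x F"
 shows "schwartz F"
proof -
 have D: "osc_class c x (iter_deriv ds F)" if "set ds \<subseteq> Basis" for ds
  using that
 proof (induction ds)
  case (Cons j ds)
  then have j: "j \<in> Basis" and "osc_class c x (iter_deriv ds F)" by auto
  then obtain F' where F': "!!y. (iter_deriv ds F has_derivative F' y) (at y)" "!!j. j \<in> Basis ==> osc_class c x (\<lambda>y. F' y j)"
   using osc_class_derivative[OF c] by blast
  have "dir_deriv j (iter_deriv ds F) y = F' y j" for y
  proof -
   have "((\<lambda>t. y + t *\<^sub>R j) has_derivative (\<lambda>t. t *\<^sub>R j)) (at 0)" by (auto intro!: derivative_eq_intros)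
   moreover have "(iter_deriv ds F has_derivative F' y) (at (y + 0 *\<^sub>R j))" using F'(1)[of y] by simp
   ultimately have "((\<lambda>t. iter_deriv ds F (y + t *\<^sub>R j)) has_derivative (\<lambda>t. F' y (t *\<^sub>R j))) (at 0)"
    by (rule has_derivative_compose)
   then have "((\<lambda>t. iter_deriv ds F (y + t *\<^sub>R j)) has_vector_derivative F' y j) (at 0)"
    unfolding has_vector_derivative_def using has_derivative_linear[OF F'(1)[of y]] by (simp add: linear_scale)
   then show ?thesis unfolding dir_deriv_def by (rule vector_derivative_at)
  qed
  then show ?case using F'(2)[OF j] by simp
 qed (use F in simp)
 show ?thesis unfolding schwartz_def
 proof (intro allI impI conjI)
  fix ds :: "'a list" assume ds: "set ds \<subseteq> Basis"
  show "iter_deriv ds F differentiable at y" for y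
   using osc_class_derivative[OF c D[OF ds]] unfolding differentiable_def by blast
  fix N
  obtain B where B: "!!y. (1 + norm (y - x)) ^ N * norm (iter_deriv ds F y) <= B" using osc_class_decay[OF c D[OF ds]] by blast
  have "norm ((1 + norm y) ^ N *\<^sub>R iter_deriv ds F y) <= (1 + norm x) ^ N * B" for y
  proof -
   have "norm y <= norm (y - x) + norm x" using norm_triangle_ineq[of "y - x" x] by simp
   \<comment> \<open>This moves the centre of the decay from x to the origin, as
     \<open>schwartz\<close> demands, at the cost of a factor depending on x.\<close>
   then have "1 + norm y <= (1 + norm x) * (1 + norm (y - x))"
    using mult_nonneg_nonneg[OF norm_ge_zero[of x] norm_ge_zero[of "y - x"]] unfolding distrib_left distrib_right by linarith
   then have "(1 + norm y) ^ N <= (1 + norm x) ^ N * (1 + norm (y - x)) ^ N"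
    unfolding power_mult_distrib[symmetric] by (intro power_mono) auto
   then have "(1 + norm y) ^ N * norm (iter_deriv ds F y) <= (1 + norm x) ^ N * (1 + norm (y - x)) ^ N * norm (iter_deriv ds F y)"
    by (intro mult_right_mono) auto
   also have "... <= (1 + norm x) ^ N * B"
    unfolding mult.assoc by (intro mult_left_mono B) auto
   finally show ?thesis by simp
  qed
  then show "bounded (range (\<lambda>y. (1 + norm y) ^ N *\<^sub>R iter_deriv ds F y))"
   unfolding bounded_iff by blast
 qed
qed

text \<open>One polynomial P serves for all t, so that a mixture over the scales t = r exp v is
  annihilated by \<open>osc\<close>.\<close>

lemma heat_central_moment_poly:
 "\<exists>P. \<forall>t>0. has_bochner_integral lborel (\<lambda>y. normal_density \<mu> (heat_sd t) y * (y - \<mu>) ^ j) (poly P t)"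
proof (cases "even j")
 case True
 then obtain k where j: "j = 2 * k" by (auto elim: evenE)
 have "has_bochner_integral lborel (\<lambda>y. normal_density \<mu> (heat_sd t) y * (y - \<mu>) ^ j) (poly (monom (fact (2 * k) / ((4 * pi) ^ k * fact k)) k) t)" if "0 < t" for t
 proof -
  have "fact (2 * k) / ((2 / (heat_sd t)\<^sup>2) ^ k * fact k) = poly (monom (fact (2 * k) / ((4 * pi) ^ k * fact k)) k) t"
   using that by (simp add: poly_monom power_divide power_mult_distrib)
  then show ?thesis using normal_moment_even[OF heat_sd_pos[OF that], of \<mu> k] by (simp only: j)
 qed
 then show ?thesis by blast
next
 case False
 then obtain k where j: "j = 2 * k + 1" by (auto elim: oddE)
 show ?thesis
  using normal_moment_odd[OF heat_sd_pos, of _ \<mu> k] unfolding j by (intro exI[of _ 0]) simp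
qed

lemma heat_moment_poly:
 "\<exists>P. \<forall>t>0. has_bochner_integral lborel (\<lambda>y. normal_density \<mu> (heat_sd t) y * y ^ k) (poly P t)"
proof -
 obtain P where P: "!!j t. 0 < t ==> has_bochner_integral lborel (\<lambda>y. normal_density \<mu> (heat_sd t) y * (y - \<mu>) ^ j) (poly (P j) t)"
  using heat_central_moment_poly by metis
 have e: "normal_density \<mu> (heat_sd t) y * y ^ k = (\<Sum>j\<le>k. (real (k choose j) * \<mu> ^ (k - j)) * (normal_density \<mu> (heat_sd t) y * (y - \<mu>) ^ j))" for t y
 proof -
  have "y ^ k = ((y - \<mu>) + \<mu>) ^ k" by simp
  then show ?thesis unfolding binomial_ring by (simp only: sum_distrib_left mult_ac)
 qed
 show ?thesis
 proof (intro exI allI impI)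
  fix t :: real assume "0 < t"
  then show "has_bochner_integral lborel (\<lambda>y. normal_density \<mu> (heat_sd t) y * y ^ k) (poly (\<Sum>j\<le>k. smult (real (k choose j) * \<mu> ^ (k - j)) (P j)) t)"
   unfolding e poly_sum poly_smult by (intro has_bochner_integral_sum has_bochner_integral_mult_right P)
 qed
qed

lemma heat_prod_moment_poly:
 fixes x :: "'a::euclidean_space"
 assumes "!!i. i \<in> Basis ==> \<exists>P. \<forall>t>0. has_bochner_integral lborel (\<lambda>y. normal_density (x \<bullet> i) (heat_sd t) y * F i y) (poly P t)"
 shows "\<exists>P. \<forall>t>0. has_bochner_integral lborel (\<lambda>y. heat t (y - x) * (\<Prod>i\<in>Basis. F i (y \<bullet> i))) (poly P t)"
proof -
 obtain P where P: "!!i t. i \<in> Basis ==> 0 < t ==> has_bochner_integral lborel (\<lambda>y. normal_density (x \<bullet> i) (heat_sd t) y * F i y) (poly (P i) t)"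
  using assms by metis
 show ?thesis
 proof (intro exI allI impI)
  fix t :: real assume t: "0 < t"
  have e: "heat t (y - x) * (\<Prod>i\<in>Basis. F i (y \<bullet> i)) = (\<Prod>i\<in>Basis. normal_density (x \<bullet> i) (heat_sd t) (y \<bullet> i) * F i (y \<bullet> i))" for y
   unfolding heat_eq_prod[OF t] prod.distrib ..
  have i: "integrable lborel (\<lambda>u. normal_density (x \<bullet> i) (heat_sd t) u * F i u)" if "i \<in> Basis" for i
   using P[OF that t] by (rule integrable.intros)
  have "(\<Prod>i\<in>Basis. LBINT u. normal_density (x \<bullet> i) (heat_sd t) u * F i u) = poly (\<Prod>i\<in>Basis. P i) t"
   unfolding poly_prod using P[OF _ t] by (intro prod.cong refl) (rule has_bochner_integral_integral_eq)
  then show "has_bochner_integral lborel (\<lambda>y. heat t (y - x) * (\<Prod>i\<in>Basis. F i (y \<bullet> i))) (poly (\<Prod>i\<in>Basis. P i) t)"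
   unfolding has_bochner_integral_iff e
   using integrable_prod_Basis[of "\<lambda>i u. normal_density (x \<bullet> i) (heat_sd t) u * F i u", OF i]
    integral_prod_Basis[of "\<lambda>i u. normal_density (x \<bullet> i) (heat_sd t) u * F i u", OF i] by simp
 qed
qed

definition osc_heat :: "real => 'a::euclidean_space => 'a => complex" where
 "osc_heat r x y = of_real (LBINT v. osc v * heat (r * exp v) (y - x))"

lemma osc_heat_measurable [measurable]: "osc_heat r x \<in> borel_measurable borel"
 unfolding osc_heat_def[abs_def] by measurable

lemma osc_heat_schwartz:
 fixes x :: "'a::euclidean_space"
 assumes "0 < r"
 shows "schwartz (osc_heat r x)"
proof -
 let ?n = "real DIM('a)"
 have "heat (r * exp v) z = r powr (- ?n / 2) * (exp (- (?n / 2) * v) * exp (- (pi / r) * (norm z)\<^sup>2 * exp (- v)))" for v and z :: 'a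
  using assms by (simp add: heat_def powr_mult exp_powr_real exp_minus field_simps)
 then have eq: "osc_heat r x = (\<lambda>y. of_real (r powr (- ?n / 2) * osc_mix (?n / 2) (pi / r) (y - x)))"
  unfolding osc_heat_def osc_mix_def integral_mult_right_zero[symmetric] by (simp add: mult_ac fun_eq_iff)
 show ?thesis
  unfolding eq by (rule osc_class_schwartz[OF _ osc_class.base]) (use assms in simp)
qed

text \<open>By Fubini a moment of the mixture is the integral of \<open>osc\<close> against a moment
  of the heat kernel at scale r exp v. The latter is a polynomial in the scale, hence the result is
  0.\<close>

lemma osc_heat_schwartz0:
 fixes x :: "'a::euclidean_space"
 assumes r: "0 < r"
 shows "schwartz0 (osc_heat r x)"
 unfolding schwartz0_def
proof (intro conjI allI osc_heat_schwartz[OF r])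
 fix \<gamma> :: "'a => nat"
 let ?m = "\<lambda>y. \<Prod>i\<in>Basis. (y \<bullet> i) ^ \<gamma> i"
 \<comment> \<open>A nonnegative majorant of the monomial that is again a product over coordinates
   with polynomial moments; it supplies the absolute convergence for Fubini.\<close>
 let ?M = "\<lambda>y. \<Prod>i\<in>Basis. 1 + (y \<bullet> i) ^ (2 * \<gamma> i)"
 from heat_prod_moment_poly[of x "\<lambda>i u. u ^ \<gamma> i", OF heat_moment_poly]
 obtain P where P: "!!t. 0 < t ==> has_bochner_integral lborel (\<lambda>y. heat t (y - x) * ?m y) (poly P t)" by auto
 have 1: "\<exists>P. \<forall>t>0. has_bochner_integral lborel (\<lambda>u. normal_density (x \<bullet> i) (heat_sd t) u * (1 + u ^ (2 * \<gamma> i))) (poly P t)" for i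
 proof -
  from heat_moment_poly[of "x \<bullet> i" 0]
  obtain Q where "!!t. 0 < t ==> has_bochner_integral lborel (\<lambda>u. normal_density (x \<bullet> i) (heat_sd t) u * u ^ 0) (poly Q t)" by auto
  moreover from heat_moment_poly[of "x \<bullet> i" "2 * \<gamma> i"]
  obtain S where "!!t. 0 < t ==> has_bochner_integral lborel (\<lambda>u. normal_density (x \<bullet> i) (heat_sd t) u * u ^ (2 * \<gamma> i)) (poly S t)" by auto
  ultimately show ?thesis
   by (intro exI[of _ "Q + S"]) (auto simp: distrib_left intro!: has_bochner_integral_add)
 qed
 from heat_prod_moment_poly[of x "\<lambda>i u. 1 + u ^ (2 * \<gamma> i)", OF 1]
 obtain Q where Q: "!!t. 0 < t ==> has_bochner_integral lborel (\<lambda>y. heat t (y - x) * ?M y) (poly Q t)" by auto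
 have mM: "\<bar>?m y\<bar> <= ?M y" for y
  unfolding abs_prod
 proof (intro prod_mono conjI)
  fix i
  have "2 * \<bar>u\<bar> <= 1 + u\<^sup>2" for u :: real
   using zero_le_power2[of "\<bar>u\<bar> - 1"] by (simp add: power2_diff)
  from this[of "(y \<bullet> i) ^ \<gamma> i"] have "\<bar>(y \<bullet> i) ^ \<gamma> i\<bar> <= 1 + ((y \<bullet> i) ^ \<gamma> i)\<^sup>2" by linarith
  then show "\<bar>(y \<bullet> i) ^ \<gamma> i\<bar> <= 1 + (y \<bullet> i) ^ (2 * \<gamma> i)" by (simp add: power_mult mult.commute)
 qed simp
 have rp: "0 < r * exp v" for v using r by simp
 let ?F = "\<lambda>v y. osc v * (heat (r * exp v) (y - x) * ?m y)"
 have fin: "(NBINT v. NBINT y. ennreal (norm (?F v y))) < \<infinity>"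
 proof -
  have "(NBINT v. NBINT y. ennreal (norm (?F v y))) <= (NBINT v. ennreal (norm (osc v * poly Q (r * exp v))))"
  proof (rule nn_integral_mono)
   fix v
   note i = has_bochner_integral_mult_right[OF Q[OF rp[of v]], of "\<bar>osc v\<bar>"]
   have "(NBINT y. ennreal (norm (?F v y))) <= (NBINT y. ennreal (\<bar>osc v\<bar> * (heat (r * exp v) (y - x) * ?M y)))"
    using mM by (intro nn_integral_mono ennreal_leI) (auto simp: abs_mult intro!: mult_left_mono)
   also have "... = ennreal (\<bar>osc v\<bar> * poly Q (r * exp v))"
    using i by (subst nn_integral_eq_integral) (auto simp: has_bochner_integral_iff intro!: mult_nonneg_nonneg prod_nonneg)
   also have "... <= ennreal (norm (osc v * poly Q (r * exp v)))"
    by (intro ennreal_leI) (auto simp: abs_mult intro!: mult_left_mono)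
   finally show "(NBINT y. ennreal (norm (?F v y))) <= ennreal (norm (osc v * poly Q (r * exp v)))" .
  qed
  also have "... < \<infinity>"
   using osc_poly_integral(2)[of Q r] by (simp add: integrable_iff_bounded)
  finally show ?thesis .
 qed
 have "(LBINT y. ?m y *\<^sub>R osc_heat r x y) = (LBINT y. complex_of_real (LBINT v. ?F v y))"
 proof (intro Bochner_Integration.integral_cong refl)
  fix y
  have "(LBINT v. ?F v y) = ?m y * (LBINT v. osc v * heat (r * exp v) (y - x))"
   unfolding integral_mult_right_zero[symmetric] by (simp only: mult_ac)
  then show "?m y *\<^sub>R osc_heat r x y = complex_of_real (LBINT v. ?F v y)"
   by (simp add: osc_heat_def scaleR_conv_of_real)
 qed
 also have "... = complex_of_real (LBINT y. LBINT v. ?F v y)" by simp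
 also have "(LBINT y. LBINT v. ?F v y) = (LBINT v. LBINT y. ?F v y)"
  by (rule Fubini_nn_eq[OF _ _ _ fin, symmetric]) (auto intro: sigma_finite_lborel)
 also have "... = (LBINT v. osc v * poly P (r * exp v))"
  using has_bochner_integral_integral_eq[OF P[OF rp]] by simp
 also have "... = 0" by (rule osc_poly_integral(1))
 finally show "(LBINT y. ?m y *\<^sub>R osc_heat r x y) = 0" by simp
qed

section \<open>Fractional derivatives in the scale variable\<close>

text \<open>The integral of \<open>frac_weight a \<tau> * (M t - M (t + \<tau>))\<close> over \<open>\<tau>\<close> is a multiple of the right-sided Weyl derivative of order \<open>a\<close>
 of \<open>M\<close>; \<open>frac_weight (- a)\<close> is the kernel of the inverse fractional integral.\<close>

definition frac_weight :: "real => real => real" where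
 "frac_weight a \<tau> = indicator {0<..} \<tau> * \<tau> powr (- a - 1)"

lemma frac_weight_measurable [measurable]: "frac_weight a \<in> borel_measurable borel"
 unfolding frac_weight_def[abs_def] by measurable

lemma frac_weight_nonneg [simp]: "0 <= frac_weight a \<tau>"
 by (simp add: frac_weight_def)

lemma frac_weight_scale: "0 < c ==> frac_weight a (c * \<tau>) = c powr (- a - 1) * frac_weight a \<tau>"
 by (auto simp: frac_weight_def indicator_def powr_mult zero_less_mult_iff)

definition frac_const :: "real => real" where
 "frac_const a = 1 / (1 - a) + 1 / a"

lemma frac_weight_min_integral:
 assumes "0 < a" "a < 1" "0 < t"
 shows "(NBINT \<tau>. ennreal (frac_weight a \<tau> * min 1 (\<tau> / t))) = ennreal (frac_const a * t powr (- a))"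
proof -
 have "(NBINT \<tau>. ennreal (frac_weight a \<tau> * min 1 (\<tau> / t)))
  = (NBINT \<tau>. ennreal (1 / t) * (ennreal (\<tau> powr ((1 - a) - 1)) * indicator {0<..<t} \<tau>) + ennreal (\<tau> powr (- a - 1)) * indicator {t..} \<tau>)"
 proof (rule nn_integral_cong)
  fix \<tau> :: real
  show "ennreal (frac_weight a \<tau> * min 1 (\<tau> / t)) = ennreal (1 / t) * (ennreal (\<tau> powr ((1 - a) - 1)) * indicator {0<..<t} \<tau>) + ennreal (\<tau> powr (- a - 1)) * indicator {t..} \<tau>"
  proof (cases "0 < \<tau> & \<tau> < t")
   case True
   then have "\<tau> powr (- a - 1) * (\<tau> / t) = 1 / t * \<tau> powr (- a)"
    by (simp add: powr_diff)
   then show ?thesis using True assms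
    by (simp add: frac_weight_def min_def divide_le_eq flip: ennreal_mult)
  qed (use assms in \<open>auto simp: frac_weight_def indicator_def min_def divide_le_eq\<close>)
 qed
 also have "... = ennreal (1 / t) * (NBINT \<tau>. ennreal (\<tau> powr ((1 - a) - 1)) * indicator {0<..<t} \<tau>) + (NBINT \<tau>. ennreal (\<tau> powr (- a - 1)) * indicator {t..} \<tau>)"
  by (subst nn_integral_add, measurable, subst nn_integral_cmult, measurable)
 also have "... = ennreal (1 / t) * ennreal (t powr (1 - a) / (1 - a)) + ennreal (t powr (- a) / a)"
  using nn_integral_powr_from_0[of "1 - a" t] nn_integral_powr_to_inf[of a t] assms by simp
 also have "... = ennreal (1 / t * (t powr (1 - a) / (1 - a)) + t powr (- a) / a)"
  using assms by (simp flip: ennreal_mult ennreal_plus)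
 also have "1 / t * (t powr (1 - a) / (1 - a)) + t powr (- a) / a = frac_const a * t powr (- a)"
  using assms by (simp add: frac_const_def powr_diff powr_minus field_simps)
 finally show ?thesis .
qed

lemma frac_integrable:
 assumes a: "0 < a" "a < 1" and t: "0 < t" and [measurable]: "h \<in> borel_measurable borel"
  and h: "!!\<tau>. 0 < \<tau> ==> \<bar>h \<tau>\<bar> <= B * min 1 (\<tau> / t)"
 shows "integrable lborel (\<lambda>\<tau>. frac_weight a \<tau> * h \<tau>)"
proof (rule Bochner_Integration.integrable_bound)
 let ?m = "\<lambda>\<tau>. frac_weight a \<tau> * min 1 (\<tau> / t)"
 show "integrable lborel (\<lambda>\<tau>. B * (?m \<tau>))"
 proof (intro integrable_mult_right integrableI_nonneg)
  show "AE \<tau> in lborel. 0 <= frac_weight a \<tau> * min 1 (\<tau> / t)"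
   using t by (auto simp: frac_weight_def indicator_def)
  show "(NBINT \<tau>. ennreal (?m \<tau>)) < \<infinity>"
   unfolding frac_weight_min_integral[OF a t] by simp
 qed measurable
 show "AE \<tau> in lborel. norm (frac_weight a \<tau> * h \<tau>) <= norm (B * (?m \<tau>))"
 proof (rule AE_I2)
  fix \<tau> :: real
  have "frac_weight a \<tau> * \<bar>h \<tau>\<bar> <= frac_weight a \<tau> * (B * min 1 (\<tau> / t))"
   using h[of \<tau>] by (cases "0 < \<tau>") (auto simp: frac_weight_def intro!: mult_left_mono)
  then have "norm (frac_weight a \<tau> * h \<tau>) <= B * (?m \<tau>)"
   by (simp add: abs_mult mult.left_commute)
  then show "norm (frac_weight a \<tau> * h \<tau>) <= norm (B * (?m \<tau>))"
   unfolding real_norm_def by (rule order_trans[OF _ abs_ge_self])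
 qed
qed measurable

text \<open>At a maximum over \<open>t \<ge> r0\<close> every increment in the integral is nonnegative.\<close>

lemma frac_max_principle:
 fixes Z :: "real => real"
 assumes a: "0 < a" "a < 1" and Z[measurable]: "Z \<in> borel_measurable borel"
  and inc: "!!t \<tau>. 0 < t ==> 0 < \<tau> ==> \<bar>Z t - Z (t + \<tau>)\<bar> <= B * min 1 (\<tau> / t)"
  and lim: "(Z \<longlongrightarrow> 0) at_top"
  and eq: "!!t. 0 < t ==> (LBINT \<tau>. frac_weight a \<tau> * (Z t - Z (t + \<tau>))) = 0"
  and r0: "0 < r0"
 shows "Z r0 <= 0"
proof (rule ccontr)
 assume "\<not> Z r0 <= 0"
 then have pos: "0 < Z r0" by simp
 have "\<forall>\<^sub>F t in at_top. Z t < Z r0" using lim pos by (rule order_tendstoD)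
 then obtain R0 where R0: "!!t. R0 <= t ==> Z t < Z r0" by (auto simp: eventually_at_top_linorder)
 define R where "R = max R0 (r0 + 1)"
 have R: "r0 < R" "!!t. R <= t ==> Z t < Z r0" using R0 by (auto simp: R_def)
 have B0: "0 <= B" using inc[of 1 1] by simp
 \<comment> \<open>The increment bound makes Z Lipschitz on t >= r0, hence continuous there. As Z is
   below Z r0 beyond R, a maximum over \<open>{r0..R}\<close> is a maximum over all t >= r0.\<close>
 have lip: "\<bar>Z x - Z y\<bar> <= (B / r0) * \<bar>x - y\<bar>" if "r0 <= x" "x < y" for x y
 proof -
  have "\<bar>Z x - Z y\<bar> <= B * min 1 ((y - x) / x)" using inc[of x "y - x"] that r0 by simp
  also have "... <= B * ((y - x) / r0)" using that r0 B0 by (intro mult_left_mono order_trans[OF min.cobounded2] divide_left_mono) auto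
  finally show ?thesis using that by simp
 qed
 have "(B / r0)-lipschitz_on {r0..R} Z"
 proof (rule lipschitz_onI)
  fix x y assume "x \<in> {r0..R}" "y \<in> {r0..R}"
  then show "dist (Z x) (Z y) <= B / r0 * dist x y"
   using lip[of x y] lip[of y x] by (cases x y rule: linorder_cases) (auto simp: dist_real_def abs_minus_commute)
 qed (use B0 r0 in simp)
 then have "continuous_on {r0..R} Z" by (rule lipschitz_on_continuous_on)
 then obtain r1 where r1: "r1 \<in> {r0..R}" "!!t. t \<in> {r0..R} ==> Z t <= Z r1"
  using continuous_attains_sup[of "{r0..R}" Z] R(1) by auto
 have max: "Z t <= Z r1" if "r0 <= t" for t
  using r1(2)[of t] r1(2)[of r0] R(1) R(2)[of t] that by (cases "t <= R") auto
 have r1p: "0 < r1" using r1(1) r0 by simp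
 let ?h = "\<lambda>\<tau>. frac_weight a \<tau> * (Z r1 - Z (r1 + \<tau>))"
 have i: "integrable lborel ?h"
  by (rule frac_integrable[OF a r1p]) (use inc[OF r1p] in auto)
 have nn: "AE \<tau> in lborel. 0 <= ?h \<tau>"
 proof (rule AE_I2)
  fix \<tau> :: real
  show "0 <= ?h \<tau>"
   using max[of "r1 + \<tau>"] r1(1) by (cases "0 < \<tau>") (auto simp: frac_weight_def)
 qed
 have "AE \<tau> in lborel. ?h \<tau> = 0"
  using integral_nonneg_eq_0_iff_AE[OF i nn] eq[OF r1p] by simp
 \<comment> \<open>For these increments r1 + \<tau> > R, so Z (r1 + \<tau>) < Z r0 <= Z r1 and the
   integrand is strictly positive, although it vanishes almost everywhere.\<close>
 then have "AE \<tau> in lborel. \<tau> \<notin> {R<..<R + 1}"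
 proof eventually_elim
  case (elim \<tau>)
  show ?case
  proof
   assume \<tau>: "\<tau> \<in> {R<..<R + 1}"
   then have "Z (r1 + \<tau>) < Z r1" using R(2)[of "r1 + \<tau>"] max[of r0] r1p by auto
   moreover have "0 < \<tau>" using \<tau> R(1) r0 by auto
   ultimately show False using elim by (simp add: frac_weight_def)
  qed
 qed
 from emeasure_eq_0_AE[OF this] have "emeasure lborel {R<..<R + 1} = 0"
  by (simp only: space_lborel space_borel UNIV_I simp_thms Collect_mem_eq)
 then show False by simp
qed

text \<open>The mean Y of the dilates of U against W has vanishing fractional derivative and tends
  to 0 at infinity. The maximum principle for Y and - Y gives Y = 0. As r tends to 0, Y r tends to L
  times the integral of W, which is nonzero since sin (pi a) is.\<close>

lemma frac_uniqueness:
 fixes U :: "real => real"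
 assumes a: "0 < a" "a < 1" and [measurable]: "U \<in> borel_measurable borel"
  and inc: "!!t \<tau>. 0 < t ==> 0 < \<tau> ==> \<bar>U t - U (t + \<tau>)\<bar> <= B * min 1 (\<tau> / t)"
  and lim: "(U \<longlongrightarrow> 0) at_top" and L: "(U \<longlongrightarrow> L) (at_right 0)"
  and eq: "!!r. 0 < r ==> (LBINT v. osc v * (LBINT \<tau>. frac_weight a \<tau> * (U (r * exp v) - U (r * exp v + \<tau>)))) = 0"
 shows "L = 0"
proof -
 let ?L = "\<lambda>r v. LBINT \<tau>. frac_weight a \<tau> * (U (r * exp v) - U (r * exp v + \<tau>))"
 let ?D = "\<lambda>r \<tau> v. U (r * exp v) - U ((r + \<tau>) * exp v)"
 \<comment> \<open>The factor exp (- a v) is the price of commuting dilation by exp v with the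
   fractional derivative of order a. With it, the hypothesis \<open>eq\<close> states that the
   derivative of Y itself vanishes.\<close>
 define W where "W v = osc v * exp (- a * v)" for v
 have Wm[measurable]: "W \<in> borel_measurable borel" unfolding W_def[abs_def] by measurable
 have Wi: "integrable lborel W" unfolding W_def[abs_def] by (rule osc_exp_integrable)
 then have WI: "(NBINT v. ennreal \<bar>W v\<bar>) < \<infinity>" by (simp add: integrable_iff_bounded)
 have B0: "0 <= B" using inc[of 1 1] by simp
 \<comment> \<open>Comparison with U at infinity, where it tends to 0.\<close>
 have bd: "\<bar>U t\<bar> <= B" if "0 < t" for t
 proof (rule tendsto_upperbound[OF _ _ sequentially_bot])
  have "((\<lambda>k. U (t + real (Suc k))) \<longlongrightarrow> 0) sequentially"
   by (rule filterlim_compose[OF lim filterlim_tendsto_add_at_top[OF tendsto_const filterlim_compose[OF filterlim_real_sequentially filterlim_Suc]]])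
  then show "(\<lambda>k. \<bar>U t - U (t + real (Suc k))\<bar>) \<longlonglongrightarrow> \<bar>U t\<bar>"
   by (auto intro!: tendsto_eq_intros)
  show "\<forall>\<^sub>F k in sequentially. \<bar>U t - U (t + real (Suc k))\<bar> <= B"
  proof (intro always_eventually allI)
   fix k
   have "B * min 1 (real (Suc k) / t) <= B * 1" using B0 by (intro mult_left_mono) auto
   then show "\<bar>U t - U (t + real (Suc k))\<bar> <= B" using inc[OF that, of "real (Suc k)"] by simp
  qed
 qed
 define Y where "Y r = (LBINT v. W v * U (r * exp v))" for r
 have Ym[measurable]: "Y \<in> borel_measurable borel" unfolding Y_def[abs_def] by measurable
 have WU: "integrable lborel (\<lambda>v. W v * U (r * exp v))" if "0 < r" for r
 proof (rule Bochner_Integration.integrable_bound[OF integrable_mult_right[OF Wi, of B]])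
  show "AE v in lborel. norm (W v * U (r * exp v)) <= norm (B * W v)"
   using mult_left_mono[OF bd abs_ge_zero] that B0 by (intro AE_I2) (simp add: abs_mult mult.commute[of B])
 qed measurable
 have Wd: "\<bar>W v * (?D r \<tau> v)\<bar> <= \<bar>W v\<bar> * (B * min 1 (\<tau> / r))" if "0 < r" "0 < \<tau>" for r \<tau> v
 proof -
  have "\<bar>U (r * exp v) - U ((r + \<tau>) * exp v)\<bar> <= B * min 1 (\<tau> / r)"
   using inc[of "r * exp v" "\<tau> * exp v"] that by (simp add: distrib_right)
  then show ?thesis unfolding abs_mult by (rule mult_left_mono) simp
 qed
 have Yd: "Y r - Y (r + \<tau>) = (LBINT v. W v * (?D r \<tau> v))" if "0 < r" "0 < \<tau>" for r \<tau>
  using WU[of r] WU[of "r + \<tau>"] that by (simp add: Y_def right_diff_distrib)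
 have Yinc: "\<bar>Y r - Y (r + \<tau>)\<bar> <= ((LBINT v. \<bar>W v\<bar>) * B) * min 1 (\<tau> / r)" if "0 < r" "0 < \<tau>" for r \<tau>
 proof -
  have i: "integrable lborel (\<lambda>v. W v * (?D r \<tau> v))"
   using WU[of r] WU[of "r + \<tau>"] that by (simp add: right_diff_distrib)
  have "\<bar>Y r - Y (r + \<tau>)\<bar> <= (LBINT v. \<bar>W v * (?D r \<tau> v)\<bar>)"
   unfolding Yd[OF that] using integral_norm_bound[of lborel "\<lambda>v. W v * (?D r \<tau> v)"] by simp
  also have "... <= (LBINT v. \<bar>W v\<bar> * (B * min 1 (\<tau> / r)))"
   using i Wi Wd[OF that] by (intro integral_mono) auto
  finally show ?thesis by (simp add: mult_ac)
 qed
 have DY: "(LBINT \<tau>. frac_weight a \<tau> * (Y r - Y (r + \<tau>))) = 0" if r: "0 < r" for r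
 proof -
  let ?F = "\<lambda>v \<tau>. W v * (frac_weight a \<tau> * (?D r \<tau> v))"
  have fin: "(NBINT v. NBINT \<tau>. ennreal (norm (?F v \<tau>))) < \<infinity>"
  proof -
   have "(NBINT v. NBINT \<tau>. ennreal (norm (?F v \<tau>)))
    <= (NBINT v. NBINT \<tau>. ennreal (\<bar>W v\<bar> * B) * ennreal (frac_weight a \<tau> * min 1 (\<tau> / r)))"
   proof (intro nn_integral_mono)
    fix v \<tau> :: real
    have "frac_weight a \<tau> * \<bar>W v * (?D r \<tau> v)\<bar> <= frac_weight a \<tau> * (\<bar>W v\<bar> * (B * min 1 (\<tau> / r)))"
     using Wd[OF r, of \<tau> v] by (cases "0 < \<tau>") (auto simp: frac_weight_def intro!: mult_left_mono)
    then have "norm (?F v \<tau>) <= (\<bar>W v\<bar> * B) * (frac_weight a \<tau> * min 1 (\<tau> / r))"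
     by (simp add: abs_mult mult_ac)
    then show "ennreal (norm (?F v \<tau>)) <= ennreal (\<bar>W v\<bar> * B) * ennreal (frac_weight a \<tau> * min 1 (\<tau> / r))"
     unfolding ennreal_mult'[OF mult_nonneg_nonneg[OF abs_ge_zero B0], symmetric] by (rule ennreal_leI)
   qed
   also have "... = (NBINT v. ennreal \<bar>W v\<bar> * (ennreal B * ennreal (frac_const a * r powr (- a))))"
    using B0 by (intro nn_integral_cong) (subst nn_integral_cmult, measurable, simp add: frac_weight_min_integral[OF a r] ennreal_mult mult.assoc)
   also have "... = (NBINT v. ennreal \<bar>W v\<bar>) * (ennreal B * ennreal (frac_const a * r powr (- a)))"
    by (intro nn_integral_multc) measurable
   also have "... < \<infinity>" using WI by (auto simp: ennreal_mult_less_top)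
   finally show ?thesis .
  qed
  have "(LBINT \<tau>. frac_weight a \<tau> * (Y r - Y (r + \<tau>))) = (LBINT \<tau>. LBINT v. ?F v \<tau>)"
  proof (intro Bochner_Integration.integral_cong refl)
   fix \<tau> :: real
   show "frac_weight a \<tau> * (Y r - Y (r + \<tau>)) = (LBINT v. ?F v \<tau>)"
   proof (cases "0 < \<tau>")
    case True
    show ?thesis unfolding Yd[OF r True] integral_mult_right_zero[symmetric] by (simp only: mult_ac)
   qed (simp add: frac_weight_def)
  qed
  also have "... = (LBINT v. LBINT \<tau>. ?F v \<tau>)"
   by (rule Fubini_nn_eq[OF _ _ _ fin, symmetric]) (auto intro: sigma_finite_lborel)
  also have "... = (LBINT v. osc v * (?L r v))"
  proof (intro Bochner_Integration.integral_cong refl)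
   fix v :: real
   have "(?L r v)
    = exp v * (LBINT \<tau>. frac_weight a (exp v * \<tau>) * (U (r * exp v) - U (r * exp v + exp v * \<tau>)))"
    using lborel_integral_real_affine[of "exp v" "\<lambda>\<tau>. frac_weight a \<tau> * (U (r * exp v) - U (r * exp v + \<tau>))" 0] by simp
   also have "... = exp (- a * v) * (LBINT \<tau>. frac_weight a \<tau> * (?D r \<tau> v))"
   proof -
    have e: "exp (- a * v) = exp v * exp v powr (- a - 1)"
     by (simp add: exp_powr_real algebra_simps flip: exp_add)
    have e2: "r * exp v + exp v * \<tau> = (r + \<tau>) * exp v" for \<tau> by (simp add: algebra_simps)
    have "(LBINT \<tau>. frac_weight a (exp v * \<tau>) * (U (r * exp v) - U (r * exp v + exp v * \<tau>)))
     = exp v powr (- a - 1) * (LBINT \<tau>. frac_weight a \<tau> * (?D r \<tau> v))"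
     unfolding integral_mult_right_zero[symmetric]
     by (intro Bochner_Integration.integral_cong refl) (simp only: e2 frac_weight_scale[OF exp_gt_zero] mult.assoc)
    then show ?thesis unfolding e by simp
   qed
   finally show "(LBINT \<tau>. ?F v \<tau>) = osc v * (?L r v)"
    by (simp add: W_def)
  qed
  also have "... = 0" by (rule eq[OF r])
  finally show ?thesis .
 qed
 have Ylim: "(Y \<longlongrightarrow> 0) at_top"
 proof -
  have "((\<lambda>r. LBINT v. W v * U (r * exp v)) \<longlongrightarrow> (LINT v|(lborel::real measure). 0)) at_top"
  proof (rule integral_dominated_convergence_at_top[where w="\<lambda>v. B * \<bar>W v\<bar>" and s="\<lambda>r v. W v * U (r * exp v)" and f="\<lambda>_. 0" and M=lborel])
   show "\<forall>\<^sub>F r in at_top. AE v in lborel. norm (W v * U (r * exp v)) <= B * \<bar>W v\<bar>"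
    using eventually_gt_at_top[of 0] by eventually_elim (simp add: abs_mult mult.commute[of B] mult_left_mono bd)
   have "((\<lambda>r. U (r * exp v)) \<longlongrightarrow> 0) at_top" for v
    by (rule filterlim_compose[OF lim filterlim_at_top_mult_tendsto_pos[OF tendsto_const _ filterlim_ident]]) simp
   then show "AE v in lborel. ((\<lambda>r. W v * U (r * exp v)) \<longlongrightarrow> 0) at_top"
    by (auto intro!: tendsto_mult_right_zero)
  qed (use Wi in auto)
  then show ?thesis by (simp add: Y_def[abs_def])
 qed
 have Y0: "Y r = 0" if "0 < r" for r
 proof (rule antisym)
  show "Y r <= 0" by (rule frac_max_principle[OF a Ym Yinc Ylim DY that])
  have "- Y r <= 0"
  proof (rule frac_max_principle[OF a _ _ _ _ that, where Z="\<lambda>r. - Y r"])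
   show "\<bar>- Y r - - Y (r + \<tau>)\<bar> <= ((LBINT v. \<bar>W v\<bar>) * B) * min 1 (\<tau> / r)" if "0 < r" "0 < \<tau>" for r \<tau>
    using Yinc[OF that] by (simp add: abs_minus_commute)
   show "((\<lambda>r. - Y r) \<longlongrightarrow> 0) at_top" using tendsto_minus[OF Ylim] by simp
   show "(LBINT \<tau>. frac_weight a \<tau> * (- Y r - - Y (r + \<tau>))) = 0" if "0 < r" for r
   proof -
    have "(\<lambda>\<tau>. frac_weight a \<tau> * (- Y r - - Y (r + \<tau>))) = (\<lambda>\<tau>. - (frac_weight a \<tau> * (Y r - Y (r + \<tau>))))"
     by (simp add: algebra_simps)
    then show ?thesis using DY[OF that] by simp
   qed
  qed measurable
  then show "0 <= Y r" by simp
 qed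
 have "(\<lambda>k. LBINT v. W v * U (inverse (real (Suc k)) * exp v)) \<longlonglongrightarrow> (LBINT v. W v * L)"
 proof (rule integral_dominated_convergence[where w="\<lambda>v. B * \<bar>W v\<bar>"])
  fix k
  show "AE v in lborel. norm (W v * U (inverse (real (Suc k)) * exp v)) <= B * \<bar>W v\<bar>"
   by (simp add: abs_mult mult.commute[of B] mult_left_mono bd)
 next
  have "(\<lambda>k. U (inverse (real (Suc k)) * exp v)) \<longlonglongrightarrow> L" for v
  proof (rule filterlim_compose[OF L])
   have "(\<lambda>k. inverse (real (Suc k)) * exp v) \<longlonglongrightarrow> 0"
    using tendsto_mult_left_zero[OF LIMSEQ_inverse_real_of_nat] by simp
   then show "filterlim (\<lambda>k. inverse (real (Suc k)) * exp v) (at_right 0) sequentially"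
    by (auto simp: filterlim_at intro!: always_eventually)
  qed
  then show "AE v in lborel. (\<lambda>k. W v * U (inverse (real (Suc k)) * exp v)) \<longlonglongrightarrow> W v * L"
   by (auto intro!: tendsto_mult_left)
 qed (use Wi in auto)
 moreover have "(LBINT v. W v * U (inverse (real (Suc k)) * exp v)) = 0" for k
  using Y0[of "inverse (real (Suc k))"] by (simp add: Y_def)
 ultimately have "(LBINT v. W v * L) = 0" by (simp add: LIMSEQ_const_iff)
 then have "(LBINT v. osc v * exp (- a * v)) * L = 0" by (simp add: W_def)
 moreover have "sin (pi * a) ~= 0" using a sin_gt_zero[of "pi * a"] by simp
 then have "(LBINT v. osc v * exp (- a * v)) ~= 0" unfolding osc_exp_integral by simp
 ultimately show ?thesis by simp
qed

section \<open>Increments of the heat kernel in time and space\<close>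

lemma heat_double:
 fixes z :: "'a::euclidean_space"
 assumes t: "0 < t"
 shows heat_le_double: "heat t z <= 2 powr (DIM('a) / 2) * heat (2 * t) z"
  and heat_moment_le_double: "((norm z)\<^sup>2 / t) * heat t z <= 2 powr (DIM('a) / 2) * heat (2 * t) z"
proof -
 define x where "x = (norm z)\<^sup>2 / t"
 have x: "0 <= x" using t by (simp add: x_def)
 have h: "heat t z = t powr (- real DIM('a) / 2) * exp (- pi * x)"
  by (simp add: heat_def x_def)
 have h2: "2 powr (DIM('a) / 2) * heat (2 * t) z = t powr (- real DIM('a) / 2) * exp (- pi * x / 2)"
  using t by (simp add: heat_def x_def powr_mult powr_minus field_simps)
 have "exp (- pi * x) <= exp (- pi * x / 2)" using x by simp
 then show "heat t z <= 2 powr (DIM('a) / 2) * heat (2 * t) z"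
  unfolding h h2 by (rule mult_left_mono) simp
 have "x <= 1 + pi * x / 2" using mult_right_mono[OF _ x, of 2 pi] pi_ge_two by simp
 also have "... <= exp (pi * x / 2)" by (rule exp_ge_add_one_self)
 finally have "x * exp (- pi * x) <= exp (pi * x / 2) * exp (- pi * x)" by (rule mult_right_mono) simp
 also have "... = exp (- pi * x / 2)" by (simp flip: exp_add)
 finally have "t powr (- real DIM('a) / 2) * (x * exp (- pi * x)) <= t powr (- real DIM('a) / 2) * exp (- pi * x / 2)"
  by (rule mult_left_mono) simp
 then show "((norm z)\<^sup>2 / t) * heat t z <= 2 powr (DIM('a) / 2) * heat (2 * t) z"
  unfolding h2 unfolding h x_def[symmetric] by (simp only: mult_ac)
qed

definition heat_const :: "'a::euclidean_space itself => real" where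
 "heat_const _ = DIM('a) / 2 + pi * 2 powr (DIM('a) / 2)"

lemma heat_const_ge: "1 <= heat_const TYPE('a::euclidean_space)" "2 powr (DIM('a) / 2) <= heat_const TYPE('a)"
proof -
 have 1: "1 <= (2::real) powr (DIM('a) / 2)" by (rule ge_one_powr_ge_zero) auto
 have "1 * 2 powr (DIM('a) / 2) <= pi * 2 powr (DIM('a) / 2)" using pi_ge_two by (intro mult_right_mono) auto
 then show 2: "2 powr (DIM('a) / 2) <= heat_const TYPE('a)" unfolding heat_const_def by linarith
 then show "1 <= heat_const TYPE('a)" using 1 by linarith
qed

text \<open>The two directions have different sources: a decrease in time comes from the power of t,
  giving the term n / 2 of \<open>heat_const\<close>; an increase comes from the exponential, giving
  a moment of the kernel that doubling the time absorbs, whence pi 2^(n / 2). For \<tau> >= t the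
  sizes of the two kernels suffice.\<close>

lemma heat_diff_le:
 fixes z :: "'a::euclidean_space"
 assumes t: "0 < t" "0 < \<tau>"
 shows "\<bar>heat t z - heat (t + \<tau>) z\<bar> <= heat_const TYPE('a) * min 1 (\<tau> / t) * (heat t z + heat (2 * (t + \<tau>)) z)"
proof -
 let ?m = "real DIM('a) / 2" and ?T = "t + \<tau>" and ?c = "2 powr (real DIM('a) / 2)"
 define A where "A = pi * (norm z)\<^sup>2"
 have A: "0 <= A" by (simp add: A_def)
 have h: "heat u z = u powr (- ?m) * exp (- (A / u))" for u
  by (simp add: heat_def A_def)
 have up: "heat t z - heat ?T z <= ?m * (\<tau> / t) * heat t z"
 proof -
  have "ln (1 + \<tau> / t) <= \<tau> / t" using t by (intro ln_add_one_self_le_self) auto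
  then have "?m * ln (1 + \<tau> / t) <= ?m * (\<tau> / t)" by (rule mult_left_mono) simp
  then have "1 - ?m * (\<tau> / t) <= 1 + - ?m * ln (1 + \<tau> / t)" by simp
  also have "... <= exp (- ?m * ln (1 + \<tau> / t))" by (rule exp_ge_add_one_self)
  also have "... = (1 + \<tau> / t) powr (- ?m)"
   using add_pos_pos[OF zero_less_one divide_pos_pos[OF t(2,1)]] by (simp add: powr_def)
  finally have 1: "1 - ?m * (\<tau> / t) <= (1 + \<tau> / t) powr (- ?m)" .
  have "(1 - ?m * (\<tau> / t)) * heat t z <= (1 + \<tau> / t) powr (- ?m) * (t powr (- ?m) * exp (- (A / t)))"
   unfolding h[of t] using 1 by (rule mult_right_mono) simp
  also have "... = ?T powr (- ?m) * exp (- (A / t))"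
  proof -
   have "(1 + \<tau> / t) * t = ?T" using t by (simp add: field_simps)
   then show ?thesis unfolding mult.assoc[symmetric] powr_mult[symmetric] by simp
  qed
  also have "... <= heat ?T z"
   unfolding h using t A by (intro mult_left_mono) (auto intro!: divide_left_mono)
  finally show ?thesis by (simp add: left_diff_distrib)
 qed
 have lo: "heat ?T z - heat t z <= pi * ?c * (\<tau> / t) * heat (2 * ?T) z"
 proof -
  have "?T powr (- ?m) <= t powr (- ?m)" using t by (intro powr_mono2') auto
  then have "heat ?T z - heat t z <= ?T powr (- ?m) * exp (- (A / ?T)) - ?T powr (- ?m) * exp (- (A / t))"
   unfolding h by (intro diff_left_mono mult_right_mono) auto
  also have "... = heat ?T z * (1 - exp (A / ?T - A / t))"
  proof -
   have "exp (- (A / t)) = exp (- (A / ?T)) * exp (A / ?T - A / t)" by (simp flip: exp_add)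
   then show ?thesis unfolding h by (simp add: algebra_simps)
  qed
  also have "... <= heat ?T z * (A / t - A / ?T)"
   by (intro mult_left_mono heat_nonneg) (use exp_ge_add_one_self[of "A / ?T - A / t"] in linarith)
  also have "A / t - A / ?T = pi * (\<tau> / t) * ((norm z)\<^sup>2 / ?T)"
   using t by (simp add: A_def field_simps)
  also have "heat ?T z * (pi * (\<tau> / t) * ((norm z)\<^sup>2 / ?T)) = pi * (\<tau> / t) * (((norm z)\<^sup>2 / ?T) * heat ?T z)"
   by (simp only: mult_ac)
  also have "... <= pi * (\<tau> / t) * (?c * heat (2 * ?T) z)"
   using t by (intro mult_left_mono heat_moment_le_double) auto
  finally show ?thesis by (simp add: mult_ac)
 qed
 have n: "0 <= heat t z" "0 <= heat (2 * ?T) z" "0 <= \<tau> / t" "0 <= heat ?T z" using t by auto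
 have b1: "\<bar>heat t z - heat ?T z\<bar> <= heat_const TYPE('a) * (\<tau> / t) * (heat t z + heat (2 * ?T) z)"
 proof -
  have "\<bar>heat t z - heat ?T z\<bar> <= ?m * (\<tau> / t) * heat t z + pi * ?c * (\<tau> / t) * heat (2 * ?T) z"
   using up lo mult_nonneg_nonneg[OF mult_nonneg_nonneg[OF _ n(3)] n(1), of ?m] mult_nonneg_nonneg[OF mult_nonneg_nonneg[OF _ n(3)] n(2), of "pi * ?c"] by (auto simp: abs_le_iff)
  moreover have "0 <= ?m * (\<tau> / t) * heat (2 * ?T) z" "0 <= pi * ?c * (\<tau> / t) * heat t z" using t by auto
  moreover have "heat_const TYPE('a) * (\<tau> / t) * (heat t z + heat (2 * ?T) z)
   = ?m * (\<tau> / t) * heat t z + ?m * (\<tau> / t) * heat (2 * ?T) z + (pi * ?c * (\<tau> / t) * heat t z + pi * ?c * (\<tau> / t) * heat (2 * ?T) z)"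
   unfolding heat_const_def by algebra
  ultimately show ?thesis by linarith
 qed
 have b2: "\<bar>heat t z - heat ?T z\<bar> <= heat_const TYPE('a) * 1 * (heat t z + heat (2 * ?T) z)"
 proof -
  have "\<bar>heat t z - heat ?T z\<bar> <= 1 * heat t z + ?c * heat (2 * ?T) z"
   by (intro abs_leI) (use heat_le_double[OF add_pos_pos[OF t], of z] n in linarith)+
  also have "... <= heat_const TYPE('a) * heat t z + heat_const TYPE('a) * heat (2 * ?T) z"
   using heat_const_ge[where 'a='a] n by (intro add_mono mult_right_mono) auto
  finally show ?thesis by (simp add: algebra_simps)
 qed
 show ?thesis using b1 b2 by (cases "1 <= \<tau> / t") (auto simp: min_def)
qed

text \<open>The difference is at most the kernel times the difference of the exponents, which is
  quadratic in the rescaled positions; doubling the time absorbs that growth. The factor \<rho> is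
  small for large t, so differences of heat averages decay.\<close>

lemma heat_space_diff_le:
 fixes z z' :: "'a::euclidean_space"
 assumes t: "0 < t" and \<rho>: "\<rho> = norm (z - z') / sqrt t"
 shows "\<bar>heat t z - heat t z'\<bar> <= pi * \<rho> * (4 + 2 * \<rho>) * 2 powr (DIM('a) / 2) * (heat (2 * t) z + heat (2 * t) z')"
proof -
 let ?c = "2 powr (real DIM('a) / 2)"
 have \<rho>0: "0 <= \<rho>" using t by (simp add: \<rho>)
 have one: "heat t z - heat t z' <= pi * \<rho> * (4 + 2 * \<rho>) * ?c * heat (2 * t) z" if \<rho>: "\<rho> = norm (z - z') / sqrt t" for z z' :: 'a
 proof -
  define b where "b = norm z / sqrt t"
  define b' where "b' = norm z' / sqrt t"
  have bsq: "b\<^sup>2 = (norm z)\<^sup>2 / t" "b'\<^sup>2 = (norm z')\<^sup>2 / t" using t by (auto simp: b_def b'_def power_divide)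
  have b0: "0 <= b" "0 <= b'" using t by (auto simp: b_def b'_def)
  have "norm z' <= norm z + norm (z - z')" using norm_triangle_ineq4[of z "z - z'"] by simp
  then have bb: "b' <= b + \<rho>" unfolding b_def b'_def \<rho> add_divide_distrib[symmetric] using t by (intro divide_right_mono) auto
  have "b'\<^sup>2 <= (b + \<rho>)\<^sup>2" using bb b0 by (intro power_mono) auto
  then have d: "b'\<^sup>2 - b\<^sup>2 <= \<rho> * (2 * b + \<rho>)" by (simp add: power2_eq_square algebra_simps)
  have h: "heat t w = t powr (- real DIM('a) / 2) * exp (- pi * ((norm w)\<^sup>2 / t))" for w :: 'a
   by (simp add: heat_def)
  have "exp (- pi * b'\<^sup>2) = exp (- pi * b\<^sup>2) * exp (pi * b\<^sup>2 - pi * b'\<^sup>2)" by (simp flip: exp_add)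
  then have "heat t z - heat t z' = heat t z * (1 - exp (pi * b\<^sup>2 - pi * b'\<^sup>2))"
   unfolding h bsq[symmetric] by (simp add: algebra_simps)
  also have "... <= heat t z * (pi * b'\<^sup>2 - pi * b\<^sup>2)"
   by (intro mult_left_mono heat_nonneg) (use exp_ge_add_one_self[of "pi * b\<^sup>2 - pi * b'\<^sup>2"] in linarith)
  also have "... <= heat t z * (pi * (\<rho> * (2 * (1 + b\<^sup>2) + \<rho> * (1 + b\<^sup>2))))"
  proof (intro mult_left_mono heat_nonneg)
   have "b <= 1 + b\<^sup>2" using zero_le_power2[of "b - 1"] b0 by (simp add: power2_diff)
   moreover have "\<rho> * 1 <= \<rho> * (1 + b\<^sup>2)" by (intro mult_left_mono \<rho>0) simp
   ultimately have "\<rho> * (2 * b + \<rho>) <= \<rho> * (2 * (1 + b\<^sup>2) + \<rho> * (1 + b\<^sup>2))" by (intro mult_left_mono \<rho>0) simp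
   then have "pi * (b'\<^sup>2 - b\<^sup>2) <= pi * (\<rho> * (2 * (1 + b\<^sup>2) + \<rho> * (1 + b\<^sup>2)))" using d by (intro mult_left_mono) auto
   then show "pi * b'\<^sup>2 - pi * b\<^sup>2 <= pi * (\<rho> * (2 * (1 + b\<^sup>2) + \<rho> * (1 + b\<^sup>2)))" by (simp add: right_diff_distrib)
  qed
  also have "... = pi * \<rho> * (2 + \<rho>) * (heat t z + b\<^sup>2 * heat t z)" by (simp add: algebra_simps)
  also have "... <= pi * \<rho> * (2 + \<rho>) * (?c * heat (2 * t) z + ?c * heat (2 * t) z)"
   unfolding bsq using \<rho>0 t by (intro mult_left_mono add_mono heat_le_double heat_moment_le_double) auto
  also have "... = pi * \<rho> * (4 + 2 * \<rho>) * ?c * heat (2 * t) z" by (simp add: algebra_simps)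
  finally show ?thesis .
 qed
 have n: "0 <= pi * \<rho> * (4 + 2 * \<rho>) * ?c * heat (2 * t) w" for w :: 'a using \<rho>0 by simp
 show ?thesis
  unfolding distrib_left[of "pi * \<rho> * (4 + 2 * \<rho>) * ?c"] abs_le_iff
  using one[OF \<rho>] one[of z' z, unfolded norm_minus_commute[of z' z], OF \<rho>] n[of z] n[of z'] by linarith
qed

text \<open>A bound for \<open>heat t z\<close> at all t >= \<sigma> simultaneously
  (\<open>heat_le_maj\<close>), hence for \<open>heat (t + \<sigma>) z\<close> uniformly in t >= 0.
  For small \<sigma> it is constant in \<sigma>, which keeps its integral against the weight
  \<sigma>^(a - 1) finite.\<close>

definition heat_maj :: "real => 'a::euclidean_space => real" where
 "heat_maj \<sigma> z = (if \<sigma> < (norm z)\<^sup>2 then (2 * pi / DIM('a)) powr (- real DIM('a) / 2) * norm z powr (- real DIM('a)) else \<sigma> powr (- real DIM('a) / 2))"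

lemma heat_maj_measurable [measurable]: "(\<lambda>(\<sigma>, z). heat_maj \<sigma> (z::'a::euclidean_space)) \<in> borel_measurable (borel \<Otimes>\<^sub>M borel)"
 unfolding heat_maj_def by measurable

lemma heat_maj_nonneg [simp]: "0 <= heat_maj \<sigma> z"
 by (simp add: heat_maj_def)

lemma heat_le_powr: "0 < \<sigma> ==> \<sigma> <= t ==> heat t (z::'a::euclidean_space) <= \<sigma> powr (- real DIM('a) / 2)"
 using mult_mono[of "t powr (- real DIM('a) / 2)" "\<sigma> powr (- real DIM('a) / 2)" "exp (- pi * (norm z)\<^sup>2 / t)" 1]
  powr_mono2'[of "- real DIM('a) / 2" \<sigma> t] by (simp add: heat_def)

lemma heat_le_maj:
 fixes z :: "'a::euclidean_space"
 assumes \<sigma>: "0 < \<sigma>" "\<sigma> <= t" and z: "z ~= 0"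
 shows "heat t z <= heat_maj \<sigma> z"
proof -
 let ?m = "real DIM('a) / 2"
 have m: "0 < ?m" by simp
 have t: "0 < t" using \<sigma> by simp
 define u where "u = (norm z)\<^sup>2 / t"
 have u: "0 < u" using t z by (simp add: u_def)
 \<comment> \<open>Raising this to the power m = n / 2 bounds u^m exp (- pi u), and the constant in
   \<open>heat_maj\<close> results.\<close>
 have "u * (pi / ?m) <= exp (u * (pi / ?m))" using exp_ge_add_one_self[of "u * (pi / ?m)"] by linarith
 then have "(u * (pi / ?m)) powr ?m <= exp (u * (pi / ?m)) powr ?m" using u by (intro powr_mono2) auto
 also have "... = exp (pi * u)" by (simp add: exp_powr_real)
 also have "(u * (pi / ?m)) powr ?m = u powr ?m * (pi / ?m) powr ?m" using powr_mult[of u "pi / ?m" ?m] u by simp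
 finally have "u powr ?m * (pi / ?m) powr ?m <= exp (pi * u)" .
 then have "u powr ?m * exp (- pi * u) <= (pi / ?m) powr (- ?m)"
  by (simp add: powr_minus exp_minus field_simps)
 then have "norm z powr (- real DIM('a)) * (u powr ?m * exp (- pi * u)) <= norm z powr (- real DIM('a)) * (pi / ?m) powr (- ?m)"
  by (rule mult_left_mono) simp
 moreover have "heat t z = norm z powr (- real DIM('a)) * (u powr ?m * exp (- pi * u))"
 proof -
  have "u powr ?m = norm z powr (real DIM('a)) * t powr (- ?m)"
   using t z by (simp add: u_def powr_divide powr_minus powr_powr field_simps flip: powr_numeral)
  then show ?thesis using z by (simp add: heat_def u_def powr_minus field_simps)
 qed
 ultimately have "heat t z <= (2 * pi / DIM('a)) powr (- ?m) * norm z powr (- real DIM('a))"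
  by (simp add: mult_ac)
 then show ?thesis using heat_le_powr[OF \<sigma>, of z] by (simp add: heat_maj_def)
qed

definition heat_maj_const :: "'a::euclidean_space itself => real => real" where
 "heat_maj_const _ a = (2 * pi / DIM('a)) powr (- real DIM('a) / 2) / a + 1 / (DIM('a) / 2 - a)"

text \<open>Cutting at \<sigma> = |z|^2 leaves two pure powers, with convergence at infinity due to
  2 a < n. Thus one multiple of the Riesz kernel dominates all the integrals in
  \<open>heat_pot\<close>.\<close>

lemma heat_maj_integral:
 fixes z :: "'a::euclidean_space"
 assumes a: "0 < a" "2 * a < real DIM('a)" and z: "z ~= 0"
 shows "(NBINT \<sigma>. ennreal (frac_weight (- a) \<sigma> * heat_maj \<sigma> z)) = ennreal (heat_maj_const TYPE('a) a * riesz (2 * a) z)"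
proof -
 let ?n = "real DIM('a)" and ?R = "(norm z)\<^sup>2"
 define k where "k = (2 * pi / ?n) powr (- ?n / 2) * norm z powr (- ?n)"
 have k: "0 <= k" by (simp add: k_def)
 define b where "b = ?n / 2 - a"
 have b: "0 < b" using a by (simp add: b_def)
 have R: "0 < ?R" using z by simp
 have "(NBINT \<sigma>. ennreal (frac_weight (- a) \<sigma> * heat_maj \<sigma> z))
  = (NBINT \<sigma>. ennreal k * (ennreal (\<sigma> powr (a - 1)) * indicator {0<..<?R} \<sigma>) + ennreal (\<sigma> powr (- b - 1)) * indicator {?R..} \<sigma>)"
 proof (rule nn_integral_cong)
  fix \<sigma> :: real
  consider "\<sigma> <= 0" | "0 < \<sigma>" "\<sigma> < ?R" | "?R <= \<sigma>" by linarith
  then show "ennreal (frac_weight (- a) \<sigma> * heat_maj \<sigma> z) = ennreal k * (ennreal (\<sigma> powr (a - 1)) * indicator {0<..<?R} \<sigma>) + ennreal (\<sigma> powr (- b - 1)) * indicator {?R..} \<sigma>"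
  proof cases
   case 1
   then have "\<not> ?R <= \<sigma>" using R by linarith
   then show ?thesis using 1 by (simp add: frac_weight_def)
  next
   case 2
   then show ?thesis using k by (simp add: frac_weight_def heat_maj_def k_def ennreal_mult[symmetric] mult_ac)
  next
   case 3
   then have "0 < \<sigma>" using R by linarith
   then show ?thesis using 3 by (simp add: frac_weight_def heat_maj_def b_def flip: powr_add) (simp add: algebra_simps)
  qed
 qed
 also have "... = ennreal k * (NBINT \<sigma>. ennreal (\<sigma> powr (a - 1)) * indicator {0<..<?R} \<sigma>) + (NBINT \<sigma>. ennreal (\<sigma> powr (- b - 1)) * indicator {?R..} \<sigma>)"
  by (subst nn_integral_add, measurable, subst nn_integral_cmult, measurable)
 also have "... = ennreal k * ennreal (?R powr a / a) + ennreal (?R powr (- b) / b)"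
  using nn_integral_powr_from_0[of a ?R] nn_integral_powr_to_inf[of b ?R] a b R by simp
 also have "... = ennreal (k * (?R powr a / a) + ?R powr (- b) / b)"
  using a b k by (simp flip: ennreal_mult ennreal_plus)
 also have "k * (?R powr a / a) + ?R powr (- b) / b = heat_maj_const TYPE('a) a * riesz (2 * a) z"
 proof -
  have "?R powr e = norm z powr (2 * e)" for e using z by (simp add: powr_powr flip: powr_numeral)
  moreover have "norm z powr (- ?n) * norm z powr (2 * a) = norm z powr (2 * a - ?n)" by (simp flip: powr_add)
  moreover have "2 * - b = 2 * a - ?n" by (simp add: b_def)
  ultimately show ?thesis
   by (simp only: k_def heat_maj_const_def riesz_def b_def[symmetric]) (simp add: algebra_simps)
 qed
 finally show ?thesis .
qed

lemma heat_maj_const_nonneg: "0 < a ==> 2 * a < real DIM('a) ==> 0 <= heat_maj_const TYPE('a::euclidean_space) a"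
 by (simp add: heat_maj_const_def)

lemma heat_maj_integrable:
 fixes z :: "'a::euclidean_space"
 assumes "0 < a" "2 * a < real DIM('a)" "z ~= 0"
 shows "integrable lborel (\<lambda>\<sigma>. frac_weight (- a) \<sigma> * heat_maj \<sigma> z)"
  and "(LBINT \<sigma>. frac_weight (- a) \<sigma> * heat_maj \<sigma> z) = heat_maj_const TYPE('a) a * riesz (2 * a) z"
proof -
 show i: "integrable lborel (\<lambda>\<sigma>. frac_weight (- a) \<sigma> * heat_maj \<sigma> z)"
  by (rule integrableI_nonneg) (auto simp: heat_maj_integral[OF assms])
 show "(LBINT \<sigma>. frac_weight (- a) \<sigma> * heat_maj \<sigma> z) = heat_maj_const TYPE('a) a * riesz (2 * a) z"
  by (subst integral_eq_nn_integral) (auto simp: heat_maj_integral[OF assms] heat_maj_const_nonneg[OF assms(1,2)])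
qed

text \<open>The fractional integral of order a of the heat kernel in its time variable, not
  normalised by \<open>Gamma a\<close>. By the semigroup law it is a multiple of the heat average at
  scale t of the Riesz kernel of order 2 a, to which it reduces at t = 0
  (\<open>heat_pot_0\<close>).\<close>

definition heat_pot :: "real => real => 'a::euclidean_space => real" where
 "heat_pot a t z = (LBINT \<sigma>. frac_weight (- a) \<sigma> * heat (t + \<sigma>) z)"

lemma heat_pot_measurable [measurable]: "(\<lambda>(t, z). heat_pot a t (z::'a::euclidean_space)) \<in> borel_measurable (borel \<Otimes>\<^sub>M borel)"
 unfolding heat_pot_def by measurable

lemma frac_weight_heat_le:
 fixes z :: "'a::euclidean_space"
 assumes "z ~= 0" "0 < \<sigma> ==> \<sigma> <= t"
 shows "frac_weight (- a) \<sigma> * heat t z <= frac_weight (- a) \<sigma> * heat_maj \<sigma> z"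
 using heat_le_maj[of \<sigma> t z] assms by (cases "0 < \<sigma>") (auto simp: frac_weight_def intro!: mult_left_mono)

lemma heat_pot_integrable:
 fixes z :: "'a::euclidean_space"
 assumes "0 < a" "2 * a < real DIM('a)" "z ~= 0" "0 <= t"
 shows "integrable lborel (\<lambda>\<sigma>. frac_weight (- a) \<sigma> * heat (t + \<sigma>) z)"
 by (rule Bochner_Integration.integrable_bound[OF heat_maj_integrable(1)[OF assms(1-3)]])
  (use frac_weight_heat_le[OF assms(3)] assms(4) in auto)

lemma heat_pot_le:
 fixes z :: "'a::euclidean_space"
 assumes "0 < a" "2 * a < real DIM('a)" "z ~= 0" "0 <= t"
 shows "\<bar>heat_pot a t z\<bar> <= heat_maj_const TYPE('a) a * riesz (2 * a) z"
proof -
 have "0 <= heat_pot a t z" unfolding heat_pot_def by (intro integral_nonneg_AE AE_I2) simp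
 moreover have "heat_pot a t z <= (LBINT \<sigma>. frac_weight (- a) \<sigma> * heat_maj \<sigma> z)"
  unfolding heat_pot_def
  by (intro integral_mono heat_pot_integrable[OF assms] heat_maj_integrable(1)[OF assms(1-3)] frac_weight_heat_le)
   (use assms in auto)
 ultimately show ?thesis unfolding heat_maj_integrable(2)[OF assms(1-3)] by simp
qed

lemma heat_pot_tendsto_0:
 fixes z :: "'a::euclidean_space"
 assumes a: "0 < a" "2 * a < real DIM('a)" and z: "z ~= 0" and X: "filterlim X at_top sequentially" "!!k. 0 < X k"
 shows "(\<lambda>k. heat_pot a (X k) z) \<longlonglongrightarrow> 0"
proof -
 have "(\<lambda>k. heat_pot a (X k) z) \<longlonglongrightarrow> (LINT \<sigma>|(lborel :: real measure). 0)"
  unfolding heat_pot_def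
 proof (rule integral_dominated_convergence[OF _ _ heat_maj_integrable(1)[OF a z]])
  have "(\<lambda>k. heat (X k + \<sigma>) z) \<longlonglongrightarrow> 0" if "0 < \<sigma>" for \<sigma>
  proof (rule real_tendsto_sandwich[OF always_eventually always_eventually tendsto_const])
   show "(\<lambda>k. X k powr (- real DIM('a) / 2)) \<longlonglongrightarrow> 0"
    by (intro tendsto_neg_powr X(1)) simp
   show "\<forall>k. heat (X k + \<sigma>) z <= X k powr (- real DIM('a) / 2)"
    using X(2) that by (intro allI heat_le_powr) (auto intro: less_imp_le)
  qed simp
  then have "(\<lambda>k. frac_weight (- a) \<sigma> * heat (X k + \<sigma>) z) \<longlonglongrightarrow> 0" for \<sigma>
   by (cases "0 < \<sigma>") (auto simp: frac_weight_def intro!: tendsto_mult_right_zero)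
  then show "AE \<sigma> in lborel. (\<lambda>k. frac_weight (- a) \<sigma> * heat (X k + \<sigma>) z) \<longlonglongrightarrow> 0" by simp
  show "AE \<sigma> in lborel. norm (frac_weight (- a) \<sigma> * heat (X k + \<sigma>) z) <= frac_weight (- a) \<sigma> * heat_maj \<sigma> z" for k
   using frac_weight_heat_le[OF z, of _ "X k + _"] less_imp_le[OF X(2)[of k]] by (intro AE_I2) auto
 qed measurable
 then show ?thesis by simp
qed

lemma heat_pot_tendsto:
 fixes z :: "'a::euclidean_space"
 assumes a: "0 < a" "2 * a < real DIM('a)" and z: "z ~= 0" and X: "X \<longlonglongrightarrow> 0" "!!k. 0 < X k"
 shows "(\<lambda>k. heat_pot a (X k) z) \<longlonglongrightarrow> heat_pot a 0 z"
 unfolding heat_pot_def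
proof (rule integral_dominated_convergence[OF _ _ heat_maj_integrable(1)[OF a z]])
 have "(\<lambda>k. frac_weight (- a) \<sigma> * heat (X k + \<sigma>) z) \<longlonglongrightarrow> frac_weight (- a) \<sigma> * heat (0 + \<sigma>) z" for \<sigma>
 proof (cases "0 < \<sigma>")
  case True
  then show ?thesis unfolding heat_def by (intro tendsto_intros X(1)) auto
 qed (simp add: frac_weight_def)
 then show "AE \<sigma> in lborel. (\<lambda>k. frac_weight (- a) \<sigma> * heat (X k + \<sigma>) z) \<longlonglongrightarrow> frac_weight (- a) \<sigma> * heat (0 + \<sigma>) z" by simp
 show "AE \<sigma> in lborel. norm (frac_weight (- a) \<sigma> * heat (X k + \<sigma>) z) <= frac_weight (- a) \<sigma> * heat_maj \<sigma> z" for k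
  using frac_weight_heat_le[OF z, of _ "X k + _"] less_imp_le[OF X(2)[of k]] by (intro AE_I2) auto
qed measurable

definition heat_pot_const :: "'a::euclidean_space itself => real => real" where
 "heat_pot_const _ a = (LBINT \<sigma>. frac_weight (- a) \<sigma> * (\<sigma> powr (- real DIM('a) / 2) * exp (- pi / \<sigma>)))"

text \<open>The substitution of |z|^2 \<sigma> for \<sigma> takes all dependence on z out of the
  integral; \<open>heat_pot_const\<close> is what is left, the value at norm 1.\<close>

lemma heat_pot_0:
 fixes z :: "'a::euclidean_space"
 assumes z: "z ~= 0"
 shows "heat_pot a 0 z = heat_pot_const TYPE('a) a * riesz (2 * a) z"
proof -
 let ?R = "(norm z)\<^sup>2" and ?m = "- real DIM('a) / 2"
 have R: "0 < ?R" using z by simp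
 have p: "?R powr e = norm z powr (2 * e)" for e using z by (simp add: powr_powr flip: powr_numeral)
 have "heat_pot a 0 z = ?R * (LBINT \<sigma>. frac_weight (- a) (?R * \<sigma>) * heat (?R * \<sigma>) z)"
  unfolding heat_pot_def using lborel_integral_real_affine[of ?R "\<lambda>\<sigma>. frac_weight (- a) \<sigma> * heat (0 + \<sigma>) z" 0] R by simp
 also have "... = (LBINT \<sigma>. (?R * ?R powr (a - 1) * ?R powr ?m) * (frac_weight (- a) \<sigma> * (\<sigma> powr ?m * exp (- pi / \<sigma>))))"
  unfolding integral_mult_right_zero[symmetric]
 proof (intro Bochner_Integration.integral_cong refl)
  fix \<sigma> :: real
  show "?R * (frac_weight (- a) (?R * \<sigma>) * heat (?R * \<sigma>) z) = (?R * ?R powr (a - 1) * ?R powr ?m) * (frac_weight (- a) \<sigma> * (\<sigma> powr ?m * exp (- pi / \<sigma>)))"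
  proof (cases "0 < \<sigma>")
   case True
   have "heat (?R * \<sigma>) z = ?R powr ?m * (\<sigma> powr ?m * exp (- pi / \<sigma>))"
    using True R z by (simp add: heat_def powr_mult)
   moreover have "frac_weight (- a) (?R * \<sigma>) = ?R powr (a - 1) * frac_weight (- a) \<sigma>" using frac_weight_scale[OF R, of "- a"] by simp
   ultimately show ?thesis by (simp only: mult_ac)
  next
   case False
   then show ?thesis using R by (simp add: frac_weight_scale) (simp add: frac_weight_def)
  qed
 qed
 also have "?R * ?R powr (a - 1) * ?R powr ?m = ?R powr (a - real DIM('a) / 2)"
 proof -
  have "?R * ?R powr (a - 1) * ?R powr ?m = ?R powr 1 * ?R powr (a - 1) * ?R powr ?m" using R by simp
  also have "... = ?R powr (1 + (a - 1) + ?m)" by (simp only: powr_add)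
  finally show ?thesis by simp
 qed
 also have "?R powr (a - real DIM('a) / 2) = riesz (2 * a) z"
  unfolding p riesz_def by (simp add: algebra_simps)
 finally show ?thesis by (simp add: heat_pot_const_def mult.commute)
qed

text \<open>The fractional derivative in t commutes with integration in y. The bound
  \<open>diff\<close> is exactly integrable against \<open>frac_weight a\<close>, which justifies
  Fubini. It is used with \<open>f\<close> and the heat kernel, with \<open>g\<close> and
  \<open>heat_pot\<close>, and on the real line with the weight of the fractional integral in place
  of \<open>h\<close>.\<close>

lemma kernel_frac:
 fixes h :: "'a::euclidean_space => real" and k :: "real => 'a => real"
 assumes a: "0 < a" "a < 1" and [measurable]: "h \<in> borel_measurable borel" "(\<lambda>(t, z). k t z) \<in> borel_measurable (borel \<Otimes>\<^sub>M borel)"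
  and int: "!!t. 0 < t ==> integrable lborel (\<lambda>y. h y * k t (y - x))"
  and B: "0 <= B" and diff: "!!t \<tau>. 0 < t ==> 0 < \<tau> ==> (NBINT y. ennreal (\<bar>h y\<bar> * \<bar>k t (y - x) - k (t + \<tau>) (y - x)\<bar>)) <= ennreal (B * min 1 (\<tau> / t))"
 defines "M \<equiv> \<lambda>t. LBINT y. h y * k t (y - x)"
 shows kernel_frac_lip: "!!t \<tau>. 0 < t ==> 0 < \<tau> ==> \<bar>M t - M (t + \<tau>)\<bar> <= B * min 1 (\<tau> / t)"
  and kernel_frac_eq: "!!t. 0 < t ==> (LBINT y. h y * (LBINT \<tau>. frac_weight a \<tau> * (k t (y - x) - k (t + \<tau>) (y - x))))
   = (LBINT \<tau>. frac_weight a \<tau> * (M t - M (t + \<tau>)))"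
  and kernel_frac_bound: "!!t. 0 < t ==> (NBINT y. ennreal \<bar>h y * (LBINT \<tau>. frac_weight a \<tau> * (k t (y - x) - k (t + \<tau>) (y - x)))\<bar>)
   <= ennreal (B * (frac_const a * t powr (- a)))"
proof -
 let ?L = "\<lambda>t y. LBINT \<tau>. frac_weight a \<tau> * (k t (y - x) - k (t + \<tau>) (y - x))"
 have d: "M t - M (t + \<tau>) = (LBINT y. h y * (k t (y - x) - k (t + \<tau>) (y - x)))" if "0 < t" "0 < \<tau>" for t \<tau>
  using int[of t] int[of "t + \<tau>"] that by (simp add: M_def right_diff_distrib)
 show "\<bar>M t - M (t + \<tau>)\<bar> <= B * min 1 (\<tau> / t)" if "0 < t" "0 < \<tau>" for t \<tau>
  unfolding d[OF that] real_norm_def[symmetric]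
  by (rule norm_integral_le_real) (use diff[OF that] B that in \<open>auto simp: abs_mult\<close>)
 fix t :: real assume t: "0 < t"
 let ?F = "\<lambda>\<tau> y. h y * (frac_weight a \<tau> * (k t (y - x) - k (t + \<tau>) (y - x)))"
 have F: "(NBINT \<tau>. NBINT y. ennreal (norm (?F \<tau> y))) <= ennreal (B * (frac_const a * t powr (- a)))"
 proof -
  have "(NBINT \<tau>. NBINT y. ennreal (norm (?F \<tau> y))) <= (NBINT \<tau>. ennreal B * ennreal (frac_weight a \<tau> * min 1 (\<tau> / t)))"
  proof (rule nn_integral_mono)
   fix \<tau> :: real
   show "(NBINT y. ennreal (norm (?F \<tau> y))) <= ennreal B * ennreal (frac_weight a \<tau> * min 1 (\<tau> / t))"
   proof (cases "0 < \<tau>")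
    case True
    have "(NBINT y. ennreal (norm (?F \<tau> y))) = (NBINT y. ennreal (frac_weight a \<tau>) * ennreal (\<bar>h y\<bar> * \<bar>k t (y - x) - k (t + \<tau>) (y - x)\<bar>))"
     by (intro nn_integral_cong) (simp add: abs_mult mult.left_commute flip: ennreal_mult)
    also have "... = ennreal (frac_weight a \<tau>) * (NBINT y. ennreal (\<bar>h y\<bar> * \<bar>k t (y - x) - k (t + \<tau>) (y - x)\<bar>))"
     by (rule nn_integral_cmult) measurable
    also have "... <= ennreal (frac_weight a \<tau>) * ennreal (B * min 1 (\<tau> / t))"
     by (rule mult_left_mono[OF diff[OF t True]]) simp
    also have "... = ennreal B * ennreal (frac_weight a \<tau> * min 1 (\<tau> / t))"
     using B t True by (simp add: mult.left_commute flip: ennreal_mult)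
    finally show ?thesis .
   qed (simp add: frac_weight_def)
  qed
  also have "... = ennreal B * (NBINT \<tau>. ennreal (frac_weight a \<tau> * min 1 (\<tau> / t)))"
   by (rule nn_integral_cmult) measurable
  also have "... = ennreal (B * (frac_const a * t powr (- a)))"
   unfolding frac_weight_min_integral[OF a t] using B by (rule ennreal_mult'[symmetric])
  finally show ?thesis .
 qed
 then have fin: "(NBINT \<tau>. NBINT y. ennreal (norm (?F \<tau> y))) < \<infinity>"
  by (rule order_le_less_trans) simp
 have in_y: "h y * (?L t y) = (LBINT \<tau>. ?F \<tau> y)" for y
  by (rule integral_mult_right_zero[symmetric])
 have in_t: "frac_weight a \<tau> * (M t - M (t + \<tau>)) = (LBINT y. ?F \<tau> y)" for \<tau>
 proof (cases "0 < \<tau>")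
  case True
  show ?thesis unfolding d[OF t True] integral_mult_right_zero[symmetric] by (simp only: mult_ac)
 qed (simp add: frac_weight_def)
 show "(LBINT y. h y * (?L t y))
   = (LBINT \<tau>. frac_weight a \<tau> * (M t - M (t + \<tau>)))"
  unfolding in_y in_t by (rule Fubini_nn_eq[OF _ _ _ fin, symmetric]) (auto intro: sigma_finite_lborel)
 have "(NBINT y. ennreal \<bar>(LBINT \<tau>. ?F \<tau> y)\<bar>) <= (NBINT y. NBINT \<tau>. ennreal (norm (?F \<tau> y)))"
  unfolding real_norm_def[symmetric] by (intro nn_integral_mono norm_integral_le_nn)
 also have "... = (NBINT \<tau>. NBINT y. ennreal (norm (?F \<tau> y)))"
  by (rule lborel_pair.Fubini') measurable
 also note F
 finally show "(NBINT y. ennreal \<bar>h y * (?L t y)\<bar>)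
   <= ennreal (B * (frac_const a * t powr (- a)))"
  unfolding in_y .
qed

section \<open>Weighted means of fractional derivatives over scales\<close>

definition frac_lip :: "(real => real) => bool" where
 "frac_lip M \<longleftrightarrow> M \<in> borel_measurable borel & (\<exists>B. \<forall>t \<tau>. 0 < t \<longrightarrow> 0 < \<tau> \<longrightarrow> \<bar>M t - M (t + \<tau>)\<bar> <= B * min 1 (\<tau> / t))"

lemma frac_lip_diff:
 assumes "frac_lip M" "frac_lip N"
 shows "frac_lip (\<lambda>t. M t - c * N t)"
proof -
 obtain B D where B: "!!t \<tau>. 0 < t ==> 0 < \<tau> ==> \<bar>M t - M (t + \<tau>)\<bar> <= B * min 1 (\<tau> / t)"
  and D: "!!t \<tau>. 0 < t ==> 0 < \<tau> ==> \<bar>N t - N (t + \<tau>)\<bar> <= D * min 1 (\<tau> / t)"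
  and [measurable]: "M \<in> borel_measurable borel" "N \<in> borel_measurable borel"
  using assms unfolding frac_lip_def by blast
 have "\<bar>(M t - c * N t) - (M (t + \<tau>) - c * N (t + \<tau>))\<bar> <= (B + \<bar>c\<bar> * D) * min 1 (\<tau> / t)" if "0 < t" "0 < \<tau>" for t \<tau>
 proof -
  have "\<bar>(M t - c * N t) - (M (t + \<tau>) - c * N (t + \<tau>))\<bar> = \<bar>(M t - M (t + \<tau>)) - c * (N t - N (t + \<tau>))\<bar>" by (simp add: algebra_simps)
  also have "... <= \<bar>M t - M (t + \<tau>)\<bar> + \<bar>c\<bar> * \<bar>N t - N (t + \<tau>)\<bar>" unfolding abs_mult[symmetric] by (rule abs_triangle_ineq4)
  also have "... <= B * min 1 (\<tau> / t) + \<bar>c\<bar> * (D * min 1 (\<tau> / t))" by (intro add_mono mult_left_mono B D that) simp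
  finally show ?thesis by (simp add: algebra_simps)
 qed
 then show ?thesis unfolding frac_lip_def by auto
qed

text \<open>The fractional derivative in the scale, averaged with \<open>osc\<close>. In this form
  the operator of order 2 a acts on the test functions (\<open>osc_heat_multiplier\<close>), and the
  hypothesis of \<open>frac_uniqueness\<close> is \<open>osc_frac a U r = 0\<close>.\<close>

definition osc_frac :: "real => (real => real) => real => real" where
 "osc_frac a M r = (LBINT v. osc v * (LBINT \<tau>. frac_weight a \<tau> * (M (r * exp v) - M (r * exp v + \<tau>))))"

lemma osc_powr_integrable: "0 < r ==> integrable lborel (\<lambda>v. \<bar>osc v\<bar> * (r * exp v) powr e)"
proof -
 assume "0 < r"
 then have "\<bar>osc v\<bar> * (r * exp v) powr e = r powr e * \<bar>osc v * exp (e * v)\<bar>" for v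
  by (simp add: powr_mult exp_powr_real abs_mult mult_ac)
 then show ?thesis by (simp add: integrable_mult_right integrable_abs[OF osc_exp_integrable])
qed

lemma osc_frac_integrable:
 assumes a: "0 < a" "a < 1" and r: "0 < r" and M: "frac_lip M"
 shows "0 < t ==> integrable lborel (\<lambda>\<tau>. frac_weight a \<tau> * (M t - M (t + \<tau>)))"
  and "integrable lborel (\<lambda>v. osc v * (LBINT \<tau>. frac_weight a \<tau> * (M (r * exp v) - M (r * exp v + \<tau>))))"
proof -
 let ?L = "\<lambda>v. LBINT \<tau>. frac_weight a \<tau> * (M (r * exp v) - M (r * exp v + \<tau>))"
 obtain B where B: "!!t \<tau>. 0 < t ==> 0 < \<tau> ==> \<bar>M t - M (t + \<tau>)\<bar> <= B * min 1 (\<tau> / t)"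
  and [measurable]: "M \<in> borel_measurable borel" using M unfolding frac_lip_def by blast
 have B0: "0 <= B" using B[of 1 1] by simp
 show "0 < t ==> integrable lborel (\<lambda>\<tau>. frac_weight a \<tau> * (M t - M (t + \<tau>)))"
  by (rule frac_integrable[OF a, of t _ B]) (use B in auto)
 have le: "\<bar>(LBINT \<tau>. frac_weight a \<tau> * (M t - M (t + \<tau>)))\<bar> <= B * (frac_const a * t powr (- a))" if t: "0 < t" for t
  unfolding real_norm_def[symmetric]
 proof (rule norm_integral_le_real)
  have "(NBINT \<tau>. ennreal (norm (frac_weight a \<tau> * (M t - M (t + \<tau>))))) <= (NBINT \<tau>. ennreal B * ennreal (frac_weight a \<tau> * min 1 (\<tau> / t)))"
  proof (rule nn_integral_mono)
   fix \<tau> :: real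
   have "frac_weight a \<tau> * \<bar>M t - M (t + \<tau>)\<bar> <= frac_weight a \<tau> * (B * min 1 (\<tau> / t))"
    using B[OF t, of \<tau>] by (cases "0 < \<tau>") (auto simp: frac_weight_def intro!: mult_left_mono)
   then show "ennreal (norm (frac_weight a \<tau> * (M t - M (t + \<tau>)))) <= ennreal B * ennreal (frac_weight a \<tau> * min 1 (\<tau> / t))"
    unfolding ennreal_mult'[OF B0, symmetric] by (intro ennreal_leI) (simp add: abs_mult mult.left_commute)
  qed
  also have "... = ennreal B * (NBINT \<tau>. ennreal (frac_weight a \<tau> * min 1 (\<tau> / t)))"
   by (rule nn_integral_cmult) measurable
  also have "... = ennreal (B * (frac_const a * t powr (- a)))"
   unfolding frac_weight_min_integral[OF a t] using B0 by (rule ennreal_mult'[symmetric])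
  finally show "(NBINT \<tau>. ennreal (norm (frac_weight a \<tau> * (M t - M (t + \<tau>))))) <= ennreal (B * (frac_const a * t powr (- a)))" .
  show "0 <= B * (frac_const a * t powr (- a))" using B0 a by (simp add: frac_const_def)
 qed
 show "integrable lborel (\<lambda>v. osc v * (?L v))"
 proof (rule Bochner_Integration.integrable_bound)
  show "integrable lborel (\<lambda>v. (B * frac_const a) * (\<bar>osc v\<bar> * (r * exp v) powr (- a)))"
   by (intro integrable_mult_right osc_powr_integrable r)
  show "AE v in lborel. norm (osc v * (?L v))
   <= norm ((B * frac_const a) * (\<bar>osc v\<bar> * (r * exp v) powr (- a)))"
  proof (rule AE_I2)
   fix v
   have "\<bar>osc v\<bar> * \<bar>(?L v)\<bar> <= \<bar>osc v\<bar> * (B * (frac_const a * (r * exp v) powr (- a)))"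
    using r by (intro mult_left_mono le) auto
   also have "... = (B * frac_const a) * (\<bar>osc v\<bar> * (r * exp v) powr (- a))" by (simp only: mult_ac)
   also have "... <= norm ..." by simp
   finally show "norm (osc v * (?L v))
    <= norm ((B * frac_const a) * (\<bar>osc v\<bar> * (r * exp v) powr (- a)))" by (simp only: real_norm_def abs_mult)
  qed
 qed measurable
qed

lemma osc_frac_diff:
 assumes a: "0 < a" "a < 1" and r: "0 < r" and M: "frac_lip M" and N: "frac_lip N"
 shows "osc_frac a (\<lambda>t. M t - c * N t) r = osc_frac a M r - c * osc_frac a N r"
proof -
 let ?I = "\<lambda>M v. LBINT \<tau>. frac_weight a \<tau> * (M (r * exp v) - M (r * exp v + \<tau>))"
 note iM = osc_frac_integrable[OF a r M] and iN = osc_frac_integrable[OF a r N]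
 have rp: "0 < r * exp v" for v using r by simp
 have I: "?I (\<lambda>t. M t - c * N t) v = ?I M v - c * ?I N v" for v
 proof -
  have "?I (\<lambda>t. M t - c * N t) v = (LBINT \<tau>. frac_weight a \<tau> * (M (r * exp v) - M (r * exp v + \<tau>)) - c * (frac_weight a \<tau> * (N (r * exp v) - N (r * exp v + \<tau>))))"
   by (intro Bochner_Integration.integral_cong refl) (simp add: algebra_simps)
  then show ?thesis using iM(1)[OF rp[of v]] iN(1)[OF rp[of v]] by simp
 qed
 have "osc_frac a (\<lambda>t. M t - c * N t) r = (LBINT v. osc v * ?I M v - c * (osc v * ?I N v))"
  unfolding osc_frac_def I by (intro Bochner_Integration.integral_cong refl) (simp only: right_diff_distrib mult.left_commute)
 then show ?thesis using iM(2) iN(2) by (simp add: osc_frac_def)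
qed

text \<open>Its value is Gamma (1 - a) / a, but positivity suffices: the constant cancels in
  \<open>riesz_representation\<close>.\<close>

definition frac_exp_const :: "real => real" where
 "frac_exp_const a = (LBINT \<tau>. frac_weight a \<tau> * (1 - exp (- \<tau>)))"

lemma
 fixes a l :: real
 assumes a: "0 < a" "a < 1" and l: "0 <= l"
 shows frac_exp_integrable: "integrable lborel (\<lambda>\<tau>. frac_weight a \<tau> * (1 - exp (- (l * \<tau>))))"
  and frac_exp_integral: "(LBINT \<tau>. frac_weight a \<tau> * (1 - exp (- (l * \<tau>)))) = frac_exp_const a * l powr a"
proof -
 have "integrable lborel (\<lambda>\<tau>. frac_weight a \<tau> * (1 - exp (- (l * \<tau>)))) &
  (LBINT \<tau>. frac_weight a \<tau> * (1 - exp (- (l * \<tau>)))) = frac_exp_const a * l powr a"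
 proof (cases "l = 0")
  case False
  then have l: "0 < l" using l by simp
  have "\<bar>1 - exp (- (l * \<tau>))\<bar> <= 1 * min 1 (\<tau> / (1 / l))" if "0 < \<tau>" for \<tau>
   using exp_ge_add_one_self[of "- (l * \<tau>)"] that l by (auto simp: abs_le_iff min_def mult.commute)
  then have i: "integrable lborel (\<lambda>\<tau>. frac_weight a \<tau> * (1 - exp (- (l * \<tau>))))"
   using l by (intro frac_integrable[OF a, of "1 / l" _ 1]) auto
  have "frac_exp_const a = l * (LBINT \<tau>. frac_weight a (l * \<tau>) * (1 - exp (- (l * \<tau>))))"
   unfolding frac_exp_const_def using lborel_integral_real_affine[of l "\<lambda>\<tau>. frac_weight a \<tau> * (1 - exp (- \<tau>))" 0] l by simp
  also have "... = (l * l powr (- a - 1)) * (LBINT \<tau>. frac_weight a \<tau> * (1 - exp (- (l * \<tau>))))"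
   by (simp only: frac_weight_scale[OF l] mult.assoc integral_mult_right_zero)
  also have "l * l powr (- a - 1) = l powr (- a)" using l by (simp add: powr_diff)
  finally show ?thesis using i l by (simp add: powr_minus field_simps)
 qed simp
 then show "integrable lborel (\<lambda>\<tau>. frac_weight a \<tau> * (1 - exp (- (l * \<tau>))))"
  "(LBINT \<tau>. frac_weight a \<tau> * (1 - exp (- (l * \<tau>)))) = frac_exp_const a * l powr a" by auto
qed

lemma frac_exp_const_pos:
 assumes a: "0 < a" "a < 1"
 shows "0 < frac_exp_const a"
proof -
 let ?h = "\<lambda>\<tau>. frac_weight a \<tau> * (1 - exp (- (1 * \<tau>)))"
 have i: "integrable lborel ?h" by (rule frac_exp_integrable[OF a]) simp
 have nn: "AE \<tau> in lborel. 0 <= ?h \<tau>" by (intro AE_I2) (auto simp: frac_weight_def indicator_def)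
 have "0 <= frac_exp_const a" unfolding frac_exp_const_def using integral_nonneg_AE[OF nn] by simp
 moreover have "frac_exp_const a ~= 0"
 proof
  assume "frac_exp_const a = 0"
  then have "AE \<tau> in lborel. ?h \<tau> = 0"
   using integral_nonneg_eq_0_iff_AE[OF i nn] by (simp add: frac_exp_const_def)
  then have "AE \<tau> in lborel. \<not> \<tau> \<in> {0<..<1::real}"
   by eventually_elim (auto simp: frac_weight_def)
  from emeasure_eq_0_AE[OF this] have "emeasure lborel {0<..<1::real} = 0"
   by (simp only: space_lborel space_borel UNIV_I simp_thms Collect_mem_eq)
  then show False by simp
 qed
 ultimately show ?thesis by simp
qed

section \<open>Fractional powers on the Fourier side\<close>

lemma
 fixes a l :: real
 assumes a: "0 < a" and l: "0 < l"
 shows gamma_exp_integrable: "integrable lborel (\<lambda>\<sigma>. frac_weight (- a) \<sigma> * exp (- (l * \<sigma>)))"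
  and gamma_exp_integral: "(LBINT \<sigma>. frac_weight (- a) \<sigma> * exp (- (l * \<sigma>))) = Gamma a * l powr (- a)"
proof -
 have G: "has_bochner_integral lborel (\<lambda>\<sigma>. frac_weight (- a) \<sigma> * exp (- \<sigma>)) (Gamma a)"
 proof (rule has_bochner_integral_nn_integral)
  have "((\<lambda>x. x powr (a - 1) / exp x * indicator {0..} x) has_integral Gamma a) UNIV"
   by (rule iffD1[OF has_integral_indicator_times Gamma_integral_real[OF a]])
  then have "(NBINT x. ennreal (x powr (a - 1) / exp x * indicator {0..} x)) = ennreal (Gamma a)"
   by (intro nn_integral_has_integral_lborel) auto
  moreover have "(NBINT x. ennreal (frac_weight (- a) x * exp (- x))) = (NBINT x. ennreal (x powr (a - 1) / exp x * indicator {0..} x))"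
  proof (rule nn_integral_cong_AE)
   show "AE x in lborel. ennreal (frac_weight (- a) x * exp (- x)) = ennreal (x powr (a - 1) / exp x * indicator {0..} x)"
    using AE_lborel_singleton[of "0::real"] by eventually_elim (auto simp: frac_weight_def indicator_def exp_minus divide_simps)
  qed
  ultimately show "(NBINT x. ennreal (frac_weight (- a) x * exp (- x))) = ennreal (Gamma a)" by simp
 qed (use a Gamma_real_pos[OF a] in auto)
 have "has_bochner_integral lborel (\<lambda>\<sigma>. frac_weight (- a) (0 + l * \<sigma>) * exp (- (0 + l * \<sigma>))) (Gamma a /\<^sub>R \<bar>l\<bar>)"
  using l by (intro lborel_has_bochner_integral_real_affine_iff[THEN iffD1] G) simp
 then have "has_bochner_integral lborel (\<lambda>\<sigma>. l powr (a - 1) * (frac_weight (- a) \<sigma> * exp (- (l * \<sigma>)))) (Gamma a / l)"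
 proof -
  have e: "frac_weight (- a) (0 + l * \<sigma>) * exp (- (0 + l * \<sigma>)) = l powr (a - 1) * (frac_weight (- a) \<sigma> * exp (- (l * \<sigma>)))" for \<sigma>
   using frac_weight_scale[OF l, of "- a" \<sigma>] by simp
  have "Gamma a /\<^sub>R \<bar>l\<bar> = Gamma a / l" using l by (simp add: divide_inverse)
  with \<open>has_bochner_integral lborel _ (Gamma a /\<^sub>R \<bar>l\<bar>)\<close> show ?thesis unfolding e by simp
 qed
 then have "has_bochner_integral lborel (\<lambda>\<sigma>. l powr (1 - a) * (l powr (a - 1) * (frac_weight (- a) \<sigma> * exp (- (l * \<sigma>))))) (l powr (1 - a) * (Gamma a / l))"
  by (rule has_bochner_integral_mult_right)
 moreover have "l powr (1 - a) * (l powr (a - 1) * u) = u" for u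
  using l by (simp add: mult.assoc[symmetric] flip: powr_add)
 moreover have "l powr (1 - a) * (Gamma a / l) = Gamma a * l powr (- a)"
  using l by (simp add: powr_diff powr_minus field_simps)
 ultimately have "has_bochner_integral lborel (\<lambda>\<sigma>. frac_weight (- a) \<sigma> * exp (- (l * \<sigma>))) (Gamma a * l powr (- a))" by simp
 then show "integrable lborel (\<lambda>\<sigma>. frac_weight (- a) \<sigma> * exp (- (l * \<sigma>)))"
  "(LBINT \<sigma>. frac_weight (- a) \<sigma> * exp (- (l * \<sigma>))) = Gamma a * l powr (- a)"
  by (auto simp: has_bochner_integral_iff)
qed

abbreviation gauss :: "real => 'a::euclidean_space => real" where
 "gauss t \<xi> \<equiv> exp (- pi * t * (norm \<xi>)\<^sup>2)"

lemma gauss_nn_integral: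
 assumes "0 < t"
 shows "(NBINT \<xi>. ennreal (gauss t (\<xi>::'a::euclidean_space))) = ennreal (t powr (- real DIM('a) / 2))"
proof -
 have i: "integrable lborel (\<lambda>\<xi>::'a. complex_of_real (gauss t \<xi>))"
  using gauss_cis_integrable[OF assms, of "0::'a"] by simp
 have "(LBINT \<xi>. gauss t (\<xi>::'a)) = heat t (0::'a)"
  using gauss_cis_integral[OF assms, of "0::'a"] unfolding inner_zero_right mult_zero_right cis_zero mult_1_right integral_complex_of_real by (simp only: of_real_eq_iff)
 then show ?thesis
  using i by (subst nn_integral_eq_integral) (auto simp: heat_def complex_of_real_integrable_eq)
qed

lemma gauss_add: "gauss (t + \<tau>) \<xi> = gauss t \<xi> * gauss \<tau> \<xi>"
 by (simp add: algebra_simps flip: exp_add)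

text \<open>The link between the Fourier multiplier and the scale variable: multiplication by
  |xi|^(2 a) becomes a superposition of differences of Gaussians at different scales.\<close>

lemma
 fixes \<xi> :: "'a::euclidean_space"
 assumes a: "0 < a" "a < 1"
 shows gauss_frac_integrable: "integrable lborel (\<lambda>\<tau>. frac_weight a \<tau> * (1 - gauss \<tau> \<xi>))"
  and gauss_frac_integral: "(LBINT \<tau>. frac_weight a \<tau> * (1 - gauss \<tau> \<xi>)) = pi powr a * frac_exp_const a * norm \<xi> powr (2 * a)"
proof -
 have e: "gauss \<tau> \<xi> = exp (- ((pi * (norm \<xi>)\<^sup>2) * \<tau>))" for \<tau> by (simp add: mult_ac)
 have p: "(pi * (norm \<xi>)\<^sup>2) powr a = pi powr a * norm \<xi> powr (2 * a)"
  by (cases "\<xi> = 0") (auto simp: powr_mult powr_powr simp flip: powr_numeral)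
 show "integrable lborel (\<lambda>\<tau>. frac_weight a \<tau> * (1 - gauss \<tau> \<xi>))"
  unfolding e by (rule frac_exp_integrable[OF a]) simp
 show "(LBINT \<tau>. frac_weight a \<tau> * (1 - gauss \<tau> \<xi>)) = pi powr a * frac_exp_const a * norm \<xi> powr (2 * a)"
  unfolding e by (subst frac_exp_integral[OF a]) (auto simp: p)
qed

lemma gauss_frac_nn_integral:
 fixes \<xi> :: "'a::euclidean_space"
 assumes a: "0 < a" "a < 1"
 shows "(NBINT \<tau>. ennreal (frac_weight a \<tau> * (1 - gauss \<tau> \<xi>))) = ennreal (pi powr a * frac_exp_const a * norm \<xi> powr (2 * a))"
proof (subst nn_integral_eq_integral[OF gauss_frac_integrable[OF a]])
 show "AE \<tau> in lborel. 0 <= frac_weight a \<tau> * (1 - gauss \<tau> \<xi>)"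
  by (intro AE_I2) (auto simp: frac_weight_def indicator_def)
qed (simp only: gauss_frac_integral[OF a])

lemma norm_powr_gauss_le:
 fixes \<xi> :: "'a::euclidean_space"
 assumes a: "0 < a" "a < 1" and t: "0 < t"
 shows "norm \<xi> powr (2 * a) * gauss t \<xi> <= 2 * t powr (- a) * gauss (t / 2) \<xi>"
proof -
 define u where "u = t * (norm \<xi>)\<^sup>2"
 have u: "0 <= u" using t by (simp add: u_def)
 have "u powr a <= 1 + u"
 proof (cases "u <= 1")
  case True
  then have "u powr a <= 1" using u a by (intro powr_le1) auto
  then show ?thesis using u by linarith
 next
  case False
  then have "u powr a <= u powr 1" using a by (intro powr_mono) auto
  then show ?thesis using False by simp
 qed
 also have "1 + u <= 2 * exp (pi * u / 2)"
 proof -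
  have "u <= pi * u / 2" using mult_right_mono[OF pi_ge_two u] by simp
  then show ?thesis using exp_ge_add_one_self[of "pi * u / 2"] u by linarith
 qed
 finally have "u powr a * exp (- pi * u) <= 2 * exp (pi * u / 2) * exp (- pi * u)" by (rule mult_right_mono) simp
 also have "... = 2 * exp (- pi * u / 2)" by (simp flip: exp_add)
 finally have "t powr (- a) * (u powr a * exp (- pi * u)) <= t powr (- a) * (2 * exp (- pi * u / 2))"
  by (rule mult_left_mono) simp
 moreover have "t powr (- a) * u powr a = norm \<xi> powr (2 * a)"
  using t by (cases "\<xi> = 0") (auto simp: u_def powr_mult powr_minus powr_powr simp flip: powr_numeral)
 ultimately show ?thesis by (simp add: u_def mult.assoc[symmetric])
qed

lemma norm_powr_gauss_nn_integral:
 assumes a: "0 < a" "a < 1" and t: "0 < t"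
 shows "(NBINT \<xi>. ennreal (norm \<xi> powr (2 * a) * gauss t (\<xi>::'a::euclidean_space))) <= ennreal (2 * 2 powr (DIM('a) / 2) * t powr (- a - DIM('a) / 2))"
proof -
 have "(NBINT \<xi>. ennreal (norm \<xi> powr (2 * a) * gauss t (\<xi>::'a))) <= (NBINT \<xi>. ennreal (2 * t powr (- a)) * ennreal (gauss (t / 2) (\<xi>::'a)))"
  using norm_powr_gauss_le[OF a t] by (intro nn_integral_mono) (simp flip: ennreal_mult)
 also have "... = ennreal (2 * t powr (- a)) * (NBINT \<xi>. ennreal (gauss (t / 2) (\<xi>::'a)))"
  by (rule nn_integral_cmult) measurable
 also have "... = ennreal (2 * t powr (- a) * (t / 2) powr (- real DIM('a) / 2))"
  using t by (subst gauss_nn_integral) (auto simp: ennreal_mult)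
 also have "2 * t powr (- a) * (t / 2) powr (- real DIM('a) / 2) = 2 * 2 powr (DIM('a) / 2) * t powr (- a - DIM('a) / 2)"
 proof -
  have "(t / 2) powr (- real DIM('a) / 2) = 2 powr (DIM('a) / 2) * t powr (- real DIM('a) / 2)"
   using t by (simp add: powr_divide powr_minus field_simps)
  moreover have "t powr (- a - DIM('a) / 2) = t powr (- a) * t powr (- real DIM('a) / 2)" by (simp flip: powr_add)
  ultimately show ?thesis by simp
 qed
 finally show ?thesis .
qed

text \<open>Replacing |xi|^(2 a) by \<open>gauss_frac_integral\<close> and exchanging integrals
  leaves inverse transforms of Gaussians, which are known. Absolute convergence is that of |xi|^(2
  a) against a Gaussian.\<close>

lemma frac_heat_fourier:
 fixes z :: "'a::euclidean_space"
 assumes a: "0 < a" "a < 1" and t: "0 < t"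
 shows "(LBINT \<xi>. complex_of_real (norm \<xi> powr (2 * a) * gauss t \<xi>) * cis (2 * pi * (\<xi> \<bullet> z)))
  = complex_of_real ((LBINT \<tau>. frac_weight a \<tau> * (heat t z - heat (t + \<tau>) z)) / (pi powr a * frac_exp_const a))"
proof -
 let ?c = "pi powr a * frac_exp_const a"
 have c: "0 < ?c" using frac_exp_const_pos[OF a] by simp
 let ?F = "\<lambda>\<xi> \<tau>. complex_of_real (frac_weight a \<tau> * (1 - gauss \<tau> \<xi>)) * (complex_of_real (gauss t \<xi>) * cis (2 * pi * (\<xi> \<bullet> z)))"
 have fin: "(NBINT \<xi>. NBINT \<tau>. ennreal (norm (?F \<xi> \<tau>))) < \<infinity>"
 proof -
  have "(NBINT \<tau>. ennreal (norm (?F \<xi> \<tau>))) = ennreal ?c * ennreal (norm \<xi> powr (2 * a) * gauss t \<xi>)" for \<xi>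
  proof -
   have "norm (?F \<xi> \<tau>) = frac_weight a \<tau> * (1 - gauss \<tau> \<xi>) * gauss t \<xi>" for \<tau>
   proof -
    have "0 <= frac_weight a \<tau> * (1 - gauss \<tau> \<xi>)" by (cases "0 < \<tau>") (auto simp: frac_weight_def)
    then show ?thesis by (simp only: norm_mult norm_of_real abs_of_nonneg norm_cis mult_1_right abs_exp_cancel)
   qed
   then have "(NBINT \<tau>. ennreal (norm (?F \<xi> \<tau>))) = (NBINT \<tau>. ennreal (frac_weight a \<tau> * (1 - gauss \<tau> \<xi>)) * ennreal (gauss t \<xi>))"
    by (simp only: ennreal_mult''[OF exp_ge_zero])
   also have "... = (NBINT \<tau>. ennreal (frac_weight a \<tau> * (1 - gauss \<tau> \<xi>))) * ennreal (gauss t \<xi>)"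
    by (rule nn_integral_multc) measurable
   also have "... = ennreal ?c * ennreal (norm \<xi> powr (2 * a) * gauss t \<xi>)"
    unfolding gauss_frac_nn_integral[OF a] ennreal_mult'[OF less_imp_le[OF c]] ennreal_mult''[OF exp_ge_zero] by (rule mult.assoc)
   finally show ?thesis .
  qed
  then have "(NBINT \<xi>. NBINT \<tau>. ennreal (norm (?F \<xi> \<tau>))) = ennreal ?c * (NBINT \<xi>. ennreal (norm \<xi> powr (2 * a) * gauss t (\<xi>::'a)))"
   by (simp only:) (rule nn_integral_cmult, measurable)
  also have "... < \<infinity>"
   using order_le_less_trans[OF norm_powr_gauss_nn_integral[OF a t, where 'a='a] ennreal_less_top] by (simp add: ennreal_mult_less_top)
  finally show ?thesis .
 qed
 let ?X = "LBINT \<xi>. complex_of_real (norm \<xi> powr (2 * a) * gauss t \<xi>) * cis (2 * pi * (\<xi> \<bullet> z))"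
 have "complex_of_real ?c * ?X = (LBINT \<xi>. LBINT \<tau>. ?F \<xi> \<tau>)"
  unfolding integral_mult_left_zero integral_complex_of_real gauss_frac_integral[OF a] integral_mult_right_zero[symmetric]
  by (simp only: of_real_mult mult.assoc)
 also have "... = (LBINT \<tau>. LBINT \<xi>. ?F \<xi> \<tau>)"
  by (rule Fubini_nn_eq[OF _ _ _ fin]) (auto intro: sigma_finite_lborel)
 also have "... = (LBINT \<tau>. complex_of_real (frac_weight a \<tau> * (heat t z - heat (t + \<tau>) z)))"
 proof (intro Bochner_Integration.integral_cong refl)
  fix \<tau> :: real
  show "(LBINT \<xi>. ?F \<xi> \<tau>) = complex_of_real (frac_weight a \<tau> * (heat t z - heat (t + \<tau>) z))"
  proof (cases "0 < \<tau>")
   case True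
   have t\<tau>: "0 < t + \<tau>" using t True by simp
   have F: "?F \<xi> \<tau> = complex_of_real (frac_weight a \<tau>) * (complex_of_real (gauss t \<xi>) * cis (2 * pi * (\<xi> \<bullet> z)) - complex_of_real (gauss (t + \<tau>) \<xi>) * cis (2 * pi * (\<xi> \<bullet> z)))" for \<xi>
    unfolding gauss_add of_real_mult of_real_diff by (simp add: algebra_simps)
   show ?thesis
    unfolding F integral_mult_right_zero Bochner_Integration.integral_diff[OF gauss_cis_integrable[OF t] gauss_cis_integrable[OF t\<tau>]]
     gauss_cis_integral[OF t] gauss_cis_integral[OF t\<tau>] by simp
  qed (simp add: frac_weight_def)
 qed
 finally have *: "complex_of_real ?c * ?X = complex_of_real (LBINT \<tau>. frac_weight a \<tau> * (heat t z - heat (t + \<tau>) z))"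
  by (simp only: integral_complex_of_real)
 have "?X = complex_of_real ?c * ?X / complex_of_real ?c" using frac_exp_const_pos[OF a] by simp
 then show ?thesis unfolding * of_real_divide .
qed

text \<open>Written with the absolute value of the weight and with \<open>\<sigma> - 0\<close> so as
  to match the hypothesis \<open>diff\<close> of \<open>kernel_frac\<close> on the real line at the
  point 0.\<close>

lemma heat_pot_increment_nn:
 fixes z :: "'a::euclidean_space"
 assumes a: "0 < a" "2 * a < real DIM('a)" and z: "z ~= 0" and t: "0 < t" "0 < \<tau>"
 shows "(NBINT \<sigma>. ennreal (\<bar>frac_weight (- a) \<sigma>\<bar> * \<bar>heat (t + (\<sigma> - 0)) z - heat (t + \<tau> + (\<sigma> - 0)) z\<bar>))
  <= ennreal (2 * heat_const TYPE('a) * heat_maj_const TYPE('a) a * riesz (2 * a) z * min 1 (\<tau> / t))"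
proof -
 let ?D = "\<lambda>\<sigma>. \<bar>frac_weight (- a) \<sigma>\<bar> * \<bar>heat (t + (\<sigma> - 0)) z - heat (t + \<tau> + (\<sigma> - 0)) z\<bar>"
 let ?C = "heat_const TYPE('a)"
 have C: "0 <= ?C" using heat_const_ge(1)[where 'a='a] by linarith
 have "(NBINT \<sigma>. ennreal (?D \<sigma>))
  <= (NBINT \<sigma>. ennreal (2 * ?C * min 1 (\<tau> / t)) * ennreal (frac_weight (- a) \<sigma> * heat_maj \<sigma> z))"
 proof (rule nn_integral_mono)
  fix \<sigma> :: real
  have "\<bar>frac_weight (- a) \<sigma>\<bar> * \<bar>heat (t + (\<sigma> - 0)) z - heat (t + \<tau> + (\<sigma> - 0)) z\<bar> <= (2 * ?C * min 1 (\<tau> / t)) * (frac_weight (- a) \<sigma> * heat_maj \<sigma> z)"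
  proof (cases "0 < \<sigma>")
   case True
   have "\<bar>heat (t + \<sigma>) z - heat (t + \<sigma> + \<tau>) z\<bar> <= ?C * min 1 (\<tau> / (t + \<sigma>)) * (heat (t + \<sigma>) z + heat (2 * (t + \<sigma> + \<tau>)) z)"
    using t True by (intro heat_diff_le) auto
   also have "... <= ?C * min 1 (\<tau> / t) * (heat_maj \<sigma> z + heat_maj \<sigma> z)"
    using t True z C by (intro mult_mono add_mono heat_le_maj min.mono divide_left_mono mult_nonneg_nonneg add_nonneg_nonneg) auto
   finally have "frac_weight (- a) \<sigma> * \<bar>heat (t + \<sigma>) z - heat (t + \<sigma> + \<tau>) z\<bar> <= frac_weight (- a) \<sigma> * (?C * min 1 (\<tau> / t) * (heat_maj \<sigma> z + heat_maj \<sigma> z))"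
    by (rule mult_left_mono) simp
   then show ?thesis by (simp add: algebra_simps)
  qed (simp add: frac_weight_def)
  then show "ennreal (?D \<sigma>)
   <= ennreal (2 * ?C * min 1 (\<tau> / t)) * ennreal (frac_weight (- a) \<sigma> * heat_maj \<sigma> z)"
   using C t by (subst ennreal_mult[symmetric]) (auto intro: ennreal_leI)
 qed
 also have "... = ennreal (2 * ?C * min 1 (\<tau> / t)) * ennreal (heat_maj_const TYPE('a) a * riesz (2 * a) z)"
  by (subst nn_integral_cmult) (auto simp: heat_maj_integral[OF a z])
 also have "... = ennreal (2 * heat_const TYPE('a) * heat_maj_const TYPE('a) a * riesz (2 * a) z * min 1 (\<tau> / t))"
  using C t heat_maj_const_nonneg[OF a] by (subst ennreal_mult[symmetric]) (auto simp: mult_ac)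
 finally show ?thesis .
qed

text \<open>The fractional derivative undoes the fractional integral. On the Fourier side the
  derivative contributes |xi|^(2 a) and the integral contributes \<open>Gamma a\<close> times (pi
  |xi|^2)^(- a); their product is constant off the origin, leaving the transform of
  \<open>heat t\<close>.\<close>

lemma
 fixes z :: "'a::euclidean_space"
 assumes a: "0 < a" "a < 1" "2 * a < real DIM('a)" and z: "z ~= 0"
 shows heat_pot_diff_le: "!!t \<tau>. 0 < t ==> 0 < \<tau> ==> \<bar>heat_pot a t z - heat_pot a (t + \<tau>) z\<bar> <= 2 * heat_const TYPE('a) * heat_maj_const TYPE('a) a * riesz (2 * a) z * min 1 (\<tau> / t)"
  and heat_pot_frac: "!!t. 0 < t ==> (LBINT \<tau>. frac_weight a \<tau> * (heat_pot a t z - heat_pot a (t + \<tau>) z)) = Gamma a * frac_exp_const a * heat t z"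
proof -
 let ?c = "pi powr a * frac_exp_const a" and ?E = "\<lambda>\<xi>. cis (2 * pi * (\<xi> \<bullet> z))"
 have c: "0 < ?c" using frac_exp_const_pos[OF a(1,2)] by simp
 let ?B = "2 * heat_const TYPE('a) * heat_maj_const TYPE('a) a * riesz (2 * a) z"
 have B: "0 <= ?B" using heat_const_ge(1)[where 'a='a] heat_maj_const_nonneg[OF a(1,3)] by simp
 have m: "(\<lambda>(t, \<sigma>). heat (t + \<sigma>) z) \<in> borel_measurable (borel \<Otimes>\<^sub>M borel)" by measurable
 \<comment> \<open>Here the integration variable is the real number \<sigma>, the density is
   \<open>frac_weight (- a)\<close>, and z is a fixed parameter.\<close>
 note k = kernel_frac[OF a(1,2) frac_weight_measurable m _ B heat_pot_increment_nn[OF a(1,3) z], unfolded diff_0_right, folded heat_pot_def]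
 note hi = heat_pot_integrable[OF a(1,3) z less_imp_le]
 show "\<bar>heat_pot a t z - heat_pot a (t + \<tau>) z\<bar> <= ?B * min 1 (\<tau> / t)" if "0 < t" "0 < \<tau>" for t \<tau>
  by (rule k(1)[OF hi _ _ that]) auto
 fix t :: real assume t: "0 < t"
 let ?F = "\<lambda>\<sigma> \<xi>. complex_of_real (frac_weight (- a) \<sigma>) * (complex_of_real (norm \<xi> powr (2 * a) * gauss (t + \<sigma>) \<xi>) * ?E \<xi>)"
 have G: "(LBINT \<sigma>. frac_weight (- a) \<sigma> * gauss \<sigma> \<xi>) * norm \<xi> powr (2 * a) = Gamma a * pi powr (- a)"
  and Gi: "integrable lborel (\<lambda>\<sigma>. frac_weight (- a) \<sigma> * gauss \<sigma> \<xi>)" if "\<xi> ~= 0" for \<xi> :: 'a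
 proof -
  have p: "0 < pi * (norm \<xi>)\<^sup>2" using that by simp
  have e: "gauss \<sigma> \<xi> = exp (- ((pi * (norm \<xi>)\<^sup>2) * \<sigma>))" for \<sigma> by (simp add: mult_ac)
  show "integrable lborel (\<lambda>\<sigma>. frac_weight (- a) \<sigma> * gauss \<sigma> \<xi>)"
   unfolding e by (rule gamma_exp_integrable[OF a(1) p])
  show "(LBINT \<sigma>. frac_weight (- a) \<sigma> * gauss \<sigma> \<xi>) * norm \<xi> powr (2 * a) = Gamma a * pi powr (- a)"
   unfolding e gamma_exp_integral[OF a(1) p] using that
   by (simp add: powr_mult powr_minus powr_powr field_simps flip: powr_numeral)
 qed
 have F: "?F \<sigma> \<xi> = complex_of_real (frac_weight (- a) \<sigma> * gauss \<sigma> \<xi>) * (complex_of_real (norm \<xi> powr (2 * a)) * (complex_of_real (gauss t \<xi>) * ?E \<xi>))" for \<sigma> \<xi>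
  unfolding gauss_add of_real_mult by (simp add: mult_ac)
 have AE0: "AE \<xi> in lborel. \<xi> ~= (0::'a)" by (rule AE_lborel_singleton)
 \<comment> \<open>The order with \<sigma> inside is the convenient one: by \<open>G\<close> the
   singular powers of |xi| cancel for xi nonzero, and an integrable Gaussian remains.\<close>
 have fin: "(NBINT \<xi>. NBINT \<sigma>. ennreal (norm (?F \<sigma> \<xi>))) < \<infinity>"
 proof -
  have "(NBINT \<xi>. NBINT \<sigma>. ennreal (norm (?F \<sigma> \<xi>))) = (NBINT \<xi>. ennreal (Gamma a * pi powr (- a)) * ennreal (gauss t (\<xi>::'a)))"
  proof (rule nn_integral_cong_AE, use AE0 in eventually_elim)
   fix \<xi> :: 'a assume \<xi>: "\<xi> ~= 0"
   have "(NBINT \<sigma>. ennreal (norm (?F \<sigma> \<xi>))) = (NBINT \<sigma>. ennreal (frac_weight (- a) \<sigma> * gauss \<sigma> \<xi> * (norm \<xi> powr (2 * a) * gauss t \<xi>)))"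
    unfolding F by (intro nn_integral_cong) (simp add: norm_mult mult_ac)
   also have "... = ennreal (LBINT \<sigma>. frac_weight (- a) \<sigma> * gauss \<sigma> \<xi> * (norm \<xi> powr (2 * a) * gauss t \<xi>))"
    by (rule nn_integral_eq_integral[OF integrable_mult_left[OF Gi[OF \<xi>]]]) simp
   finally show "(NBINT \<sigma>. ennreal (norm (?F \<sigma> \<xi>))) = ennreal (Gamma a * pi powr (- a)) * ennreal (gauss t \<xi>)"
    unfolding integral_mult_left_zero mult.assoc[symmetric, of _ "norm \<xi> powr (2 * a)"] G[OF \<xi>] ennreal_mult''[OF exp_ge_zero] .
  qed
  also have "... = ennreal (Gamma a * pi powr (- a)) * (NBINT \<xi>. ennreal (gauss t (\<xi>::'a)))"
   by (rule nn_integral_cmult) measurable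
  finally show ?thesis unfolding gauss_nn_integral[OF t] by (simp add: ennreal_mult_less_top)
 qed
 let ?D = "\<lambda>t. LBINT \<tau>. frac_weight a \<tau> * (heat t z - heat (t + \<tau>) z)"
 have "complex_of_real (LBINT \<sigma>. frac_weight (- a) \<sigma> * (?D (t + \<sigma>) / ?c)) = (LBINT \<sigma>. LBINT \<xi>. ?F \<sigma> \<xi>)"
  unfolding integral_complex_of_real[symmetric]
 proof (intro Bochner_Integration.integral_cong refl)
  fix \<sigma> :: real
  show "complex_of_real (frac_weight (- a) \<sigma> * (?D (t + \<sigma>) / ?c)) = (LBINT \<xi>. ?F \<sigma> \<xi>)"
  proof (cases "0 < \<sigma>")
   case True
   have t\<sigma>: "0 < t + \<sigma>" using t True by simp
   show ?thesis unfolding integral_mult_right_zero frac_heat_fourier[OF a(1,2) t\<sigma>] of_real_mult[of "frac_weight (- a) \<sigma>"] by (rule refl)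
  qed (simp add: frac_weight_def)
 qed
 also have "... = (LBINT \<xi>. LBINT \<sigma>. ?F \<sigma> \<xi>)"
  by (rule Fubini_nn_eq[OF _ _ _ fin, symmetric]) (auto intro: sigma_finite_lborel)
 also have "... = (LBINT \<xi>. complex_of_real (Gamma a * pi powr (- a)) * (complex_of_real (gauss t \<xi>) * ?E \<xi>))"
 proof (rule integral_cong_AE)
  show "AE \<xi> in lborel. (LBINT \<sigma>. ?F \<sigma> \<xi>) = complex_of_real (Gamma a * pi powr (- a)) * (complex_of_real (gauss t \<xi>) * ?E \<xi>)"
   using AE0
  proof eventually_elim
   case (elim \<xi>)
   show ?case unfolding F integral_mult_left_zero integral_complex_of_real G[OF elim, symmetric] by (simp only: of_real_mult mult.assoc)
  qed
 qed measurable
 also have "... = complex_of_real (Gamma a * pi powr (- a) * heat t z)"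
  unfolding integral_mult_right_zero gauss_cis_integral[OF t] by simp
 finally have "(LBINT \<sigma>. frac_weight (- a) \<sigma> * (?D (t + \<sigma>) / ?c)) = Gamma a * pi powr (- a) * heat t z"
  by (simp only: of_real_eq_iff)
 then have "(LBINT \<sigma>. frac_weight (- a) \<sigma> * ?D (t + \<sigma>)) = Gamma a * pi powr (- a) * heat t z * ?c"
  using c by (simp add: divide_eq_eq zero_less_mult_iff split: if_splits)
 moreover have "(LBINT \<sigma>. frac_weight (- a) \<sigma> * ?D (t + \<sigma>)) = (LBINT \<tau>. frac_weight a \<tau> * (heat_pot a t z - heat_pot a (t + \<tau>) z))"
 proof -
  have "(LBINT \<sigma>. frac_weight (- a) \<sigma> * (LBINT \<tau>. frac_weight a \<tau> * (heat (t + \<sigma>) z - heat (t + \<tau> + \<sigma>) z)))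
   = (LBINT \<tau>. frac_weight a \<tau> * (heat_pot a t z - heat_pot a (t + \<tau>) z))"
   by (rule k(2)[OF hi _ _ t]) auto
  then show ?thesis by (simp only: add_ac)
 qed
 ultimately show "(LBINT \<tau>. frac_weight a \<tau> * (heat_pot a t z - heat_pot a (t + \<tau>) z)) = Gamma a * frac_exp_const a * heat t z"
  by (simp add: powr_minus)
qed

text \<open>All transforms are computed inside the mixture: the inverse transform of each heat
  kernel is a Gaussian times a character, and \<open>frac_heat_fourier\<close> then brings it back
  at each scale. Both exchanges rest on the decay of \<open>osc\<close> against every power of exp
  v.\<close>

lemma osc_heat_multiplier:
 fixes x y :: "'a::euclidean_space"
 assumes a: "0 < a" "a < 1" and r: "0 < r"
 shows "fourier (\<lambda>\<xi>. complex_of_real (norm \<xi> powr (2 * a)) * inv_fourier (osc_heat r x) \<xi>) y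
  = complex_of_real (osc_frac a (\<lambda>t. heat t (y - x)) r / (pi powr a * frac_exp_const a))"
proof -
 let ?c = "pi powr a * frac_exp_const a"
 have rp: "0 < r * exp v" for v using r by simp
 have inv: "inv_fourier (osc_heat r x) \<xi> = (LBINT v. complex_of_real (osc v * gauss (r * exp v) \<xi>) * cis (2 * pi * (x \<bullet> \<xi>)))" for \<xi>
 proof -
  let ?F = "\<lambda>v y. complex_of_real (osc v) * (complex_of_real (heat (r * exp v) (y - x)) * cis (2 * pi * (y \<bullet> \<xi>)))"
  have "(NBINT v. NBINT y. ennreal (norm (?F v y))) = (NBINT v. ennreal \<bar>osc v\<bar>)"
  proof (rule nn_integral_cong)
   fix v
   have "(NBINT y. ennreal (norm (?F v y))) = (NBINT y. ennreal \<bar>osc v\<bar> * ennreal (heat (r * exp v) (y - x)))"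
    by (simp add: norm_mult flip: ennreal_mult)
   also have "... = ennreal \<bar>osc v\<bar> * (NBINT y. ennreal (heat (r * exp v) (y - x)))"
    by (rule nn_integral_cmult) measurable
   finally show "(NBINT y. ennreal (norm (?F v y))) = ennreal \<bar>osc v\<bar>" unfolding heat_nn_integral[OF rp] by simp
  qed
  also have "... < \<infinity>" using osc_exp_integrable[of 0] by (simp add: integrable_iff_bounded)
  finally have fin: "(NBINT v. NBINT y. ennreal (norm (?F v y))) < \<infinity>" .
  have "inv_fourier (osc_heat r x) \<xi> = (LBINT y. LBINT v. ?F v y)"
   unfolding inv_fourier_def inner_commute[of \<xi>] osc_heat_def integral_complex_of_real[symmetric] integral_mult_left_zero[symmetric]
   by (simp only: of_real_mult mult.assoc)
  also have "... = (LBINT v. LBINT y. ?F v y)"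
   by (rule Fubini_nn_eq[OF _ _ _ fin, symmetric]) (auto intro: sigma_finite_lborel)
  finally show ?thesis
   unfolding integral_mult_right_zero heat_cis_integral[OF rp] by (simp only: of_real_mult mult_ac)
 qed
 let ?F = "\<lambda>v \<xi>. complex_of_real (osc v) * (complex_of_real (norm \<xi> powr (2 * a) * gauss (r * exp v) \<xi>) * cis (2 * pi * (\<xi> \<bullet> (x - y))))"
 let ?n = "real DIM('a)"
 have "(NBINT v. NBINT \<xi>. ennreal (norm (?F v \<xi>))) <= (NBINT v. ennreal (2 * 2 powr (?n / 2) * (\<bar>osc v\<bar> * (r * exp v) powr (- a - ?n / 2))))"
 proof (rule nn_integral_mono)
  fix v
  have "(NBINT \<xi>. ennreal (norm (?F v \<xi>))) = (NBINT \<xi>. ennreal \<bar>osc v\<bar> * ennreal (norm \<xi> powr (2 * a) * gauss (r * exp v) (\<xi>::'a)))"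
   by (simp add: norm_mult flip: ennreal_mult)
  also have "... = ennreal \<bar>osc v\<bar> * (NBINT \<xi>. ennreal (norm \<xi> powr (2 * a) * gauss (r * exp v) (\<xi>::'a)))"
   by (rule nn_integral_cmult) measurable
  also have "... <= ennreal \<bar>osc v\<bar> * ennreal (2 * 2 powr (?n / 2) * (r * exp v) powr (- a - ?n / 2))"
   by (rule mult_left_mono[OF norm_powr_gauss_nn_integral[OF a rp]]) simp
  finally show "(NBINT \<xi>. ennreal (norm (?F v \<xi>))) <= ennreal (2 * 2 powr (?n / 2) * (\<bar>osc v\<bar> * (r * exp v) powr (- a - ?n / 2)))"
   by (simp add: mult_ac flip: ennreal_mult)
 qed
 also have "... < \<infinity>"
  using integrable_mult_right[OF osc_powr_integrable[OF r], of "2 * 2 powr (?n / 2)" "- a - ?n / 2"]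
  by (subst nn_integral_eq_integral) auto
 finally have fin: "(NBINT v. NBINT \<xi>. ennreal (norm (?F v \<xi>))) < \<infinity>" .
 have "fourier (\<lambda>\<xi>. complex_of_real (norm \<xi> powr (2 * a)) * inv_fourier (osc_heat r x) \<xi>) y = (LBINT \<xi>. LBINT v. ?F v \<xi>)"
  unfolding fourier_def
 proof (intro Bochner_Integration.integral_cong refl)
  fix \<xi> :: 'a
  have "cis (2 * pi * (\<xi> \<bullet> (x - y))) = cis (2 * pi * (x \<bullet> \<xi>)) * cis (- 2 * pi * (\<xi> \<bullet> y))"
   by (simp add: cis_mult inner_diff_right inner_commute algebra_simps)
  then show "complex_of_real (norm \<xi> powr (2 * a)) * inv_fourier (osc_heat r x) \<xi> * cis (- 2 * pi * (\<xi> \<bullet> y)) = (LBINT v. ?F v \<xi>)"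
   unfolding inv integral_mult_right_zero[symmetric] integral_mult_left_zero[symmetric]
   by (simp only: of_real_mult mult_ac)
 qed
 also have "... = (LBINT v. LBINT \<xi>. ?F v \<xi>)"
  by (rule Fubini_nn_eq[OF _ _ _ fin, symmetric]) (auto intro: sigma_finite_lborel)
 also have "... = complex_of_real (osc_frac a (\<lambda>t. heat t (y - x)) r / ?c)"
  unfolding integral_mult_right_zero frac_heat_fourier[OF a rp] of_real_mult[symmetric] integral_complex_of_real osc_frac_def
   times_divide_eq_right integral_divide_zero heat_minus[of _ "y - x", symmetric] minus_diff_eq ..
 finally show ?thesis .
qed

section \<open>Representation by a Riesz potential\<close>

text \<open>The increment from x to x + h is split along a path of coordinate segments. By
  compactness all partial derivatives are bounded on the unit ball about x, so each segment obeys
  the mean value inequality. Continuity is needed for the heat averages to converge to the point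
  values.\<close>

lemma C1_partials_continuous:
 fixes f :: "'a::euclidean_space => real"
 assumes "C1_partials f"
 shows "continuous_on UNIV f"
proof -
 obtain d where dc: "!!i. i \<in> Basis ==> continuous_on UNIV (d i)"
  and d: "!!i x. i \<in> Basis ==> ((\<lambda>t. f (x + t *\<^sub>R i)) has_real_derivative d i x) (at 0)"
  using bchoice[OF assms[unfolded C1_partials_def]] by blast
 have "isCont f x" for x
 proof -
  have "bounded (\<Union>i\<in>Basis. d i ` cball x 1)"
   by (intro bounded_UN finite_Basis ballI compact_imp_bounded compact_continuous_image compact_cball continuous_on_subset[OF dc]) auto
  then obtain L where "\<forall>u\<in>\<Union>i\<in>Basis. d i ` cball x 1. norm u <= L" unfolding bounded_iff by blast
  then have L: "!!i y. i \<in> Basis ==> y \<in> cball x 1 ==> \<bar>d i y\<bar> <= L" by auto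
  let ?P = "\<lambda>S h. \<Sum>j\<in>S. (h \<bullet> j) *\<^sub>R j" and ?N = "\<lambda>S h. \<Sum>j\<in>S. \<bar>h \<bullet> j\<bar>"
  have P: "norm (?P S h) <= ?N S h" if "S \<subseteq> Basis" for S and h :: 'a
   by (rule order_trans[OF norm_sum sum_mono]) (use that in auto)
  \<comment> \<open>Induction on the set of coordinates already moved. The l^1 norm of h is at most
    1, which keeps the path in the ball where the derivatives are bounded by L.\<close>
  have step: "\<bar>f (x + ?P S h) - f x\<bar> <= L * ?N S h" if h: "?N Basis h <= 1" and "finite S" "S \<subseteq> Basis" for S h
   using that(2,3)
  proof (induction S rule: finite_induct)
   case (insert i S)
   have i: "i \<in> Basis" and S: "S \<subseteq> Basis" using insert.prems by auto
   let ?w = "x + ?P S h" and ?I = "closed_segment 0 (h \<bullet> i)"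
   let ?g = "\<lambda>t. f (?w + t *\<^sub>R i)"
   have "norm (?g (h \<bullet> i) - ?g 0) <= L * norm (h \<bullet> i - 0)"
   proof (rule field_differentiable_bound[of ?I ?g "\<lambda>t. d i (?w + t *\<^sub>R i)"])
    fix t assume t: "t \<in> ?I"
    have "((\<lambda>u. ?g (u + t)) has_real_derivative d i (?w + t *\<^sub>R i)) (at 0)"
     using d[OF i, of "?w + t *\<^sub>R i"] by (simp only: scaleR_add_left add_ac)
    then have "(?g has_real_derivative d i (?w + t *\<^sub>R i)) (at (0 + t))" by (rule DERIV_shift[THEN iffD2])
    then show "(?g has_real_derivative d i (?w + t *\<^sub>R i)) (at t within ?I)"
     unfolding add_0_left by (rule has_field_derivative_at_within)
    have "norm (?P S h + t *\<^sub>R i) <= ?N S h + \<bar>h \<bullet> i\<bar>"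
     by (intro norm_triangle_mono P S) (use t i in \<open>auto simp: closed_segment_eq_real_ivl split: if_splits\<close>)
    also have "... = ?N (insert i S) h" using insert.hyps by simp
    also have "... <= ?N Basis h" using insert.prems by (intro sum_mono2) auto
    finally have "dist x (?w + t *\<^sub>R i) <= 1" using h by (simp only: dist_norm norm_minus_commute[of x] add.assoc add_diff_cancel_left' order_trans)
    then show "norm (d i (?w + t *\<^sub>R i)) <= L" using L[OF i] by simp
   qed auto
   then show ?case using insert.IH[OF S] insert.hyps by (simp add: algebra_simps)
  qed simp
  have N0: "((\<lambda>h. ?N Basis h) \<longlongrightarrow> 0) (at (0::'a))"
   by (auto intro!: tendsto_eq_intros)
  have "((\<lambda>h. f (x + h) - f x) \<longlongrightarrow> 0) (at 0)"
  proof (rule Lim_null_comparison)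
   show "\<forall>\<^sub>F h in at 0. norm (f (x + h) - f x) <= L * ?N Basis h"
    using order_tendstoD(2)[OF N0 zero_less_one]
   proof eventually_elim
    case (elim h)
    then show ?case using step[of h Basis] by (simp add: euclidean_representation)
   qed
   show "((\<lambda>h. L * ?N Basis h) \<longlongrightarrow> 0) (at (0::'a))" by (rule tendsto_mult_right_zero[OF N0])
  qed
  then show ?thesis unfolding isCont_iff by (rule LIM_zero_cancel)
 qed
 then show ?thesis by (simp add: continuous_on_eq_continuous_at)
qed

text \<open>\<open>kernel_frac\<close> at the scales r exp v, integrated once more against
  \<open>osc\<close>; the bound (r exp v) powr (- a) it leaves is integrable against |osc|.\<close>

lemma kernel_osc:
 fixes h :: "'a::euclidean_space => real" and k :: "real => 'a => real"
 assumes a: "0 < a" "a < 1" and [measurable]: "h \<in> borel_measurable borel" "(\<lambda>(t, z). k t z) \<in> borel_measurable (borel \<Otimes>\<^sub>M borel)"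
  and int: "!!t. 0 < t ==> integrable lborel (\<lambda>y. h y * k t (y - x))"
  and B: "0 <= B" and diff: "!!t \<tau>. 0 < t ==> 0 < \<tau> ==> (NBINT y. ennreal (\<bar>h y\<bar> * \<bar>k t (y - x) - k (t + \<tau>) (y - x)\<bar>)) <= ennreal (B * min 1 (\<tau> / t))"
 shows kernel_osc_lip: "frac_lip (\<lambda>t. LBINT y. h y * k t (y - x))"
  and kernel_osc_integrable: "0 < r ==> integrable lborel (\<lambda>y. h y * osc_frac a (\<lambda>t. k t (y - x)) r)"
  and kernel_osc_eq: "0 < r ==> (LBINT y. h y * osc_frac a (\<lambda>t. k t (y - x)) r) = osc_frac a (\<lambda>t. LBINT y. h y * k t (y - x)) r"
proof -
 note k = kernel_frac[OF a assms(3,4) int B diff]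
 show "frac_lip (\<lambda>t. LBINT y. h y * k t (y - x))"
  unfolding frac_lip_def by (intro conjI exI[of _ B] allI impI k(1)) auto
 assume r: "0 < r"
 have rp: "0 < r * exp v" for v using r by simp
 let ?I = "\<lambda>v y. LBINT \<tau>. frac_weight a \<tau> * (k (r * exp v) (y - x) - k (r * exp v + \<tau>) (y - x))"
 let ?F = "\<lambda>v y. osc v * (h y * ?I v y)"
 have eq: "h y * osc_frac a (\<lambda>t. k t (y - x)) r = (LBINT v. ?F v y)" for y
  unfolding osc_frac_def integral_mult_right_zero[symmetric] by (simp only: mult_ac)
 have "(NBINT v. NBINT y. ennreal (norm (?F v y))) <= (NBINT v. ennreal (B * frac_const a * (\<bar>osc v\<bar> * (r * exp v) powr (- a))))"
 proof (rule nn_integral_mono)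
  fix v
  have "(NBINT y. ennreal (norm (?F v y))) = ennreal \<bar>osc v\<bar> * (NBINT y. ennreal \<bar>h y * ?I v y\<bar>)"
   by (subst nn_integral_cmult[symmetric]) (simp_all add: abs_mult ennreal_mult')
  also have "... <= ennreal \<bar>osc v\<bar> * ennreal (B * (frac_const a * (r * exp v) powr (- a)))"
   by (rule mult_left_mono[OF k(3)[OF _ _ _ rp]]) auto
  also have "... = ennreal (B * frac_const a * (\<bar>osc v\<bar> * (r * exp v) powr (- a)))"
   by (simp add: mult_ac flip: ennreal_mult')
  finally show "(NBINT y. ennreal (norm (?F v y))) <= ennreal (B * frac_const a * (\<bar>osc v\<bar> * (r * exp v) powr (- a)))" .
 qed
 also have "... < \<infinity>"
  using integrable_mult_right[OF osc_powr_integrable[OF r], of "B * frac_const a" "- a"] B a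
  by (subst nn_integral_eq_integral) (auto simp: frac_const_def)
 finally have fin: "(NBINT v. NBINT y. ennreal (norm (?F v y))) < \<infinity>" .
 have m: "(\<lambda>(v, y). ?F v y) \<in> borel_measurable (lborel \<Otimes>\<^sub>M lborel)" by measurable
 note fub = Fubini_nn[OF lborel.sigma_finite_measure_axioms lborel.sigma_finite_measure_axioms m fin]
 show "integrable lborel (\<lambda>y. h y * osc_frac a (\<lambda>t. k t (y - x)) r)"
  unfolding eq by (rule fub(2))
 have "(LBINT y. h y * osc_frac a (\<lambda>t. k t (y - x)) r) = (LBINT v. LBINT y. ?F v y)"
  unfolding eq by (rule fub(1)[symmetric])
 moreover have "(LBINT y. ?F v y) = osc v * (LBINT \<tau>. frac_weight a \<tau> * ((LBINT y. h y * k (r * exp v) (y - x)) - (LBINT y. h y * k (r * exp v + \<tau>) (y - x))))" for v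
  unfolding integral_mult_right_zero by (subst k(2)[OF _ _ _ rp]) auto
 ultimately show "(LBINT y. h y * osc_frac a (\<lambda>t. k t (y - x)) r) = osc_frac a (\<lambda>t. LBINT y. h y * k t (y - x)) r"
  by (simp only: osc_frac_def)
qed

lemma integral_lborel_scale:
 fixes f :: "'a::euclidean_space => 'b::{banach, second_countable_topology}"
 assumes [measurable]: "f \<in> borel_measurable borel" and "c ~= 0"
 shows "(LBINT x. f x) = \<bar>c\<bar> ^ DIM('a) *\<^sub>R (LBINT x. f (t + c *\<^sub>R x))"
 by (subst lborel_affine[OF assms(2), of t]) (simp add: integral_density integral_distr)

lemma heat_avg_eq:
 fixes f :: "'a::euclidean_space => real"
 assumes [measurable]: "f \<in> borel_measurable borel" and t: "0 < t"
 shows "(LBINT y. f y * heat t (y - x)) = (LBINT z. f (x + sqrt t *\<^sub>R z) * heat 1 z)"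
proof -
 have "sqrt t ^ DIM('a) * heat t (sqrt t *\<^sub>R z) = heat 1 z" for z :: 'a
 proof -
  have "sqrt t ^ DIM('a) * t powr (- real DIM('a) / 2) = 1"
   using t by (simp add: powr_half_sqrt[symmetric] powr_realpow[symmetric] powr_powr flip: powr_add)
  then show ?thesis using t by (simp add: heat_def mult.assoc[symmetric] power_mult_distrib)
 qed
 then have *: "sqrt t ^ DIM('a) * (u * heat t (sqrt t *\<^sub>R z)) = u * heat 1 z" for u and z :: 'a by (simp add: mult.left_commute)
 show ?thesis
  using integral_lborel_scale[of "\<lambda>y. f y * heat t (y - x)" "sqrt t" x] t
  by (simp add: * flip: integral_mult_right_zero)
qed

context
 fixes f :: "'a::euclidean_space => real" and A :: real
 assumes f_measurable [measurable]: "f \<in> borel_measurable borel" and f_le: "!!y. \<bar>f y\<bar> <= A"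
begin

lemma heat_avg_integrable: "0 < t ==> integrable lborel (\<lambda>y. f y * heat t (y - x))"
 by (rule Bochner_Integration.integrable_bound[OF integrable_mult_right[OF heat_integrable[of t x], of A]])
  (use f_le order_trans[OF abs_ge_zero f_le] in \<open>auto simp: abs_mult intro!: mult_right_mono\<close>)

lemma heat_avg_diff_le:
 assumes "0 < t" "0 < \<tau>"
 shows "(NBINT y. ennreal (\<bar>f y\<bar> * \<bar>heat t (y - x) - heat (t + \<tau>) (y - x)\<bar>)) <= ennreal (2 * A * heat_const TYPE('a) * min 1 (\<tau> / t))"
proof -
 let ?C = "A * (heat_const TYPE('a) * min 1 (\<tau> / t))"
 have A: "0 <= A" using order_trans[OF abs_ge_zero f_le] .
 have C: "0 <= ?C" using assms A heat_const_ge(1)[where 'a='a] by simp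
 have "(NBINT y. ennreal (\<bar>f y\<bar> * \<bar>heat t (y - x) - heat (t + \<tau>) (y - x)\<bar>))
  <= (NBINT y. ennreal ?C * (ennreal (heat t (y - x)) + ennreal (heat (2 * (t + \<tau>)) (y - x))))"
 proof (rule nn_integral_mono)
  fix y
  have "\<bar>f y\<bar> * \<bar>heat t (y - x) - heat (t + \<tau>) (y - x)\<bar> <= A * (heat_const TYPE('a) * min 1 (\<tau> / t) * (heat t (y - x) + heat (2 * (t + \<tau>)) (y - x)))"
   by (rule mult_mono[OF f_le heat_diff_le[OF assms] A]) simp
  then show "ennreal (\<bar>f y\<bar> * \<bar>heat t (y - x) - heat (t + \<tau>) (y - x)\<bar>) <= ennreal ?C * (ennreal (heat t (y - x)) + ennreal (heat (2 * (t + \<tau>)) (y - x)))"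
   by (simp add: mult.assoc ennreal_leI flip: ennreal_mult'[OF C] ennreal_plus)
 qed
 also have "... = ennreal ?C * ((NBINT y. ennreal (heat t (y - x))) + (NBINT y. ennreal (heat (2 * (t + \<tau>)) (y - x))))"
  by (subst nn_integral_cmult, measurable, subst nn_integral_add, measurable)
 also have "... = ennreal (2 * A * heat_const TYPE('a) * min 1 (\<tau> / t))"
  using assms heat_nn_integral[of t x] heat_nn_integral[of "2 * (t + \<tau>)" x] C
  by (simp add: mult_ac) (simp flip: ennreal_mult'' ennreal_numeral)
 finally show ?thesis .
qed

text \<open>On scales much larger than |x - x'| the two averages see almost the same Gaussian. Taken
  singly, an average of a bounded function need not converge as t grows.\<close>

lemma heat_avg_space_diff_tendsto_0:
 "((\<lambda>t. (LBINT y. f y * heat t (y - x)) - (LBINT y. f y * heat t (y - x'))) \<longlongrightarrow> 0) at_top"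
proof (rule Lim_null_comparison)
 have A: "0 <= A" using order_trans[OF abs_ge_zero f_le] .
 let ?\<rho> = "\<lambda>t. norm (x - x') / sqrt t"
 let ?C = "\<lambda>t. A * (pi * ?\<rho> t * (4 + 2 * ?\<rho> t) * 2 powr (DIM('a) / 2))"
 show "\<forall>\<^sub>F t in at_top. norm ((LBINT y. f y * heat t (y - x)) - (LBINT y. f y * heat t (y - x'))) <= 2 * ?C t"
  using eventually_gt_at_top[of 0]
 proof eventually_elim
  case (elim t)
  have t2: "0 < 2 * t" using elim by simp
  have "norm ((LBINT y. f y * heat t (y - x)) - (LBINT y. f y * heat t (y - x'))) = norm (LBINT y. f y * heat t (y - x) - f y * heat t (y - x'))"
   using heat_avg_integrable[OF elim] by simp
  also have "... <= (LBINT y. ?C t * (heat (2 * t) (y - x) + heat (2 * t) (y - x')))"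
  proof (rule Bochner_Integration.integral_norm_bound_integral)
   fix y
   have \<rho>: "?\<rho> t = norm ((y - x) - (y - x')) / sqrt t" by (simp add: norm_minus_commute)
   have "norm (f y * heat t (y - x) - f y * heat t (y - x')) = \<bar>f y\<bar> * \<bar>heat t (y - x) - heat t (y - x')\<bar>"
    by (simp add: abs_mult flip: right_diff_distrib)
   also have "... <= A * (pi * ?\<rho> t * (4 + 2 * ?\<rho> t) * 2 powr (DIM('a) / 2) * (heat (2 * t) (y - x) + heat (2 * t) (y - x')))"
    by (rule mult_mono[OF f_le heat_space_diff_le[OF elim \<rho>] A]) simp
   finally show "norm (f y * heat t (y - x) - f y * heat t (y - x')) <= ?C t * (heat (2 * t) (y - x) + heat (2 * t) (y - x'))"
    by (simp only: mult.assoc)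
  qed (intro Bochner_Integration.integrable_diff Bochner_Integration.integrable_add integrable_mult_right heat_avg_integrable elim heat_integrable t2)+
  also have "... = 2 * ?C t"
   unfolding integral_mult_right_zero Bochner_Integration.integral_add[OF heat_integrable[OF t2] heat_integrable[OF t2]] heat_integral[OF t2] by simp
  finally show ?case .
 qed
 have \<rho>0: "(?\<rho> \<longlongrightarrow> 0) at_top"
  by (intro tendsto_divide_0[OF tendsto_const] filterlim_at_top_imp_at_infinity sqrt_at_top)
 have "((\<lambda>t. 2 * ?C t) \<longlongrightarrow> 2 * (A * (pi * 0 * (4 + 2 * 0) * 2 powr (DIM('a) / 2)))) at_top"
  by (intro tendsto_intros \<rho>0)
 then show "((\<lambda>t. 2 * ?C t) \<longlongrightarrow> 0) at_top" by simp
qed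

lemma heat_avg_tendsto:
 assumes c: "continuous_on UNIV f"
 shows "((\<lambda>t. LBINT y. f y * heat t (y - x)) \<longlongrightarrow> f x) (at_right 0)"
proof (rule tendsto_at_right_sequentially[OF zero_less_one])
 fix X :: "nat => real" assume X: "!!n. 0 < X n" "X \<longlonglongrightarrow> 0"
 have h: "integrable lborel (heat 1 :: 'a => real)" "(LBINT z. heat 1 (z::'a)) = 1"
  using heat_integrable[of 1 "0::'a"] heat_integral[of 1 "0::'a"] by auto
 have "(\<lambda>n. LBINT z. f (x + sqrt (X n) *\<^sub>R z) * heat 1 z) \<longlonglongrightarrow> (LBINT z. f x * heat 1 (z::'a))"
 proof (rule integral_dominated_convergence[OF _ _ integrable_mult_right[OF h(1), of A]])
  have "(\<lambda>n. x + sqrt (X n) *\<^sub>R z) \<longlonglongrightarrow> x + sqrt 0 *\<^sub>R z" for z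
   by (intro tendsto_intros X)
  then have "(\<lambda>n. f (x + sqrt (X n) *\<^sub>R z)) \<longlonglongrightarrow> f x" for z
   by (intro continuous_on_tendsto_compose[OF c]) simp_all
  then show "AE z in lborel. (\<lambda>n. f (x + sqrt (X n) *\<^sub>R z) * heat 1 z) \<longlonglongrightarrow> f x * heat 1 z"
   by (intro AE_I2 tendsto_mult_right)
  show "AE z in lborel. norm (f (x + sqrt (X n) *\<^sub>R z) * heat 1 z) <= A * heat 1 z" for n
   by (intro AE_I2) (simp add: abs_mult mult_right_mono[OF f_le])
 qed measurable
 then show "(\<lambda>n. LBINT y. f y * heat (X n) (y - x)) \<longlonglongrightarrow> f x"
  using X(1) by (simp add: heat_avg_eq h(2))
qed

end

lemma AE_nonzero_diff: "AE y in lborel. y - x ~= (0::'a::euclidean_space)"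
 using AE_lborel_singleton[of x] by eventually_elim simp

context
 fixes h :: "'a::euclidean_space => real" and a :: real and x :: 'a
 assumes h_measurable [measurable]: "h \<in> borel_measurable borel" and h_finite: "riesz_abs (2 * a) h x < \<infinity>"
  and a: "0 < a" "a < 1" "2 * a < real DIM('a)"
begin

lemma riesz_centered_integrable: "integrable lborel (\<lambda>y. riesz (2 * a) (y - x) * h y)"
 using riesz_integrable[OF h_measurable h_finite] by (simp add: riesz_def norm_minus_commute)

lemma pot_avg_integrable:
 assumes "0 <= t"
 shows "integrable lborel (\<lambda>y. h y * heat_pot a t (y - x))"
proof (rule Bochner_Integration.integrable_bound[OF integrable_mult_right[OF riesz_centered_integrable, of "heat_maj_const TYPE('a) a"]])
 show "AE y in lborel. norm (h y * heat_pot a t (y - x)) <= norm (heat_maj_const TYPE('a) a * (riesz (2 * a) (y - x) * h y))"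
  using AE_nonzero_diff[of x]
 proof eventually_elim
  case (elim y)
  have "\<bar>h y\<bar> * \<bar>heat_pot a t (y - x)\<bar> <= \<bar>h y\<bar> * (heat_maj_const TYPE('a) a * riesz (2 * a) (y - x))"
   by (rule mult_left_mono[OF heat_pot_le[OF a(1,3) elim assms]]) simp
  then show ?case using heat_maj_const_nonneg[OF a(1,3)] by (simp add: abs_mult mult_ac)
 qed
qed measurable

lemma pot_avg_diff_le:
 obtains B where "0 <= B" "!!t \<tau>. 0 < t ==> 0 < \<tau> ==>
  (NBINT y. ennreal (\<bar>h y\<bar> * \<bar>heat_pot a t (y - x) - heat_pot a (t + \<tau>) (y - x)\<bar>)) <= ennreal (B * min 1 (\<tau> / t))"
proof
 let ?N = "\<lambda>t \<tau>. NBINT y. ennreal (\<bar>h y\<bar> * \<bar>heat_pot a t (y - x) - heat_pot a (t + \<tau>) (y - x)\<bar>)"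
 let ?c = "2 * heat_const TYPE('a) * heat_maj_const TYPE('a) a" and ?I = "LBINT y. \<bar>riesz (2 * a) (y - x) * h y\<bar>"
 have c: "0 <= ?c" using heat_const_ge(1)[where 'a='a] heat_maj_const_nonneg[OF a(1,3)] by simp
 show "0 <= ?c * ?I" by (rule mult_nonneg_nonneg[OF c]) simp
 fix t \<tau> :: real assume t: "0 < t" "0 < \<tau>"
 have "(?N t \<tau>)
  <= (NBINT y. ennreal (?c * min 1 (\<tau> / t) * \<bar>riesz (2 * a) (y - x) * h y\<bar>))"
 proof (rule nn_integral_mono_AE, use AE_nonzero_diff[of x] in eventually_elim)
  case (elim y)
  have "\<bar>h y\<bar> * \<bar>heat_pot a t (y - x) - heat_pot a (t + \<tau>) (y - x)\<bar> <= \<bar>h y\<bar> * (?c * riesz (2 * a) (y - x) * min 1 (\<tau> / t))"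
   by (rule mult_left_mono[OF heat_pot_diff_le[OF a elim t]]) simp
  then show ?case by (intro ennreal_leI) (simp add: abs_mult mult_ac)
 qed
 also have "... = ennreal (?c * ?I * min 1 (\<tau> / t))"
 proof (subst nn_integral_eq_integral[OF integrable_mult_right[OF integrable_abs[OF riesz_centered_integrable]]])
  have ct: "0 <= ?c * min 1 (\<tau> / t)" using t by (intro mult_nonneg_nonneg[OF c]) simp
  show "AE y in lborel. 0 <= ?c * min 1 (\<tau> / t) * \<bar>riesz (2 * a) (y - x) * h y\<bar>" by (rule AE_I2) (rule mult_nonneg_nonneg[OF ct abs_ge_zero])
 qed (simp add: mult_ac)
 finally show "(?N t \<tau>) <= ennreal (?c * ?I * min 1 (\<tau> / t))" .
qed

text \<open>\<open>heat_pot\<close> is dominated by a multiple of the Riesz kernel at all scales, so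
  finiteness of \<open>riesz_abs\<close> at x supplies the dominating function.\<close>

lemma pot_avg_tendsto:
 assumes X: "!!n. 0 < X n" and l: "!!z::'a. z ~= 0 ==> (\<lambda>n. heat_pot a (X n) z) \<longlonglongrightarrow> l z" and [measurable]: "l \<in> borel_measurable borel"
 shows "(\<lambda>n. LBINT y. h y * heat_pot a (X n) (y - x)) \<longlonglongrightarrow> (LBINT y. h y * l (y - x))"
proof (rule integral_dominated_convergence[OF _ _ integrable_mult_right[OF integrable_abs[OF riesz_centered_integrable], of "heat_maj_const TYPE('a) a"]])
 show "AE y in lborel. (\<lambda>n. h y * heat_pot a (X n) (y - x)) \<longlonglongrightarrow> h y * l (y - x)"
  using AE_nonzero_diff[of x] by eventually_elim (intro tendsto_mult_left l)
 show "AE y in lborel. norm (h y * heat_pot a (X n) (y - x)) <= heat_maj_const TYPE('a) a * \<bar>riesz (2 * a) (y - x) * h y\<bar>" for n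
  using AE_nonzero_diff[of x]
 proof eventually_elim
  case (elim y)
  have "\<bar>h y\<bar> * \<bar>heat_pot a (X n) (y - x)\<bar> <= \<bar>h y\<bar> * (heat_maj_const TYPE('a) a * riesz (2 * a) (y - x))"
   by (rule mult_left_mono[OF heat_pot_le[OF a(1,3) elim less_imp_le[OF X]]]) simp
  then show ?case by (simp add: abs_mult mult_ac)
 qed
qed measurable

lemma pot_avg_at_top: "((\<lambda>t. LBINT y. h y * heat_pot a t (y - x)) \<longlongrightarrow> 0) at_top"
proof (rule tendsto_at_topI_sequentially)
 fix X :: "nat => real" assume X: "filterlim X at_top sequentially"
 \<comment> \<open>\<open>pot_avg_tendsto\<close> needs positive scales for every index, while X is
   only eventually positive.\<close>
 have e: "\<forall>\<^sub>F n in sequentially. max 1 (X n) = X n"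
  using X[unfolded filterlim_at_top, rule_format, of 1] by eventually_elim simp
 have X1: "filterlim (\<lambda>n. max 1 (X n)) at_top sequentially"
  by (rule filterlim_at_top_mono[OF X]) simp
 have "(\<lambda>n. LBINT y. h y * heat_pot a (max 1 (X n)) (y - x)) \<longlonglongrightarrow> (LBINT y. h y * 0)"
  by (rule pot_avg_tendsto[where l="\<lambda>_. 0"], simp) (auto intro: heat_pot_tendsto_0[OF a(1,3) _ X1])
 then have "(\<lambda>n. LBINT y. h y * heat_pot a (max 1 (X n)) (y - x)) \<longlonglongrightarrow> 0" by simp
 then show "(\<lambda>n. LBINT y. h y * heat_pot a (X n) (y - x)) \<longlonglongrightarrow> 0"
  by (rule Lim_transform_eventually) (use e in eventually_elim, simp)
qed

lemma pot_avg_at_0: "((\<lambda>t. LBINT y. h y * heat_pot a t (y - x)) \<longlongrightarrow> heat_pot_const TYPE('a) a * riesz_pot (2 * a) h x) (at_right 0)"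
proof (rule tendsto_at_right_sequentially[OF zero_less_one])
 fix X :: "nat => real" assume X: "!!n. 0 < X n" "X \<longlonglongrightarrow> 0"
 have "(\<lambda>n. LBINT y. h y * heat_pot a (X n) (y - x)) \<longlonglongrightarrow> (LBINT y. h y * (heat_pot_const TYPE('a) a * riesz (2 * a) (y - x)))"
  by (rule pot_avg_tendsto[OF X(1)]) (auto simp: heat_pot_0[symmetric] intro: heat_pot_tendsto[OF a(1,3) _ X(2,1)])
 also have "(LBINT y. h y * (heat_pot_const TYPE('a) a * riesz (2 * a) (y - x))) = heat_pot_const TYPE('a) a * riesz_pot (2 * a) h x"
  unfolding riesz_pot_def integral_mult_right_zero[symmetric]
  by (intro Bochner_Integration.integral_cong refl) (simp add: riesz_def norm_minus_commute mult_ac)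
 finally show "(\<lambda>n. LBINT y. h y * heat_pot a (X n) (y - x)) \<longlonglongrightarrow> heat_pot_const TYPE('a) a * riesz_pot (2 * a) h x" .
qed

end

text \<open>For each base point u the test functions \<open>osc_heat r u\<close> show that V, the
  heat average of \<open>f\<close> minus \<kappa> times that of the potential, satisfies
  \<open>osc_frac a V r = 0\<close>. The difference of V at x and x' also tends to 0 at large
  scales, so \<open>frac_uniqueness\<close> makes its limit at scale 0 vanish. The constant \<kappa>
  compares \<open>heat_pot_frac\<close> with the constant in \<open>osc_heat_multiplier\<close>.
  Only the real part of \<open>g\<close> remains, as the tested side is real.\<close>

lemma riesz_representation:
 fixes f :: "'a::euclidean_space => real" and g :: "'a => complex"
 assumes a: "0 < a" "a < 1" "2 * a < real DIM('a)"
  and f: "bounded (range f)" "continuous_on UNIV f" and g: "Is_Lp_rep p (2 * a) f g"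
  and fin: "riesz_abs (2 * a) (\<lambda>y. norm (g y)) x < \<infinity>" "riesz_abs (2 * a) (\<lambda>y. norm (g y)) x' < \<infinity>"
 defines "\<kappa> \<equiv> pi powr a / Gamma a"
 shows "f x - f x' = \<kappa> * heat_pot_const TYPE('a) a * (riesz_pot (2 * a) (\<lambda>y. Re (g y)) x - riesz_pot (2 * a) (\<lambda>y. Re (g y)) x')"
proof -
 let ?h = "\<lambda>y. Re (g y)" and ?k = "heat_pot_const TYPE('a) a"
 have \<Gamma>: "0 < Gamma a" and c: "0 < frac_exp_const a" by (rule Gamma_real_pos[OF a(1)]) (rule frac_exp_const_pos[OF a(1,2)])
 obtain A where A: "!!y. \<bar>f y\<bar> <= A" using f(1) unfolding bounded_iff by auto
 have A0: "0 <= A" using order_trans[OF abs_ge_zero A] .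
 have [measurable]: "f \<in> borel_measurable borel" "g \<in> borel_measurable borel"
  using borel_measurable_continuous_onI[OF f(2)] g by (auto simp: Is_Lp_rep_def)
 have hm: "?h \<in> borel_measurable borel" "(\<lambda>y. norm (g y)) \<in> borel_measurable borel" by measurable
 have h_fin: "riesz_abs (2 * a) ?h u < \<infinity>" if "riesz_abs (2 * a) (\<lambda>y. norm (g y)) u < \<infinity>" for u
  using that unfolding riesz_abs_def
  by (rule order_le_less_trans[rotated]) (auto intro!: nn_integral_mono ennreal_leI mult_left_mono abs_Re_le_cmod)
 let ?M = "\<lambda>u t. LBINT y. f y * heat t (y - u)" and ?N = "\<lambda>u t. LBINT y. ?h y * heat_pot a t (y - u)"
 let ?V = "\<lambda>u t. ?M u t - \<kappa> * ?N u t"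
 have V: "frac_lip (?V u)" "0 < r ==> osc_frac a (?V u) r = 0"
  if u: "riesz_abs (2 * a) (\<lambda>y. norm (g y)) u < \<infinity>" for u r
 proof -
  obtain B where B: "0 <= B" "!!t \<tau>. 0 < t ==> 0 < \<tau> ==>
   (NBINT y. ennreal (\<bar>?h y\<bar> * \<bar>heat_pot a t (y - u) - heat_pot a (t + \<tau>) (y - u)\<bar>)) <= ennreal (B * min 1 (\<tau> / t))"
   using pot_avg_diff_le[OF hm(1) h_fin[OF u] a] by blast
  \<comment> \<open>The same bound for |g|, because the complex integrand has to be integrable
    before its real part can be taken under the integral.\<close>
  obtain D where D: "0 <= D" "!!t \<tau>. 0 < t ==> 0 < \<tau> ==>
   (NBINT y. ennreal (\<bar>norm (g y)\<bar> * \<bar>heat_pot a t (y - u) - heat_pot a (t + \<tau>) (y - u)\<bar>)) <= ennreal (D * min 1 (\<tau> / t))"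
   using pot_avg_diff_le[OF hm(2) u a] by blast
  have "0 <= 2 * A * heat_const TYPE('a)" using A0 heat_const_ge(1)[where 'a='a] by simp
  note M = kernel_osc[where x = u, OF a(1,2) _ heat_measurable heat_avg_integrable[OF _ A] this heat_avg_diff_le[OF _ A]]
  note N = kernel_osc[OF a(1,2) hm(1) heat_pot_measurable pot_avg_integrable[OF hm(1) h_fin[OF u] a less_imp_le] B]
  note G = kernel_osc[OF a(1,2) hm(2) heat_pot_measurable pot_avg_integrable[OF hm(2) u a less_imp_le] D]
  have lip: "frac_lip (?M u)" "frac_lip (?N u)" using A by (auto intro!: M(1) N(1))
  show "frac_lip (?V u)" by (rule frac_lip_diff[OF lip])
  assume r: "0 < r"
  have rp: "0 < r * exp v" for v using r by simp
  let ?O = "\<lambda>y. LBINT v. osc v * heat (r * exp v) (y - u)"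
  have pot: "AE y in lborel. osc_frac a (\<lambda>t. heat_pot a t (y - u)) r = Gamma a * frac_exp_const a * ?O y"
   using AE_nonzero_diff[of u]
  proof eventually_elim
   case (elim y)
   show ?case unfolding osc_frac_def heat_pot_frac[OF a elim rp] integral_mult_right_zero[symmetric] by (simp only: mult_ac)
  qed
  have Om[measurable]: "?O \<in> borel_measurable borel" by measurable
  have Fm[measurable]: "(\<lambda>y. osc_frac a (\<lambda>t. heat_pot a t (y - u)) r) \<in> borel_measurable borel"
   unfolding osc_frac_def by measurable
  have "integrable lborel (\<lambda>y. norm (g y) * osc_frac a (\<lambda>t. heat_pot a t (y - u)) r)" by (rule G(2)) (use r in auto)
  then have "integrable lborel (\<lambda>y. norm (g y) * (Gamma a * frac_exp_const a * ?O y))"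
   by (rule integrable_cong_AE_imp) (use pot in auto)
  then have "integrable lborel (\<lambda>y. (Gamma a * frac_exp_const a) * (norm (g y) * ?O y))" by (simp only: mult_ac)
  then have "integrable lborel (\<lambda>y. norm (g y) * ?O y)" using \<Gamma> c by simp
  then have gO: "integrable lborel (\<lambda>y. g y * osc_heat r u y)"
   by (rule Bochner_Integration.integrable_bound) (auto simp: osc_heat_def norm_mult abs_mult)
  have "osc_frac a (?N u) r = (LBINT y. ?h y * osc_frac a (\<lambda>t. heat_pot a t (y - u)) r)" by (rule N(3)[symmetric]) (use r in auto)
  also have "... = (LBINT y. ?h y * (Gamma a * frac_exp_const a * ?O y))"
   by (rule integral_cong_AE) (use pot in auto)
  also have "... = (LBINT y. Gamma a * frac_exp_const a * Re (g y * osc_heat r u y))"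
   by (intro Bochner_Integration.integral_cong refl) (simp add: osc_heat_def)
  also have "... = Gamma a * frac_exp_const a * (LBINT y. Re (g y * osc_heat r u y))"
   by (rule integral_mult_right_zero)
  also have "(LBINT y. Re (g y * osc_heat r u y)) = Re (LBINT y. g y * osc_heat r u y)"
   by (rule integral_Re[OF gO])
  \<comment> \<open>The point where the hypothesis on \<open>g\<close> is used, with test function
    \<open>osc_heat r u\<close>.\<close>
  also have "(LBINT y. g y * osc_heat r u y) = (LBINT y. complex_of_real (f y) * complex_of_real (osc_frac a (\<lambda>t. heat t (y - u)) r / (pi powr a * frac_exp_const a)))"
   unfolding osc_heat_multiplier[OF a(1,2) r, symmetric] using g osc_heat_schwartz0[OF r] unfolding Is_Lp_rep_def by blast
  also have "... = complex_of_real ((LBINT y. f y * osc_frac a (\<lambda>t. heat t (y - u)) r) / (pi powr a * frac_exp_const a))"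
   unfolding of_real_mult[symmetric] integral_complex_of_real times_divide_eq_right integral_divide_zero ..
  also have "(LBINT y. f y * osc_frac a (\<lambda>t. heat t (y - u)) r) = osc_frac a (?M u) r" by (rule M(3)) (use r A in auto)
  finally have "osc_frac a (?M u) r = \<kappa> * osc_frac a (?N u) r"
   using \<Gamma> c by (simp add: \<kappa>_def)
  then show "osc_frac a (?V u) r = 0" unfolding osc_frac_diff[OF a(1,2) r lip] by simp
 qed
 \<comment> \<open>The factor 1 gives the difference the shape required by
   \<open>frac_lip_diff\<close> and \<open>osc_frac_diff\<close>.\<close>
 let ?U = "\<lambda>t. ?V x t - 1 * ?V x' t"
 have U: "frac_lip ?U" by (rule frac_lip_diff[OF V(1)[OF fin(1)] V(1)[OF fin(2)]])
 then obtain B where Um: "?U \<in> borel_measurable borel"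
  and B: "!!t \<tau>. 0 < t ==> 0 < \<tau> ==> \<bar>?U t - ?U (t + \<tau>)\<bar> <= B * min 1 (\<tau> / t)" unfolding frac_lip_def by blast
 have N0: "(?N u \<longlongrightarrow> 0) at_top" "(?N u \<longlongrightarrow> ?k * riesz_pot (2 * a) ?h u) (at_right 0)"
  if "riesz_abs (2 * a) (\<lambda>y. norm (g y)) u < \<infinity>" for u
  using pot_avg_at_top[OF hm(1) h_fin[OF that] a] pot_avg_at_0[OF hm(1) h_fin[OF that] a] by auto
 have "(f x - \<kappa> * (?k * riesz_pot (2 * a) ?h x)) - 1 * (f x' - \<kappa> * (?k * riesz_pot (2 * a) ?h x')) = 0"
 proof (rule frac_uniqueness[OF a(1,2) Um B])
  have "((\<lambda>t. (?M x t - ?M x' t) - \<kappa> * (?N x t - ?N x' t)) \<longlongrightarrow> 0 - \<kappa> * (0 - 0)) at_top"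
   by (intro tendsto_intros N0(1) fin heat_avg_space_diff_tendsto_0[OF _ A]) measurable
  then show "(?U \<longlongrightarrow> 0) at_top" by (simp add: algebra_simps)
  show "(?U \<longlongrightarrow> (f x - \<kappa> * (?k * riesz_pot (2 * a) ?h x)) - 1 * (f x' - \<kappa> * (?k * riesz_pot (2 * a) ?h x'))) (at_right 0)"
   by (intro tendsto_intros N0(2) fin heat_avg_tendsto[OF _ A f(2)]) measurable
  fix r :: real assume r: "0 < r"
  have "osc_frac a ?U r = 0"
   using osc_frac_diff[OF a(1,2) r V(1)[OF fin(1)] V(1)[OF fin(2)], of 1] V(2)[OF fin(1) r] V(2)[OF fin(2) r] by simp
  then show "(LBINT v. osc v * (LBINT \<tau>. frac_weight a \<tau> * (?U (r * exp v) - ?U (r * exp v + \<tau>)))) = 0"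
   unfolding osc_frac_def .
 qed
 then show ?thesis by (simp add: algebra_simps)
qed

section \<open>Reduction of the theorem to level 1\<close>

lemma D_sq_le:
 fixes f :: "'a::euclidean_space => real"
 assumes "0 < q" "0 < \<alpha>" "(NBINT y. ennreal (\<bar>f (x + y) - f x\<bar> powr q / norm y powr (real DIM('a) + s * q))) <= ennreal (\<alpha> powr q)"
 shows "D_sq s q f x <= ennreal \<alpha>"
proof -
 let ?I = "NBINT y. ennreal (\<bar>f (x + y) - f x\<bar> powr q / norm y powr (real DIM('a) + s * q))"
 have "?I ~= \<infinity>" using assms(3) by (auto simp: top_unique)
 moreover have "enn2real ?I powr (1 / q) <= \<alpha>"
 proof -
  have "enn2real ?I <= \<alpha> powr q" using enn2real_mono[OF assms(3)] by simp
  then have "enn2real ?I powr (1 / q) <= (\<alpha> powr q) powr (1 / q)" using assms(1) by (intro powr_mono2) auto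
  then show ?thesis using assms by (simp add: powr_powr)
 qed
 ultimately show ?thesis unfolding D_sq_def Let_def by (simp add: ennreal_leI)
qed

theorem theorem2:
  fixes p q :: real
  assumes "1 < p" and "p < q" and "2 \<le> q"
    and "0 < real DIM('a::euclidean_space) * (1 / p - 1 / q)"
    and "real DIM('a) * (1 / p - 1 / q) < 1"
  shows "\<exists>C>0. \<forall>(f::'a \<Rightarrow> real) g (\<alpha>::real).
           bounded (range f) \<longrightarrow> C1_partials f \<longrightarrow>
           Is_Lp_rep p (real DIM('a) * (1 / p - 1 / q)) f g \<longrightarrow> \<alpha> > 0 \<longrightarrow>
           emeasure lborel {x. D_sq (real DIM('a) * (1 / p - 1 / q)) q f x > ennreal \<alpha>}
             \<le> ennreal (C * \<alpha> powr (- p)) * Lp_pow p g"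
proof -
 let ?n = "real DIM('a)"
 define s where "s = ?n * (1 / p - 1 / q)"
 let ?H = "\<lambda>h (x::'a) y. \<bar>riesz_pot s h (x + y) - riesz_pot s h x\<bar> powr q * norm y powr (- ?n - s * q)"
 define a where "a = s / 2"
 have s: "0 < s" "s < 1" using assms by (auto simp: s_def)
 have sn: "s < ?n / p" using assms by (simp add: s_def right_diff_distrib)
 have a: "0 < a" "a < 1" "2 * a < ?n" and sa: "s = 2 * a" using s order_less_le_trans[OF s(2) DIM_ge_1[where 'a='a]] by (auto simp: a_def)
 obtain K where K: "0 < K" and weak: "!!g::'a => real. g \<in> borel_measurable borel ==> (NBINT w. ennreal (\<bar>g w\<bar> powr p)) < \<infinity> ==>
  emeasure lborel {x. riesz_abs s g x < \<infinity> & 1 < (NBINT y. ennreal (?H g x y))}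
   <= ennreal K * (NBINT w. ennreal (\<bar>g w\<bar> powr p))"
  using riesz_weak_type[OF assms(1-3) s_def s] by (elim exE conjE) (rule that, assumption, simp)
 \<comment> \<open>The constant of proportionality between increments of \<open>f\<close> and of the
   Riesz potential of Re g.\<close>
 define k where "k = pi powr a / Gamma a * heat_pot_const TYPE('a) a"
 show ?thesis
  unfolding s_def[symmetric]
 \<comment> \<open>The summand 1 makes the constant positive without deciding whether
   \<open>k\<close> vanishes.\<close>
 proof (intro exI[of _ "K * \<bar>k\<bar> powr p + 1"] conjI allI impI)
  show "0 < K * \<bar>k\<bar> powr p + 1" using K by (intro add_nonneg_pos mult_nonneg_nonneg) auto
  fix f :: "'a => real" and g :: "'a => complex" and \<alpha> :: real
  assume f: "bounded (range f)" "C1_partials f" and g: "Is_Lp_rep p s f g" and \<alpha>: "0 < \<alpha>"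
  have gm[measurable]: "g \<in> borel_measurable borel" and gp: "Lp_pow p g < \<infinity>" using g by (auto simp: Is_Lp_rep_def Lp_pow_def)
  \<comment> \<open>Absorbs both \<open>k\<close> and the level: increments of \<open>f\<close>
    become \<alpha> times increments of the potential of \<open>h\<close>, up to sign or default
    values nowhere, and level \<alpha> for \<open>f\<close> becomes level 1 for
    \<open>h\<close>.\<close>
  define h where "h w = k / \<alpha> * Re (g w)" for w
  have hm[measurable]: "h \<in> borel_measurable borel" unfolding h_def[abs_def] by measurable
  have hp: "(NBINT w. ennreal (\<bar>h w\<bar> powr p)) <= ennreal (\<bar>k\<bar> powr p * \<alpha> powr (- p)) * Lp_pow p g"
  proof -
   have "(NBINT w. ennreal (\<bar>h w\<bar> powr p)) <= (NBINT w. ennreal (\<bar>k\<bar> powr p * \<alpha> powr (- p)) * ennreal (norm (g w) powr p))"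
   proof (rule nn_integral_mono)
    fix w
    have "\<bar>h w\<bar> powr p <= (\<bar>k\<bar> / \<alpha> * norm (g w)) powr p"
     using \<alpha> assms(1) by (intro powr_mono2) (auto simp: h_def abs_mult abs_divide intro!: divide_right_mono mult_left_mono abs_Re_le_cmod)
    also have "... = \<bar>k\<bar> powr p * \<alpha> powr (- p) * norm (g w) powr p"
     using \<alpha> by (simp add: powr_mult powr_divide powr_minus field_simps)
    finally show "ennreal (\<bar>h w\<bar> powr p) <= ennreal (\<bar>k\<bar> powr p * \<alpha> powr (- p)) * ennreal (norm (g w) powr p)"
     by (simp add: ennreal_leI flip: ennreal_mult)
   qed
   also have "... = ennreal (\<bar>k\<bar> powr p * \<alpha> powr (- p)) * Lp_pow p g"
    unfolding Lp_pow_def by (rule nn_integral_cmult) measurable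
   finally show ?thesis .
  qed
  have hfin: "(NBINT w. ennreal (\<bar>h w\<bar> powr p)) < \<infinity>"
   by (rule order_le_less_trans[OF hp]) (use gp in \<open>simp add: ennreal_mult_less_top\<close>)
  let ?S = "{x. riesz_abs s h x < \<infinity> & 1 < (NBINT y. ennreal (?H h x y))}"
  have fin: "AE x in lborel. riesz_abs s (\<lambda>y. norm (g y)) x < \<infinity>"
   by (rule riesz_abs_AE_finite[OF assms(1) s(1) sn]) (use gp in \<open>auto simp: Lp_pow_def\<close>)
  have rep: "\<bar>f u - f u'\<bar> = \<alpha> * \<bar>riesz_pot s h u - riesz_pot s h u'\<bar>"
   if "riesz_abs s (\<lambda>y. norm (g y)) u < \<infinity>" "riesz_abs s (\<lambda>y. norm (g y)) u' < \<infinity>" for u u'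
  proof -
   have h: "riesz_pot s h v = k / \<alpha> * riesz_pot s (\<lambda>y. Re (g y)) v" for v
    unfolding riesz_pot_def h_def integral_mult_right_zero[symmetric] by (simp only: mult_ac)
   have "f u - f u' = k * (riesz_pot s (\<lambda>y. Re (g y)) u - riesz_pot s (\<lambda>y. Re (g y)) u')"
    using riesz_representation[OF a f(1) C1_partials_continuous[OF f(2)] g[unfolded sa] that[unfolded sa]] by (simp add: k_def sa)
   also have "... = \<alpha> * (riesz_pot s h u - riesz_pot s h u')" unfolding h using \<alpha> by (simp add: right_diff_distrib)
   finally show ?thesis using \<alpha> by (simp add: abs_mult)
  qed
  \<comment> \<open>The representation holds only where the potentials converge absolutely. For
    almost every x it is available at x and at x + y for almost every y, which is enough inside the
    integral.\<close>
  have "AE x in lborel. x \<in> {x. D_sq s q f x > ennreal \<alpha>} \<longrightarrow> x \<in> ?S"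
   using fin
  proof eventually_elim
   case (elim x)
   show ?case
   proof
    assume D: "x \<in> {x. D_sq s q f x > ennreal \<alpha>}"
    let ?J = "NBINT y. ennreal (?H h x y)"
    have "(NBINT y. ennreal (\<bar>f (x + y) - f x\<bar> powr q / norm y powr (?n + s * q)))
     = (NBINT y. ennreal (\<alpha> powr q) * ennreal (?H h x y))"
    proof (rule nn_integral_cong_AE, use AE_lborel_shift[OF fin, of x] in eventually_elim)
     case (elim y)
     have "- ?n - s * q = - (?n + s * q)" by simp
     then show ?case using \<alpha> unfolding rep[OF elim \<open>riesz_abs s (\<lambda>y. norm (g y)) x < \<infinity>\<close>]
      by (simp only: powr_minus) (simp add: powr_mult divide_inverse mult.assoc flip: ennreal_mult)
    qed
    also have "... = ennreal (\<alpha> powr q) * ?J" by (rule nn_integral_cmult) measurable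
    finally have I: "(NBINT y. ennreal (\<bar>f (x + y) - f x\<bar> powr q / norm y powr (?n + s * q))) = ennreal (\<alpha> powr q) * ?J" .
    have "1 < ?J"
    proof (rule ccontr)
     assume "\<not> 1 < ?J"
     then have "ennreal (\<alpha> powr q) * ?J <= ennreal (\<alpha> powr q) * 1" by (intro mult_left_mono) auto
     then have "D_sq s q f x <= ennreal \<alpha>" using assms(3) \<alpha> by (intro D_sq_le) (auto simp: I)
     with D show False by auto
    qed
    moreover have "riesz_abs s h x < \<infinity>"
    proof -
     have "riesz_abs s h x <= (NBINT w. ennreal (\<bar>k\<bar> / \<alpha>) * ennreal (riesz s (x - w) * \<bar>norm (g w)\<bar>))"
      unfolding riesz_abs_def
     proof (rule nn_integral_mono)
      fix w
      have "riesz s (x - w) * \<bar>h w\<bar> <= riesz s (x - w) * (\<bar>k\<bar> / \<alpha> * norm (g w))"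
       using \<alpha> by (intro mult_left_mono) (auto simp: h_def abs_mult abs_divide intro!: divide_right_mono mult_left_mono abs_Re_le_cmod)
      then show "ennreal (riesz s (x - w) * \<bar>h w\<bar>) <= ennreal (\<bar>k\<bar> / \<alpha>) * ennreal (riesz s (x - w) * \<bar>norm (g w)\<bar>)"
       using \<alpha> by (subst ennreal_mult[symmetric]) (auto simp: mult_ac intro!: ennreal_leI)
     qed
     also have "... = ennreal (\<bar>k\<bar> / \<alpha>) * riesz_abs s (\<lambda>y. norm (g y)) x"
      unfolding riesz_abs_def by (rule nn_integral_cmult) measurable
     also have "... < \<infinity>" using elim by (simp add: ennreal_mult_less_top)
     finally show ?thesis .
    qed
    ultimately show "x \<in> ?S" by simp
   qed
  qed
  moreover have "?S \<in> sets lborel" by measurable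
  \<comment> \<open>Monotonicity up to a null set asks for measurability of the larger set
    \<open>?S\<close> only.\<close>
  ultimately have "emeasure lborel {x. D_sq s q f x > ennreal \<alpha>} <= emeasure lborel ?S" by (rule emeasure_mono_AE)
  also have "... <= ennreal K * (NBINT w. ennreal (\<bar>h w\<bar> powr p))" by (rule weak[OF hm hfin])
  also have "... <= ennreal K * (ennreal (\<bar>k\<bar> powr p * \<alpha> powr (- p)) * Lp_pow p g)" by (rule mult_left_mono[OF hp]) simp
  also have "... = ennreal (K * \<bar>k\<bar> powr p * \<alpha> powr (- p)) * Lp_pow p g"
   using K by (simp add: mult.assoc ennreal_mult')
  also have "... <= ennreal ((K * \<bar>k\<bar> powr p + 1) * \<alpha> powr (- p)) * Lp_pow p g"
   by (intro mult_right_mono ennreal_leI) (auto simp: algebra_simps)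
  finally show "emeasure lborel {x. D_sq s q f x > ennreal \<alpha>} <= ennreal ((K * \<bar>k\<bar> powr p + 1) * \<alpha> powr (- p)) * Lp_pow p g" .
 qed
qed

end
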